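(* Work over $\mathsf{ACA}_0^\omega+\mathsf{IND}_2$. Each of the following items implies $\mathsf{Finite\ Choice}$, and $\mathsf{QF\text{-}AC}^{0,1}$ implies each of them ($(M,d)$ ranges over metric spaces with $M\subseteq\mathbb{R}$): (a) For a metric space $(M,d)$, every sequentially compact $C\subseteq M$ is bounded, i.e.\ there are $w\in M$ and $m\in\mathbb{N}$ with $(\forall v\in C)(d(v,w)\le m)$. (b) If $(M,d)$ is sequentially compact, every uniformly continuous $f:M\to\mathbb{R}$ is bounded. (c) If $(M,d)$ is sequentially compact, every Hölder continuous $f:M\to\mathbb{R}$ is bounded; likewise every Lipschitz continuous $f:M\to\mathbb{R}$ is bounded. (d) If $(M,d)$ is sequentially compact and infinite, there exists $f:M\to\mathbb{R}$ that is bounded but not Lipschitz continuous. (e) If $(M,d)$ is sequentially compact and bounded, $f:M\to\mathbb{R}$ is Lipschitz and $y\in\mathbb{R}$ is given with $y=\inf_{x\in M}f(x)$, then there is $x\in M$ with $f(x)=y$.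
   Context: Framework: Kohlenbach's higher-order reverse mathematics with base theory $\mathsf{RCA}_0^\omega$. $\mathsf{ACA}_0^\omega$ is $\mathsf{RCA}_0^\omega$ plus $(\exists^2)$: there is $E:\mathbb{N}^\mathbb{N}\to\{0,1\}$ with $(\forall f)[(\exists n)(f(n)=0)\leftrightarrow E(f)=0]$. $\mathsf{QF\text{-}AC}^{0,1}$: for any $Y$ with $(\forall n)(\exists f\in\mathbb{N}^\mathbb{N})(Y(f,n)=0)$ there is $(f_n)_n$ with $(\forall n)(Y(f_n,n)=0)$. $\mathsf{IND}_2$: for any $Y$ with $(\forall n)(\exists f\in2^\mathbb{N})(Y(n,f)=0)$, for every $n$ there is a finite sequence $w$ of elements of $2^\mathbb{N}$ of length $n$ with $Y(i,w(i))=0$ for $i<n$. Subsets of $\mathbb{R}$ are given by characteristic functions; a set $A$ is finite if there is $N$ such that every finite sequence $(x_0,\dots,x_N)$ has some $x_i\notin A$; infinite otherwise. $\mathsf{Finite\ Choice}$: for every sequence $(X_n)_n$ of non-empty finite subsets of $[0,1]$ there is $(x_n)_n$ with $x_n\in X_n$ for all $n$. Metric spaces: $M\subseteq\mathbb{R}$ (up to coding of finite sequences), given by a characteristic function, with an equivalence relation $=_M$; $d:M^2\to\mathbb{R}$ respects $=_M$ and satisfies $d(x,y)=0\leftrightarrow x=_My$, $0\le d(x,y)=d(y,x)$, triangle inequality; functions and subsets respect $=_M$. A set $C\subseteq M$ is sequentially compact if every sequence in $C$ has a sub-sequence converging to a point of $C$; $(M,d)$ is sequentially compact if $M$ is; $(M,d)$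 is bounded if there are $w\in M,m\in\mathbb{N}$ with $d(v,w)\le m$ for all $v\in M$. $f:M\to\mathbb{R}$ is Hölder continuous if there are $K,\alpha>0$ with $|f(v)-f(w)|\le K\,d(v,w)^\alpha$ for all $v,w\in M$, and Lipschitz if this holds with $\alpha=1$.
   Formalization: "Finite" is read with the sequences (x_0,…,x_N) consisting of pairwise distinct elements, as otherwise every non-empty set is infinite and (d) fails for a one-point space; metric spaces are taken non-empty, as otherwise (a) fails for M = C = ∅. *)

theory Defs
  imports Main
begin

section \<open>The language of all finite types\<close>

datatype ty = N | Fn ty ty  (infixr "\<rightarrow>" 70)

abbreviation N\<^sub>1 :: ty where "N\<^sub>1 \<equiv> N \<rightarrow> N"

datatype cst =
    Zero | One | Plus | Times
  | Pi ty ty        \<comment> \<open>\<open>\<Pi> x y = x\<close>\<close>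
  | Sig ty ty ty    \<comment> \<open>\<open>\<Sigma> x y z = x z (y z)\<close>\<close>
  | Rec             \<comment> \<open>the recursor of type 0\<close>

fun cst_ty :: "cst \<Rightarrow> ty" where
  "cst_ty Zero = N"
| "cst_ty One = N"
| "cst_ty Plus = N \<rightarrow> N \<rightarrow> N"
| "cst_ty Times = N \<rightarrow> N \<rightarrow> N"
| "cst_ty (Pi \<sigma> \<tau>) = \<sigma> \<rightarrow> \<tau> \<rightarrow> \<sigma>"
| "cst_ty (Sig \<rho> \<sigma> \<tau>) = (\<rho> \<rightarrow> \<sigma> \<rightarrow> \<tau>) \<rightarrow> (\<rho> \<rightarrow> \<sigma>) \<rightarrow> \<rho> \<rightarrow> \<tau>"
| "cst_ty Rec = (N \<rightarrow> N \<rightarrow> N) \<rightarrow> N \<rightarrow> N \<rightarrow> N"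

text \<open>A variable is a number together with its type, so \<open>Var 0 \<sigma>\<close> and \<open>Var 0 \<tau>\<close> differ for
  \<open>\<sigma> \<noteq> \<tau>\<close>.\<close>

datatype trm = Var nat ty | Cst cst | App trm trm  (infixl "\<cdot>" 90)

fun ty_of :: "trm \<Rightarrow> ty option" where
  "ty_of (Var n \<sigma>) = Some \<sigma>"
| "ty_of (Cst c) = Some (cst_ty c)"
| "ty_of (s \<cdot> t) = (case ty_of s of
      Some (\<sigma> \<rightarrow> \<tau>) \<Rightarrow> if ty_of t = Some \<sigma> then Some \<tau> else None
    | _ \<Rightarrow> None)"

fun vars :: "trm \<Rightarrow> (nat \<times> ty) set" where
  "vars (Var n \<sigma>) = {(n, \<sigma>)}"
| "vars (Cst c) = {}"
| "vars (s \<cdot> t) = vars s \<union> vars t"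

fun subst_t :: "nat \<Rightarrow> ty \<Rightarrow> trm \<Rightarrow> trm \<Rightarrow> trm" where
  "subst_t x \<sigma> u (Var n \<tau>) = (if n = x \<and> \<tau> = \<sigma> then u else Var n \<tau>)"
| "subst_t x \<sigma> u (Cst c) = Cst c"
| "subst_t x \<sigma> u (s \<cdot> t) = subst_t x \<sigma> u s \<cdot> subst_t x \<sigma> u t"

abbreviation zero :: trm  ("\<zero>") where "\<zero> \<equiv> Cst Zero"
abbreviation one :: trm  ("\<one>") where "\<one> \<equiv> Cst One"
abbreviation plus_t :: "trm \<Rightarrow> trm \<Rightarrow> trm"  (infixl "\<oplus>" 75) where
  "s \<oplus> t \<equiv> Cst Plus \<cdot> s \<cdot> t"
abbreviation times_t :: "trm \<Rightarrow> trm \<Rightarrow> trm"  (infixl "\<otimes>" 80) where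
  "s \<otimes> t \<equiv> Cst Times \<cdot> s \<cdot> t"

text \<open>Only equality and order of type 0 are primitive.\<close>

datatype fm = EqF trm trm | LtF trm trm | BotF | ImpF fm fm | AllF nat ty fm

abbreviation NegF :: "fm \<Rightarrow> fm" where "NegF \<phi> \<equiv> ImpF \<phi> BotF"
abbreviation ExF :: "nat \<Rightarrow> ty \<Rightarrow> fm \<Rightarrow> fm" where "ExF n \<sigma> \<phi> \<equiv> NegF (AllF n \<sigma> (NegF \<phi>))"

fun wff :: "fm \<Rightarrow> bool" where
  "wff (EqF s t) \<longleftrightarrow> ty_of s = Some N \<and> ty_of t = Some N"
| "wff (LtF s t) \<longleftrightarrow> ty_of s = Some N \<and> ty_of t = Some N"
| "wff BotF \<longleftrightarrow> True"
| "wff (ImpF \<phi> \<psi>) \<longleftrightarrow> wff \<phi> \<and> wff \<psi>"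
| "wff (AllF n \<sigma> \<phi>) \<longleftrightarrow> wff \<phi>"

fun qf :: "fm \<Rightarrow> bool" where
  "qf (ImpF \<phi> \<psi>) \<longleftrightarrow> qf \<phi> \<and> qf \<psi>"
| "qf (AllF n \<sigma> \<phi>) \<longleftrightarrow> False"
| "qf _ \<longleftrightarrow> True"

fun fv :: "fm \<Rightarrow> (nat \<times> ty) set" where
  "fv (EqF s t) = vars s \<union> vars t"
| "fv (LtF s t) = vars s \<union> vars t"
| "fv BotF = {}"
| "fv (ImpF \<phi> \<psi>) = fv \<phi> \<union> fv \<psi>"
| "fv (AllF n \<sigma> \<phi>) = fv \<phi> - {(n, \<sigma>)}"

fun subst :: "nat \<Rightarrow> ty \<Rightarrow> trm \<Rightarrow> fm \<Rightarrow> fm" where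
  "subst x \<sigma> u (EqF s t) = EqF (subst_t x \<sigma> u s) (subst_t x \<sigma> u t)"
| "subst x \<sigma> u (LtF s t) = LtF (subst_t x \<sigma> u s) (subst_t x \<sigma> u t)"
| "subst x \<sigma> u BotF = BotF"
| "subst x \<sigma> u (ImpF \<phi> \<psi>) = ImpF (subst x \<sigma> u \<phi>) (subst x \<sigma> u \<psi>)"
| "subst x \<sigma> u (AllF n \<tau> \<phi>) =
     (if n = x \<and> \<tau> = \<sigma> then AllF n \<tau> \<phi> else AllF n \<tau> (subst x \<sigma> u \<phi>))"

fun free_for :: "trm \<Rightarrow> nat \<Rightarrow> ty \<Rightarrow> fm \<Rightarrow> bool" where
  "free_for u x \<sigma> (ImpF \<phi> \<psi>) \<longleftrightarrow> free_for u x \<sigma> \<phi> \<and> free_for u x \<sigma> \<psi>"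
| "free_for u x \<sigma> (AllF n \<tau> \<phi>) \<longleftrightarrow>
     (x, \<sigma>) \<notin> fv (AllF n \<tau> \<phi>) \<or> (n, \<tau>) \<notin> vars u \<and> free_for u x \<sigma> \<phi>"
| "free_for u x \<sigma> _ \<longleftrightarrow> True"


section \<open>Derivability\<close>

text \<open>A Hilbert calculus for classical many-sorted first-order logic, with equality for the
  sort of type 0. The non-logical axioms \<open>T\<close> may have free variables, which are read
  universally.\<close>

inductive derives :: "fm set \<Rightarrow> fm \<Rightarrow> bool"  (infix "\<turnstile>" 50) for T :: "fm set" where
  axm: "\<phi> \<in> T \<Longrightarrow> T \<turnstile> \<phi>"
| imp_K: "wff \<phi> \<Longrightarrow> wff \<psi> \<Longrightarrow> T \<turnstile> ImpF \<phi> (ImpF \<psi> \<phi>)"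
| imp_S: "wff \<phi> \<Longrightarrow> wff \<psi> \<Longrightarrow> wff \<chi> \<Longrightarrow>
    T \<turnstile> ImpF (ImpF \<phi> (ImpF \<psi> \<chi>)) (ImpF (ImpF \<phi> \<psi>) (ImpF \<phi> \<chi>))"
| dneg: "wff \<phi> \<Longrightarrow> T \<turnstile> ImpF (NegF (NegF \<phi>)) \<phi>"
| all_inst: "wff \<phi> \<Longrightarrow> ty_of u = Some \<sigma> \<Longrightarrow> free_for u x \<sigma> \<phi> \<Longrightarrow>
    T \<turnstile> ImpF (AllF x \<sigma> \<phi>) (subst x \<sigma> u \<phi>)"
| all_imp: "wff \<phi> \<Longrightarrow> wff \<psi> \<Longrightarrow> (x, \<sigma>) \<notin> fv \<phi> \<Longrightarrow>
    T \<turnstile> ImpF (AllF x \<sigma> (ImpF \<phi> \<psi>)) (ImpF \<phi> (AllF x \<sigma> \<psi>))"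
| eq_refl: "ty_of t = Some N \<Longrightarrow> T \<turnstile> EqF t t"
| eq_subst: "wff \<phi> \<Longrightarrow> qf \<phi> \<Longrightarrow> ty_of s = Some N \<Longrightarrow> ty_of t = Some N \<Longrightarrow>
    T \<turnstile> ImpF (EqF s t) (ImpF (subst x N s \<phi>) (subst x N t \<phi>))"
| mp: "T \<turnstile> ImpF \<phi> \<psi> \<Longrightarrow> T \<turnstile> \<phi> \<Longrightarrow> T \<turnstile> \<psi>"
| gen: "T \<turnstile> \<phi> \<Longrightarrow> T \<turnstile> AllF x \<sigma> \<phi>"


section \<open>Writing formulas with binders\<close>

text \<open>A \<^emph>\<open>builder\<close> is a formula awaiting the number of quantifiers it is placed under. A
  quantifier at depth \<open>k\<close> binds the variable with number \<open>k\<close>, so bound variables never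
  clash as long as the terms put into a builder contain only variables bound further out.
  A closed builder becomes a sentence at depth 0.\<close>

type_synonym bfm = "nat \<Rightarrow> fm"

abbreviation sentence :: "bfm \<Rightarrow> fm" where "sentence B \<equiv> B 0"

definition bot :: bfm  ("\<^bold>\<bottom>") where "\<^bold>\<bottom> = (\<lambda>k. BotF)"
definition eq :: "trm \<Rightarrow> trm \<Rightarrow> bfm"  (infix "\<^bold>=" 50) where "(s \<^bold>= t) = (\<lambda>k. EqF s t)"
definition lt :: "trm \<Rightarrow> trm \<Rightarrow> bfm"  (infix "\<^bold><" 50) where "(s \<^bold>< t) = (\<lambda>k. LtF s t)"
definition imp :: "bfm \<Rightarrow> bfm \<Rightarrow> bfm"  (infixr "\<^bold>\<longrightarrow>" 25) where
  "(A \<^bold>\<longrightarrow> B) = (\<lambda>k. ImpF (A k) (B k))"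
definition neg :: "bfm \<Rightarrow> bfm"  ("\<^bold>\<not> _" [40] 40) where "(\<^bold>\<not> A) = (A \<^bold>\<longrightarrow> \<^bold>\<bottom>)"
definition conj :: "bfm \<Rightarrow> bfm \<Rightarrow> bfm"  (infixr "\<^bold>\<and>" 35) where
  "(A \<^bold>\<and> B) = (\<^bold>\<not> (A \<^bold>\<longrightarrow> \<^bold>\<not> B))"
definition disj :: "bfm \<Rightarrow> bfm \<Rightarrow> bfm"  (infixr "\<^bold>\<or>" 30) where
  "(A \<^bold>\<or> B) = (\<^bold>\<not> A \<^bold>\<longrightarrow> B)"
definition iff :: "bfm \<Rightarrow> bfm \<Rightarrow> bfm"  (infixr "\<^bold>\<longleftrightarrow>" 24) where
  "(A \<^bold>\<longleftrightarrow> B) = ((A \<^bold>\<longrightarrow> B) \<^bold>\<and> (B \<^bold>\<longrightarrow> A))"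
definition le :: "trm \<Rightarrow> trm \<Rightarrow> bfm"  (infix "\<^bold>\<le>" 50) where
  "(s \<^bold>\<le> t) = (s \<^bold>< t \<^bold>\<or> s \<^bold>= t)"

definition allq :: "ty \<Rightarrow> (trm \<Rightarrow> bfm) \<Rightarrow> bfm" where
  "allq \<sigma> F = (\<lambda>k. AllF k \<sigma> (F (Var k \<sigma>) (Suc k)))"
definition exq :: "ty \<Rightarrow> (trm \<Rightarrow> bfm) \<Rightarrow> bfm" where
  "exq \<sigma> F = (\<^bold>\<not> allq \<sigma> (\<lambda>x. \<^bold>\<not> F x))"

syntax
  "_allq" :: "pttrn \<Rightarrow> ty \<Rightarrow> bfm \<Rightarrow> bfm"  ("(3\<^bold>\<forall>_ \<^bold>: _./ _)" [0, 51, 10] 10)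
  "_exq" :: "pttrn \<Rightarrow> ty \<Rightarrow> bfm \<Rightarrow> bfm"  ("(3\<^bold>\<exists>_ \<^bold>: _./ _)" [0, 51, 10] 10)
translations
  "\<^bold>\<forall>x \<^bold>: \<sigma>. A" \<rightleftharpoons> "CONST allq \<sigma> (\<lambda>x. A)"
  "\<^bold>\<exists>x \<^bold>: \<sigma>. A" \<rightleftharpoons> "CONST exq \<sigma> (\<lambda>x. A)"

text \<open>Quantification over a class of objects of type 1 that is given by a formula.\<close>

definition ballq :: "(trm \<Rightarrow> bfm) \<Rightarrow> (trm \<Rightarrow> bfm) \<Rightarrow> bfm" where
  "ballq P F = (\<^bold>\<forall>x \<^bold>: N\<^sub>1. P x \<^bold>\<longrightarrow> F x)"
definition bexq :: "(trm \<Rightarrow> bfm) \<Rightarrow> (trm \<Rightarrow> bfm) \<Rightarrow> bfm" where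
  "bexq P F = (\<^bold>\<exists>x \<^bold>: N\<^sub>1. P x \<^bold>\<and> F x)"

syntax
  "_ballq" :: "pttrn \<Rightarrow> (trm \<Rightarrow> bfm) \<Rightarrow> bfm \<Rightarrow> bfm"  ("(3\<^bold>\<forall>_ \<^bold>\<in> _./ _)" [0, 51, 10] 10)
  "_bexq" :: "pttrn \<Rightarrow> (trm \<Rightarrow> bfm) \<Rightarrow> bfm \<Rightarrow> bfm"  ("(3\<^bold>\<exists>_ \<^bold>\<in> _./ _)" [0, 51, 10] 10)
translations
  "\<^bold>\<forall>x \<^bold>\<in> P. A" \<rightleftharpoons> "CONST ballq P (\<lambda>x. A)"
  "\<^bold>\<exists>x \<^bold>\<in> P. A" \<rightleftharpoons> "CONST bexq P (\<lambda>x. A)"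

text \<open>Equality of higher type is extensional equality.\<close>

fun eqt :: "ty \<Rightarrow> trm \<Rightarrow> trm \<Rightarrow> bfm" where
  "eqt N s t = (s \<^bold>= t)"
| "eqt (\<sigma> \<rightarrow> \<tau>) s t = (\<^bold>\<forall>z \<^bold>: \<sigma>. eqt \<tau> (s \<cdot> z) (t \<cdot> z))"


section \<open>The base theories\<close>

text \<open>The basic axioms are those of second-order arithmetic; with quantifier-free induction
  they make the natural numbers a discretely ordered semi-ring.\<close>

definition basic_axioms :: "fm set" where
  "basic_axioms = sentence ` {
     \<^bold>\<forall>m \<^bold>: N. \<^bold>\<not> (m \<oplus> \<one> \<^bold>= \<zero>),
     \<^bold>\<forall>m \<^bold>: N. \<^bold>\<forall>n \<^bold>: N. m \<oplus> \<one> \<^bold>= n \<oplus> \<one> \<^bold>\<longrightarrow> m \<^bold>= n,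
     \<^bold>\<forall>m \<^bold>: N. m \<oplus> \<zero> \<^bold>= m,
     \<^bold>\<forall>m \<^bold>: N. \<^bold>\<forall>n \<^bold>: N. m \<oplus> (n \<oplus> \<one>) \<^bold>= (m \<oplus> n) \<oplus> \<one>,
     \<^bold>\<forall>m \<^bold>: N. m \<otimes> \<zero> \<^bold>= \<zero>,
     \<^bold>\<forall>m \<^bold>: N. \<^bold>\<forall>n \<^bold>: N. m \<otimes> (n \<oplus> \<one>) \<^bold>= (m \<otimes> n) \<oplus> m,
     \<^bold>\<forall>m \<^bold>: N. \<^bold>\<not> (m \<^bold>< \<zero>),
     \<^bold>\<forall>m \<^bold>: N. \<^bold>\<forall>n \<^bold>: N. m \<^bold>< n \<oplus> \<one> \<^bold>\<longleftrightarrow> (m \<^bold>< n \<^bold>\<or> m \<^bold>= n)}"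

definition combinator_axioms :: "fm set" where
  "combinator_axioms =
     {sentence (\<^bold>\<forall>x \<^bold>: \<sigma>. \<^bold>\<forall>y \<^bold>: \<tau>. eqt \<sigma> (Cst (Pi \<sigma> \<tau>) \<cdot> x \<cdot> y) x) |\<sigma> \<tau>. True} \<union>
     {sentence (\<^bold>\<forall>x \<^bold>: \<rho> \<rightarrow> \<sigma> \<rightarrow> \<tau>. \<^bold>\<forall>y \<^bold>: \<rho> \<rightarrow> \<sigma>. \<^bold>\<forall>z \<^bold>: \<rho>.
        eqt \<tau> (Cst (Sig \<rho> \<sigma> \<tau>) \<cdot> x \<cdot> y \<cdot> z) (x \<cdot> z \<cdot> (y \<cdot> z))) |\<rho> \<sigma> \<tau>. True}"

definition recursor_axioms :: "fm set" where
  "recursor_axioms = sentence ` {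
     \<^bold>\<forall>f \<^bold>: N \<rightarrow> N \<rightarrow> N. \<^bold>\<forall>m \<^bold>: N. Cst Rec \<cdot> f \<cdot> m \<cdot> \<zero> \<^bold>= m,
     \<^bold>\<forall>f \<^bold>: N \<rightarrow> N \<rightarrow> N. \<^bold>\<forall>m \<^bold>: N. \<^bold>\<forall>n \<^bold>: N.
       Cst Rec \<cdot> f \<cdot> m \<cdot> (n \<oplus> \<one>) \<^bold>= f \<cdot> n \<cdot> (Cst Rec \<cdot> f \<cdot> m \<cdot> n)}"

definition extensionality_axioms :: "fm set" where
  "extensionality_axioms =
     {sentence (\<^bold>\<forall>x \<^bold>: \<rho>. \<^bold>\<forall>y \<^bold>: \<rho>. \<^bold>\<forall>f \<^bold>: \<rho> \<rightarrow> \<tau>. eqt \<rho> x y \<^bold>\<longrightarrow> eqt \<tau> (f \<cdot> x) (f \<cdot> y)) |\<rho> \<tau>. True}"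

text \<open>The two schemas allow arbitrary further free variables (parameters of any type) in \<open>A\<close>.\<close>

definition qf_induction :: "fm set" where
  "qf_induction =
     {ImpF (subst n N \<zero> A)
        (ImpF (AllF n N (ImpF A (subst n N (Var n N \<oplus> \<one>) A))) (AllF n N A)) |n A. wff A \<and> qf A}"

definition QF_AC_1_0 :: "fm set" where
  "QF_AC_1_0 =
     {ImpF (AllF f N\<^sub>1 (ExF n N A))
        (ExF Y (N\<^sub>1 \<rightarrow> N) (AllF f N\<^sub>1 (subst n N (Var Y (N\<^sub>1 \<rightarrow> N) \<cdot> Var f N\<^sub>1) A))) |f n Y A.
      wff A \<and> qf A \<and> (Y, N\<^sub>1 \<rightarrow> N) \<notin> fv A}"

definition RCA0_omega :: "fm set" where
  "RCA0_omega = basic_axioms \<union> combinator_axioms \<union> recursor_axioms \<union> extensionality_axioms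
     \<union> qf_induction \<union> QF_AC_1_0"

definition exists_two :: bfm where
  "exists_two = (\<^bold>\<exists>E \<^bold>: N\<^sub>1 \<rightarrow> N. \<^bold>\<forall>f \<^bold>: N\<^sub>1.
     (E \<cdot> f \<^bold>= \<zero> \<^bold>\<or> E \<cdot> f \<^bold>= \<one>) \<^bold>\<and> ((\<^bold>\<exists>n \<^bold>: N. f \<cdot> n \<^bold>= \<zero>) \<^bold>\<longleftrightarrow> E \<cdot> f \<^bold>= \<zero>))"

definition ACA0_omega :: "fm set" where
  "ACA0_omega = RCA0_omega \<union> {sentence exists_two}"

definition QF_AC_0_1 :: bfm where
  "QF_AC_0_1 = (\<^bold>\<forall>Y \<^bold>: N\<^sub>1 \<rightarrow> N \<rightarrow> N.
     (\<^bold>\<forall>n \<^bold>: N. \<^bold>\<exists>f \<^bold>: N\<^sub>1. Y \<cdot> f \<cdot> n \<^bold>= \<zero>) \<^bold>\<longrightarrow>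
     (\<^bold>\<exists>F \<^bold>: N \<rightarrow> N\<^sub>1. \<^bold>\<forall>n \<^bold>: N. Y \<cdot> (F \<cdot> n) \<cdot> n \<^bold>= \<zero>))"

definition Cantor :: "trm \<Rightarrow> bfm" where
  "Cantor f = (\<^bold>\<forall>k \<^bold>: N. f \<cdot> k \<^bold>= \<zero> \<^bold>\<or> f \<cdot> k \<^bold>= \<one>)"

text \<open>Here and below, a finite sequence of objects of type 1 is an object of type \<open>0 \<rightarrow> 1\<close>
  of which only the values below the given length matter.\<close>

definition IND_2 :: bfm where
  "IND_2 = (\<^bold>\<forall>Y \<^bold>: N \<rightarrow> N\<^sub>1 \<rightarrow> N.
     (\<^bold>\<forall>n \<^bold>: N. \<^bold>\<exists>f \<^bold>\<in> Cantor. Y \<cdot> n \<cdot> f \<^bold>= \<zero>) \<^bold>\<longrightarrow>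
     (\<^bold>\<forall>n \<^bold>: N. \<^bold>\<exists>w \<^bold>: N \<rightarrow> N\<^sub>1. \<^bold>\<forall>i \<^bold>: N. i \<^bold>< n \<^bold>\<longrightarrow> Cantor (w \<cdot> i) \<^bold>\<and> Y \<cdot> i \<cdot> (w \<cdot> i) \<^bold>= \<zero>))"


section \<open>Rational and real numbers\<close>

text \<open>\<open>(a, b, c)\<close> stands for the rational number \<open>(a - b) / c\<close>, where \<open>c > 0\<close>.\<close>

type_synonym rat_exp = "trm \<times> trm \<times> trm"

fun leQ :: "rat_exp \<Rightarrow> rat_exp \<Rightarrow> bfm"  (infix "\<le>\<^sub>Q" 50) where
  "((a, b, c) \<le>\<^sub>Q (a', b', c')) = (a \<otimes> c' \<oplus> b' \<otimes> c \<^bold>\<le> a' \<otimes> c \<oplus> b \<otimes> c')"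
fun ltQ :: "rat_exp \<Rightarrow> rat_exp \<Rightarrow> bfm"  (infix "<\<^sub>Q" 50) where
  "((a, b, c) <\<^sub>Q (a', b', c')) = (a \<otimes> c' \<oplus> b' \<otimes> c \<^bold>< a' \<otimes> c \<oplus> b \<otimes> c')"
fun addQ :: "rat_exp \<Rightarrow> rat_exp \<Rightarrow> rat_exp"  (infixl "+\<^sub>Q" 65) where
  "(a, b, c) +\<^sub>Q (a', b', c') = (a \<otimes> c' \<oplus> a' \<otimes> c, b \<otimes> c' \<oplus> b' \<otimes> c, c \<otimes> c')"
fun mulQ :: "rat_exp \<Rightarrow> rat_exp \<Rightarrow> rat_exp"  (infixl "*\<^sub>Q" 70) where
  "(a, b, c) *\<^sub>Q (a', b', c') = (a \<otimes> a' \<oplus> b \<otimes> b', a \<otimes> b' \<oplus> b \<otimes> a', c \<otimes> c')"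
fun negQ :: "rat_exp \<Rightarrow> rat_exp"  ("-\<^sub>Q _" [81] 80) where
  "-\<^sub>Q (a, b, c) = (b, a, c)"

definition natQ :: "trm \<Rightarrow> rat_exp" where "natQ t = (t, \<zero>, \<one>)"

text \<open>\<open>Rec f 1 n\<close> with \<open>f = \<lambda>k y. y + y\<close>.\<close>

definition pow2 :: "trm \<Rightarrow> trm" where
  "pow2 n = Cst Rec \<cdot> (Cst (Pi N\<^sub>1 N) \<cdot> (Cst (Sig N N N) \<cdot> Cst Plus \<cdot>
     (Cst (Sig N N\<^sub>1 N) \<cdot> Cst (Pi N N\<^sub>1) \<cdot> Cst (Pi N N)))) \<cdot> \<one> \<cdot> n"

definition half_pow :: "trm \<Rightarrow> rat_exp" where "half_pow n = (\<one>, \<zero>, pow2 n)"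

definition pair :: "trm \<Rightarrow> trm \<Rightarrow> trm" where
  "pair i j = (i \<oplus> j) \<otimes> (i \<oplus> j) \<oplus> i"

text \<open>\<open>decodeQ t K\<close>: the number \<open>t\<close> is the code \<open>((a, b), c)\<close> of a rational number
  \<open>q = (a - b) / (c + 1)\<close> such that \<open>K q\<close>.\<close>

definition decodeQ :: "trm \<Rightarrow> (rat_exp \<Rightarrow> bfm) \<Rightarrow> bfm" where
  "decodeQ t K = (\<^bold>\<exists>a \<^bold>: N. \<^bold>\<exists>b \<^bold>: N. \<^bold>\<exists>c \<^bold>: N. t \<^bold>= pair (pair a b) c \<^bold>\<and> K (a, b, c \<oplus> \<one>))"

text \<open>A real number is a sequence \<open>q\<close> of rational numbers with
  \<open>|q n - q (n + i)| < 2 ^ -n\<close> for all \<open>n\<close>, \<open>i\<close>.\<close>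

definition Reals :: "trm \<Rightarrow> bfm" where
  "Reals x = (\<^bold>\<forall>n \<^bold>: N. \<^bold>\<forall>i \<^bold>: N. decodeQ (x \<cdot> n) (\<lambda>p. decodeQ (x \<cdot> (n \<oplus> i)) (\<lambda>q.
     p <\<^sub>Q q +\<^sub>Q half_pow n \<^bold>\<and> q <\<^sub>Q p +\<^sub>Q half_pow n)))"

text \<open>An expression for a real number is given by its \<open>n\<close>-th rational approximations:
  \<open>e n K\<close> says that the \<open>n\<close>-th approximation \<open>q\<close> of \<open>e\<close> satisfies \<open>K q\<close>. The operations are
  the usual ones on fast converging Cauchy sequences; in particular
  \<open>(x * y) n = x (n + k) * y (n + k)\<close> for the least \<open>k\<close> with \<open>|x 0| + |y 0| + 2 \<le> 2 ^ k\<close>.\<close>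

type_synonym real_exp = "trm \<Rightarrow> (rat_exp \<Rightarrow> bfm) \<Rightarrow> bfm"

definition rval :: "trm \<Rightarrow> real_exp"  ("\<langle>_\<rangle>") where
  "\<langle>x\<rangle> = (\<lambda>n K. decodeQ (x \<cdot> n) K)"
definition rconst :: "rat_exp \<Rightarrow> real_exp" where
  "rconst q = (\<lambda>n K. K q)"
abbreviation rnat :: "trm \<Rightarrow> real_exp" where
  "rnat t \<equiv> rconst (natQ t)"
definition radd :: "real_exp \<Rightarrow> real_exp \<Rightarrow> real_exp"  (infixl "+\<^sub>R" 65) where
  "e +\<^sub>R e' = (\<lambda>n K. e (n \<oplus> \<one>) (\<lambda>p. e' (n \<oplus> \<one>) (\<lambda>q. K (p +\<^sub>Q q))))"
definition rneg :: "real_exp \<Rightarrow> real_exp"  ("-\<^sub>R _" [81] 80) where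
  "-\<^sub>R e = (\<lambda>n K. e n (\<lambda>p. K (-\<^sub>Q p)))"
definition rsub :: "real_exp \<Rightarrow> real_exp \<Rightarrow> real_exp"  (infixl "-\<^sub>R" 65) where
  "e -\<^sub>R e' = e +\<^sub>R (-\<^sub>R e')"

definition absQ :: "rat_exp \<Rightarrow> (rat_exp \<Rightarrow> bfm) \<Rightarrow> bfm" where
  "absQ p K = ((natQ \<zero> \<le>\<^sub>Q p \<^bold>\<longrightarrow> K p) \<^bold>\<and> (p <\<^sub>Q natQ \<zero> \<^bold>\<longrightarrow> K (-\<^sub>Q p)))"

definition rabs :: "real_exp \<Rightarrow> real_exp"  ("\<bar>_\<bar>\<^sub>R") where
  "\<bar>e\<bar>\<^sub>R = (\<lambda>n K. e n (\<lambda>p. absQ p K))"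

definition mul_bound :: "rat_exp \<Rightarrow> rat_exp \<Rightarrow> trm \<Rightarrow> bfm" where
  "mul_bound p q k = absQ p (\<lambda>p'. absQ q (\<lambda>q'. p' +\<^sub>Q q' +\<^sub>Q natQ (\<one> \<oplus> \<one>) \<le>\<^sub>Q natQ (pow2 k)))"

definition rmul :: "real_exp \<Rightarrow> real_exp \<Rightarrow> real_exp"  (infixl "*\<^sub>R" 70) where
  "e *\<^sub>R e' = (\<lambda>n K. e \<zero> (\<lambda>p0. e' \<zero> (\<lambda>q0. \<^bold>\<exists>k \<^bold>: N.
     mul_bound p0 q0 k \<^bold>\<and> (\<^bold>\<forall>j \<^bold>: N. j \<^bold>< k \<^bold>\<longrightarrow> \<^bold>\<not> mul_bound p0 q0 j) \<^bold>\<and>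
     e (n \<oplus> k) (\<lambda>p. e' (n \<oplus> k) (\<lambda>q. K (p *\<^sub>Q q))))))"

definition leR :: "real_exp \<Rightarrow> real_exp \<Rightarrow> bfm"  (infix "\<le>\<^sub>R" 50) where
  "(e \<le>\<^sub>R e') = (\<^bold>\<forall>n \<^bold>: N. e n (\<lambda>p. e' n (\<lambda>q. p \<le>\<^sub>Q q +\<^sub>Q (\<one> \<oplus> \<one>, \<zero>, pow2 n))))"
definition ltR :: "real_exp \<Rightarrow> real_exp \<Rightarrow> bfm"  (infix "<\<^sub>R" 50) where
  "(e <\<^sub>R e') = (\<^bold>\<not> e' \<le>\<^sub>R e)"
definition eqR :: "real_exp \<Rightarrow> real_exp \<Rightarrow> bfm"  (infix "=\<^sub>R" 50) where
  "(e =\<^sub>R e') = (e \<le>\<^sub>R e' \<^bold>\<and> e' \<le>\<^sub>R e)"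

abbreviation zeroR :: real_exp  ("0\<^sub>R") where "0\<^sub>R \<equiv> rnat \<zero>"
abbreviation oneR :: real_exp  ("1\<^sub>R") where "1\<^sub>R \<equiv> rnat \<one>"

text \<open>\<open>is_npow x n y\<close>: \<open>y = x ^ n\<close> for a natural number \<open>n\<close>.\<close>

definition is_npow :: "trm \<Rightarrow> trm \<Rightarrow> trm \<Rightarrow> bfm" where
  "is_npow x n y = (\<^bold>\<exists>s \<^bold>: N \<rightarrow> N\<^sub>1. (\<^bold>\<forall>i \<^bold>: N. Reals (s \<cdot> i)) \<^bold>\<and> \<langle>s \<cdot> \<zero>\<rangle> =\<^sub>R 1\<^sub>R \<^bold>\<and>
     (\<^bold>\<forall>i \<^bold>: N. i \<^bold>< n \<^bold>\<longrightarrow> \<langle>s \<cdot> (i \<oplus> \<one>)\<rangle> =\<^sub>R \<langle>s \<cdot> i\<rangle> *\<^sub>R \<langle>x\<rangle>) \<^bold>\<and> \<langle>y\<rangle> =\<^sub>R \<langle>s \<cdot> n\<rangle>)"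

text \<open>\<open>is_rpow x \<alpha> y\<close>: \<open>y = x powr \<alpha>\<close> for real numbers \<open>x \<ge> 0\<close> and \<open>\<alpha> > 0\<close>, as the real
  number \<open>y \<ge> 0\<close> that \<open>x powr r\<close>, for rational \<open>r = m / n\<close> below and above \<open>\<alpha>\<close>, bounds from
  both sides; \<open>x powr r\<close> and \<open>y\<close> are compared through their \<open>n\<close>-th powers \<open>x ^ m\<close> and
  \<open>y ^ n\<close>. This includes \<open>0 powr \<alpha> = 0\<close>.\<close>

definition is_rpow :: "trm \<Rightarrow> trm \<Rightarrow> trm \<Rightarrow> bfm" where
  "is_rpow x \<alpha> y = (0\<^sub>R \<le>\<^sub>R \<langle>y\<rangle> \<^bold>\<and>
     (\<^bold>\<forall>m \<^bold>: N. \<^bold>\<forall>n \<^bold>: N. \<zero> \<^bold>< n \<^bold>\<longrightarrow>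
       (\<^bold>\<forall>u \<^bold>\<in> Reals. \<^bold>\<forall>v \<^bold>\<in> Reals. is_npow x m u \<^bold>\<and> is_npow y n v \<^bold>\<longrightarrow>
         (rconst (m, \<zero>, n) \<le>\<^sub>R \<langle>\<alpha>\<rangle> \<^bold>\<longrightarrow>
            (1\<^sub>R \<le>\<^sub>R \<langle>x\<rangle> \<^bold>\<longrightarrow> \<langle>u\<rangle> \<le>\<^sub>R \<langle>v\<rangle>) \<^bold>\<and> (\<langle>x\<rangle> \<le>\<^sub>R 1\<^sub>R \<^bold>\<longrightarrow> \<langle>v\<rangle> \<le>\<^sub>R \<langle>u\<rangle>)) \<^bold>\<and>
         (\<langle>\<alpha>\<rangle> \<le>\<^sub>R rconst (m, \<zero>, n) \<^bold>\<longrightarrow>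
            (1\<^sub>R \<le>\<^sub>R \<langle>x\<rangle> \<^bold>\<longrightarrow> \<langle>v\<rangle> \<le>\<^sub>R \<langle>u\<rangle>) \<^bold>\<and> (\<langle>x\<rangle> \<le>\<^sub>R 1\<^sub>R \<^bold>\<longrightarrow> \<langle>u\<rangle> \<le>\<^sub>R \<langle>v\<rangle>)))))"


section \<open>Sets of real numbers and finite choice\<close>

text \<open>A set of real numbers is a characteristic function of type \<open>1 \<rightarrow> 0\<close> respecting
  equality of real numbers.\<close>

definition real_set :: "trm \<Rightarrow> bfm" where
  "real_set X = (\<^bold>\<forall>x \<^bold>\<in> Reals. (X \<cdot> x \<^bold>= \<zero> \<^bold>\<or> X \<cdot> x \<^bold>= \<one>) \<^bold>\<and>
     (\<^bold>\<forall>y \<^bold>\<in> Reals. \<langle>x\<rangle> =\<^sub>R \<langle>y\<rangle> \<^bold>\<longrightarrow> X \<cdot> x \<^bold>= X \<cdot> y))"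

definition elem :: "trm \<Rightarrow> trm \<Rightarrow> bfm" where
  "elem X x = (Reals x \<^bold>\<and> X \<cdot> x \<^bold>= \<one>)"

text \<open>Finiteness, where \<open>E\<close> is the equality of the space at hand and the terms of the
  sequences are pairwise distinct (constant sequences would make every non-empty set
  infinite).\<close>

definition finite_set :: "(trm \<Rightarrow> trm \<Rightarrow> bfm) \<Rightarrow> trm \<Rightarrow> bfm" where
  "finite_set E X = (\<^bold>\<exists>n \<^bold>: N. \<^bold>\<forall>w \<^bold>: N \<rightarrow> N\<^sub>1.
     (\<^bold>\<forall>i \<^bold>: N. i \<^bold>\<le> n \<^bold>\<longrightarrow> Reals (w \<cdot> i)) \<^bold>\<and>
     (\<^bold>\<forall>i \<^bold>: N. \<^bold>\<forall>j \<^bold>: N. i \<^bold>< j \<^bold>\<and> j \<^bold>\<le> n \<^bold>\<longrightarrow> \<^bold>\<not> E (w \<cdot> i) (w \<cdot> j)) \<^bold>\<longrightarrow>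
     (\<^bold>\<exists>i \<^bold>: N. i \<^bold>\<le> n \<^bold>\<and> \<^bold>\<not> elem X (w \<cdot> i)))"

definition Finite_Choice :: bfm where
  "Finite_Choice = (\<^bold>\<forall>X \<^bold>: N \<rightarrow> N\<^sub>1 \<rightarrow> N.
     (\<^bold>\<forall>n \<^bold>: N. real_set (X \<cdot> n) \<^bold>\<and> (\<^bold>\<forall>x \<^bold>\<in> elem (X \<cdot> n). 0\<^sub>R \<le>\<^sub>R \<langle>x\<rangle> \<^bold>\<and> \<langle>x\<rangle> \<le>\<^sub>R 1\<^sub>R) \<^bold>\<and>
        (\<^bold>\<exists>x \<^bold>: N\<^sub>1. elem (X \<cdot> n) x) \<^bold>\<and> finite_set (\<lambda>x y. \<langle>x\<rangle> =\<^sub>R \<langle>y\<rangle>) (X \<cdot> n)) \<^bold>\<longrightarrow>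
     (\<^bold>\<exists>x \<^bold>: N \<rightarrow> N\<^sub>1. \<^bold>\<forall>n \<^bold>: N. elem (X \<cdot> n) (x \<cdot> n)))"


section \<open>Metric spaces\<close>

text \<open>A metric space is given by the characteristic functions \<open>M\<close> of a non-empty set of real
  numbers and \<open>e\<close> of its equality, and by the metric \<open>d\<close>. Non-emptiness matters: the empty
  subset of an empty space is sequentially compact, but has no bounding ball.\<close>

definition eqM :: "trm \<Rightarrow> trm \<Rightarrow> trm \<Rightarrow> bfm" where
  "eqM e x y = (e \<cdot> x \<cdot> y \<^bold>= \<one>)"

definition metric_equality :: "trm \<Rightarrow> trm \<Rightarrow> bfm" where
  "metric_equality M e =
    ((\<^bold>\<forall>x \<^bold>\<in> elem M. \<^bold>\<forall>y \<^bold>\<in> elem M. e \<cdot> x \<cdot> y \<^bold>= \<zero> \<^bold>\<or> e \<cdot> x \<cdot> y \<^bold>= \<one>) \<^bold>\<and>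
     (\<^bold>\<forall>x \<^bold>\<in> elem M. \<^bold>\<forall>y \<^bold>\<in> elem M. \<langle>x\<rangle> =\<^sub>R \<langle>y\<rangle> \<^bold>\<longrightarrow> eqM e x y) \<^bold>\<and>
     (\<^bold>\<forall>x \<^bold>\<in> elem M. \<^bold>\<forall>y \<^bold>\<in> elem M. eqM e x y \<^bold>\<longrightarrow> eqM e y x) \<^bold>\<and>
     (\<^bold>\<forall>x \<^bold>\<in> elem M. \<^bold>\<forall>y \<^bold>\<in> elem M. \<^bold>\<forall>z \<^bold>\<in> elem M. eqM e x y \<^bold>\<and> eqM e y z \<^bold>\<longrightarrow> eqM e x z))"

definition metric_space :: "trm \<Rightarrow> trm \<Rightarrow> trm \<Rightarrow> bfm" where
  "metric_space M e d =
    (real_set M \<^bold>\<and> (\<^bold>\<exists>x \<^bold>: N\<^sub>1. elem M x) \<^bold>\<and> metric_equality M e \<^bold>\<and>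
     (\<^bold>\<forall>x \<^bold>\<in> elem M. \<^bold>\<forall>y \<^bold>\<in> elem M. Reals (d \<cdot> x \<cdot> y)) \<^bold>\<and>
     (\<^bold>\<forall>x \<^bold>\<in> elem M. \<^bold>\<forall>x' \<^bold>\<in> elem M. \<^bold>\<forall>y \<^bold>\<in> elem M. \<^bold>\<forall>y' \<^bold>\<in> elem M.
        eqM e x x' \<^bold>\<and> eqM e y y' \<^bold>\<longrightarrow> \<langle>d \<cdot> x \<cdot> y\<rangle> =\<^sub>R \<langle>d \<cdot> x' \<cdot> y'\<rangle>) \<^bold>\<and>
     (\<^bold>\<forall>x \<^bold>\<in> elem M. \<^bold>\<forall>y \<^bold>\<in> elem M. \<langle>d \<cdot> x \<cdot> y\<rangle> =\<^sub>R 0\<^sub>R \<^bold>\<longleftrightarrow> eqM e x y) \<^bold>\<and>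
     (\<^bold>\<forall>x \<^bold>\<in> elem M. \<^bold>\<forall>y \<^bold>\<in> elem M. 0\<^sub>R \<le>\<^sub>R \<langle>d \<cdot> x \<cdot> y\<rangle> \<^bold>\<and> \<langle>d \<cdot> x \<cdot> y\<rangle> =\<^sub>R \<langle>d \<cdot> y \<cdot> x\<rangle>) \<^bold>\<and>
     (\<^bold>\<forall>x \<^bold>\<in> elem M. \<^bold>\<forall>y \<^bold>\<in> elem M. \<^bold>\<forall>z \<^bold>\<in> elem M.
        \<langle>d \<cdot> x \<cdot> z\<rangle> \<le>\<^sub>R \<langle>d \<cdot> x \<cdot> y\<rangle> +\<^sub>R \<langle>d \<cdot> y \<cdot> z\<rangle>))"

definition for_all_metric_spaces :: "(trm \<Rightarrow> trm \<Rightarrow> trm \<Rightarrow> bfm) \<Rightarrow> bfm" where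
  "for_all_metric_spaces F = (\<^bold>\<forall>M \<^bold>: N\<^sub>1 \<rightarrow> N. \<^bold>\<forall>e \<^bold>: N\<^sub>1 \<rightarrow> N\<^sub>1 \<rightarrow> N. \<^bold>\<forall>d \<^bold>: N\<^sub>1 \<rightarrow> N\<^sub>1 \<rightarrow> N\<^sub>1.
     metric_space M e d \<^bold>\<longrightarrow> F M e d)"

definition subset_of_space :: "trm \<Rightarrow> trm \<Rightarrow> trm \<Rightarrow> bfm" where
  "subset_of_space M e C = (real_set C \<^bold>\<and> (\<^bold>\<forall>x \<^bold>\<in> elem C. elem M x) \<^bold>\<and>
     (\<^bold>\<forall>x \<^bold>\<in> elem M. \<^bold>\<forall>y \<^bold>\<in> elem M. eqM e x y \<^bold>\<longrightarrow> C \<cdot> x \<^bold>= C \<cdot> y))"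

definition real_function :: "trm \<Rightarrow> trm \<Rightarrow> trm \<Rightarrow> bfm" where
  "real_function M e f = ((\<^bold>\<forall>x \<^bold>\<in> elem M. Reals (f \<cdot> x)) \<^bold>\<and>
     (\<^bold>\<forall>x \<^bold>\<in> elem M. \<^bold>\<forall>y \<^bold>\<in> elem M. eqM e x y \<^bold>\<longrightarrow> \<langle>f \<cdot> x\<rangle> =\<^sub>R \<langle>f \<cdot> y\<rangle>))"

definition seq_compact_set :: "trm \<Rightarrow> trm \<Rightarrow> bfm" where
  "seq_compact_set d C = (\<^bold>\<forall>s \<^bold>: N \<rightarrow> N\<^sub>1. (\<^bold>\<forall>n \<^bold>: N. elem C (s \<cdot> n)) \<^bold>\<longrightarrow>
     (\<^bold>\<exists>g \<^bold>: N\<^sub>1. (\<^bold>\<forall>n \<^bold>: N. g \<cdot> n \<^bold>< g \<cdot> (n \<oplus> \<one>)) \<^bold>\<and>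
       (\<^bold>\<exists>x \<^bold>\<in> elem C. \<^bold>\<forall>\<epsilon> \<^bold>\<in> Reals. 0\<^sub>R <\<^sub>R \<langle>\<epsilon>\<rangle> \<^bold>\<longrightarrow>
         (\<^bold>\<exists>m \<^bold>: N. \<^bold>\<forall>n \<^bold>: N. m \<^bold>\<le> n \<^bold>\<longrightarrow> \<langle>d \<cdot> (s \<cdot> (g \<cdot> n)) \<cdot> x\<rangle> <\<^sub>R \<langle>\<epsilon>\<rangle>))))"

text \<open>The set \<open>C\<close> is bounded in the space; for \<open>C = M\<close>, the space is bounded.\<close>

definition bounded_set :: "trm \<Rightarrow> trm \<Rightarrow> trm \<Rightarrow> bfm" where
  "bounded_set M d C = (\<^bold>\<exists>w \<^bold>\<in> elem M. \<^bold>\<exists>m \<^bold>: N. \<^bold>\<forall>v \<^bold>\<in> elem C. \<langle>d \<cdot> v \<cdot> w\<rangle> \<le>\<^sub>R rnat m)"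

definition bounded_function :: "trm \<Rightarrow> trm \<Rightarrow> bfm" where
  "bounded_function M f = (\<^bold>\<exists>m \<^bold>: N. \<^bold>\<forall>x \<^bold>\<in> elem M. \<bar>\<langle>f \<cdot> x\<rangle>\<bar>\<^sub>R \<le>\<^sub>R rnat m)"

definition unif_continuous :: "trm \<Rightarrow> trm \<Rightarrow> trm \<Rightarrow> bfm" where
  "unif_continuous M d f = (\<^bold>\<forall>\<epsilon> \<^bold>\<in> Reals. 0\<^sub>R <\<^sub>R \<langle>\<epsilon>\<rangle> \<^bold>\<longrightarrow> (\<^bold>\<exists>\<delta> \<^bold>\<in> Reals. 0\<^sub>R <\<^sub>R \<langle>\<delta>\<rangle> \<^bold>\<and>
     (\<^bold>\<forall>v \<^bold>\<in> elem M. \<^bold>\<forall>w \<^bold>\<in> elem M. \<langle>d \<cdot> v \<cdot> w\<rangle> <\<^sub>R \<langle>\<delta>\<rangle> \<^bold>\<longrightarrow>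
       \<bar>\<langle>f \<cdot> v\<rangle> -\<^sub>R \<langle>f \<cdot> w\<rangle>\<bar>\<^sub>R <\<^sub>R \<langle>\<epsilon>\<rangle>)))"

definition Hoelder :: "trm \<Rightarrow> trm \<Rightarrow> trm \<Rightarrow> bfm" where
  "Hoelder M d f = (\<^bold>\<exists>K \<^bold>\<in> Reals. \<^bold>\<exists>\<alpha> \<^bold>\<in> Reals. 0\<^sub>R <\<^sub>R \<langle>K\<rangle> \<^bold>\<and> 0\<^sub>R <\<^sub>R \<langle>\<alpha>\<rangle> \<^bold>\<and>
     (\<^bold>\<forall>v \<^bold>\<in> elem M. \<^bold>\<forall>w \<^bold>\<in> elem M. \<^bold>\<exists>p \<^bold>\<in> Reals. is_rpow (d \<cdot> v \<cdot> w) \<alpha> p \<^bold>\<and>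
       \<bar>\<langle>f \<cdot> v\<rangle> -\<^sub>R \<langle>f \<cdot> w\<rangle>\<bar>\<^sub>R \<le>\<^sub>R \<langle>K\<rangle> *\<^sub>R \<langle>p\<rangle>))"

definition Lipschitz :: "trm \<Rightarrow> trm \<Rightarrow> trm \<Rightarrow> bfm" where
  "Lipschitz M d f = (\<^bold>\<exists>K \<^bold>\<in> Reals. 0\<^sub>R <\<^sub>R \<langle>K\<rangle> \<^bold>\<and>
     (\<^bold>\<forall>v \<^bold>\<in> elem M. \<^bold>\<forall>w \<^bold>\<in> elem M.
       \<bar>\<langle>f \<cdot> v\<rangle> -\<^sub>R \<langle>f \<cdot> w\<rangle>\<bar>\<^sub>R \<le>\<^sub>R \<langle>K\<rangle> *\<^sub>R \<langle>d \<cdot> v \<cdot> w\<rangle>))"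

definition is_infimum :: "trm \<Rightarrow> trm \<Rightarrow> trm \<Rightarrow> bfm" where
  "is_infimum M f y = ((\<^bold>\<forall>x \<^bold>\<in> elem M. \<langle>y\<rangle> \<le>\<^sub>R \<langle>f \<cdot> x\<rangle>) \<^bold>\<and>
     (\<^bold>\<forall>z \<^bold>\<in> Reals. (\<^bold>\<forall>x \<^bold>\<in> elem M. \<langle>z\<rangle> \<le>\<^sub>R \<langle>f \<cdot> x\<rangle>) \<^bold>\<longrightarrow> \<langle>z\<rangle> \<le>\<^sub>R \<langle>y\<rangle>))"


section \<open>The items\<close>

definition item_a :: bfm where
  "item_a = for_all_metric_spaces (\<lambda>M e d. \<^bold>\<forall>C \<^bold>: N\<^sub>1 \<rightarrow> N.
     subset_of_space M e C \<^bold>\<and> seq_compact_set d C \<^bold>\<longrightarrow> bounded_set M d C)"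

definition item_b :: bfm where
  "item_b = for_all_metric_spaces (\<lambda>M e d. seq_compact_set d M \<^bold>\<longrightarrow> (\<^bold>\<forall>f \<^bold>: N\<^sub>1 \<rightarrow> N\<^sub>1.
     real_function M e f \<^bold>\<and> unif_continuous M d f \<^bold>\<longrightarrow> bounded_function M f))"

definition item_c_Hoelder :: bfm where
  "item_c_Hoelder = for_all_metric_spaces (\<lambda>M e d. seq_compact_set d M \<^bold>\<longrightarrow> (\<^bold>\<forall>f \<^bold>: N\<^sub>1 \<rightarrow> N\<^sub>1.
     real_function M e f \<^bold>\<and> Hoelder M d f \<^bold>\<longrightarrow> bounded_function M f))"

definition item_c_Lipschitz :: bfm where
  "item_c_Lipschitz = for_all_metric_spaces (\<lambda>M e d. seq_compact_set d M \<^bold>\<longrightarrow> (\<^bold>\<forall>f \<^bold>: N\<^sub>1 \<rightarrow> N\<^sub>1.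
     real_function M e f \<^bold>\<and> Lipschitz M d f \<^bold>\<longrightarrow> bounded_function M f))"

definition item_d :: bfm where
  "item_d = for_all_metric_spaces (\<lambda>M e d.
     seq_compact_set d M \<^bold>\<and> \<^bold>\<not> finite_set (eqM e) M \<^bold>\<longrightarrow> (\<^bold>\<exists>f \<^bold>: N\<^sub>1 \<rightarrow> N\<^sub>1.
       real_function M e f \<^bold>\<and> bounded_function M f \<^bold>\<and> \<^bold>\<not> Lipschitz M d f))"

definition item_e :: bfm where
  "item_e = for_all_metric_spaces (\<lambda>M e d.
     seq_compact_set d M \<^bold>\<and> bounded_set M d M \<^bold>\<longrightarrow> (\<^bold>\<forall>f \<^bold>: N\<^sub>1 \<rightarrow> N\<^sub>1. \<^bold>\<forall>y \<^bold>\<in> Reals.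
       real_function M e f \<^bold>\<and> Lipschitz M d f \<^bold>\<and> is_infimum M f y \<^bold>\<longrightarrow>
       (\<^bold>\<exists>x \<^bold>\<in> elem M. \<langle>f \<cdot> x\<rangle> =\<^sub>R \<langle>y\<rangle>)))"

end

theory Submission
  imports Defs "HOL-Library.Countable" "HOL-Computational_Algebra.Fraction_Field"
begin

text \<open>
  Derivability is established through completeness. If one of the sentences is not derivable,
  then Henkin's construction yields a model of the theory in which that sentence fails, and
  extensionality makes it possible to regard the objects of higher type as functions of a model
  whose numbers satisfy induction only for internal predicates. Whatever has a definition with
  quantifiers over numbers is internal, thanks to \<open>(\<exists>\<^sup>2)\<close>. Real numbers of the model get
  values in a field built from its numbers, and the sentences become ordinary statements about
  internal functions.

  For the choice principle, a sequence with values far apart (or close to the infimum, or pairwise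
  distinct) is picked with the help of \<open>QF-AC\<^sup>0\<^sup>,\<^sup>1\<close> and a convergent subsequence is considered.
  Conversely, suppose that the non-empty sets \<open>X\<^sub>n\<close> admit no choice function, and let \<open>M\<close> be
  the set of (codes of) finite sequences \<open>(x\<^sub>i)\<^sub>i\<^sub><\<^sub>n\<close> with \<open>x\<^sub>i \<in> X\<^sub>i\<close>. By \<open>IND\<^sub>2\<close> every length
  occurs. A sequence of unbounded lengths would compute a choice function, so that along every
  sequence in \<open>M\<close> some length occurs infinitely often. Hence \<open>M\<close> is sequentially compact for
  every metric that depends injectively on the length: \<open>|l - l'|\<close> refutes (a) to (d), and
  \<open>|1 / (l + 1) - 1 / (l' + 1)|\<close> refutes (e).
\<close>

subsection \<open>Substitution\<close>

text \<open>Explicit derivations in a Hilbert calculus would be unmanageable, whereas in a model the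
  arguments become ordinary mathematics. The price is that the numbers of the model may be
  nonstandard: induction, least numbers, recursion and counting are available only for predicates
  and functions that are internal. Hence the constructions below come with proofs of internal
  definability (\<open>idef\<close>, \<open>idefp\<close>), and the values of reals live in a
  completion built over the numbers of the model. The second obstacle is coding. A point of a metric
  space is a real number, and characteristic functions must respect equality of reals, so a finite
  sequence of reals has to be coded by a real whose decoding depends on its value alone. Moreover,
  \<open>IND_2\<close> provides elements of Cantor space only. Nonnegative reals are therefore
  turned into 0/1-valued cuts, and the cuts are stored in the base 4 digits of a real: with digits 0
  and 1 there are no carries, so the digits can be read off the value.\<close>

fun avars :: "fm \<Rightarrow> (nat \<times> ty) set" where
  "avars (EqF s t) = vars s \<union> vars t"
| "avars (LtF s t) = vars s \<union> vars t"
| "avars BotF = {}"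
| "avars (ImpF \<phi> \<psi>) = avars \<phi> \<union> avars \<psi>"
| "avars (AllF n \<sigma> \<phi>) = insert (n, \<sigma>) (avars \<phi>)"

fun tsub :: "(nat \<times> ty \<Rightarrow> trm) \<Rightarrow> trm \<Rightarrow> trm" where
  "tsub v (Var n \<sigma>) = v (n, \<sigma>)"
| "tsub v (Cst c) = Cst c"
| "tsub v (s \<cdot> t) = tsub v s \<cdot> tsub v t"

text \<open>Bound variables are never renamed. Capture is excluded by a separation of indices
  instead: the formulas concerned have all variables below \<open>B\<close>, the terms put in have
  theirs at \<open>B\<close> or above.\<close>

fun ssub :: "(nat \<times> ty \<Rightarrow> trm) \<Rightarrow> fm \<Rightarrow> fm" where
  "ssub v (EqF s t) = EqF (tsub v s) (tsub v t)"
| "ssub v (LtF s t) = LtF (tsub v s) (tsub v t)"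
| "ssub v BotF = BotF"
| "ssub v (ImpF \<phi> \<psi>) = ImpF (ssub v \<phi>) (ssub v \<psi>)"
| "ssub v (AllF n \<sigma> \<phi>) = AllF n \<sigma> (ssub (v((n, \<sigma>) := Var n \<sigma>)) \<phi>)"

lemma finite_vars [simp]: "finite (vars t)"
  by (induction t) auto

lemma finite_avars [simp]: "finite (avars \<phi>)"
  by (induction \<phi>) auto

lemma fv_subset_avars: "fv \<phi> \<subseteq> avars \<phi>"
  by (induction \<phi>) auto

lemma subst_t_idle: "(x, \<sigma>) \<notin> vars t \<Longrightarrow> subst_t x \<sigma> u t = t"
  by (induction t) auto

lemma subst_t_self [simp]: "subst_t x \<sigma> (Var x \<sigma>) t = t"
  by (induction t) auto

lemma subst_self [simp]: "subst x \<sigma> (Var x \<sigma>) \<phi> = \<phi>"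
  by (induction \<phi>) auto

lemma free_for_self [simp]: "free_for (Var x \<sigma>) x \<sigma> \<phi>"
  by (induction \<phi>) auto

lemma ty_of_subst_t: "ty_of u = Some \<sigma> \<Longrightarrow> ty_of (subst_t x \<sigma> u t) = ty_of t"
  by (induction t) (auto split: option.splits ty.splits)

lemma wff_subst: "ty_of u = Some \<sigma> \<Longrightarrow> wff (subst x \<sigma> u \<phi>) = wff \<phi>"
  by (induction \<phi>) (auto simp: ty_of_subst_t)

lemma vars_subst_t_subset: "vars (subst_t x \<sigma> u t) \<subseteq> (vars t - {(x, \<sigma>)}) \<union> vars u"
  by (induction t) auto

lemma fv_subst_subset: "fv (subst x \<sigma> u \<phi>) \<subseteq> (fv \<phi> - {(x, \<sigma>)}) \<union> vars u"
proof (induction \<phi>)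
  case (EqF s t)
  then show ?case
    using vars_subst_t_subset[of x \<sigma> u s] vars_subst_t_subset[of x \<sigma> u t] by auto
next
  case (LtF s t)
  then show ?case
    using vars_subst_t_subset[of x \<sigma> u s] vars_subst_t_subset[of x \<sigma> u t] by auto
qed auto

lemma subst_t_back: "(y, \<sigma>) \<notin> vars t \<Longrightarrow> subst_t y \<sigma> (Var x \<sigma>) (subst_t x \<sigma> (Var y \<sigma>) t) = t"
  by (induction t) auto

lemma subst_idle: "(x, \<sigma>) \<notin> fv \<phi> \<Longrightarrow> subst x \<sigma> u \<phi> = \<phi>"
  by (induction \<phi>) (auto simp: subst_t_idle)

text \<open>Freshness refers to \<open>avars\<close> because a quantifier over \<open>y\<close>
  inside the formula would capture the new occurrences and make the renaming irreversible.\<close>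

lemma subst_back:
  "(y, \<sigma>) \<notin> avars \<phi> \<Longrightarrow> subst y \<sigma> (Var x \<sigma>) (subst x \<sigma> (Var y \<sigma>) \<phi>) = \<phi>"
proof (induction \<phi>)
  case (AllF n \<tau> \<phi>)
  then have "(y, \<sigma>) \<notin> fv \<phi>" using fv_subset_avars by auto
  with AllF show ?case by (auto simp: subst_idle)
qed (auto simp: subst_t_back)

lemma free_for_back:
  "(y, \<sigma>) \<notin> avars \<phi> \<Longrightarrow> free_for (Var x \<sigma>) y \<sigma> (subst x \<sigma> (Var y \<sigma>) \<phi>)"
proof (induction \<phi>)
  case (AllF n \<tau> \<phi>)
  then have "(y, \<sigma>) \<notin> fv \<phi>" using fv_subset_avars by auto
  with AllF show ?case by auto
qed auto

lemma ty_of_tsub: "(\<And>n \<sigma>. ty_of (v (n, \<sigma>)) = Some \<sigma>) \<Longrightarrow> ty_of (tsub v t) = ty_of t"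
  by (induction t) (auto split: option.splits ty.splits)

lemma wff_ssub: "(\<And>n \<sigma>. ty_of (v (n, \<sigma>)) = Some \<sigma>) \<Longrightarrow> wff (ssub v \<phi>) = wff \<phi>"
  by (induction \<phi> arbitrary: v) (auto simp: ty_of_tsub)

lemma tsub_cong: "(\<And>x. x \<in> vars t \<Longrightarrow> v x = v' x) \<Longrightarrow> tsub v t = tsub v' t"
  by (induction t) auto

lemma ssub_cong: "(\<And>x. x \<in> fv \<phi> \<Longrightarrow> v x = v' x) \<Longrightarrow> ssub v \<phi> = ssub v' \<phi>"
proof (induction \<phi> arbitrary: v v')
  case (EqF s t) then show ?case by (auto intro: tsub_cong)
next
  case (LtF s t) then show ?case by (auto intro: tsub_cong)
next
  case (AllF n \<sigma> \<phi>)
  show ?case using AllF.prems by (auto intro!: AllF.IH)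
next
  case (ImpF \<phi> \<psi>)
  have "ssub v \<phi> = ssub v' \<phi>" by (rule ImpF.IH(1)) (use ImpF.prems in simp)
  moreover have "ssub v \<psi> = ssub v' \<psi>" by (rule ImpF.IH(2)) (use ImpF.prems in simp)
  ultimately show ?case by simp
qed auto

lemma tsub_Var: "tsub (\<lambda>(n, \<sigma>). Var n \<sigma>) t = t"
  by (induction t) auto

lemma ssub_Var: "ssub (\<lambda>(n, \<sigma>). Var n \<sigma>) \<phi> = \<phi>"
proof (induction \<phi>)
  case (AllF n \<sigma> \<phi>)
  have "(\<lambda>(n, \<sigma>). Var n \<sigma>)((n, \<sigma>) := Var n \<sigma>) = (\<lambda>(n, \<sigma>). Var n \<sigma>)" by auto
  with AllF show ?case by simp
qed (auto simp: tsub_Var)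

lemma ssub_closed: "fv \<phi> = {} \<Longrightarrow> ssub v \<phi> = \<phi>"
  using ssub_cong[of \<phi> v "\<lambda>(n, \<sigma>). Var n \<sigma>"] by (simp add: ssub_Var)

lemma subst_t_tsub:
  "(\<And>z. z \<in> vars t \<Longrightarrow> z \<noteq> (x, \<sigma>) \<Longrightarrow> (x, \<sigma>) \<notin> vars (v z)) \<Longrightarrow> v (x, \<sigma>) = Var x \<sigma> \<Longrightarrow>
   subst_t x \<sigma> u (tsub v t) = tsub (v((x, \<sigma>) := u)) t"
proof (induction t)
  case (Var n \<tau>)
  then show ?case by (cases "(n, \<tau>) = (x, \<sigma>)") (auto simp: subst_t_idle)
qed auto

text \<open>A later instantiation of \<open>x\<close> can be merged into the simultaneous
  substitution because no other value of \<open>v\<close> mentions \<open>x\<close>. This is the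
  quantifier case of \<open>truth\<close>.\<close>

lemma subst_ssub:
  assumes "\<And>z. z \<noteq> (x, \<sigma>) \<Longrightarrow> (x, \<sigma>) \<notin> vars (v z)" "v (x, \<sigma>) = Var x \<sigma>"
  shows "subst x \<sigma> u (ssub v \<phi>) = ssub (v((x, \<sigma>) := u)) \<phi>"
  using assms
proof (induction \<phi> arbitrary: v)
  case (AllF n \<tau> \<phi>)
  show ?case
  proof (cases "(n, \<tau>) = (x, \<sigma>)")
    case True
    then have "n = x" "\<tau> = \<sigma>" by auto
    then show ?thesis by (simp only: ssub.simps subst.simps fun_upd_upd) simp
  next
    case False
    then have "subst x \<sigma> u (ssub (v((n, \<tau>) := Var n \<tau>)) \<phi>) =
        ssub ((v((n, \<tau>) := Var n \<tau>))((x, \<sigma>) := u)) \<phi>"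
      using AllF.prems by (intro AllF.IH) auto
    with False show ?thesis by (auto simp: fun_upd_twist simp del: fun_upd_apply)
  qed
qed (auto simp: subst_t_tsub)

lemma free_for_ssub:
  "(\<And>n \<tau>. (n, \<tau>) \<in> avars \<phi> \<Longrightarrow> (n, \<tau>) \<notin> vars u) \<Longrightarrow> free_for u x \<sigma> (ssub v \<phi>)"
  by (induction \<phi> arbitrary: v) auto


subsection \<open>Local derivability\<close>

text \<open>The free variables of the hypotheses \<open>G\<close> act as constants: there is no rule of
  generalisation over them.\<close>

inductive ld :: "fm set \<Rightarrow> fm set \<Rightarrow> fm \<Rightarrow> bool" for T G where
  base: "T \<turnstile> \<phi> \<Longrightarrow> wff \<phi> \<Longrightarrow> ld T G \<phi>"
| hyp: "\<phi> \<in> G \<Longrightarrow> wff \<phi> \<Longrightarrow> ld T G \<phi>"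
| mp: "ld T G (ImpF \<phi> \<psi>) \<Longrightarrow> ld T G \<phi> \<Longrightarrow> ld T G \<psi>"

lemma ld_wff: "ld T G \<phi> \<Longrightarrow> wff \<phi>"
  by (induction rule: ld.induct) auto

lemma ld_mono: "ld T G \<phi> \<Longrightarrow> G \<subseteq> G' \<Longrightarrow> ld T G' \<phi>"
  by (induction rule: ld.induct) (auto intro: ld.intros)

lemma ld_empty: "ld T {} \<phi> \<Longrightarrow> T \<turnstile> \<phi>"
  by (induction rule: ld.induct) (auto intro: derives.intros)

lemma ld_imp_intro: "wff \<psi> \<Longrightarrow> ld T G \<phi> \<Longrightarrow> ld T G (ImpF \<psi> \<phi>)"
  by (rule ld.mp[where \<phi> = \<phi>]) (auto intro!: ld.base imp_K dest: ld_wff)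

lemma derives_refl: "wff \<phi> \<Longrightarrow> T \<turnstile> ImpF \<phi> \<phi>"
  by (rule derives.mp[OF derives.mp[OF imp_S[of _ "ImpF \<phi> \<phi>"] imp_K] imp_K]) auto

lemma deduction:
  assumes "ld T (insert \<alpha> G) \<phi>" and "wff \<alpha>"
  shows "ld T G (ImpF \<alpha> \<phi>)"
  using assms(1)
proof (induction rule: ld.induct)
  case (base \<phi>)
  then show ?case using assms(2) by (auto intro: ld_imp_intro ld.base)
next
  case (hyp \<phi>)
  then show ?case using assms(2)
    by (cases "\<phi> = \<alpha>") (auto intro: ld_imp_intro ld.hyp ld.base derives_refl)
next
  case (mp \<phi> \<psi>)
  have "ld T G (ImpF (ImpF \<alpha> (ImpF \<phi> \<psi>)) (ImpF (ImpF \<alpha> \<phi>) (ImpF \<alpha> \<psi>)))"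
    using ld_wff[OF mp.IH(1)] by (auto intro!: ld.base imp_S)
  then show ?case using mp.IH by (blast intro: ld.mp)
qed

lemma ld_dneg: "ld T G (NegF (NegF \<phi>)) \<Longrightarrow> ld T G \<phi>"
  by (rule ld.mp[where \<phi> = "NegF (NegF \<phi>)"]) (auto intro!: ld.base dneg dest: ld_wff)

lemma ld_all_inst:
  "ld T G (AllF x \<sigma> \<phi>) \<Longrightarrow> ty_of u = Some \<sigma> \<Longrightarrow> free_for u x \<sigma> \<phi> \<Longrightarrow> ld T G (subst x \<sigma> u \<phi>)"
  by (rule ld.mp[where \<phi> = "AllF x \<sigma> \<phi>"])
    (auto intro!: ld.base all_inst dest: ld_wff simp: wff_subst)

lemma derives_imp_all:
  assumes "T \<turnstile> ImpF \<phi> \<psi>" "wff \<phi>" "wff \<psi>" "(x, \<sigma>) \<notin> fv \<phi>"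
  shows "T \<turnstile> ImpF \<phi> (AllF x \<sigma> \<psi>)"
  by (rule derives.mp[OF all_imp gen]) (use assms in auto)

text \<open>Generalisation is recovered by induction on the local derivation. The modus ponens case
  amounts to distributing a universal quantifier over an implication; this is derived from the two
  universal formulas alone, in which \<open>x\<close> is not free.\<close>

lemma ld_gen:
  assumes "ld T G \<phi>" "\<And>\<gamma>. \<gamma> \<in> G \<Longrightarrow> (x, \<sigma>) \<notin> fv \<gamma>"
  shows "ld T G (AllF x \<sigma> \<phi>)"
  using assms(1)
proof (induction rule: ld.induct)
  case (base \<phi>)
  then show ?case by (auto intro: ld.base gen)
next
  case (hyp \<phi>)
  then have "T \<turnstile> ImpF \<phi> (AllF x \<sigma> \<phi>)"
    using assms(2) by (auto intro: derives_imp_all derives_refl)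
  then show ?case using hyp by (auto intro: ld.mp[OF ld.base] ld.hyp)
next
  case (mp \<phi> \<psi>)
  let ?A = "AllF x \<sigma> (ImpF \<phi> \<psi>)" and ?B = "AllF x \<sigma> \<phi>"
  have wf: "wff \<phi>" "wff \<psi>" using ld_wff[OF mp.hyps(1)] by auto
  have "ld T {?A, ?B} ?A" "ld T {?A, ?B} ?B" using wf by (auto intro: ld.hyp)
  then have "ld T {?A, ?B} (ImpF \<phi> \<psi>)" "ld T {?A, ?B} \<phi>"
    by (auto dest!: ld_all_inst[where u = "Var x \<sigma>"])
  then have "ld T {?A, ?B} \<psi>" by (rule ld.mp)
  then have "ld T {?A} (ImpF ?B \<psi>)"
    using wf by (intro deduction) (auto simp: insert_commute)
  then have "T \<turnstile> ImpF ?A (ImpF ?B \<psi>)" using wf by (auto intro!: ld_empty deduction)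
  then have 1: "T \<turnstile> ImpF ?A (AllF x \<sigma> (ImpF ?B \<psi>))" using wf by (intro derives_imp_all) auto
  have 2: "T \<turnstile> ImpF (AllF x \<sigma> (ImpF ?B \<psi>)) (ImpF ?B (AllF x \<sigma> \<psi>))"
    using wf by (intro all_imp) auto
  have "ld T G (AllF x \<sigma> (ImpF ?B \<psi>))" using wf by (intro ld.mp[OF ld.base[OF 1] mp.IH(1)]) simp
  then have "ld T G (ImpF ?B (AllF x \<sigma> \<psi>))" using wf by (intro ld.mp[OF ld.base[OF 2]]) simp_all
  then show ?case using mp.IH(2) by (rule ld.mp)
qed

text \<open>Derivations are finite: both premises of a modus ponens are already available at the
  later of their two stages.\<close>

lemma ld_Union_chain:
  assumes "ld T (\<Union>n. S n) \<phi>" "\<And>m n. m \<le> n \<Longrightarrow> S m \<subseteq> S (n::nat)"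
  shows "\<exists>n. ld T (S n) \<phi>"
  using assms(1)
proof (induction rule: ld.induct)
  case (mp \<phi> \<psi>)
  then obtain m n where "ld T (S m) (ImpF \<phi> \<psi>)" "ld T (S n) \<phi>" by blast
  then have "ld T (S (max m n)) (ImpF \<phi> \<psi>)" "ld T (S (max m n)) \<phi>"
    using assms(2)[of m "max m n"] assms(2)[of n "max m n"] by (auto intro: ld_mono)
  then show ?case by (auto intro: ld.mp)
qed (auto intro: ld.intros)

abbreviation con :: "fm set \<Rightarrow> fm set \<Rightarrow> bool" where "con T G \<equiv> \<not> ld T G BotF"

text \<open>If the witness for the failure of \<open>\<chi>\<close> were refutable, then
  \<open>G\<close> would derive \<open>\<chi>\<close> at the fresh variable \<open>y\<close>.
  Generalising over \<open>y\<close> and renaming it back to \<open>x\<close> gives the universal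
  formula, whose negation is in \<open>G\<close>.\<close>

lemma con_witness:
  assumes con: "con T G" and in_G: "NegF (AllF x \<sigma> \<chi>) \<in> G" and wf: "wff \<chi>"
    and fresh: "\<And>\<gamma>. \<gamma> \<in> G \<Longrightarrow> (y, \<sigma>) \<notin> avars \<gamma>"
  shows "con T (insert (NegF (subst x \<sigma> (Var y \<sigma>) \<chi>)) G)"
proof
  let ?\<chi>y = "subst x \<sigma> (Var y \<sigma>) \<chi>"
  have wfy: "wff ?\<chi>y" using wf by (simp add: wff_subst)
  have y: "(y, \<sigma>) \<notin> avars \<chi>" "x \<noteq> y" using fresh[OF in_G] by auto
  assume "ld T (insert (NegF ?\<chi>y) G) BotF"
  then have "ld T G ?\<chi>y" using wfy by (auto dest: ld_dneg[OF deduction])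
  then have all_y: "ld T G (AllF y \<sigma> ?\<chi>y)"
    using fresh fv_subset_avars by (blast intro: ld_gen)
  have "T \<turnstile> ImpF (AllF y \<sigma> ?\<chi>y) (subst y \<sigma> (Var x \<sigma>) ?\<chi>y)"
    using wfy y free_for_back by (intro all_inst) auto
  then have "T \<turnstile> ImpF (AllF y \<sigma> ?\<chi>y) \<chi>" using y by (simp add: subst_back)
  moreover have "(x, \<sigma>) \<notin> fv (AllF y \<sigma> ?\<chi>y)" using fv_subst_subset[of x \<sigma> "Var y \<sigma>" \<chi>] y by auto
  ultimately have "T \<turnstile> ImpF (AllF y \<sigma> ?\<chi>y) (AllF x \<sigma> \<chi>)"
    using wf wfy by (intro derives_imp_all) auto
  then have "ld T G (AllF x \<sigma> \<chi>)" using all_y wf wfy by (auto intro: ld.mp[OF ld.base])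
  then have "ld T G BotF" using in_G wf by (auto intro: ld.mp[OF ld.hyp])
  with con show False by simp
qed


subsection \<open>Henkin sets\<close>

text \<open>The witnesses are variables of index at least \<open>B\<close>, which are to play the role of
  constants for the formulas all of whose variables have an index below \<open>B\<close>.\<close>

locale henkin =
  fixes T :: "fm set" and B :: nat and \<Gamma> :: "fm set"
  assumes wff_\<Gamma>: "\<phi> \<in> \<Gamma> \<Longrightarrow> wff \<phi>"
    and con_\<Gamma>: "con T \<Gamma>"
    and max_\<Gamma>: "wff \<phi> \<Longrightarrow> con T (insert \<phi> \<Gamma>) \<Longrightarrow> \<phi> \<in> \<Gamma>"
    and witness_\<Gamma>: "NegF (AllF x \<sigma> \<chi>) \<in> \<Gamma> \<Longrightarrow>
      \<exists>y \<ge> B. (\<forall>z \<in> avars \<chi>. fst z < y) \<and> NegF (subst x \<sigma> (Var y \<sigma>) \<chi>) \<in> \<Gamma>"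

instance ty :: countable by countable_datatype
instance cst :: countable by countable_datatype
instance trm :: countable by countable_datatype
instance fm :: countable by countable_datatype

definition fresh :: "nat \<Rightarrow> fm set \<Rightarrow> nat" where
  "fresh B G = (SOME y. B \<le> y \<and> (\<forall>\<gamma> \<in> G. \<forall>z \<in> avars \<gamma>. fst z < y))"

lemma fresh:
  assumes "finite G"
  shows "B \<le> fresh B G" "\<gamma> \<in> G \<Longrightarrow> z \<in> avars \<gamma> \<Longrightarrow> fst z < fresh B G"
proof -
  let ?I = "fst ` (\<Union>\<gamma> \<in> G. avars \<gamma>)"
  have "finite ?I" using assms by auto
  then have *: "i \<le> Max ?I" if "i \<in> ?I" for i using that by (rule Max_ge)
  have "fst z < B + Suc (Max ?I)" if "\<gamma> \<in> G" "z \<in> avars \<gamma>" for \<gamma> z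
    using *[of "fst z"] that by (force simp: less_Suc_eq_le trans_le_add2)
  then have "\<exists>y. B \<le> y \<and> (\<forall>\<gamma> \<in> G. \<forall>z \<in> avars \<gamma>. fst z < y)"
    by (intro exI[of _ "B + Suc (Max ?I)"]) auto
  from someI_ex[OF this] show "B \<le> fresh B G" "\<gamma> \<in> G \<Longrightarrow> z \<in> avars \<gamma> \<Longrightarrow> fst z < fresh B G"
    unfolding fresh_def by auto
qed

text \<open>The witness is added together with the negated universal formula. At this moment the set
  is still finite, which guarantees a fresh variable.\<close>

definition extend :: "fm set \<Rightarrow> nat \<Rightarrow> fm \<Rightarrow> fm set \<Rightarrow> fm set" where
  "extend T B \<psi> G = (if wff \<psi> \<and> con T (insert \<psi> G) then
     (case \<psi> of ImpF (AllF x \<sigma> \<chi>) BotF \<Rightarrow>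
        insert (NegF (subst x \<sigma> (Var (fresh B (insert \<psi> G)) \<sigma>) \<chi>)) (insert \<psi> G)
      | _ \<Rightarrow> insert \<psi> G)
   else G)"

lemma extend_cases:
  assumes "\<not> (wff \<psi> \<and> con T (insert \<psi> G)) \<Longrightarrow> P G"
    and "wff \<psi> \<Longrightarrow> con T (insert \<psi> G) \<Longrightarrow> \<forall>x \<sigma> \<chi>. \<psi> \<noteq> NegF (AllF x \<sigma> \<chi>) \<Longrightarrow> P (insert \<psi> G)"
    and "\<And>x \<sigma> \<chi>. wff \<psi> \<Longrightarrow> con T (insert \<psi> G) \<Longrightarrow> \<psi> = NegF (AllF x \<sigma> \<chi>) \<Longrightarrow>
      P (insert (NegF (subst x \<sigma> (Var (fresh B (insert \<psi> G)) \<sigma>) \<chi>)) (insert \<psi> G))"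
  shows "P (extend T B \<psi> G)"
  unfolding extend_def using assms by (auto split: fm.splits)

lemma extend_in: "wff \<psi> \<Longrightarrow> con T (insert \<psi> G) \<Longrightarrow> \<psi> \<in> extend T B \<psi> G"
  unfolding extend_def by (auto split: fm.splits)

primrec chain :: "fm set \<Rightarrow> nat \<Rightarrow> fm \<Rightarrow> nat \<Rightarrow> fm set" where
  "chain T B \<phi> 0 = {\<phi>}"
| "chain T B \<phi> (Suc n) = extend T B (from_nat n) (chain T B \<phi> n)"

lemma chain_step: "chain T B \<phi> n \<subseteq> chain T B \<phi> (Suc n)"
  unfolding chain.simps by (rule extend_cases) auto

lemma chain_mono: "m \<le> n \<Longrightarrow> chain T B \<phi> m \<subseteq> chain T B \<phi> n"
  using chain_step lift_Suc_mono_le by metis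

lemma chain_invariant:
  assumes "con T {\<phi>}" "wff \<phi>"
  shows "finite (chain T B \<phi> n) \<and> con T (chain T B \<phi> n) \<and> (\<forall>\<gamma> \<in> chain T B \<phi> n. wff \<gamma>)"
proof (induction n)
  case (Suc n)
  show ?case
    unfolding chain.simps
  proof (rule extend_cases)
    fix x \<sigma> \<chi>
    let ?G = "insert (from_nat n) (chain T B \<phi> n)"
    assume *: "wff (from_nat n)" "con T ?G" "from_nat n = NegF (AllF x \<sigma> \<chi>)"
    have fin: "finite ?G" using Suc by simp
    have "con T (insert (NegF (subst x \<sigma> (Var (fresh B ?G) \<sigma>) \<chi>)) ?G)"
      using * fresh(2)[OF fin, where z = "(fresh B ?G, \<sigma>)" and B = B] by (intro con_witness) auto
    then show "finite (insert (NegF (subst x \<sigma> (Var (fresh B ?G) \<sigma>) \<chi>)) ?G) \<and>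
      con T (insert (NegF (subst x \<sigma> (Var (fresh B ?G) \<sigma>) \<chi>)) ?G) \<and>
      (\<forall>\<gamma> \<in> insert (NegF (subst x \<sigma> (Var (fresh B ?G) \<sigma>) \<chi>)) ?G. wff \<gamma>)"
      using * Suc by (auto simp: wff_subst)
  qed (use Suc in auto)
qed (use assms in auto)

theorem henkin_exists:
  assumes "\<not> T \<turnstile> \<phi>" "wff \<phi>"
  shows "\<exists>\<Gamma>. henkin T B \<Gamma> \<and> NegF \<phi> \<in> \<Gamma>"
proof -
  let ?S = "chain T B (NegF \<phi>)"
  have "con T {NegF \<phi>}"
  proof
    assume "ld T {NegF \<phi>} BotF"
    then have "ld T {} \<phi>" using assms(2) by (auto dest: ld_dneg[OF deduction])
    with assms(1) show False using ld_empty by auto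
  qed
  then have inv: "finite (?S n)" "con T (?S n)" "\<gamma> \<in> ?S n \<Longrightarrow> wff \<gamma>" for n \<gamma>
    using chain_invariant[of T "NegF \<phi>" B n] assms(2) by auto
  have "henkin T B (\<Union>n. ?S n)"
  proof
    show con: "con T (\<Union>n. ?S n)" using ld_Union_chain[of T ?S BotF, OF _ chain_mono] inv(2) by auto
    show "wff \<psi>" if "\<psi> \<in> (\<Union>n. ?S n)" for \<psi>
      using that by (elim UN_E) (rule inv(3))
    show "\<psi> \<in> (\<Union>n. ?S n)" if "wff \<psi>" "con T (insert \<psi> (\<Union>n. ?S n))" for \<psi>
    proof -
      obtain n where n: "\<psi> = from_nat n" by (metis from_nat_to_nat)
      have "con T (insert \<psi> (?S n))"
        using that(2) ld_mono[of T "insert \<psi> (?S n)" BotF "insert \<psi> (\<Union>n. ?S n)"] by blast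
      then have "\<psi> \<in> ?S (Suc n)" using that(1) n extend_in by simp
      then show ?thesis by blast
    qed
    show "\<exists>y \<ge> B. (\<forall>z \<in> avars \<chi>. fst z < y) \<and> NegF (subst x \<sigma> (Var y \<sigma>) \<chi>) \<in> (\<Union>n. ?S n)"
      if in_S: "NegF (AllF x \<sigma> \<chi>) \<in> (\<Union>n. ?S n)" for x \<sigma> \<chi>
    proof -
      \<comment> \<open>The formula may have entered the chain before its turn in the enumeration.
        At its turn it is still consistent with the stage, being a member of the consistent union,
        so that its witness is added then.\<close>
      let ?\<psi> = "NegF (AllF x \<sigma> \<chi>)"
      obtain n where n: "?\<psi> = from_nat n" by (metis from_nat_to_nat)
      let ?G = "insert ?\<psi> (?S n)"
      have "ld T (\<Union>n. ?S n) BotF" if "ld T ?G BotF"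
        using ld_mono[OF that, of "\<Union>n. ?S n"] in_S by auto
      then have "con T ?G" using con by auto
      moreover have "wff ?\<psi>" using in_S by (elim UN_E) (rule inv(3))
      ultimately have "NegF (subst x \<sigma> (Var (fresh B ?G) \<sigma>) \<chi>) \<in> ?S (Suc n)"
        unfolding chain.simps using n[symmetric] by (simp add: extend_def)
      moreover have "finite ?G" using inv by simp
      then have "B \<le> fresh B ?G" "\<forall>z \<in> avars \<chi>. fst z < fresh B ?G"
        using fresh(1)[where B = B and G = ?G] fresh(2)[where B = B and G = ?G and \<gamma> = ?\<psi>] by auto
      ultimately show ?thesis by blast
    qed
  qed
  moreover have "NegF \<phi> \<in> (\<Union>n. ?S n)" by (rule UN_I[of 0]) auto
  ultimately show ?thesis by blast
qed

context henkin
begin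

lemma ld_iff: "ld T \<Gamma> \<phi> \<longleftrightarrow> \<phi> \<in> \<Gamma>"
proof
  assume *: "ld T \<Gamma> \<phi>"
  have wf: "wff \<phi>" using * by (rule ld_wff)
  have "con T (insert \<phi> \<Gamma>)"
  proof
    assume "ld T (insert \<phi> \<Gamma>) BotF"
    then have "ld T \<Gamma> (NegF \<phi>)" using wf by (rule deduction)
    with * con_\<Gamma> show False by (blast intro: ld.mp)
  qed
  with wf show "\<phi> \<in> \<Gamma>" by (rule max_\<Gamma>)
qed (auto intro: ld.hyp wff_\<Gamma>)

lemma derives_in: "T \<turnstile> \<phi> \<Longrightarrow> wff \<phi> \<Longrightarrow> \<phi> \<in> \<Gamma>"
  by (auto simp: ld_iff[symmetric] intro: ld.base)

lemma Bot_notin: "BotF \<notin> \<Gamma>"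
  using con_\<Gamma> by (simp add: ld_iff)

lemma mp_in: "ImpF \<phi> \<psi> \<in> \<Gamma> \<Longrightarrow> \<phi> \<in> \<Gamma> \<Longrightarrow> \<psi> \<in> \<Gamma>"
  by (simp add: ld_iff[symmetric]) (rule ld.mp)

lemma derives_mp_in: "T \<turnstile> ImpF \<phi> \<psi> \<Longrightarrow> \<phi> \<in> \<Gamma> \<Longrightarrow> wff \<psi> \<Longrightarrow> \<psi> \<in> \<Gamma>"
  using mp_in derives_in wff_\<Gamma> wff.simps(4) by metis

lemma Neg_in: "wff \<phi> \<Longrightarrow> \<phi> \<notin> \<Gamma> \<Longrightarrow> NegF \<phi> \<in> \<Gamma>"
  using max_\<Gamma>[of \<phi>] deduction[of T \<phi> \<Gamma> BotF] by (auto simp: ld_iff)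

lemma Imp_in: "wff \<phi> \<Longrightarrow> wff \<psi> \<Longrightarrow> ImpF \<phi> \<psi> \<in> \<Gamma> \<longleftrightarrow> (\<phi> \<in> \<Gamma> \<longrightarrow> \<psi> \<in> \<Gamma>)"
proof
  assume wf: "wff \<phi>" "wff \<psi>" and imp: "\<phi> \<in> \<Gamma> \<longrightarrow> \<psi> \<in> \<Gamma>"
  show "ImpF \<phi> \<psi> \<in> \<Gamma>"
  proof (cases "\<phi> \<in> \<Gamma>")
    case True
    with imp wf show ?thesis by (auto simp: ld_iff[symmetric] intro: ld_imp_intro)
  next
    case False
    then have "NegF \<phi> \<in> insert (NegF \<psi>) (insert \<phi> \<Gamma>)" using Neg_in wf by auto
    then have "ld T (insert (NegF \<psi>) (insert \<phi> \<Gamma>)) BotF"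
      using wf by (auto intro!: ld.mp[OF ld.hyp[of "NegF \<phi>"] ld.hyp])
    then have "ld T \<Gamma> (ImpF \<phi> \<psi>)" using wf by (auto dest: deduction[OF ld_dneg[OF deduction]])
    then show ?thesis by (simp add: ld_iff)
  qed
qed (auto intro: mp_in)

lemma All_inst_in:
  "AllF x \<sigma> \<phi> \<in> \<Gamma> \<Longrightarrow> ty_of u = Some \<sigma> \<Longrightarrow> free_for u x \<sigma> \<phi> \<Longrightarrow> subst x \<sigma> u \<phi> \<in> \<Gamma>"
  by (simp add: ld_iff[symmetric]) (rule ld_all_inst)

end

subsection \<open>Extensional equality and its bound variables\<close>

fun ar :: "ty \<Rightarrow> nat" where
  "ar N = 0"
| "ar (\<sigma> \<rightarrow> \<tau>) = Suc (ar \<tau>)"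

text \<open>The builder \<open>eqt \<sigma> s t k\<close> binds variables with exactly the indices
  from \<open>k\<close> up to, but excluding, \<open>k + ar \<sigma>\<close>; the terms put into it
  have to avoid these.\<close>

definition clear :: "nat \<Rightarrow> ty \<Rightarrow> trm \<Rightarrow> bool" where
  "clear k \<sigma> t \<longleftrightarrow> (\<forall>z \<in> vars t. fst z < k \<or> k + ar \<sigma> \<le> fst z)"

lemma wff_eqt: "ty_of s = Some \<sigma> \<Longrightarrow> ty_of t = Some \<sigma> \<Longrightarrow> wff (eqt \<sigma> s t k)"
  by (induction \<sigma> arbitrary: s t k) (auto simp: eq_def allq_def)

lemma avars_eqt_bound: "i < ar \<sigma> \<Longrightarrow> \<exists>\<tau>. (k + i, \<tau>) \<in> avars (eqt \<sigma> s t k)"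
proof (induction \<sigma> arbitrary: s t k i)
  case (Fn \<sigma> \<tau>)
  show ?case
  proof (cases i)
    case (Suc j)
    with Fn.IH(2)[of j "Suc k"] Fn.prems show ?thesis by (fastforce simp: allq_def)
  qed (auto simp: allq_def)
qed simp

lemma fv_eqt: "fv (eqt \<sigma> s t k) \<subseteq> vars s \<union> vars t"
proof (induction \<sigma> arbitrary: s t k)
  case (Fn \<sigma> \<tau>)
  show ?case using Fn.IH(2)[of "s \<cdot> Var k \<sigma>" "t \<cdot> Var k \<sigma>" "Suc k"] by (auto simp: allq_def)
qed (auto simp: eq_def)

lemma subst_eqt:
  "x < k \<or> k + ar \<sigma> \<le> x \<Longrightarrow>
    subst x \<rho> u (eqt \<sigma> s t k) = eqt \<sigma> (subst_t x \<rho> u s) (subst_t x \<rho> u t) k"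
  by (induction \<sigma> arbitrary: s t k) (auto simp: eq_def allq_def)

lemma free_for_eqt: "clear k \<sigma> u \<Longrightarrow> free_for u x \<rho> (eqt \<sigma> s t k)"
proof (induction \<sigma> arbitrary: s t k)
  case (Fn \<sigma> \<tau>)
  have "clear (Suc k) \<tau> u" "(k, \<sigma>) \<notin> vars u" using Fn.prems by (force simp: clear_def)+
  with Fn.IH(2) show ?case by (auto simp: allq_def)
qed (auto simp: eq_def)

lemma clear_bound: "(\<And>z. z \<in> vars t \<Longrightarrow> fst z < k) \<Longrightarrow> clear k \<sigma> t"
  by (auto simp: clear_def)

lemma derives_trans:
  assumes "T \<turnstile> ImpF \<phi> \<psi>" "T \<turnstile> ImpF \<psi> \<chi>" "wff \<phi>" "wff \<psi>" "wff \<chi>"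
  shows "T \<turnstile> ImpF \<phi> \<chi>"
  by (rule derives.mp[OF derives.mp[OF imp_S] assms(1)])
    (use assms in \<open>auto intro: derives.mp[OF imp_K]\<close>)

lemma index_bound: "finite Z \<Longrightarrow> \<exists>K \<ge> m. \<forall>z \<in> Z. fst z < (K :: nat)"
proof (induction rule: finite_induct)
  case (insert x F)
  then obtain K where "m \<le> K" "\<forall>z \<in> F. fst z < K" by blast
  then show ?case by (intro exI[of _ "max K (Suc (fst x))"]) fastforce
qed auto

text \<open>The calculus has no rule for renaming bound variables, but the same extensional equality
  is written with different ones at different depths. In the induction step the body is first moved
  to a depth \<open>K\<close> above all variables at hand, then the outer variable is renamed, and
  finally the body is moved down again.\<close>

lemma eqt_alpha:
  assumes "ty_of s = Some \<sigma>" "ty_of t = Some \<sigma>"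
    and "clear k \<sigma> s" "clear k \<sigma> t" "clear k' \<sigma> s" "clear k' \<sigma> t"
  shows "T \<turnstile> ImpF (eqt \<sigma> s t k) (eqt \<sigma> s t k')"
  using assms
proof (induction \<sigma> arbitrary: s t k k')
  case N
  then show ?case by (auto simp: eq_def intro: derives_refl)
next
  case (Fn \<rho> \<tau>)
  note [simp] = Fn.prems(1,2)
  obtain K where K: "\<forall>z \<in> vars s \<union> vars t. fst z < K" "K \<ge> k + k' + ar \<tau> + 2"
    using index_bound[of "vars s \<union> vars t" "k + k' + ar \<tau> + 2"] by auto
  define b where "b i m = eqt \<tau> (s \<cdot> Var i \<rho>) (t \<cdot> Var i \<rho>) m" for i m
  have wf [simp]: "wff (b i m)" for i m by (auto simp: b_def intro!: wff_eqt)
  have A: "eqt (\<rho> \<rightarrow> \<tau>) s t i = AllF i \<rho> (b i (Suc i))" for i by (simp add: allq_def b_def)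
  have idle: "(i, \<rho>) \<notin> vars s \<union> vars t" if "i = k \<or> i = k'" for i
    using that Fn.prems by (force simp: clear_def)
  have cl: "clear (Suc i) \<tau> (s \<cdot> Var i \<rho>) \<and> clear (Suc i) \<tau> (t \<cdot> Var i \<rho>)" if "i = k \<or> i = k'" for i
    using that Fn.prems by (auto simp: clear_def)
  have clK: "clear K \<tau> (s \<cdot> Var i \<rho>) \<and> clear K \<tau> (t \<cdot> Var i \<rho>)" if "i = k \<or> i = k'" for i
    using that K by (auto intro!: clear_bound)
  have b_k: "T \<turnstile> ImpF (b k (Suc k)) (b k K)" and b_k': "T \<turnstile> ImpF (b k' K) (b k' (Suc k'))"
    unfolding b_def using cl clK by (auto intro!: Fn.IH(2))
  have "T \<turnstile> ImpF (AllF k \<rho> (b k (Suc k))) (b k (Suc k))"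
    using all_inst[of "b k (Suc k)" "Var k \<rho>" \<rho> k] by simp
  then have "T \<turnstile> ImpF (AllF k \<rho> (b k (Suc k))) (b k K)"
    using b_k by (rule derives_trans) auto
  then have 1: "T \<turnstile> ImpF (AllF k \<rho> (b k (Suc k))) (AllF k \<rho> (b k K))"
    by (rule derives_imp_all) auto
  have "T \<turnstile> ImpF (AllF k \<rho> (b k K)) (subst k \<rho> (Var k' \<rho>) (b k K))"
    using K by (intro all_inst) (auto simp: b_def clear_def intro!: free_for_eqt wff_eqt)
  also have "subst k \<rho> (Var k' \<rho>) (b k K) = b k' K"
    using K idle[of k] by (simp add: b_def subst_eqt subst_t_idle)
  finally have "T \<turnstile> ImpF (AllF k \<rho> (b k (Suc k))) (b k' K)"
    by (intro derives_trans[OF 1]) auto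
  then have "T \<turnstile> ImpF (AllF k \<rho> (b k (Suc k))) (b k' (Suc k'))"
    using b_k' by (rule derives_trans) auto
  moreover have "(k', \<rho>) \<notin> fv (AllF k \<rho> (b k (Suc k)))"
    using fv_eqt[of "\<rho> \<rightarrow> \<tau>" s t k] idle[of k'] unfolding A by blast
  ultimately show ?case unfolding A by (intro derives_imp_all) auto
qed


subsection \<open>Semantics\<close>

fun eval :: "('a \<Rightarrow> 'a \<Rightarrow> 'a) \<Rightarrow> (cst \<Rightarrow> 'a) \<Rightarrow> (nat \<times> ty \<Rightarrow> 'a) \<Rightarrow> trm \<Rightarrow> 'a" where
  "eval ap cs w (Var n \<sigma>) = w (n, \<sigma>)"
| "eval ap cs w (Cst c) = cs c"
| "eval ap cs w (s \<cdot> t) = ap (eval ap cs w s) (eval ap cs w t)"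

fun Sat :: "(ty \<Rightarrow> 'a set) \<Rightarrow> ('a \<Rightarrow> 'a \<Rightarrow> 'a) \<Rightarrow> (cst \<Rightarrow> 'a) \<Rightarrow> ('a \<Rightarrow> 'a \<Rightarrow> bool) \<Rightarrow>
    (nat \<times> ty \<Rightarrow> 'a) \<Rightarrow> fm \<Rightarrow> bool" where
  "Sat D ap cs ls w (EqF s t) \<longleftrightarrow> eval ap cs w s = eval ap cs w t"
| "Sat D ap cs ls w (LtF s t) \<longleftrightarrow> ls (eval ap cs w s) (eval ap cs w t)"
| "Sat D ap cs ls w BotF \<longleftrightarrow> False"
| "Sat D ap cs ls w (ImpF \<phi> \<psi>) \<longleftrightarrow> (Sat D ap cs ls w \<phi> \<longrightarrow> Sat D ap cs ls w \<psi>)"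
| "Sat D ap cs ls w (AllF n \<sigma> \<phi>) \<longleftrightarrow> (\<forall>a \<in> D \<sigma>. Sat D ap cs ls (w((n, \<sigma>) := a)) \<phi>)"


subsection \<open>The term model\<close>

definition hterms :: "nat \<Rightarrow> ty \<Rightarrow> trm set" where
  "hterms B \<sigma> = {t. ty_of t = Some \<sigma> \<and> (\<forall>z \<in> vars t. B \<le> fst z)}"

fun rel :: "nat \<Rightarrow> fm set \<Rightarrow> ty \<Rightarrow> trm \<Rightarrow> trm \<Rightarrow> bool" where
  "rel B \<Gamma> N s t \<longleftrightarrow> EqF s t \<in> \<Gamma>"
| "rel B \<Gamma> (\<rho> \<rightarrow> \<tau>) s t \<longleftrightarrow> (\<forall>u \<in> hterms B \<rho>. rel B \<Gamma> \<tau> (s \<cdot> u) (t \<cdot> u))"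

definition cls :: "nat \<Rightarrow> fm set \<Rightarrow> trm \<Rightarrow> trm set" where
  "cls B \<Gamma> t = {u. \<exists>\<sigma>. t \<in> hterms B \<sigma> \<and> u \<in> hterms B \<sigma> \<and> rel B \<Gamma> \<sigma> t u}"

definition tdom :: "nat \<Rightarrow> fm set \<Rightarrow> ty \<Rightarrow> trm set set" where
  "tdom B \<Gamma> \<sigma> = cls B \<Gamma> ` hterms B \<sigma>"

definition tapp :: "nat \<Rightarrow> fm set \<Rightarrow> trm set \<Rightarrow> trm set \<Rightarrow> trm set" where
  "tapp B \<Gamma> a b = cls B \<Gamma> ((SOME t. t \<in> a) \<cdot> (SOME t. t \<in> b))"

definition tless :: "fm set \<Rightarrow> trm set \<Rightarrow> trm set \<Rightarrow> bool" where
  "tless \<Gamma> a b \<longleftrightarrow> LtF (SOME t. t \<in> a) (SOME t. t \<in> b) \<in> \<Gamma>"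

lemma hterms_unique: "t \<in> hterms B \<sigma> \<Longrightarrow> t \<in> hterms B \<tau> \<Longrightarrow> \<sigma> = \<tau>"
  by (auto simp: hterms_def)

lemma hterms_app: "s \<in> hterms B (\<sigma> \<rightarrow> \<tau>) \<Longrightarrow> t \<in> hterms B \<sigma> \<Longrightarrow> s \<cdot> t \<in> hterms B \<tau>"
  by (auto simp: hterms_def)

lemma hterms_Cst: "Cst c \<in> hterms B (cst_ty c)"
  by (auto simp: hterms_def)

lemma hterms_Var: "B \<le> n \<Longrightarrow> Var n \<sigma> \<in> hterms B \<sigma>"
  by (auto simp: hterms_def)

lemma hterms_tsub:
  assumes "\<And>n \<sigma>. v (n, \<sigma>) \<in> hterms B \<sigma>"
  shows "ty_of t = Some \<sigma> \<Longrightarrow> tsub v t \<in> hterms B \<sigma>"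
proof (induction t arbitrary: \<sigma>)
  case (App s t)
  then show ?case by (auto intro: hterms_app split: option.splits ty.splits if_splits)
qed (use assms hterms_Cst in auto)

locale henkin_rca = henkin +
  assumes rca: "RCA0_omega \<subseteq> T" and B: "3 \<le> B"
begin

lemma eq_congr:
  assumes "EqF s t \<in> \<Gamma>" "wff \<phi>" "qf \<phi>" "s \<in> hterms B N" "t \<in> hterms B N"
    and "subst 0 N s \<phi> \<in> \<Gamma>"
  shows "subst 0 N t \<phi> \<in> \<Gamma>"
proof -
  have ty: "ty_of s = Some N" "ty_of t = Some N" using assms by (auto simp: hterms_def)
  then have "ImpF (EqF s t) (ImpF (subst 0 N s \<phi>) (subst 0 N t \<phi>)) \<in> \<Gamma>"
    using assms by (intro derives_in eq_subst) (auto simp: wff_subst)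
  with assms show ?thesis by (blast intro: mp_in)
qed

lemma subst_hterm: "t \<in> hterms B \<tau> \<Longrightarrow> x < B \<Longrightarrow> subst_t x \<sigma> u t = t"
  by (force simp: hterms_def intro!: subst_t_idle)

lemma rel_refl: "t \<in> hterms B \<sigma> \<Longrightarrow> rel B \<Gamma> \<sigma> t t"
proof (induction \<sigma> arbitrary: t)
  case N then show ?case by (auto simp: hterms_def intro: derives_in eq_refl)
next
  case (Fn \<rho> \<tau>) then show ?case by (auto intro: hterms_app)
qed

lemma rel_sym: "s \<in> hterms B \<sigma> \<Longrightarrow> t \<in> hterms B \<sigma> \<Longrightarrow> rel B \<Gamma> \<sigma> s t \<Longrightarrow> rel B \<Gamma> \<sigma> t s"
proof (induction \<sigma> arbitrary: s t)
  case N
  then show ?case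
    using eq_congr[of s t "EqF (Var 0 N) s"] rel_refl[of s N] B
    by (auto simp: subst_hterm) (auto simp: hterms_def)
next
  case (Fn \<rho> \<tau>)
  then have "s \<cdot> u \<in> hterms B \<tau> \<and> t \<cdot> u \<in> hterms B \<tau>" if "u \<in> hterms B \<rho>" for u
    using that hterms_app by blast
  with Fn show ?case by simp
qed

lemma rel_trans:
  "r \<in> hterms B \<sigma> \<Longrightarrow> s \<in> hterms B \<sigma> \<Longrightarrow> t \<in> hterms B \<sigma> \<Longrightarrow>
    rel B \<Gamma> \<sigma> r s \<Longrightarrow> rel B \<Gamma> \<sigma> s t \<Longrightarrow> rel B \<Gamma> \<sigma> r t"
proof (induction \<sigma> arbitrary: r s t)
  case N
  then show ?case
    using eq_congr[of s t "EqF r (Var 0 N)"] B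
    by (auto simp: subst_hterm) (auto simp: hterms_def)
next
  case (Fn \<rho> \<tau>)
  then have "r \<cdot> u \<in> hterms B \<tau> \<and> s \<cdot> u \<in> hterms B \<tau> \<and> t \<cdot> u \<in> hterms B \<tau>"
    if "u \<in> hterms B \<rho>" for u
    using that hterms_app by blast
  with Fn.prems show ?case using Fn.IH(2) by (simp, blast)
qed

lemma eqt_in_alpha:
  assumes "eqt \<sigma> s t k \<in> \<Gamma>" "ty_of s = Some \<sigma>" "ty_of t = Some \<sigma>"
    and "clear k \<sigma> s" "clear k \<sigma> t" "clear k' \<sigma> s" "clear k' \<sigma> t"
  shows "eqt \<sigma> s t k' \<in> \<Gamma>"
  using derives_mp_in[OF eqt_alpha] assms wff_eqt by blast

text \<open>If the formula failed, Henkin's condition would supply a variable at which it fails,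
  contradicting the relation. Conversely, before a term \<open>u\<close> is put in, the formula is
  moved to a depth above the variables of all three terms, so that nothing is captured.\<close>

lemma rel_iff_eqt:
  assumes "s \<in> hterms B \<sigma>" "t \<in> hterms B \<sigma>" "clear k \<sigma> s" "clear k \<sigma> t"
  shows "rel B \<Gamma> \<sigma> s t \<longleftrightarrow> eqt \<sigma> s t k \<in> \<Gamma>"
  using assms
proof (induction \<sigma> arbitrary: s t k)
  case N then show ?case by (auto simp: eq_def)
next
  case (Fn \<rho> \<tau>)
  have ty: "ty_of s = Some (\<rho> \<rightarrow> \<tau>)" "ty_of t = Some (\<rho> \<rightarrow> \<tau>)"
    using Fn.prems by (auto simp: hterms_def)
  define b where "b m = eqt \<tau> (s \<cdot> Var m \<rho>) (t \<cdot> Var m \<rho>) (Suc m)" for m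
  have A: "eqt (\<rho> \<rightarrow> \<tau>) s t m = AllF m \<rho> (b m)" for m by (simp add: allq_def b_def)
  have wf: "wff (b m)" for m unfolding b_def using ty by (intro wff_eqt) auto
  have sub: "subst m \<rho> u (b m) = eqt \<tau> (s \<cdot> u) (t \<cdot> u) (Suc m)"
    if "clear m (\<rho> \<rightarrow> \<tau>) s" "clear m (\<rho> \<rightarrow> \<tau>) t" for m u
  proof -
    have "(m, \<rho>) \<notin> vars s" "(m, \<rho>) \<notin> vars t" using that by (force simp: clear_def)+
    then show ?thesis unfolding b_def by (simp add: subst_eqt subst_t_idle)
  qed
  show ?case
  proof
    assume rel: "rel B \<Gamma> (\<rho> \<rightarrow> \<tau>) s t"
    show "eqt (\<rho> \<rightarrow> \<tau>) s t k \<in> \<Gamma>"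
    proof (rule ccontr)
      assume "eqt (\<rho> \<rightarrow> \<tau>) s t k \<notin> \<Gamma>"
      then have "NegF (AllF k \<rho> (b k)) \<in> \<Gamma>" using wf Neg_in by (simp add: A del: eqt.simps)
      then obtain y where y: "B \<le> y" "\<forall>z \<in> avars (b k). fst z < y"
          "NegF (subst k \<rho> (Var y \<rho>) (b k)) \<in> \<Gamma>"
        using witness_\<Gamma> by blast
      \<comment> \<open>The witness exceeds all bound variables of the nested equality as well, so
        that the instance at the witness is clear at the same depth.\<close>
      have "Suc k + i < y" if "i < ar \<tau>" for i
        using avars_eqt_bound[OF that, of "Suc k" "s \<cdot> Var k \<rho>" "t \<cdot> Var k \<rho>"] y(2)
        unfolding b_def[symmetric] by fastforce
      from this[of "ar \<tau> - 1"] have y': "ar \<tau> = 0 \<or> Suc k + ar \<tau> \<le> y"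
        by (cases "ar \<tau>") auto
      have "rel B \<Gamma> \<tau> (s \<cdot> Var y \<rho>) (t \<cdot> Var y \<rho>)" using rel y hterms_Var by auto
      moreover have "s \<cdot> Var y \<rho> \<in> hterms B \<tau>" "t \<cdot> Var y \<rho> \<in> hterms B \<tau>"
        using Fn.prems y(1) by (auto intro: hterms_app hterms_Var)
      moreover have "clear (Suc k) \<tau> (s \<cdot> Var y \<rho>)" "clear (Suc k) \<tau> (t \<cdot> Var y \<rho>)"
        using Fn.prems y' by (auto simp: clear_def)
      ultimately have "eqt \<tau> (s \<cdot> Var y \<rho>) (t \<cdot> Var y \<rho>) (Suc k) \<in> \<Gamma>" using Fn.IH(2) by blast
      then have "subst k \<rho> (Var y \<rho>) (b k) \<in> \<Gamma>" using Fn.prems by (simp add: sub)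
      with y(3) Bot_notin show False by (blast intro: mp_in)
    qed
  next
    assume eqt: "eqt (\<rho> \<rightarrow> \<tau>) s t k \<in> \<Gamma>"
    show "rel B \<Gamma> (\<rho> \<rightarrow> \<tau>) s t"
      unfolding rel.simps
    proof
      fix u assume u: "u \<in> hterms B \<rho>"
      obtain K where K: "\<forall>z \<in> vars s \<union> vars t \<union> vars u. fst z < K"
        using index_bound[of "vars s \<union> vars t \<union> vars u" 0] by auto
      then have clK: "clear K \<theta> s" "clear K \<theta> t" "clear (Suc K) \<theta> (s \<cdot> u)" "clear (Suc K) \<theta> (t \<cdot> u)"
        "clear (Suc K) \<theta> u" for \<theta>
        by (auto intro!: clear_bound less_SucI)
      have "AllF K \<rho> (b K) \<in> \<Gamma>" using eqt_in_alpha[OF eqt] ty Fn.prems clK by (simp add: A[symmetric] del: eqt.simps)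
      then have "subst K \<rho> u (b K) \<in> \<Gamma>"
        using u clK by (intro All_inst_in) (auto simp: hterms_def b_def intro: free_for_eqt)
      then have "eqt \<tau> (s \<cdot> u) (t \<cdot> u) (Suc K) \<in> \<Gamma>" by (simp add: sub clK)
      then show "rel B \<Gamma> \<tau> (s \<cdot> u) (t \<cdot> u)"
        using Fn.IH(2) Fn.prems u clK hterms_app by blast
    qed
  qed
qed

section \<open>Extensionality and the combinator axioms for terms of the model\<close>

lemma derives_inst:
  "T \<turnstile> \<phi> \<Longrightarrow> wff \<phi> \<Longrightarrow> ty_of u = Some \<sigma> \<Longrightarrow> free_for u x \<sigma> \<phi> \<Longrightarrow> T \<turnstile> subst x \<sigma> u \<phi>"
  by (blast intro: derives.mp[OF all_inst] gen)

lemma derives_All_elim: "T \<turnstile> AllF x \<sigma> \<phi> \<Longrightarrow> wff \<phi> \<Longrightarrow> T \<turnstile> \<phi>"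
  using derives.mp[OF all_inst[of \<phi> "Var x \<sigma>" \<sigma> x T]] by simp

text \<open>The axiom speaks of the variables 0, 1 and 2. Both equalities are moved to a depth above
  all variables of \<open>f\<close>, \<open>x\<close> and \<open>y\<close>, and then the three terms
  are put in one after the other; they do not interfere, since their own variables have index at
  least \<open>B\<close>, which is at least 3.\<close>

lemma rel_ext:
  assumes f: "f \<in> hterms B (\<rho> \<rightarrow> \<tau>)" and xy: "x \<in> hterms B \<rho>" "y \<in> hterms B \<rho>"
    and rel: "rel B \<Gamma> \<rho> x y"
  shows "rel B \<Gamma> \<tau> (f \<cdot> x) (f \<cdot> y)"
proof -
  let ?x = "Var 0 \<rho>" and ?y = "Var 1 \<rho>" and ?f = "Var 2 (\<rho> \<rightarrow> \<tau>)"
  have ty: "ty_of f = Some (\<rho> \<rightarrow> \<tau>)" "ty_of x = Some \<rho>" "ty_of y = Some \<rho>"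
    using f xy by (auto simp: hterms_def)
  have wf: "wff (eqt \<rho> ?x ?y k)" "wff (eqt \<tau> (?f \<cdot> ?x) (?f \<cdot> ?y) k)" for k by (auto intro!: wff_eqt)
  have "sentence (\<^bold>\<forall>x \<^bold>: \<rho>. \<^bold>\<forall>y \<^bold>: \<rho>. \<^bold>\<forall>f \<^bold>: \<rho> \<rightarrow> \<tau>. eqt \<rho> x y \<^bold>\<longrightarrow> eqt \<tau> (f \<cdot> x) (f \<cdot> y)) \<in> T"
    using rca unfolding RCA0_omega_def extensionality_axioms_def by blast
  then have "T \<turnstile> AllF 0 \<rho> (AllF 1 \<rho> (AllF 2 (\<rho> \<rightarrow> \<tau>)
      (ImpF (eqt \<rho> ?x ?y 3) (eqt \<tau> (?f \<cdot> ?x) (?f \<cdot> ?y) 3))))"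
    by (intro axm) (simp add: allq_def imp_def numeral_eq_Suc)
  then have 0: "T \<turnstile> ImpF (eqt \<rho> ?x ?y 3) (eqt \<tau> (?f \<cdot> ?x) (?f \<cdot> ?y) 3)"
    using wf by (auto dest!: derives_All_elim)
  obtain K where K: "\<forall>z \<in> vars f \<union> vars x \<union> vars y. fst z < K" "3 \<le> K"
    using index_bound[of "vars f \<union> vars x \<union> vars y" 3] by auto
  have clK: "clear K \<theta> f" "clear K \<theta> x" "clear K \<theta> y" "clear K \<theta> (f \<cdot> x)" "clear K \<theta> (f \<cdot> y)" for \<theta>
    using K by (auto intro!: clear_bound)
  have "T \<turnstile> ImpF (eqt \<rho> ?x ?y K) (eqt \<rho> ?x ?y 3)"
    using K by (intro eqt_alpha) (auto simp: clear_def)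
  then have "T \<turnstile> ImpF (eqt \<rho> ?x ?y K) (eqt \<tau> (?f \<cdot> ?x) (?f \<cdot> ?y) 3)"
    using 0 by (rule derives_trans) (auto intro!: wff_eqt)
  moreover have "T \<turnstile> ImpF (eqt \<tau> (?f \<cdot> ?x) (?f \<cdot> ?y) 3) (eqt \<tau> (?f \<cdot> ?x) (?f \<cdot> ?y) K)"
    using K by (intro eqt_alpha) (auto simp: clear_def)
  ultimately have 1: "T \<turnstile> ImpF (eqt \<rho> ?x ?y K) (eqt \<tau> (?f \<cdot> ?x) (?f \<cdot> ?y) K)"
    by (rule derives_trans) (auto intro!: wff_eqt)
  have 2: "T \<turnstile> ImpF (eqt \<rho> ?x ?y K) (eqt \<tau> (f \<cdot> ?x) (f \<cdot> ?y) K)"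
    using derives_inst[OF 1, of f "\<rho> \<rightarrow> \<tau>" 2] ty wf clK K by (simp add: subst_eqt free_for_eqt)
  have 3: "T \<turnstile> ImpF (eqt \<rho> x ?y K) (eqt \<tau> (f \<cdot> x) (f \<cdot> ?y) K)"
    using derives_inst[OF 2, of x \<rho> 0] ty wf clK K B f
    by (simp add: subst_eqt free_for_eqt wff_eqt subst_hterm)
  have 4: "T \<turnstile> ImpF (eqt \<rho> x y K) (eqt \<tau> (f \<cdot> x) (f \<cdot> y) K)"
    using derives_inst[OF 3, of y \<rho> 1] ty wf clK K B f xy
    by (simp add: subst_eqt free_for_eqt wff_eqt subst_hterm)
  have "eqt \<rho> x y K \<in> \<Gamma>" using rel rel_iff_eqt[OF xy clK(2,3)] by simp
  then have "eqt \<tau> (f \<cdot> x) (f \<cdot> y) K \<in> \<Gamma>" using ty by (intro derives_mp_in[OF 4] wff_eqt) auto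
  then show ?thesis
    using rel_iff_eqt[OF hterms_app[OF f xy(1)] hterms_app[OF f xy(2)] clK(4,5)] by simp
qed

lemma rel_app:
  assumes "f \<in> hterms B (\<rho> \<rightarrow> \<tau>)" "g \<in> hterms B (\<rho> \<rightarrow> \<tau>)" "x \<in> hterms B \<rho>" "y \<in> hterms B \<rho>"
    and "rel B \<Gamma> (\<rho> \<rightarrow> \<tau>) f g" "rel B \<Gamma> \<rho> x y"
  shows "rel B \<Gamma> \<tau> (f \<cdot> x) (g \<cdot> y)"
proof (rule rel_trans)
  show "rel B \<Gamma> \<tau> (f \<cdot> x) (f \<cdot> y)" using assms by (intro rel_ext)
  show "rel B \<Gamma> \<tau> (f \<cdot> y) (g \<cdot> y)" using assms by auto
qed (use assms hterms_app in blast)+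

lemma rel_axiom:
  assumes "T \<turnstile> eqt \<sigma> s t k" and ty: "ty_of s = Some \<sigma>" "ty_of t = Some \<sigma>"
    and "clear k \<sigma> s" "clear k \<sigma> t"
    and K: "\<forall>z \<in> vars s \<union> vars t. fst z < K"
  shows "T \<turnstile> eqt \<sigma> s t K"
  using assms by (intro derives.mp[OF eqt_alpha assms(1)]) (auto intro: clear_bound)

lemma rel_Pi:
  assumes x: "x \<in> hterms B \<sigma>" and y: "y \<in> hterms B \<tau>"
  shows "rel B \<Gamma> \<sigma> (Cst (Pi \<sigma> \<tau>) \<cdot> x \<cdot> y) x"
proof -
  have ty: "ty_of x = Some \<sigma>" "ty_of y = Some \<tau>" using x y by (auto simp: hterms_def)
  have "sentence (\<^bold>\<forall>x \<^bold>: \<sigma>. \<^bold>\<forall>y \<^bold>: \<tau>. eqt \<sigma> (Cst (Pi \<sigma> \<tau>) \<cdot> x \<cdot> y) x) \<in> T"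
    using rca unfolding RCA0_omega_def combinator_axioms_def by blast
  then have "T \<turnstile> AllF 0 \<sigma> (AllF 1 \<tau> (eqt \<sigma> (Cst (Pi \<sigma> \<tau>) \<cdot> Var 0 \<sigma> \<cdot> Var 1 \<tau>) (Var 0 \<sigma>) 2))"
    by (intro axm) (simp add: allq_def numeral_eq_Suc)
  then have 0: "T \<turnstile> eqt \<sigma> (Cst (Pi \<sigma> \<tau>) \<cdot> Var 0 \<sigma> \<cdot> Var 1 \<tau>) (Var 0 \<sigma>) 2"
    by (rule derives_All_elim[OF derives_All_elim]) (auto intro!: wff_eqt)
  obtain K where K: "\<forall>z \<in> vars x \<union> vars y. fst z < K" "3 \<le> K"
    using index_bound[of "vars x \<union> vars y" 3] by auto
  have clK: "clear K \<theta> x" "clear K \<theta> y" "clear K \<theta> (Cst (Pi \<sigma> \<tau>) \<cdot> x \<cdot> y)" for \<theta>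
    using K by (auto intro!: clear_bound)
  have 1: "T \<turnstile> eqt \<sigma> (Cst (Pi \<sigma> \<tau>) \<cdot> Var 0 \<sigma> \<cdot> Var 1 \<tau>) (Var 0 \<sigma>) K"
    using K by (intro rel_axiom[OF 0]) (auto simp: clear_def)
  have 2: "T \<turnstile> eqt \<sigma> (Cst (Pi \<sigma> \<tau>) \<cdot> x \<cdot> Var 1 \<tau>) x K"
    using derives_inst[OF 1, of x \<sigma> 0] ty clK K by (simp add: subst_eqt free_for_eqt wff_eqt)
  have "T \<turnstile> eqt \<sigma> (Cst (Pi \<sigma> \<tau>) \<cdot> x \<cdot> y) x K"
    using derives_inst[OF 2, of y \<tau> 1] ty clK K B x
    by (simp add: subst_eqt free_for_eqt wff_eqt subst_hterm)
  then have "eqt \<sigma> (Cst (Pi \<sigma> \<tau>) \<cdot> x \<cdot> y) x K \<in> \<Gamma>" using ty by (auto intro!: derives_in wff_eqt)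
  then show ?thesis
    by (subst rel_iff_eqt[where k = K]) (use clK x y in \<open>auto simp: hterms_def\<close>)
qed

lemma rel_Sig:
  assumes x: "x \<in> hterms B (\<rho> \<rightarrow> \<sigma> \<rightarrow> \<tau>)" and y: "y \<in> hterms B (\<rho> \<rightarrow> \<sigma>)" and z: "z \<in> hterms B \<rho>"
  shows "rel B \<Gamma> \<tau> (Cst (Sig \<rho> \<sigma> \<tau>) \<cdot> x \<cdot> y \<cdot> z) (x \<cdot> z \<cdot> (y \<cdot> z))"
proof -
  let ?x = "Var 0 (\<rho> \<rightarrow> \<sigma> \<rightarrow> \<tau>)" and ?y = "Var 1 (\<rho> \<rightarrow> \<sigma>)" and ?z = "Var 2 \<rho>"
  let ?S = "Cst (Sig \<rho> \<sigma> \<tau>)"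
  have ty: "ty_of x = Some (\<rho> \<rightarrow> \<sigma> \<rightarrow> \<tau>)" "ty_of y = Some (\<rho> \<rightarrow> \<sigma>)" "ty_of z = Some \<rho>"
    using x y z by (auto simp: hterms_def)
  have "sentence (\<^bold>\<forall>x \<^bold>: \<rho> \<rightarrow> \<sigma> \<rightarrow> \<tau>. \<^bold>\<forall>y \<^bold>: \<rho> \<rightarrow> \<sigma>. \<^bold>\<forall>z \<^bold>: \<rho>.
        eqt \<tau> (Cst (Sig \<rho> \<sigma> \<tau>) \<cdot> x \<cdot> y \<cdot> z) (x \<cdot> z \<cdot> (y \<cdot> z))) \<in> T"
    using rca unfolding RCA0_omega_def combinator_axioms_def by blast
  then have "T \<turnstile> AllF 0 (\<rho> \<rightarrow> \<sigma> \<rightarrow> \<tau>) (AllF 1 (\<rho> \<rightarrow> \<sigma>) (AllF 2 \<rho>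
      (eqt \<tau> (?S \<cdot> ?x \<cdot> ?y \<cdot> ?z) (?x \<cdot> ?z \<cdot> (?y \<cdot> ?z)) 3)))"
    by (intro axm) (simp add: allq_def numeral_eq_Suc)
  then have 0: "T \<turnstile> eqt \<tau> (?S \<cdot> ?x \<cdot> ?y \<cdot> ?z) (?x \<cdot> ?z \<cdot> (?y \<cdot> ?z)) 3"
    by (rule derives_All_elim[OF derives_All_elim[OF derives_All_elim]]) (auto intro!: wff_eqt)
  obtain K where K: "\<forall>v \<in> vars x \<union> vars y \<union> vars z. fst v < K" "3 \<le> K"
    using index_bound[of "vars x \<union> vars y \<union> vars z" 3] by auto
  have clK: "clear K \<theta> x" "clear K \<theta> y" "clear K \<theta> z" "clear K \<theta> (?S \<cdot> x \<cdot> y \<cdot> z)"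
    "clear K \<theta> (x \<cdot> z \<cdot> (y \<cdot> z))" for \<theta>
    using K by (auto intro!: clear_bound)
  have 1: "T \<turnstile> eqt \<tau> (?S \<cdot> ?x \<cdot> ?y \<cdot> ?z) (?x \<cdot> ?z \<cdot> (?y \<cdot> ?z)) K"
    using K by (intro rel_axiom[OF 0]) (auto simp: clear_def)
  have 2: "T \<turnstile> eqt \<tau> (?S \<cdot> x \<cdot> ?y \<cdot> ?z) (x \<cdot> ?z \<cdot> (?y \<cdot> ?z)) K"
    using derives_inst[OF 1, of x "\<rho> \<rightarrow> \<sigma> \<rightarrow> \<tau>" 0] ty clK K
    by (simp add: subst_eqt free_for_eqt wff_eqt)
  have 3: "T \<turnstile> eqt \<tau> (?S \<cdot> x \<cdot> y \<cdot> ?z) (x \<cdot> ?z \<cdot> (y \<cdot> ?z)) K"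
    using derives_inst[OF 2, of y "\<rho> \<rightarrow> \<sigma>" 1] ty clK K B x
    by (simp add: subst_eqt free_for_eqt wff_eqt subst_hterm)
  have "T \<turnstile> eqt \<tau> (?S \<cdot> x \<cdot> y \<cdot> z) (x \<cdot> z \<cdot> (y \<cdot> z)) K"
    using derives_inst[OF 3, of z \<rho> 2] ty clK K B x y
    by (simp add: subst_eqt free_for_eqt wff_eqt subst_hterm)
  then have "eqt \<tau> (?S \<cdot> x \<cdot> y \<cdot> z) (x \<cdot> z \<cdot> (y \<cdot> z)) K \<in> \<Gamma>"
    using ty by (auto intro!: derives_in wff_eqt)
  then show ?thesis
    by (subst rel_iff_eqt[where k = K]) (use clK x y z in \<open>auto simp: hterms_def\<close>)
qed

section \<open>Satisfaction in the model of equivalence classes\<close>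

abbreviation "cl \<equiv> cls B \<Gamma>"

lemma cl_eq_iff: "s \<in> hterms B \<sigma> \<Longrightarrow> t \<in> hterms B \<sigma> \<Longrightarrow> cl s = cl t \<longleftrightarrow> rel B \<Gamma> \<sigma> s t"
proof
  assume st: "s \<in> hterms B \<sigma>" "t \<in> hterms B \<sigma>" and "cl s = cl t"
  moreover have "t \<in> cl t" using st rel_refl by (auto simp: cls_def)
  ultimately have "t \<in> cl s" by simp
  then show "rel B \<Gamma> \<sigma> s t" using st hterms_unique by (auto simp: cls_def)
next
  assume st: "s \<in> hterms B \<sigma>" "t \<in> hterms B \<sigma>" and rel: "rel B \<Gamma> \<sigma> s t"
  have mem: "u \<in> cl r \<longleftrightarrow> u \<in> hterms B \<sigma> \<and> rel B \<Gamma> \<sigma> r u" if "r \<in> hterms B \<sigma>" for r u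
    using that hterms_unique by (auto simp: cls_def)
  have "rel B \<Gamma> \<sigma> s u \<longleftrightarrow> rel B \<Gamma> \<sigma> t u" if u: "u \<in> hterms B \<sigma>" for u
    using rel_trans[OF st u rel] rel_trans[OF st(2) st(1) u rel_sym[OF st rel]] by auto
  with mem[OF st(1)] mem[OF st(2)] show "cl s = cl t" by auto
qed

lemma some_cl:
  assumes "s \<in> hterms B \<sigma>"
  shows "(SOME t. t \<in> cl s) \<in> hterms B \<sigma> \<and> rel B \<Gamma> \<sigma> s (SOME t. t \<in> cl s)"
proof -
  have "s \<in> cl s" using assms rel_refl by (auto simp: cls_def)
  then have "(SOME t. t \<in> cl s) \<in> cl s" by (rule someI)
  then show ?thesis using assms hterms_unique unfolding cls_def by blast
qed

lemma tapp_cl: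
  assumes "s \<in> hterms B (\<sigma> \<rightarrow> \<tau>)" "t \<in> hterms B \<sigma>"
  shows "tapp B \<Gamma> (cl s) (cl t) = cl (s \<cdot> t)"
proof -
  define s' t' where "s' = (SOME u. u \<in> cl s)" and "t' = (SOME u. u \<in> cl t)"
  have *: "s' \<in> hterms B (\<sigma> \<rightarrow> \<tau>)" "t' \<in> hterms B \<sigma>" "rel B \<Gamma> (\<sigma> \<rightarrow> \<tau>) s s'" "rel B \<Gamma> \<sigma> t t'"
    using some_cl assms unfolding s'_def t'_def by blast+
  have "rel B \<Gamma> \<tau> (s \<cdot> t) (s' \<cdot> t')" by (rule rel_app[OF assms(1) *(1) assms(2) *(2-4)])
  then have "cl (s \<cdot> t) = cl (s' \<cdot> t')"
    using cl_eq_iff[OF hterms_app[OF assms] hterms_app[OF *(1,2)]] by simp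
  then show ?thesis by (simp add: tapp_def s'_def t'_def)
qed

lemma tless_cl:
  assumes "s \<in> hterms B N" "t \<in> hterms B N"
  shows "tless \<Gamma> (cl s) (cl t) \<longleftrightarrow> LtF s t \<in> \<Gamma>"
proof -
  define s' t' where "s' = (SOME u. u \<in> cl s)" and "t' = (SOME u. u \<in> cl t)"
  have *: "s' \<in> hterms B N" "t' \<in> hterms B N" "EqF s s' \<in> \<Gamma>" "EqF t t' \<in> \<Gamma>"
    using some_cl[of s N] some_cl[of t N] assms by (auto simp: s'_def t'_def)
  then have **: "EqF s' s \<in> \<Gamma>" "EqF t' t \<in> \<Gamma>" using rel_sym[of _ N] assms by auto
  have ty: "ty_of s = Some N" "ty_of t = Some N" "ty_of s' = Some N" "ty_of t' = Some N"
    using * assms by (auto simp: hterms_def)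
  have "LtF s' t' \<in> \<Gamma> \<longleftrightarrow> LtF s t' \<in> \<Gamma>"
    using eq_congr[of s s' "LtF (Var 0 N) t'"] eq_congr[of s' s "LtF (Var 0 N) t'"] * ** assms ty B
    by (auto simp: subst_hterm)
  moreover have "LtF s t' \<in> \<Gamma> \<longleftrightarrow> LtF s t \<in> \<Gamma>"
    using eq_congr[of t t' "LtF s (Var 0 N)"] eq_congr[of t' t "LtF s (Var 0 N)"] * ** assms ty B
    by (auto simp: subst_hterm)
  ultimately show ?thesis by (simp add: tless_def s'_def t'_def)
qed

abbreviation "ev \<equiv> eval (tapp B \<Gamma>) (\<lambda>c. cl (Cst c))"
abbreviation "sat \<equiv> Sat (tdom B \<Gamma>) (tapp B \<Gamma>) (\<lambda>c. cl (Cst c)) (tless \<Gamma>)"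

lemma eval_cl:
  assumes v: "\<And>n \<sigma>. v (n, \<sigma>) \<in> hterms B \<sigma>"
  shows "ty_of t = Some \<sigma> \<Longrightarrow> ev (\<lambda>z. cl (v z)) t = cl (tsub v t)"
proof (induction t arbitrary: \<sigma>)
  case (App s t)
  then obtain \<tau> where "ty_of s = Some (\<tau> \<rightarrow> \<sigma>)" "ty_of t = Some \<tau>"
    by (auto split: option.splits ty.splits if_splits)
  with App tapp_cl[OF hterms_tsub[OF v] hterms_tsub[OF v], of s \<tau> \<sigma> t] show ?case by auto
qed auto

text \<open>The separation of indices at \<open>B\<close> is what makes the substitution
  capture-free. For a universal formula, a counterexample in the model exists because
  \<open>\<Gamma>\<close> contains a witness with a variable of index at least \<open>B\<close>,
  which is itself an element of the model.\<close>

theorem truth: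
  assumes "wff \<phi>" "\<And>z. z \<in> avars \<phi> \<Longrightarrow> fst z < B" "\<And>n \<sigma>. v (n, \<sigma>) \<in> hterms B \<sigma>"
  shows "sat (\<lambda>z. cl (v z)) \<phi> \<longleftrightarrow> ssub v \<phi> \<in> \<Gamma>"
  using assms
proof (induction \<phi> arbitrary: v)
  case (EqF s t)
  have "tsub v s \<in> hterms B N" "tsub v t \<in> hterms B N"
    using EqF hterms_tsub[OF EqF.prems(3)] by auto
  with EqF eval_cl[OF EqF.prems(3)] show ?case by (simp add: cl_eq_iff)
next
  case (LtF s t)
  have "tsub v s \<in> hterms B N" "tsub v t \<in> hterms B N"
    using LtF hterms_tsub[OF LtF.prems(3)] by auto
  with LtF eval_cl[OF LtF.prems(3)] show ?case by (simp add: tless_cl)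
next
  case BotF
  then show ?case by (simp add: Bot_notin)
next
  case (ImpF \<phi> \<psi>)
  have "ty_of (v (n, \<sigma>)) = Some \<sigma>" for n \<sigma> using ImpF.prems(3)[of n \<sigma>] by (simp add: hterms_def)
  then have "wff (ssub v \<phi>)" "wff (ssub v \<psi>)" using ImpF.prems by (auto simp: wff_ssub)
  with ImpF show ?case by (simp add: Imp_in)
next
  case (AllF n \<sigma> \<phi>)
  define \<chi> where "\<chi> = ssub (v((n, \<sigma>) := Var n \<sigma>)) \<phi>"
  have ty: "ty_of (v (m, \<tau>)) = Some \<tau>" for m \<tau> using AllF.prems(3)[of m \<tau>] by (simp add: hterms_def)
  have wf: "wff \<chi>" unfolding \<chi>_def using AllF.prems ty by (subst wff_ssub) auto
  have n: "n < B" using AllF.prems(2)[of "(n, \<sigma>)"] by simp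
  have sub: "subst n \<sigma> u \<chi> = ssub (v((n, \<sigma>) := u)) \<phi>" for u
  proof -
    have "(n, \<sigma>) \<notin> vars (v z)" for z
      using AllF.prems(3)[of "fst z" "snd z"] n by (force simp: hterms_def)
    then show ?thesis unfolding \<chi>_def by (subst subst_ssub) auto
  qed
  have IH: "sat ((\<lambda>z. cl (v z))((n, \<sigma>) := cl u)) \<phi> \<longleftrightarrow> subst n \<sigma> u \<chi> \<in> \<Gamma>" if "u \<in> hterms B \<sigma>" for u
  proof -
    have "(\<lambda>z. cl (v z))((n, \<sigma>) := cl u) = (\<lambda>z. cl ((v((n, \<sigma>) := u)) z))"
      by (simp add: fun_eq_iff)
    then show ?thesis
      unfolding sub using AllF.prems that by (simp only:, intro AllF.IH) auto
  qed
  have "(\<forall>u \<in> hterms B \<sigma>. subst n \<sigma> u \<chi> \<in> \<Gamma>) \<longleftrightarrow> AllF n \<sigma> \<chi> \<in> \<Gamma>"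
  proof
    assume *: "\<forall>u \<in> hterms B \<sigma>. subst n \<sigma> u \<chi> \<in> \<Gamma>"
    show "AllF n \<sigma> \<chi> \<in> \<Gamma>"
    proof (rule ccontr)
      assume "AllF n \<sigma> \<chi> \<notin> \<Gamma>"
      then have "NegF (AllF n \<sigma> \<chi>) \<in> \<Gamma>" using wf by (intro Neg_in) auto
      then obtain y where "B \<le> y" "NegF (subst n \<sigma> (Var y \<sigma>) \<chi>) \<in> \<Gamma>" using witness_\<Gamma> by blast
      with * Bot_notin show False by (blast intro: mp_in hterms_Var)
    qed
  next
    assume *: "AllF n \<sigma> \<chi> \<in> \<Gamma>"
    show "\<forall>u \<in> hterms B \<sigma>. subst n \<sigma> u \<chi> \<in> \<Gamma>"
    proof
      fix u assume u: "u \<in> hterms B \<sigma>"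
      have "free_for u n \<sigma> \<chi>"
        unfolding \<chi>_def using AllF.prems(2) u by (intro free_for_ssub) (force simp: hterms_def)
      with * u show "subst n \<sigma> u \<chi> \<in> \<Gamma>" by (intro All_inst_in) (auto simp: hterms_def)
    qed
  qed
  moreover have "sat (\<lambda>z. cl (v z)) (AllF n \<sigma> \<phi>) \<longleftrightarrow>
      (\<forall>u \<in> hterms B \<sigma>. sat ((\<lambda>z. cl (v z))((n, \<sigma>) := cl u)) \<phi>)"
    by (simp add: tdom_def[of B \<Gamma> \<sigma>])
  ultimately show ?case using IH by (simp add: \<chi>_def)
qed

lemma sat_closed_iff:
  assumes "wff \<phi>" "\<And>z. z \<in> avars \<phi> \<Longrightarrow> fst z < B" "fv \<phi> = {}" "\<And>n \<sigma>. w (n, \<sigma>) \<in> tdom B \<Gamma> \<sigma>"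
  shows "sat w \<phi> \<longleftrightarrow> \<phi> \<in> \<Gamma>"
proof -
  have "\<exists>u. u \<in> hterms B (snd z) \<and> w z = cl u" for z
    using assms(4)[of "fst z" "snd z"] by (auto simp: tdom_def)
  then obtain v where v: "\<And>z. v z \<in> hterms B (snd z) \<and> w z = cl (v z)" by metis
  then have "w = (\<lambda>z. cl (v z))" by auto
  moreover have "v (n, \<sigma>) \<in> hterms B \<sigma>" for n \<sigma> using v[of "(n, \<sigma>)"] by simp
  ultimately show ?thesis using truth[of \<phi> v] assms ssub_closed by auto
qed

section \<open>The domains of the term model as extensional combinatory algebras\<close>

lemma tdom_app: "f \<in> tdom B \<Gamma> (\<sigma> \<rightarrow> \<tau>) \<Longrightarrow> a \<in> tdom B \<Gamma> \<sigma> \<Longrightarrow> tapp B \<Gamma> f a \<in> tdom B \<Gamma> \<tau>"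
  using hterms_app by (fastforce simp: tdom_def tapp_cl)

lemma tdom_ext:
  assumes "f \<in> tdom B \<Gamma> (\<sigma> \<rightarrow> \<tau>)" "g \<in> tdom B \<Gamma> (\<sigma> \<rightarrow> \<tau>)"
    and "\<And>a. a \<in> tdom B \<Gamma> \<sigma> \<Longrightarrow> tapp B \<Gamma> f a = tapp B \<Gamma> g a"
  shows "f = g"
proof -
  obtain s t where st: "s \<in> hterms B (\<sigma> \<rightarrow> \<tau>)" "t \<in> hterms B (\<sigma> \<rightarrow> \<tau>)" "f = cl s" "g = cl t"
    using assms(1,2) by (auto simp: tdom_def)
  have "rel B \<Gamma> \<tau> (s \<cdot> u) (t \<cdot> u)" if "u \<in> hterms B \<sigma>" for u
    using assms(3)[of "cl u"] st that cl_eq_iff[OF hterms_app hterms_app, OF st(1) that st(2) that]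
    by (auto simp: tdom_def tapp_cl)
  then show ?thesis using st by (simp add: cl_eq_iff)
qed

lemma tdom_nonempty: "tdom B \<Gamma> \<sigma> \<noteq> {}"
  using hterms_Var[of B B \<sigma>] by (auto simp: tdom_def)

lemma tdom_Cst: "cl (Cst c) \<in> tdom B \<Gamma> (cst_ty c)"
  by (auto simp: tdom_def hterms_Cst)

lemma tdom_Pi:
  "a \<in> tdom B \<Gamma> \<sigma> \<Longrightarrow> b \<in> tdom B \<Gamma> \<tau> \<Longrightarrow> tapp B \<Gamma> (tapp B \<Gamma> (cl (Cst (Pi \<sigma> \<tau>))) a) b = a"
proof -
  assume "a \<in> tdom B \<Gamma> \<sigma>" "b \<in> tdom B \<Gamma> \<tau>"
  then obtain s t where st: "s \<in> hterms B \<sigma>" "t \<in> hterms B \<tau>" "a = cl s" "b = cl t"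
    by (auto simp: tdom_def)
  have P: "Cst (Pi \<sigma> \<tau>) \<in> hterms B (\<sigma> \<rightarrow> \<tau> \<rightarrow> \<sigma>)" using hterms_Cst[of "Pi \<sigma> \<tau>"] by simp
  note h = hterms_app[OF P st(1)]
  show ?thesis unfolding st(3,4) using tapp_cl[OF P st(1)] tapp_cl[OF h st(2)]
    cl_eq_iff[OF hterms_app[OF h st(2)] st(1)] rel_Pi[OF st(1,2)] by simp
qed

lemma tdom_Sig:
  "a \<in> tdom B \<Gamma> (\<rho> \<rightarrow> \<sigma> \<rightarrow> \<tau>) \<Longrightarrow> b \<in> tdom B \<Gamma> (\<rho> \<rightarrow> \<sigma>) \<Longrightarrow> c \<in> tdom B \<Gamma> \<rho> \<Longrightarrow>
   tapp B \<Gamma> (tapp B \<Gamma> (tapp B \<Gamma> (cl (Cst (Sig \<rho> \<sigma> \<tau>))) a) b) c =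
   tapp B \<Gamma> (tapp B \<Gamma> a c) (tapp B \<Gamma> b c)"
proof -
  assume "a \<in> tdom B \<Gamma> (\<rho> \<rightarrow> \<sigma> \<rightarrow> \<tau>)" "b \<in> tdom B \<Gamma> (\<rho> \<rightarrow> \<sigma>)" "c \<in> tdom B \<Gamma> \<rho>"
  then obtain r s t where *: "r \<in> hterms B (\<rho> \<rightarrow> \<sigma> \<rightarrow> \<tau>)" "s \<in> hterms B (\<rho> \<rightarrow> \<sigma>)" "t \<in> hterms B \<rho>"
      "a = cl r" "b = cl s" "c = cl t"
    by (auto simp: tdom_def)
  let ?S = "Cst (Sig \<rho> \<sigma> \<tau>)"
  have S: "?S \<in> hterms B ((\<rho> \<rightarrow> \<sigma> \<rightarrow> \<tau>) \<rightarrow> (\<rho> \<rightarrow> \<sigma>) \<rightarrow> \<rho> \<rightarrow> \<tau>)"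
    using hterms_Cst[of "Sig \<rho> \<sigma> \<tau>"] by simp
  have h: "?S \<cdot> r \<in> hterms B ((\<rho> \<rightarrow> \<sigma>) \<rightarrow> \<rho> \<rightarrow> \<tau>)" "?S \<cdot> r \<cdot> s \<in> hterms B (\<rho> \<rightarrow> \<tau>)"
    "?S \<cdot> r \<cdot> s \<cdot> t \<in> hterms B \<tau>" "r \<cdot> t \<in> hterms B (\<sigma> \<rightarrow> \<tau>)" "s \<cdot> t \<in> hterms B \<sigma>"
    "r \<cdot> t \<cdot> (s \<cdot> t) \<in> hterms B \<tau>"
    using S * by (meson hterms_app)+
  show ?thesis unfolding * using tapp_cl[OF S *(1)] tapp_cl[OF h(1) *(2)] tapp_cl[OF h(2) *(3)]
    tapp_cl[OF *(1) *(3)] tapp_cl[OF *(2) *(3)] tapp_cl[OF h(4) h(5)]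
    cl_eq_iff[OF h(3) h(6)] rel_Sig[OF *(1-3)] by simp
qed

end

subsection \<open>The model under consideration\<close>

definition T0 :: "fm set" where
  "T0 = ACA0_omega \<union> {sentence IND_2}"

definition goals :: "fm set" where
  "goals = (\<Union>item \<in> {item_a, item_b, item_c_Hoelder, item_c_Lipschitz, item_d, item_e}.
     {sentence (item \<^bold>\<longrightarrow> Finite_Choice), sentence (QF_AC_0_1 \<^bold>\<longrightarrow> item)})"

text \<open>Induction for the formula \<open>f n = 0\<close> with a function variable
  \<open>f\<close>. One instance is enough, because an internal predicate is the set of zeros of an
  internal function.\<close>

definition induction_instance :: fm where
  "induction_instance = (let A = EqF (Var 1 N\<^sub>1 \<cdot> Var 0 N) \<zero> in
     AllF 1 N\<^sub>1 (ImpF (subst 0 N \<zero> A)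
       (ImpF (AllF 0 N (ImpF A (subst 0 N (Var 0 N \<oplus> \<one>) A))) (AllF 0 N A))))"

definition choice_instance :: "fm \<Rightarrow> fm" where
  "choice_instance A = AllF 3 (N\<^sub>1 \<rightarrow> N) (ImpF (AllF 0 N\<^sub>1 (ExF 1 N A))
     (ExF 2 (N\<^sub>1 \<rightarrow> N) (AllF 0 N\<^sub>1 (subst 1 N (Var 2 (N\<^sub>1 \<rightarrow> N) \<cdot> Var 0 N\<^sub>1) A))))"

text \<open>With the functional of \<open>(\<exists>\<^sup>2)\<close> as parameter (variable 3),
  choice applied to this formula gives Feferman's search functional, which returns a zero of every
  function that has one.\<close>

definition mu_fm :: fm where
  "mu_fm = ImpF (EqF (Var 3 (N\<^sub>1 \<rightarrow> N) \<cdot> Var 0 N\<^sub>1) \<zero>) (EqF (Var 0 N\<^sub>1 \<cdot> Var 1 N) \<zero>)"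

text \<open>The number variable 1 is 0 or 1 according to whether \<open>A\<close> holds, so that
  choice yields a characteristic functional of \<open>A\<close>.\<close>

definition decide_fm :: "fm \<Rightarrow> fm" where
  "decide_fm A = NegF (ImpF (ImpF A (EqF (Var 1 N) \<zero>)) (NegF (ImpF (NegF A) (EqF (Var 1 N) \<one>))))"

text \<open>Choice is available over objects of type 1, so the two numbers to be compared are packed
  into one function as its first two values.\<close>

definition eq_fm :: fm where
  "eq_fm = EqF (Var 0 N\<^sub>1 \<cdot> \<zero>) (Var 0 N\<^sub>1 \<cdot> (\<zero> \<oplus> \<one>))"
definition lt_fm :: fm where
  "lt_fm = LtF (Var 0 N\<^sub>1 \<cdot> \<zero>) (Var 0 N\<^sub>1 \<cdot> (\<zero> \<oplus> \<one>))"

text \<open>The axioms whose truth is carried into the model are finite in number, so that a common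
  bound \<open>B0\<close> for their variables exists. The infinite schemas of extensionality and of
  the combinators have been treated on the level of derivations, in \<open>rel_ext\<close>,
  \<open>rel_Pi\<close> and \<open>rel_Sig\<close>.\<close>

definition axioms_used :: "fm set" where
  "axioms_used = basic_axioms \<union> recursor_axioms \<union> {sentence exists_two, sentence IND_2} \<union>
     {induction_instance, choice_instance mu_fm, choice_instance (decide_fm eq_fm),
      choice_instance (decide_fm lt_fm)}"

lemma T0_axioms_used: "\<phi> \<in> axioms_used \<Longrightarrow> T0 \<turnstile> \<phi>"
proof -
  have ax: "\<phi> \<in> T0" if "\<phi> \<in> basic_axioms \<union> recursor_axioms \<union> {sentence exists_two, sentence IND_2}" for \<phi>
    using that unfolding T0_def ACA0_omega_def RCA0_omega_def by blast
  have ind: "T0 \<turnstile> induction_instance"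
    unfolding induction_instance_def Let_def
    by (intro gen axm)
      (force simp: T0_def ACA0_omega_def RCA0_omega_def qf_induction_def
        intro!: exI[of _ 0] exI[of _ "EqF (Var 1 N\<^sub>1 \<cdot> Var 0 N) \<zero>"])
  have ch: "T0 \<turnstile> choice_instance A" if "wff A" "qf A" "(2, N\<^sub>1 \<rightarrow> N) \<notin> fv A" for A
  proof -
    have "ImpF (AllF 0 N\<^sub>1 (ExF 1 N A))
     (ExF 2 (N\<^sub>1 \<rightarrow> N) (AllF 0 N\<^sub>1 (subst 1 N (Var 2 (N\<^sub>1 \<rightarrow> N) \<cdot> Var 0 N\<^sub>1) A))) \<in> QF_AC_1_0"
      using that unfolding QF_AC_1_0_def by blast
    then show ?thesis
      unfolding choice_instance_def T0_def ACA0_omega_def RCA0_omega_def by (intro gen axm) simp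
  qed
  assume "\<phi> \<in> axioms_used"
  then show ?thesis
    unfolding axioms_used_def
    using ax ind ch[of mu_fm] ch[of "decide_fm eq_fm"] ch[of "decide_fm lt_fm"]
    by (auto simp: mu_fm_def decide_fm_def eq_fm_def lt_fm_def intro: axm)
qed

definition B0 :: nat where
  "B0 = (SOME B. 3 \<le> B \<and> (\<forall>\<phi> \<in> axioms_used \<union> goals. \<forall>z \<in> avars \<phi>. fst z < B))"

lemma B0: "3 \<le> B0" "\<phi> \<in> axioms_used \<union> goals \<Longrightarrow> z \<in> avars \<phi> \<Longrightarrow> fst z < B0"
proof -
  have "finite (axioms_used \<union> goals)"
    by (auto simp: axioms_used_def goals_def basic_axioms_def recursor_axioms_def)
  then have "finite (\<Union>\<phi> \<in> axioms_used \<union> goals. avars \<phi>)" by auto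
  then obtain B where "3 \<le> B" "\<forall>z \<in> (\<Union>\<phi> \<in> axioms_used \<union> goals. avars \<phi>). fst z < B"
    using index_bound by blast
  then have "\<exists>B. 3 \<le> B \<and> (\<forall>\<phi> \<in> axioms_used \<union> goals. \<forall>z \<in> avars \<phi>. fst z < B)" by blast
  from someI_ex[OF this]
  show "3 \<le> B0" "\<phi> \<in> axioms_used \<union> goals \<Longrightarrow> z \<in> avars \<phi> \<Longrightarrow> fst z < B0"
    unfolding B0_def by auto
qed

text \<open>The proof is by contradiction. Types cannot depend on the assumption \<open>Bad\<close>, so the
  domains get a default meaning when it fails: a copy of the natural numbers for \<open>N\<close>, and a
  single element for all other types.\<close>

definition Bad :: bool where
  "Bad \<longleftrightarrow> (\<exists>\<phi> \<in> goals. wff \<phi> \<and> \<not> T0 \<turnstile> \<phi>)"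

definition Gam :: "fm set" where
  "Gam = (SOME \<Gamma>. henkin T0 B0 \<Gamma> \<and> (\<exists>\<phi> \<in> goals. wff \<phi> \<and> NegF \<phi> \<in> \<Gamma>))"

text \<open>Zero is coded by the empty set because the default application always returns the empty
  set, which therefore has to belong to every domain.\<close>

definition code0 :: "nat \<Rightarrow> trm set" where
  "code0 n = (if n = 0 then {} else {Var n N})"

definition Dm :: "ty \<Rightarrow> trm set set" where
  "Dm = (if Bad then tdom B0 Gam else (\<lambda>\<sigma>. if \<sigma> = N then range code0 else {{}}))"
definition apm :: "trm set \<Rightarrow> trm set \<Rightarrow> trm set" where
  "apm = (if Bad then tapp B0 Gam else (\<lambda>a b. {}))"
definition csm :: "cst \<Rightarrow> trm set" where
  "csm = (\<lambda>c. cls B0 Gam (Cst c))"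
definition lsm :: "trm set \<Rightarrow> trm set \<Rightarrow> bool" where
  "lsm = tless Gam"

abbreviation "evm \<equiv> eval apm csm"
abbreviation "SatM \<equiv> Sat Dm apm csm lsm"

lemma Gam:
  assumes Bad
  shows "henkin_rca T0 B0 Gam" "\<exists>\<phi> \<in> goals. wff \<phi> \<and> NegF \<phi> \<in> Gam"
proof -
  from assms have "\<exists>\<Gamma>. henkin T0 B0 \<Gamma> \<and> (\<exists>\<phi> \<in> goals. wff \<phi> \<and> NegF \<phi> \<in> \<Gamma>)"
    unfolding Bad_def using henkin_exists by blast
  from someI_ex[OF this]
  have "henkin T0 B0 Gam \<and> (\<exists>\<phi> \<in> goals. wff \<phi> \<and> NegF \<phi> \<in> Gam)" unfolding Gam_def .
  moreover have "RCA0_omega \<subseteq> T0" by (auto simp: T0_def ACA0_omega_def)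
  ultimately show "henkin_rca T0 B0 Gam" "\<exists>\<phi> \<in> goals. wff \<phi> \<and> NegF \<phi> \<in> Gam"
    using B0(1) by (auto simp: henkin_rca_def henkin_rca_axioms_def)
qed

lemma Dm_nonempty: "Dm \<sigma> \<noteq> {}"
  using henkin_rca.tdom_nonempty[OF Gam(1)] by (auto simp: Dm_def)

lemma Dm_app: "f \<in> Dm (\<sigma> \<rightarrow> \<tau>) \<Longrightarrow> a \<in> Dm \<sigma> \<Longrightarrow> apm f a \<in> Dm \<tau>"
  using henkin_rca.tdom_app[OF Gam(1)] by (auto simp: Dm_def apm_def code0_def image_iff)

lemma Dm_ext:
  "f \<in> Dm (\<sigma> \<rightarrow> \<tau>) \<Longrightarrow> g \<in> Dm (\<sigma> \<rightarrow> \<tau>) \<Longrightarrow> (\<And>a. a \<in> Dm \<sigma> \<Longrightarrow> apm f a = apm g a) \<Longrightarrow> f = g"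
  using henkin_rca.tdom_ext[OF Gam(1)] by (auto simp: Dm_def apm_def split: if_splits)


subsection \<open>Types for the domains of the model\<close>

typedef nn = "Dm N"
  using Dm_nonempty by blast

text \<open>Types of this class are in bijection with domains of the model. Thereby Isabelle's type
  checking replaces the finite types, and statements about the model can use ordinary
  variables.\<close>

class sort =
  fixes sty :: "'a itself \<Rightarrow> ty" and enc :: "'a \<Rightarrow> trm set"
  assumes inj_enc: "inj enc" and range_enc: "range enc = Dm (sty TYPE('a))"
begin

definition dec :: "trm set \<Rightarrow> 'a" where "dec = inv enc"

lemma enc_in: "enc x \<in> Dm (sty TYPE('a))"
  using range_enc by blast

lemma enc_dec: "a \<in> Dm (sty TYPE('a)) \<Longrightarrow> enc (dec a) = a"
  unfolding dec_def range_enc[symmetric] by (rule f_inv_into_f)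

lemma enc_eq_iff [simp]: "enc x = enc y \<longleftrightarrow> x = y"
  using inj_enc by (auto dest: injD)

lemma ball_Dm: "(\<forall>a \<in> Dm (sty TYPE('a)). P a) \<longleftrightarrow> (\<forall>x. P (enc x))"
  unfolding range_enc[symmetric] by auto

end

instantiation nn :: sort
begin
definition "sty (_ :: nn itself) = N"
definition "enc = Rep_nn"
instance
  by standard (auto simp: sty_nn_def enc_nn_def inj_def Rep_nn_inject type_definition.Rep_range[OF type_definition_nn])
end

text \<open>The internal functions. By extensionality of the model the representing element is
  unique, so this type is again in bijection with a domain.\<close>

typedef (overloaded) ('a, 'b) ifn =
  "{f :: 'a :: sort \<Rightarrow> 'b :: sort.
     \<exists>e \<in> Dm (sty TYPE('a) \<rightarrow> sty TYPE('b)). \<forall>x. apm e (enc x) = enc (f x)}"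
proof -
  obtain e where e: "e \<in> Dm (sty TYPE('a) \<rightarrow> sty TYPE('b))" using Dm_nonempty by blast
  then have "apm e (enc x) = enc (dec (apm e (enc x)) :: 'b)" for x :: 'a
    using Dm_app enc_in by (metis enc_dec)
  with e show ?thesis by (intro exI[of _ "\<lambda>x. dec (apm e (enc x))"]) auto
qed

definition ifn_app :: "('a :: sort, 'b :: sort) ifn \<Rightarrow> 'a \<Rightarrow> 'b"  (infixl "\<bullet>" 90) where
  "f \<bullet> x = Rep_ifn f x"

lemma ifn_eqI: "(\<And>x. f \<bullet> x = g \<bullet> x) \<Longrightarrow> f = g"
  by (simp add: ifn_app_def Rep_ifn_inject[symmetric] fun_eq_iff)

definition ifn_code :: "('a :: sort, 'b :: sort) ifn \<Rightarrow> trm set \<Rightarrow> bool" where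
  "ifn_code f e \<longleftrightarrow> e \<in> Dm (sty TYPE('a) \<rightarrow> sty TYPE('b)) \<and> (\<forall>x. apm e (enc x) = enc (f \<bullet> x))"

lemma ifn_code_ex: "\<exists>e. ifn_code f e"
  using Rep_ifn[of f] by (auto simp: ifn_code_def ifn_app_def)

lemma ifn_code_unique: "ifn_code (f :: ('a :: sort, 'b :: sort) ifn) e \<Longrightarrow> ifn_code f e' \<Longrightarrow> e = e'"
  by (rule Dm_ext[of _ "sty TYPE('a)" "sty TYPE('b)"])
    (auto simp: ifn_code_def range_enc[symmetric])

instantiation ifn :: (sort, sort) sort
begin
definition "sty (_ :: ('a, 'b) ifn itself) = sty TYPE('a) \<rightarrow> sty TYPE('b)"
definition "enc f = (SOME e. ifn_code f e)"
lemma enc_ifn: "ifn_code f (enc f)"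
  unfolding enc_ifn_def using ifn_code_ex by (rule someI_ex)
instance
proof
  show "inj (enc :: ('a, 'b) ifn \<Rightarrow> _)"
  proof (rule injI)
    fix f g :: "('a, 'b) ifn" assume "enc f = enc g"
    then have "ifn_code f (enc g)" using enc_ifn[of f] by simp
    then have "enc (f \<bullet> x) = enc (g \<bullet> x)" for x using enc_ifn[of g] by (auto simp: ifn_code_def)
    then show "f = g" by (auto intro: ifn_eqI)
  qed
  have "e \<in> range (enc :: ('a, 'b) ifn \<Rightarrow> _)" if e: "e \<in> Dm (sty TYPE('a) \<rightarrow> sty TYPE('b))" for e
  proof -
    have *: "apm e (enc x) = enc (dec (apm e (enc x)) :: 'b)" for x :: 'a
      using Dm_app[OF e] enc_in by (metis enc_dec)
    define f :: "('a, 'b) ifn" where "f = Abs_ifn (\<lambda>x. dec (apm e (enc x)))"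
    have "f \<bullet> x = dec (apm e (enc x))" for x
      unfolding f_def ifn_app_def using e * by (subst Abs_ifn_inverse) auto
    then have "ifn_code f e" using e * by (auto simp: ifn_code_def)
    then have "e = enc f" using enc_ifn by (rule ifn_code_unique)
    then show ?thesis by blast
  qed
  then show "range (enc :: ('a, 'b) ifn \<Rightarrow> _) = Dm (sty TYPE(('a, 'b) ifn))"
    using enc_ifn by (auto simp: sty_ifn_def ifn_code_def)
qed
end

lemma apm_enc: "apm (enc f) (enc x) = enc (f \<bullet> x)"
  using enc_ifn by (auto simp: ifn_code_def)

type_synonym n1 = "(nn, nn) ifn"

lemmas sty_simps = sty_nn_def sty_ifn_def


subsection \<open>Definability in the model\<close>

definition Lam :: "('a :: sort \<Rightarrow> 'b :: sort) \<Rightarrow> ('a, 'b) ifn" where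
  "Lam f = Abs_ifn f"

text \<open>Contexts are nested pairs of elements ending in the unit element. That \<open>cdef \<tau> f\<close>
  holds means that the function \<open>f\<close>, curried, is given by an element of the model.\<close>

class ctx =
  fixes cdef :: "ty \<Rightarrow> ('a \<Rightarrow> trm set) \<Rightarrow> bool"
  assumes cdef_const: "Bad \<Longrightarrow> a \<in> Dm \<tau> \<Longrightarrow> cdef \<tau> (\<lambda>_. a)"
    and cdef_app: "Bad \<Longrightarrow> cdef (\<sigma> \<rightarrow> \<tau>) f \<Longrightarrow> cdef \<sigma> g \<Longrightarrow> cdef \<tau> (\<lambda>c. apm (f c) (g c))"
    and cdef_Dm: "cdef \<tau> f \<Longrightarrow> f c \<in> Dm \<tau>"

instantiation unit :: ctx
begin
definition "cdef \<tau> f \<longleftrightarrow> f () \<in> Dm \<tau>"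
instance by standard (auto simp: cdef_unit_def intro: Dm_app)
end

lemma csm_in: "Bad \<Longrightarrow> csm c \<in> Dm (cst_ty c)"
  using henkin_rca.tdom_Cst[OF Gam(1)] by (simp add: Dm_def csm_def)

lemma apm_Pi: "Bad \<Longrightarrow> a \<in> Dm \<sigma> \<Longrightarrow> b \<in> Dm \<tau> \<Longrightarrow> apm (apm (csm (Pi \<sigma> \<tau>)) a) b = a"
  using henkin_rca.tdom_Pi[OF Gam(1)] by (simp add: Dm_def apm_def csm_def)

lemma apm_Sig:
  "Bad \<Longrightarrow> a \<in> Dm (\<rho> \<rightarrow> \<sigma> \<rightarrow> \<tau>) \<Longrightarrow> b \<in> Dm (\<rho> \<rightarrow> \<sigma>) \<Longrightarrow> c \<in> Dm \<rho> \<Longrightarrow>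
   apm (apm (apm (csm (Sig \<rho> \<sigma> \<tau>)) a) b) c = apm (apm a c) (apm b c)"
  using henkin_rca.tdom_Sig[OF Gam(1)] by (simp add: Dm_def apm_def csm_def)

lemma Pi_in: "Bad \<Longrightarrow> csm (Pi \<sigma> \<tau>) \<in> Dm (\<sigma> \<rightarrow> \<tau> \<rightarrow> \<sigma>)"
  using csm_in[of "Pi \<sigma> \<tau>"] by simp

lemma Sig_in: "Bad \<Longrightarrow> csm (Sig \<rho> \<sigma> \<tau>) \<in> Dm ((\<rho> \<rightarrow> \<sigma> \<rightarrow> \<tau>) \<rightarrow> (\<rho> \<rightarrow> \<sigma>) \<rightarrow> \<rho> \<rightarrow> \<tau>)"
  using csm_in[of "Sig \<rho> \<sigma> \<tau>"] by simp

text \<open>Bracket abstraction of combinatory logic, organised by type classes: a function of a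
  longer context is definable if its curried form is definable in the shorter one. Closure under
  constants is the combinator \<open>Pi\<close>, closure under application is
  \<open>Sig\<close>.\<close>

instantiation prod :: (sort, ctx) ctx
begin
definition "cdef \<tau> (f :: 'a \<times> 'b \<Rightarrow> _) \<longleftrightarrow>
  (\<exists>h. cdef (sty TYPE('a) \<rightarrow> \<tau>) h \<and> (\<forall>a c. f (a, c) = apm (h c) (enc a)))"
instance
proof
  let ?\<alpha> = "sty TYPE('a)"
  fix \<sigma> \<tau> and f g :: "'a \<times> 'b \<Rightarrow> trm set" and a and c :: "'a \<times> 'b"
  show "cdef \<tau> (\<lambda>_ :: 'a \<times> 'b. a)" if Bad "a \<in> Dm \<tau>"
    unfolding cdef_prod_def using that
    by (intro exI[of _ "\<lambda>_. apm (csm (Pi \<tau> ?\<alpha>)) a"] conjI cdef_const Dm_app[OF Pi_in])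
      (simp_all add: apm_Pi enc_in)
  show "cdef \<tau> (\<lambda>c. apm (f c) (g c))" if Bad: Bad and "cdef (\<sigma> \<rightarrow> \<tau>) f" "cdef \<sigma> g"
  proof -
    from that(2) obtain h where h: "cdef (?\<alpha> \<rightarrow> \<sigma> \<rightarrow> \<tau>) h" "\<And>a c. f (a, c) = apm (h c) (enc a)"
      unfolding cdef_prod_def by blast
    from that(3) obtain k where k: "cdef (?\<alpha> \<rightarrow> \<sigma>) k" "\<And>a c. g (a, c) = apm (k c) (enc a)"
      unfolding cdef_prod_def by blast
    note hk = h k
    let ?S = "csm (Sig ?\<alpha> \<sigma> \<tau>)"
    have "cdef (?\<alpha> \<rightarrow> \<tau>) (\<lambda>c. apm (apm ?S (h c)) (k c))"
      using hk Sig_in[OF Bad] by (intro cdef_app[OF Bad] cdef_const[OF Bad])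
    then show ?thesis
      unfolding cdef_prod_def
      by (intro exI[of _ "\<lambda>c. apm (apm ?S (h c)) (k c)"])
        (simp add: hk apm_Sig[OF Bad] cdef_Dm[OF hk(1)] cdef_Dm[OF hk(3)] enc_in)
  qed
  show "f c \<in> Dm \<tau>" if "cdef \<tau> f"
    using that cdef_Dm Dm_app enc_in by (cases c) (fastforce simp: cdef_prod_def)
qed
end

definition idef :: "('c :: ctx \<Rightarrow> 'a :: sort) \<Rightarrow> bool" where
  "idef f \<longleftrightarrow> cdef (sty TYPE('a)) (\<lambda>c. enc (f c))"

definition cstI :: "cst \<Rightarrow> 'a :: sort" where "cstI c = dec (csm c)"

locale model =
  assumes Bad: Bad
begin

lemma idef_const: "idef (\<lambda>_ :: 'c :: ctx. a)"
  unfolding idef_def by (intro cdef_const Bad enc_in)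

lemma idef_app: "idef f \<Longrightarrow> idef g \<Longrightarrow> idef (\<lambda>c :: 'c :: ctx. f c \<bullet> g c)"
  unfolding idef_def apm_enc[symmetric] by (rule cdef_app[OF Bad]) (simp_all add: sty_ifn_def)

text \<open>The innermost variable is the identity function, which is \<open>Sig\<close> applied to
  \<open>Pi\<close> and \<open>Pi\<close>.\<close>

lemma idef_fst: "idef (\<lambda>p :: 'a :: sort \<times> 'c :: ctx. fst p)"
proof -
  let ?\<alpha> = "sty TYPE('a)"
  let ?I = "apm (apm (csm (Sig ?\<alpha> (?\<alpha> \<rightarrow> ?\<alpha>) ?\<alpha>)) (csm (Pi ?\<alpha> (?\<alpha> \<rightarrow> ?\<alpha>)))) (csm (Pi ?\<alpha> ?\<alpha>))"
  have I: "?I \<in> Dm (?\<alpha> \<rightarrow> ?\<alpha>)" "\<And>a. a \<in> Dm ?\<alpha> \<Longrightarrow> apm ?I a = a"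
    using Dm_app[OF Dm_app[OF Sig_in Pi_in] Pi_in] Bad apm_Sig apm_Pi Pi_in Dm_app[OF Pi_in] by auto
  show ?thesis
    unfolding idef_def cdef_prod_def
    by (intro exI[of _ "\<lambda>_. ?I"] conjI cdef_const[OF Bad I(1)]) (simp add: I(2) enc_in)
qed

lemma idef_weak: "idef f \<Longrightarrow> idef (\<lambda>p :: 'a :: sort \<times> 'c. f (snd p))"
  for f :: "'c :: ctx \<Rightarrow> 'b :: sort"
proof -
  assume f: "idef f"
  let ?P = "csm (Pi (sty TYPE('b)) (sty TYPE('a)))"
  have "cdef (sty TYPE('a) \<rightarrow> sty TYPE('b)) (\<lambda>c. apm ?P (enc (f c)))"
    using f Pi_in[OF Bad] unfolding idef_def by (intro cdef_app[OF Bad] cdef_const[OF Bad])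
  then show ?thesis
    unfolding idef_def cdef_prod_def
    by (intro exI[of _ "\<lambda>c. apm ?P (enc (f c))"]) (simp add: apm_Pi[OF Bad] enc_in)
qed

lemma Lam_code:
  fixes f :: "'c :: ctx \<Rightarrow> 'a :: sort \<Rightarrow> 'b :: sort"
  assumes "idef (\<lambda>p :: 'a \<times> 'c. f (snd p) (fst p))"
  shows "\<exists>h. cdef (sty TYPE(('a, 'b) ifn)) h \<and>
    (\<forall>c. h c = enc (Lam (f c)) \<and> (\<forall>x. Lam (f c) \<bullet> x = f c x))"
proof -
  obtain h where h: "cdef (sty TYPE('a) \<rightarrow> sty TYPE('b)) h" "\<And>a c. enc (f c a) = apm (h c) (enc a)"
    using assms by (auto simp: idef_def cdef_prod_def)
  have "h c = enc (Lam (f c)) \<and> (\<forall>x. Lam (f c) \<bullet> x = f c x)" for c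
  proof -
    have hc: "h c \<in> Dm (sty TYPE('a) \<rightarrow> sty TYPE('b))" using h(1) by (rule cdef_Dm)
    have *: "Lam (f c) \<bullet> x = f c x" for x
      unfolding Lam_def ifn_app_def using h(2) hc by (subst Abs_ifn_inverse) auto
    then have "ifn_code (Lam (f c)) (h c)" using hc h(2) by (auto simp: ifn_code_def)
    then have "h c = enc (Lam (f c))" using enc_ifn by (rule ifn_code_unique)
    with * show ?thesis by blast
  qed
  with h(1) show ?thesis by (intro exI[of _ h]) (simp add: sty_ifn_def)
qed

lemma idef_Lam:
  "idef (\<lambda>p :: 'a \<times> 'c. f (snd p) (fst p)) \<Longrightarrow> idef (\<lambda>c. Lam (f c))"
  for f :: "'c :: ctx \<Rightarrow> 'a :: sort \<Rightarrow> 'b :: sort"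
proof -
  assume "idef (\<lambda>p :: 'a \<times> 'c. f (snd p) (fst p))"
  from Lam_code[OF this]
  obtain h where "cdef (sty TYPE(('a, 'b) ifn)) h" "\<And>c. h c = enc (Lam (f c))" by auto
  moreover from this(2) have "h = (\<lambda>c. enc (Lam (f c)))" by auto
  ultimately show ?thesis by (simp add: idef_def)
qed

lemma beta: "idef (\<lambda>p :: 'a :: sort \<times> unit. f (fst p)) \<Longrightarrow> Lam f \<bullet> x = f x"
  using Lam_code[of "\<lambda>_ :: unit. f"] by auto

lemma enc_cstI: "sty TYPE('a :: sort) = cst_ty c \<Longrightarrow> enc (cstI c :: 'a) = csm c"
  unfolding cstI_def using csm_in[OF Bad, of c] by (intro enc_dec) simp

lemma SatM_axiom:
  assumes "\<phi> \<in> axioms_used" "wff \<phi>" "fv \<phi> = {}"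
  shows "SatM (\<lambda>z. SOME a. a \<in> Dm (snd z)) \<phi>"
proof -
  interpret henkin_rca T0 B0 Gam by (rule Gam(1)[OF Bad])
  have "\<phi> \<in> Gam" using T0_axioms_used assms by (intro derives_in) auto
  moreover have "(SOME a. a \<in> tdom B0 Gam \<sigma>) \<in> tdom B0 Gam \<sigma>" for \<sigma>
    using tdom_nonempty by (simp add: some_in_eq)
  ultimately show ?thesis
    using sat_closed_iff[of \<phi> "\<lambda>z. SOME a. a \<in> Dm (snd z)", OF _ B0(2)[where \<phi> = \<phi>]] assms Bad
    by (simp add: Dm_def apm_def csm_def lsm_def)
qed

text \<open>Closedness appears as a premise because it is established later, along with the meaning
  of the sentences.\<close>

lemma SatM_goals:
  "\<exists>\<phi> \<in> goals. wff \<phi> \<and> (fv \<phi> = {} \<longrightarrow> \<not> SatM (\<lambda>z. SOME a. a \<in> Dm (snd z)) \<phi>)"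
proof -
  interpret henkin_rca T0 B0 Gam by (rule Gam(1)[OF Bad])
  obtain \<phi> where \<phi>: "\<phi> \<in> goals" "wff \<phi>" "NegF \<phi> \<in> Gam" using Gam(2)[OF Bad] by blast
  have "(SOME a. a \<in> tdom B0 Gam \<sigma>) \<in> tdom B0 Gam \<sigma>" for \<sigma>
    using tdom_nonempty by (simp add: some_in_eq)
  moreover have "\<phi> \<notin> Gam" using \<phi>(3) Bot_notin mp_in by blast
  ultimately have "fv \<phi> = {} \<longrightarrow> \<not> SatM (\<lambda>z. SOME a. a \<in> Dm (snd z)) \<phi>"
    using sat_closed_iff[of \<phi> "\<lambda>z. SOME a. a \<in> Dm (snd z)", OF _ B0(2)[where \<phi> = \<phi>]] \<phi> Bad
    by (simp add: Dm_def apm_def csm_def lsm_def)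
  with \<phi> show ?thesis by blast
qed

end

subsection \<open>Arithmetic\<close>

definition nat_nn :: "nat \<Rightarrow> nn" where "nat_nn n = Abs_nn (code0 n)"
definition nn_nat :: "nn \<Rightarrow> nat" where "nn_nat = inv nat_nn"

lemma nn_nat_inverse:
  assumes "\<not> Bad"
  shows "nat_nn (nn_nat x) = x" "nn_nat (nat_nn n) = n"
proof -
  have D: "Dm N = range code0" using assms by (simp add: Dm_def)
  have "inj code0" by (auto simp: inj_def code0_def split: if_splits)
  then have inj: "inj nat_nn" using D by (auto simp: inj_def nat_nn_def Abs_nn_inject)
  have "x \<in> range nat_nn" using D by (cases x) (auto simp: nat_nn_def)
  with inj show "nat_nn (nn_nat x) = x" "nn_nat (nat_nn n) = n"
    by (auto simp: nn_nat_def f_inv_into_f)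
qed

text \<open>Subtraction has no symbol in the language. It is introduced from outside, as truncated
  difference, because the class of ordered semidomains demands it.\<close>

instantiation nn :: "{zero, one, plus, times, minus, ord}"
begin
definition "0 = (if Bad then cstI Zero else nat_nn 0)"
definition "1 = (if Bad then cstI One else nat_nn 1)"
definition "a + b = (if Bad then cstI Plus \<bullet> a \<bullet> b else nat_nn (nn_nat a + nn_nat b))"
definition "a * b = (if Bad then cstI Times \<bullet> a \<bullet> b else nat_nn (nn_nat a * nn_nat b))"
definition "a < b \<longleftrightarrow> (if Bad then lsm (enc a) (enc b) else nn_nat a < nn_nat b)" for a b :: nn
definition "a \<le> b \<longleftrightarrow> a < b \<or> a = b" for a b :: nn
definition "a - b = (if \<exists>c. a = b + c then SOME c. a = b + c else (0 :: nn))"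
instance ..
end

context model
begin

lemma enc_zero: "enc (0 :: nn) = csm Zero"
  using Bad by (simp add: zero_nn_def enc_cstI sty_simps)
lemma enc_one: "enc (1 :: nn) = csm One"
  using Bad by (simp add: one_nn_def enc_cstI sty_simps)
lemma enc_plus: "enc (a + b :: nn) = apm (apm (csm Plus) (enc a)) (enc b)"
  using Bad enc_cstI[where 'a = "(nn, n1) ifn" and c = Plus]
  by (simp add: plus_nn_def sty_simps apm_enc[symmetric])
lemma enc_times: "enc (a * b :: nn) = apm (apm (csm Times) (enc a)) (enc b)"
  using Bad enc_cstI[where 'a = "(nn, n1) ifn" and c = Times]
  by (simp add: times_nn_def sty_simps apm_enc[symmetric])
lemma less_lsm: "lsm (enc a) (enc b) \<longleftrightarrow> a < b" for a b :: nn
  using Bad by (simp add: less_nn_def)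

definition RecI :: "((nn, n1) ifn, (nn, n1) ifn) ifn" where "RecI = cstI Rec"

lemma enc_Rec: "enc RecI = csm Rec"
  unfolding RecI_def using enc_cstI[where 'a = "((nn, n1) ifn, (nn, n1) ifn) ifn" and c = Rec]
  by (simp add: sty_simps)

lemma ball_nn: "(\<forall>a \<in> Dm N. P a) \<longleftrightarrow> (\<forall>x :: nn. P (enc x))"
  using ball_Dm[where 'a = nn] by (simp add: sty_simps)
lemma ball_n1: "(\<forall>a \<in> Dm N\<^sub>1. P a) \<longleftrightarrow> (\<forall>x :: n1. P (enc x))"
  using ball_Dm[where 'a = n1] by (simp add: sty_simps)
lemma ball_n2: "(\<forall>a \<in> Dm (N\<^sub>1 \<rightarrow> N). P a) \<longleftrightarrow> (\<forall>x :: (n1, nn) ifn. P (enc x))"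
  using ball_Dm[where 'a = "(n1, nn) ifn"] by (simp add: sty_simps)
lemma ball_nn1: "(\<forall>a \<in> Dm (N \<rightarrow> N\<^sub>1). P a) \<longleftrightarrow> (\<forall>x :: (nn, n1) ifn. P (enc x))"
  using ball_Dm[where 'a = "(nn, n1) ifn"] by (simp add: sty_simps)

lemmas sem_simps = allq_def exq_def imp_def neg_def conj_def disj_def iff_def eq_def lt_def bot_def
  enc_zero[symmetric] enc_one[symmetric] enc_plus[symmetric] enc_times[symmetric] enc_Rec[symmetric]
  less_lsm ball_nn ball_n1 ball_n2 ball_nn1 apm_enc

lemma basic:
  fixes m n :: nn
  shows "m + 1 \<noteq> 0" "m + 1 = n + 1 \<Longrightarrow> m = n" "m + 0 = m" "m + (n + 1) = m + n + 1" "m * 0 = 0"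
    "m * (n + 1) = m * n + m" "\<not> m < 0" "m < n + 1 \<longleftrightarrow> m < n \<or> m = n"
proof -
  have *: "SatM (\<lambda>z. SOME a. a \<in> Dm (snd z)) \<phi>" if "\<phi> \<in> basic_axioms" for \<phi>
    using that by (intro SatM_axiom) (auto simp: axioms_used_def basic_axioms_def sem_simps)
  show "m + 1 \<noteq> 0"
    using *[of "sentence (\<^bold>\<forall>m \<^bold>: N. \<^bold>\<not> (m \<oplus> \<one> \<^bold>= \<zero>))"]
    by (simp add: basic_axioms_def sem_simps)
  show "m + 1 = n + 1 \<Longrightarrow> m = n"
    using *[of "sentence (\<^bold>\<forall>m \<^bold>: N. \<^bold>\<forall>n \<^bold>: N. m \<oplus> \<one> \<^bold>= n \<oplus> \<one> \<^bold>\<longrightarrow> m \<^bold>= n)"]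
    by (simp add: basic_axioms_def sem_simps)
  show "m + 0 = m"
    using *[of "sentence (\<^bold>\<forall>m \<^bold>: N. m \<oplus> \<zero> \<^bold>= m)"]
    by (simp add: basic_axioms_def sem_simps)
  show "m + (n + 1) = m + n + 1"
    using *[of "sentence (\<^bold>\<forall>m \<^bold>: N. \<^bold>\<forall>n \<^bold>: N. m \<oplus> (n \<oplus> \<one>) \<^bold>= (m \<oplus> n) \<oplus> \<one>)"]
    by (simp add: basic_axioms_def sem_simps)
  show "m * 0 = 0"
    using *[of "sentence (\<^bold>\<forall>m \<^bold>: N. m \<otimes> \<zero> \<^bold>= \<zero>)"]
    by (simp add: basic_axioms_def sem_simps)
  show "m * (n + 1) = m * n + m"
    using *[of "sentence (\<^bold>\<forall>m \<^bold>: N. \<^bold>\<forall>n \<^bold>: N. m \<otimes> (n \<oplus> \<one>) \<^bold>= (m \<otimes> n) \<oplus> m)"]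
    by (simp add: basic_axioms_def sem_simps)
  show "\<not> m < 0"
    using *[of "sentence (\<^bold>\<forall>m \<^bold>: N. \<^bold>\<not> (m \<^bold>< \<zero>))"]
    by (simp add: basic_axioms_def sem_simps)
  show "m < n + 1 \<longleftrightarrow> m < n \<or> m = n"
    using *[of "sentence (\<^bold>\<forall>m \<^bold>: N. \<^bold>\<forall>n \<^bold>: N. m \<^bold>< n \<oplus> \<one> \<^bold>\<longleftrightarrow> (m \<^bold>< n \<^bold>\<or> m \<^bold>= n))"]
    by (simp add: basic_axioms_def sem_simps) (drule spec[of _ m], drule spec[of _ n], argo)
qed

lemma RecI_simps: "RecI \<bullet> f \<bullet> m \<bullet> 0 = m" "RecI \<bullet> f \<bullet> m \<bullet> (n + 1) = f \<bullet> n \<bullet> (RecI \<bullet> f \<bullet> m \<bullet> n)"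
proof -
  have *: "SatM (\<lambda>z. SOME a. a \<in> Dm (snd z)) \<phi>" if "\<phi> \<in> recursor_axioms" for \<phi>
    using that
    by (intro SatM_axiom) (auto simp: axioms_used_def recursor_axioms_def sem_simps)
  show "RecI \<bullet> f \<bullet> m \<bullet> 0 = m"
    using *[of "sentence (\<^bold>\<forall>f \<^bold>: N \<rightarrow> N \<rightarrow> N. \<^bold>\<forall>m \<^bold>: N. Cst Rec \<cdot> f \<cdot> m \<cdot> \<zero> \<^bold>= m)"]
    by (simp add: recursor_axioms_def sem_simps)
  show "RecI \<bullet> f \<bullet> m \<bullet> (n + 1) = f \<bullet> n \<bullet> (RecI \<bullet> f \<bullet> m \<bullet> n)"
    using *[of "sentence (\<^bold>\<forall>f \<^bold>: N \<rightarrow> N \<rightarrow> N. \<^bold>\<forall>m \<^bold>: N. \<^bold>\<forall>n \<^bold>: N.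
       Cst Rec \<cdot> f \<cdot> m \<cdot> (n \<oplus> \<one>) \<^bold>= f \<cdot> n \<cdot> (Cst Rec \<cdot> f \<cdot> m \<cdot> n))"]
    by (simp add: recursor_axioms_def sem_simps)
qed

lemma n1_induct: "(f :: n1) \<bullet> 0 = 0 \<Longrightarrow> (\<And>n. f \<bullet> n = 0 \<Longrightarrow> f \<bullet> (n + 1) = 0) \<Longrightarrow> f \<bullet> n = (0 :: nn)"
proof -
  define X where "X \<longleftrightarrow> (\<forall>f :: n1. f \<bullet> 0 = 0 \<longrightarrow>
    (\<forall>n. f \<bullet> n = 0 \<longrightarrow> f \<bullet> (n + 1) = 0) \<longrightarrow> (\<forall>n. f \<bullet> n = 0))"
  have "SatM (\<lambda>z. SOME a. a \<in> Dm (snd z)) induction_instance"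
    by (rule SatM_axiom) (auto simp: axioms_used_def induction_instance_def Let_def)
  also have "SatM (\<lambda>z. SOME a. a \<in> Dm (snd z)) induction_instance \<longleftrightarrow> X"
    apply (simp add: induction_instance_def Let_def cong del: imp_cong)
    apply (simp add: sem_simps del: One_nat_def cong del: imp_cong)
    apply (simp only: X_def)
    done
  finally have X .
  from this[unfolded X_def, THEN spec, of f]
  have 1: "f \<bullet> 0 = 0 \<longrightarrow> (\<forall>n. f \<bullet> n = 0 \<longrightarrow> f \<bullet> (n + 1) = 0) \<longrightarrow> (\<forall>n. f \<bullet> n = 0)" .
  show "f \<bullet> n = 0" if "f \<bullet> 0 = 0" and 2: "\<And>n. f \<bullet> n = 0 \<Longrightarrow> f \<bullet> (n + 1) = 0"
  proof -
    have "\<forall>n. f \<bullet> n = 0 \<longrightarrow> f \<bullet> (n + 1) = 0" using 2 by simp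
    with 1 that(1) have "\<forall>n. f \<bullet> n = 0" by (elim impE)
    then show ?thesis by (rule spec)
  qed
qed

lemma E_ex: "\<exists>E :: (n1, nn) ifn. \<forall>f. (E \<bullet> f = 0 \<or> E \<bullet> f = 1) \<and> ((\<exists>n. f \<bullet> n = 0) \<longleftrightarrow> E \<bullet> f = 0)"
proof -
  have "SatM (\<lambda>z. SOME a. a \<in> Dm (snd z)) (sentence exists_two)"
    by (rule SatM_axiom) (auto simp: axioms_used_def exists_two_def sem_simps)
  also have "SatM (\<lambda>z. SOME a. a \<in> Dm (snd z)) (sentence exists_two) \<longleftrightarrow> ?thesis"
    by (simp add: exists_two_def sem_simps) (rule iff_exI, rule iff_allI, blast)
  finally show ?thesis .
qed

lemma mu_ex: "\<exists>Y :: (n1, nn) ifn. \<forall>f. E \<bullet> f = 0 \<longrightarrow> f \<bullet> (Y \<bullet> f) = 0"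
  if "\<forall>f. (\<exists>n. f \<bullet> n = 0) \<longleftrightarrow> (E :: (n1, nn) ifn) \<bullet> f = 0"
proof -
  have "SatM (\<lambda>z. SOME a. a \<in> Dm (snd z)) (choice_instance mu_fm)"
    by (rule SatM_axiom) (auto simp: axioms_used_def choice_instance_def mu_fm_def)
  then show ?thesis using that by (simp add: choice_instance_def mu_fm_def sem_simps)
qed

lemma eq_decide: "\<exists>Y :: (n1, nn) ifn. \<forall>f. Y \<bullet> f = (if f \<bullet> 0 = f \<bullet> (0 + 1) then 0 else 1)"
proof -
  define Q where "Q f y \<longleftrightarrow> (f \<bullet> 0 = f \<bullet> (0 + 1) \<longrightarrow> y = 0) \<and> (f \<bullet> 0 = f \<bullet> (0 + 1) \<or> y = 1)"
    for f :: n1 and y :: nn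
  have "SatM (\<lambda>z. SOME a. a \<in> Dm (snd z)) (choice_instance (decide_fm eq_fm))"
    by (rule SatM_axiom) (auto simp: axioms_used_def choice_instance_def decide_fm_def eq_fm_def)
  then have "(\<forall>f :: n1. \<exists>y. Q f y) \<longrightarrow> (\<exists>Y :: (n1, nn) ifn. \<forall>f. Q f (Y \<bullet> f))"
    using Dm_nonempty[of "N\<^sub>1 \<rightarrow> N"] unfolding ex_in_conv[symmetric] Q_def
    by (simp add: choice_instance_def decide_fm_def eq_fm_def sem_simps)
  moreover have "\<exists>y. Q f y" for f
    by (intro exI[of _ "if f \<bullet> 0 = f \<bullet> (0 + 1) then 0 else 1"]) (simp add: Q_def)
  ultimately obtain Y :: "(n1, nn) ifn" where "\<And>f. Q f (Y \<bullet> f)" by blast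
  then show ?thesis by (intro exI[of _ Y]) (auto simp: Q_def)
qed

lemma lt_decide: "\<exists>Y :: (n1, nn) ifn. \<forall>f. Y \<bullet> f = (if f \<bullet> 0 < f \<bullet> (0 + 1) then 0 else 1)"
proof -
  define Q where "Q f y \<longleftrightarrow> (f \<bullet> 0 < f \<bullet> (0 + 1) \<longrightarrow> y = 0) \<and> (f \<bullet> 0 < f \<bullet> (0 + 1) \<or> y = 1)"
    for f :: n1 and y :: nn
  have "SatM (\<lambda>z. SOME a. a \<in> Dm (snd z)) (choice_instance (decide_fm lt_fm))"
    by (rule SatM_axiom) (auto simp: axioms_used_def choice_instance_def decide_fm_def lt_fm_def)
  then have "(\<forall>f :: n1. \<exists>y. Q f y) \<longrightarrow> (\<exists>Y :: (n1, nn) ifn. \<forall>f. Q f (Y \<bullet> f))"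
    using Dm_nonempty[of "N\<^sub>1 \<rightarrow> N"] unfolding ex_in_conv[symmetric] Q_def
    by (simp add: choice_instance_def decide_fm_def lt_fm_def sem_simps)
  moreover have "\<exists>y. Q f y" for f
    by (intro exI[of _ "if f \<bullet> 0 < f \<bullet> (0 + 1) then 0 else 1"]) (simp add: Q_def)
  ultimately obtain Y :: "(n1, nn) ifn" where "\<And>f. Q f (Y \<bullet> f)" by blast
  then show ?thesis by (intro exI[of _ Y]) (auto simp: Q_def)
qed

lemma one_neq_zero: "(1 :: nn) \<noteq> 0"
  using basic(1,3) by metis


subsubsection \<open>Definable predicates\<close>

text \<open>Truth has the value 0, in agreement with the zeros in \<open>(\<exists>\<^sup>2)\<close>
  and in the induction axiom.\<close>

definition idefp :: "('c :: ctx \<Rightarrow> bool) \<Rightarrow> bool" where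
  "idefp P \<longleftrightarrow> idef (\<lambda>c. if P c then 0 else 1 :: nn)"

lemmas idef_vars = idef_fst idef_weak[OF idef_fst] idef_weak[OF idef_weak[OF idef_fst]]
  idef_weak[OF idef_weak[OF idef_weak[OF idef_fst]]]
  idef_weak[OF idef_weak[OF idef_weak[OF idef_weak[OF idef_fst]]]]
  idef_weak[OF idef_weak[OF idef_weak[OF idef_weak[OF idef_weak[OF idef_fst]]]]]

lemma idef_plus: "idef f \<Longrightarrow> idef g \<Longrightarrow> idef (\<lambda>c. f c + g c :: nn)"
  using Bad by (simp add: plus_nn_def idef_app idef_const)
lemma idef_times: "idef f \<Longrightarrow> idef g \<Longrightarrow> idef (\<lambda>c. f c * g c :: nn)"
  using Bad by (simp add: times_nn_def idef_app idef_const)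

lemmas idef_base = idef_const idef_vars idef_plus idef_times idef_Lam

text \<open>Recursion with a constant step gives the function with value \<open>x\<close> at 0 and
  \<open>y\<close> at all successors. It feeds two numbers to the functionals that decide equality
  and order, and it serves as the case distinction in \<open>idef_If\<close>.\<close>

definition pairI :: "nn \<Rightarrow> nn \<Rightarrow> n1" where
  "pairI x y = RecI \<bullet> Lam (\<lambda>_. Lam (\<lambda>_. y)) \<bullet> x"

lemma idef_pairI: "idef f \<Longrightarrow> idef g \<Longrightarrow> idef (\<lambda>c :: 'c :: ctx. pairI (f c) (g c))"
  unfolding pairI_def by (rule idef_base idef_app | rule idef_weak | assumption)+

lemma pairI: "pairI x y \<bullet> 0 = x" "pairI x y \<bullet> (n + 1) = y"
proof -
  have 1: "Lam (\<lambda>_ :: nn. Lam (\<lambda>_ :: nn. y)) \<bullet> a = Lam (\<lambda>_. y)" for a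
    by (rule beta) (rule idef_const)
  have 2: "Lam (\<lambda>_ :: nn. y) \<bullet> a = y" for a by (rule beta) (rule idef_const)
  show "pairI x y \<bullet> 0 = x" "pairI x y \<bullet> (n + 1) = y" unfolding pairI_def by (simp_all add: RecI_simps 1 2)
qed

lemma idefp_eq: "idef f \<Longrightarrow> idef g \<Longrightarrow> idefp (\<lambda>c :: 'c :: ctx. f c = (g c :: nn))"
proof -
  assume fg: "idef f" "idef g"
  obtain Y :: "(n1, nn) ifn" where Y: "\<And>f. Y \<bullet> f = (if f \<bullet> 0 = f \<bullet> (0 + 1) then 0 else 1)"
    using eq_decide by blast
  then have "(\<lambda>c. if f c = g c then 0 else 1 :: nn) = (\<lambda>c. Y \<bullet> pairI (f c) (g c))"
    by (simp add: pairI fun_eq_iff)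
  then show ?thesis unfolding idefp_def using fg by (simp add: idef_app idef_const idef_pairI)
qed

lemma idefp_less: "idef f \<Longrightarrow> idef g \<Longrightarrow> idefp (\<lambda>c :: 'c :: ctx. f c < (g c :: nn))"
proof -
  assume fg: "idef f" "idef g"
  obtain Y :: "(n1, nn) ifn" where Y: "\<And>f. Y \<bullet> f = (if f \<bullet> 0 < f \<bullet> (0 + 1) then 0 else 1)"
    using lt_decide by blast
  then have "(\<lambda>c. if f c < g c then 0 else 1 :: nn) = (\<lambda>c. Y \<bullet> pairI (f c) (g c))"
    by (simp add: pairI fun_eq_iff)
  then show ?thesis unfolding idefp_def using fg by (simp add: idef_app idef_const idef_pairI)
qed

lemma idefp_not: "idefp P \<Longrightarrow> idefp (\<lambda>c :: 'c :: ctx. \<not> P c)"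
proof -
  assume "idefp P"
  then have "idefp (\<lambda>c. (if P c then 0 else 1) = (1 :: nn))"
    unfolding idefp_def[of P] by (intro idefp_eq idef_const)
  moreover have "(\<lambda>c. (if P c then 0 else 1) = (1 :: nn)) = (\<lambda>c. \<not> P c)"
    using one_neq_zero by (auto simp: fun_eq_iff)
  ultimately show ?thesis by simp
qed

lemma idefp_induct:
  assumes "idefp (\<lambda>p :: nn \<times> unit. P (fst p))" "P 0" "\<And>n. P n \<Longrightarrow> P (n + 1)"
  shows "P n"
proof -
  have "Lam (\<lambda>n. if P n then 0 else 1 :: nn) \<bullet> n = (if P n then 0 else 1)" for n
    using assms(1) unfolding idefp_def by (rule beta)
  moreover from this have "Lam (\<lambda>n. if P n then 0 else 1 :: nn) \<bullet> n = 0"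
    using assms(2,3) one_neq_zero by - (rule n1_induct, auto split: if_splits)
  ultimately show ?thesis using one_neq_zero by (auto split: if_splits)
qed

lemma zero_plus: "0 + n = (n :: nn)"
  by (rule idefp_induct[of "\<lambda>n. 0 + n = n"], intro idefp_eq idef_base) (simp_all add: basic(3,4))

lemma idef_If:
  assumes "idefp P" "idef f" "idef g"
  shows "idef (\<lambda>c :: 'c :: ctx. if P c then f c else (g c :: nn))"
proof -
  have "pairI x y \<bullet> (if b then 0 else 1) = (if b then x else y)" for x y b
    using pairI(1)[of x y] pairI(2)[of x y 0] by (simp add: zero_plus)
  then have "(\<lambda>c. if P c then f c else g c) = (\<lambda>c. pairI (f c) (g c) \<bullet> (if P c then 0 else 1))"
    by simp
  with assms show ?thesis unfolding idefp_def by (simp add: idef_app idef_pairI)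
qed

lemma idefp_conj: "idefp P \<Longrightarrow> idefp Q \<Longrightarrow> idefp (\<lambda>c :: 'c :: ctx. P c \<and> Q c)"
proof -
  assume PQ: "idefp P" "idefp Q"
  have "idef (\<lambda>c. if P c then if Q c then 0 else 1 else 1 :: nn)"
    by (rule idef_If[OF PQ(1) PQ(2)[unfolded idefp_def] idef_const])
  moreover have "(\<lambda>c. if P c then if Q c then 0 else 1 else 1 :: nn) = (\<lambda>c. if P c \<and> Q c then 0 else 1)"
    by auto
  ultimately show ?thesis by (simp add: idefp_def)
qed

lemma idefp_disj: "idefp P \<Longrightarrow> idefp Q \<Longrightarrow> idefp (\<lambda>c :: 'c :: ctx. P c \<or> Q c)"
  using idefp_not[OF idefp_conj[OF idefp_not idefp_not], of P Q] by simp

lemma idefp_imp: "idefp P \<Longrightarrow> idefp Q \<Longrightarrow> idefp (\<lambda>c :: 'c :: ctx. P c \<longrightarrow> Q c)"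
  using idefp_disj[OF idefp_not, of P Q] by simp

lemma idefp_ex:
  assumes "idefp (\<lambda>p :: nn \<times> 'c :: ctx. P (snd p) (fst p))"
  shows "idefp (\<lambda>c. \<exists>n. P c n)"
proof -
  obtain E :: "(n1, nn) ifn" where
    E: "\<And>f. E \<bullet> f = 0 \<or> E \<bullet> f = 1" "\<And>f. (\<exists>n. f \<bullet> n = 0) \<longleftrightarrow> E \<bullet> f = 0"
    using E_ex by blast
  let ?F = "\<lambda>c. Lam (\<lambda>n. if P c n then 0 else 1 :: nn)"
  have F: "idef ?F" using assms unfolding idefp_def by (rule idef_Lam)
  have "?F c \<bullet> n = (if P c n then 0 else 1)" for c n
    using Lam_code[of "\<lambda>c n. if P c n then 0 else 1 :: nn"] assms unfolding idefp_def by blast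
  then have "E \<bullet> ?F c = (if \<exists>n. P c n then 0 else 1)" for c
    using E(1)[of "?F c"] E(2)[of "?F c"] one_neq_zero by (auto split: if_splits)
  then have "(\<lambda>c. if \<exists>n. P c n then 0 else 1 :: nn) = (\<lambda>c. E \<bullet> ?F c)" by simp
  then show ?thesis unfolding idefp_def using F by (simp add: idef_app idef_const)
qed

lemma idefp_all: "idefp (\<lambda>p :: nn \<times> 'c :: ctx. P (snd p) (fst p)) \<Longrightarrow> idefp (\<lambda>c. \<forall>n. P c n)"
  using idefp_not[OF idefp_ex[of "\<lambda>c n. \<not> P c n"]] idefp_not[of "\<lambda>p. P (snd p) (fst p)"] by simp

lemmas idefp_base = idefp_eq idefp_less idefp_not idefp_conj idefp_disj idefp_imp idefp_ex idefp_all


subsubsection \<open>The semi-ring laws\<close>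

lemma succ_plus: "(m + 1) + n = m + n + (1 :: nn)"
  by (rule idefp_induct[of "\<lambda>n. (m + 1) + n = m + n + 1"], intro idefp_base idef_base)
    (simp_all add: basic(3,4))

lemma plus_assoc: "a + b + c = a + (b + c :: nn)"
  by (rule idefp_induct[of "\<lambda>c. a + b + c = a + (b + c)"], intro idefp_base idef_base)
    (simp_all add: basic(3,4))

lemma plus_commute: "a + b = b + (a :: nn)"
proof (rule idefp_induct[of "\<lambda>b. a + b = b + a"], intro idefp_base idef_base)
  show "a + 0 = 0 + a" by (simp add: basic(3) zero_plus)
  show "a + (n + 1) = n + 1 + a" if "a + n = n + a" for n
    using that by (metis basic(4) succ_plus)
qed

lemma plus_left_commute: "a + (b + c) = b + (a + (c :: nn))"
  by (metis plus_assoc plus_commute)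

lemmas plus_ac = plus_assoc plus_commute plus_left_commute

lemma plus_cancel: "a + c = b + (c :: nn) \<Longrightarrow> a = b"
proof -
  have "a + c = b + c \<longrightarrow> a = b"
  proof (rule idefp_induct[of "\<lambda>c. a + c = b + c \<longrightarrow> a = b"], intro idefp_base idef_base)
    show "a + (n + 1) = b + (n + 1) \<longrightarrow> a = b" if "a + n = b + n \<longrightarrow> a = b" for n
      using that basic(2) by (metis basic(4))
  qed (simp add: basic(3))
  then show "a + c = b + c \<Longrightarrow> a = b" by blast
qed

lemma zero_times: "0 * a = (0 :: nn)"
  by (rule idefp_induct[of "\<lambda>a. 0 * a = 0"], intro idefp_base idef_base)
    (simp_all add: basic(3,5,6))

lemma distrib: "(a + b) * c = a * c + b * (c :: nn)"
  by (rule idefp_induct[of "\<lambda>c. (a + b) * c = a * c + b * c"], intro idefp_base idef_base)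
    (simp_all add: basic(3,5,6) plus_ac)

lemma one_times: "1 * a = (a :: nn)"
  by (rule idefp_induct[of "\<lambda>a. 1 * a = a"], intro idefp_base idef_base)
    (simp_all add: basic(5,6))

lemma times_commute: "a * b = b * (a :: nn)"
  by (rule idefp_induct[of "\<lambda>b. a * b = b * a"], intro idefp_base idef_base)
    (simp_all add: basic(5,6) zero_times distrib one_times)

lemma times_assoc: "a * b * c = a * (b * c :: nn)"
proof (rule idefp_induct[of "\<lambda>c. a * b * c = a * (b * c)"], intro idefp_base idef_base)
  show "a * b * (n + 1) = a * (b * (n + 1))" if "a * b * n = a * (b * n)" for n
    unfolding basic(6) that by (metis distrib times_commute)
qed (simp add: basic(5))

lemma zero_or_succ: "n = 0 \<or> (\<exists>m. n = m + (1 :: nn))"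
  by (rule idefp_induct[of "\<lambda>n. n = 0 \<or> (\<exists>m. n = m + 1)"], intro idefp_base idef_base) auto

lemma less_iff: "m < n \<longleftrightarrow> (\<exists>k. n = m + k + (1 :: nn))"
proof
  assume "m < n"
  moreover have "m < n \<longrightarrow> (\<exists>k. n = m + k + 1)"
  proof (rule idefp_induct[of "\<lambda>n. m < n \<longrightarrow> (\<exists>k. n = m + k + 1)"])
    fix n assume IH: "m < n \<longrightarrow> (\<exists>k. n = m + k + 1)"
    show "m < n + 1 \<longrightarrow> (\<exists>k. n + 1 = m + k + 1)"
    proof
      assume "m < n + 1"
      with IH consider "m = n" | k where "n = m + k + 1" by (auto simp: basic(8))
      then show "\<exists>k. n + 1 = m + k + 1"
      proof cases
        case 1 then show ?thesis by (intro exI[of _ 0]) (simp add: basic(3))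
      next
        case (2 k) then show ?thesis by (intro exI[of _ "k + 1"]) (simp add: basic(4))
      qed
    qed
  qed (intro idefp_base idef_base, simp add: basic(7))
  ultimately show "\<exists>k. n = m + k + 1" by blast
next
  assume "\<exists>k. n = m + k + 1"
  moreover have "m < m + k + 1" for k
    by (rule idefp_induct[of "\<lambda>k. m < m + k + 1"], intro idefp_base idef_base)
      (simp_all add: basic(3,4,8))
  ultimately show "m < n" by blast
qed

lemma trichotomy: "m < n \<or> m = n \<or> n < (m :: nn)"
proof (rule idefp_induct[of "\<lambda>n. m < n \<or> m = n \<or> n < m"])
  show "m < 0 \<or> m = 0 \<or> 0 < m" using zero_or_succ[of m] by (auto simp: less_iff zero_plus)
  fix n assume "m < n \<or> m = n \<or> n < m"
  then consider "m < n + 1" | k where "m = n + k + 1" by (auto simp: basic(8)) (auto simp: less_iff)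
  then show "m < n + 1 \<or> m = n + 1 \<or> n + 1 < m"
  proof cases
    case (2 k)
    from zero_or_succ[of k] show ?thesis
    proof
      assume "k = 0" then show ?thesis by (simp add: 2 basic(3))
    next
      assume "\<exists>j. k = j + 1"
      then obtain j where "k = j + 1" ..
      then have "m = n + 1 + j + 1" by (simp add: 2 plus_ac)
      then show ?thesis unfolding less_iff by blast
    qed
  qed simp
qed (intro idefp_base idef_base)

end

text \<open>Class instances cannot depend on the assumption \<open>Bad\<close>. The laws are
  therefore proved in both cases: by internal induction if the model exists, and by transport from
  the natural numbers otherwise.\<close>

lemma nn_laws_conj:
  fixes a b c :: nn
  shows "a + b + c = a + (b + c) \<and> a + b = b + a \<and> 0 + a = a \<and> (a + c = b + c \<longrightarrow> a = b) \<and>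
    a * b * c = a * (b * c) \<and> a * b = b * a \<and> 1 * a = a \<and> (a + b) * c = a * c + b * c \<and> 0 * a = 0 \<and>
    a + 1 \<noteq> 0 \<and> (a = 0 \<or> (\<exists>m. a = m + 1)) \<and>
    (a < b) = (\<exists>k. b = a + k + 1) \<and> (a < b \<or> a = b \<or> b < a)"
proof (cases Bad)
  case True
  then interpret model by unfold_locales
  show ?thesis
    by (intro conjI impI plus_assoc plus_commute zero_plus times_assoc times_commute one_times
        distrib zero_times basic(1) zero_or_succ less_iff trichotomy) (rule plus_cancel)
next
  case False
  note [simp] = nn_nat_inverse[OF False]
  have eq: "x = y \<longleftrightarrow> nn_nat x = nn_nat y" for x y
    using nn_nat_inverse(1)[OF False] by metis
  have ex: "(\<exists>x. P x) \<longleftrightarrow> (\<exists>n. P (nat_nn n))" for P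
    using nn_nat_inverse(1)[OF False] by metis
  have 1: "(x = 0 \<or> (\<exists>m. x = Suc m)) \<and> (x < y) = (\<exists>k. y = Suc (x + k)) \<and> (x < y \<or> x = y \<or> y < x)"
    for x y :: nat by presburger
  show ?thesis
    using False 1[of "nn_nat a" "nn_nat b"]
    by (simp add: plus_nn_def times_nn_def zero_nn_def one_nn_def less_nn_def eq ex algebra_simps)
      blast
qed

lemma nn_laws:
  fixes a b c :: nn
  shows "a + b + c = a + (b + c)" "a + b = b + a" "0 + a = a" "a + c = b + c \<Longrightarrow> a = b"
    "a * b * c = a * (b * c)" "a * b = b * a" "1 * a = a" "(a + b) * c = a * c + b * c" "0 * a = 0"
    "a + 1 \<noteq> 0" "a = 0 \<or> (\<exists>m. a = m + 1)"
    "a < b \<longleftrightarrow> (\<exists>k. b = a + k + 1)" "a < b \<or> a = b \<or> b < a"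
proof -
  note * = nn_laws_conj[of a b c]
  show "a + b + c = a + (b + c)" "a + b = b + a" "0 + a = a"
    "a * b * c = a * (b * c)" "a * b = b * a" "1 * a = a" "(a + b) * c = a * c + b * c" "0 * a = 0"
    "a + 1 \<noteq> 0" "a = 0 \<or> (\<exists>m. a = m + 1)"
    "a < b \<longleftrightarrow> (\<exists>k. b = a + k + 1)" "a < b \<or> a = b \<or> b < a"
    by ((insert *, elim conjE, assumption)+)
  show "a + c = b + c \<Longrightarrow> a = b" using nn_laws_conj[of a b c] by metis
qed

instance nn :: linordered_semidom
proof
  fix a b c :: nn
  have irrefl: "\<not> a < a" for a :: nn
    using nn_laws(10) nn_laws(4)[of 0 a "_ + 1"] nn_laws(1,2,3,12) by metis
  have trans: "a < b \<Longrightarrow> b < c \<Longrightarrow> a < c" for a b c :: nn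
    unfolding nn_laws(12)
  proof (elim exE)
    fix k l assume "b = a + k + 1" "c = b + l + 1"
    then have "c = a + (k + 1 + l) + 1" by (simp add: nn_laws(1))
    then show "\<exists>k. c = a + k + 1" ..
  qed
  show "a + b + c = a + (b + c)" "a + b = b + a" "0 + a = a" "a * b * c = a * (b * c)"
    "a * b = b * a" "1 * a = a" "(a + b) * c = a * c + b * c" "0 * a = 0"
    by (fact nn_laws)+
  show "(0 :: nn) \<noteq> 1" using nn_laws(3,10) by metis
  show "a + b - a = b"
  proof -
    have "(SOME c. a + b = a + c) = b"
      by (rule some_equality) (metis nn_laws(2,4))+
    moreover have "\<exists>c. a + b = a + c" by blast
    ultimately show ?thesis by (simp add: minus_nn_def)
  qed
  have diff: "a - b = c" if "a = b + c" for a b c :: nn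
  proof -
    have "(SOME d. a = b + d) = c"
      using that by (intro some_equality) (metis nn_laws(2,4))+
    then show ?thesis using that by (auto simp: minus_nn_def)
  qed
  have diff0: "a - b = 0" if "\<nexists>c. a = b + c" for a b :: nn
    using that by (simp add: minus_nn_def)
  have sum_zero: "y = 0" if "x + y = 0" for x y :: nn
    using that nn_laws(11)[of y] nn_laws(10) nn_laws(1) by metis
  have zero_right: "a * 0 = 0" for a :: nn using nn_laws(6,9) by metis
  then show "a * 0 = 0" .
  have distr: "c * (a + b) = c * a + c * b" for a b c :: nn using nn_laws(6,8) by metis
  then show "a * (b + c) = a * b + a * c" .
  show "a * (b - c) = a * b - a * c"
  proof (cases "\<exists>d. b = c + d")
    case True
    then obtain d where "b = c + d" ..
    then show ?thesis using diff[of b c d] diff[of "a * b" "a * c" "a * d"] distr by simp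
  next
    case False
    then have 0: "b - c = 0" by (rule diff0)
    have "c = b \<or> (\<exists>k. c = b + k + 1)" using nn_laws(13)[of b c] False nn_laws(1,12) by metis
    then obtain l where l: "c = b + l" using False nn_laws(1,2,3) by metis
    \<comment> \<open>Although \<open>c\<close> exceeds \<open>b\<close>, the products may still be
      comparable in the other direction, namely when \<open>a\<close> is 0; the difference is 0 in
      either case.\<close>
    have "a * b - a * c = 0"
    proof (cases "\<exists>e. a * b = a * c + e")
      case True
      then obtain e where e: "a * b = a * c + e" ..
      then have "0 + a * b = (a * l + e) + a * b"
        unfolding l distr using nn_laws(1,2,3) by metis
      then have "a * l + e = 0" using nn_laws(4) by metis
      then have "e = 0" by (rule sum_zero)
      then show ?thesis using diff[OF e] by simp
    qed (rule diff0)
    then show ?thesis using 0 zero_right by simp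
  qed
  show "a - b - c = a - (b + c)"
  proof (cases "\<exists>d. a = b + c + d")
    case True
    then obtain d where "a = b + c + d" ..
    then show ?thesis using diff[of a "b + c" d] diff[of a b "c + d"] diff[of "c + d" c d]
      by (simp add: nn_laws(1))
  next
    case False
    then have 0: "a - (b + c) = 0" by (rule diff0)
    show ?thesis
    proof (cases "\<exists>e. a = b + e")
      case True
      then obtain e where e: "a = b + e" ..
      then have "\<nexists>d. e = c + d" using False by (auto simp: nn_laws(1))
      then show ?thesis using diff[OF e] diff0[of e c] 0 by simp
    next
      case 2: False
      have "0 - c = 0"
      proof (cases "\<exists>d. 0 = c + d")
        case True
        then obtain d where d: "0 = c + d" ..
        then show ?thesis using diff[OF d] sum_zero[of c d] by simp
      qed (rule diff0)
      then show ?thesis using diff0[OF 2] 0 by simp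
    qed
  qed
  show "a < b \<longleftrightarrow> a \<le> b \<and> \<not> b \<le> a"
    using irrefl trans by (auto simp: less_eq_nn_def)
  show "a \<le> a" by (simp add: less_eq_nn_def)
  show "a \<le> b \<Longrightarrow> b \<le> c \<Longrightarrow> a \<le> c" using trans by (auto simp: less_eq_nn_def)
  show "a \<le> b \<Longrightarrow> b \<le> a \<Longrightarrow> a = b" using trans irrefl unfolding less_eq_nn_def by metis
  show "a \<le> b \<or> b \<le> a" using nn_laws(13) by (auto simp: less_eq_nn_def)
  show "a \<le> b \<Longrightarrow> c + a \<le> c + b"
    unfolding less_eq_nn_def nn_laws(12) using nn_laws(1) by metis
  show "b \<le> a \<Longrightarrow> a - b + b = a"
    unfolding less_eq_nn_def nn_laws(12) using diff nn_laws(1,2,3) by metis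
  show "a < b \<Longrightarrow> 0 < c \<Longrightarrow> c * a < c * b"
  proof -
    assume "a < b" "0 < c"
    then obtain k l where "b = a + k + 1" "c = 0 + l + 1" unfolding nn_laws(12) by blast
    then have "c * b = c * a + (c * k + l) + 1"
      by (metis nn_laws(1,3,6,7,8))
    then show "c * a < c * b" unfolding nn_laws(12) by blast
  qed
  show "(0 :: nn) < 1" unfolding nn_laws(12) using nn_laws(3) by metis
  show "a \<noteq> 0 \<Longrightarrow> b \<noteq> 0 \<Longrightarrow> a * b \<noteq> 0"
  proof -
    assume "a \<noteq> 0" "b \<noteq> 0"
    then obtain k l where "a = k + 1" "b = l + 1" using nn_laws(11) by metis
    then have "a * b = k * (l + 1) + l + 1" by (metis nn_laws(1,7,8))
    then show ?thesis using nn_laws(10) by metis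
  qed
qed

lemma nn_zero_le [simp]: "0 \<le> (n :: nn)"
  using nn_laws(3)[of n] nn_laws(11)[of n] nn_laws(12)[of 0 n] by (auto simp: le_less)

subsection \<open>Integers and rational numbers over the model\<close>

quotient_type zz = "nn \<times> nn" / "\<lambda>(a, b) (c, d). a + d = c + b"
proof (rule equivpI)
  show "reflp (\<lambda>(a, b) (c, d). a + d = c + (b :: nn))" by (auto intro: reflpI)
  show "symp (\<lambda>(a, b) (c, d). a + d = c + (b :: nn))" by (auto intro!: sympI)
  show "transp (\<lambda>(a, b) (c, d). a + d = c + (b :: nn))"
  proof (rule transpI, clarify)
    fix a b c d e f :: nn
    assume "a + d = c + b" "c + f = e + d"
    then have "(a + f) + (c + d) = (e + b) + (c + d)" by (metis add.assoc add.commute)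
    then show "a + f = e + b" by simp
  qed
qed

instantiation zz :: comm_ring_1
begin
lift_definition zero_zz :: zz is "(0, 0)" .
lift_definition one_zz :: zz is "(1, 0)" .
lift_definition plus_zz :: "zz \<Rightarrow> zz \<Rightarrow> zz" is "\<lambda>(a, b) (c, d). (a + c, b + d)"
  by (clarsimp simp: add_ac) (metis add.assoc add.commute)
lift_definition uminus_zz :: "zz \<Rightarrow> zz" is "\<lambda>(a, b). (b, a)"
  by (auto simp: add.commute)
lift_definition minus_zz :: "zz \<Rightarrow> zz \<Rightarrow> zz" is "\<lambda>(a, b) (c, d). (a + d, b + c)"
  by (clarsimp simp: add_ac) (metis add.assoc add.commute)
lift_definition times_zz :: "zz \<Rightarrow> zz \<Rightarrow> zz" is "\<lambda>(a, b) (c, d). (a * c + b * d, a * d + b * c)"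
proof (clarify)
  fix a b a' b' c d c' d' :: nn
  assume 1: "a + b' = a' + b" and 2: "c + d' = c' + d"
  let ?k = "a' * c + a' * d + b' * c + b' * d"
  have "(a * c + b * d + (a' * d' + b' * c')) + ?k
      = (a + b') * c + (b + a') * d + a' * (c + d') + b' * (d + c')"
    by (simp add: algebra_simps)
  also have "\<dots> = (a' + b) * c + (a + b') * d + a' * (c' + d) + b' * (c + d')"
    using 1 2 by (simp add: add.commute)
  also have "\<dots> = (a' * c' + b' * d' + (a * d + b * c)) + ?k"
    by (simp add: algebra_simps)
  finally show "a * c + b * d + (a' * d' + b' * c') = a' * c' + b' * d' + (a * d + b * c)"
    by (rule add_right_imp_eq)
qed
instance
  by standard (transfer; clarsimp simp: algebra_simps)+
end

instantiation zz :: linordered_idom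
begin
lift_definition less_eq_zz :: "zz \<Rightarrow> zz \<Rightarrow> bool" is "\<lambda>(a, b) (c, d). a + d \<le> c + b"
proof (clarify)
  fix a b a' b' c d c' d' :: nn
  assume 1: "a + b' = a' + b" and 2: "c + d' = c' + d"
  have "a + d \<le> c + b \<longleftrightarrow> (a + d) + (b' + d') \<le> (c + b) + (b' + d')" by simp
  also have "(a + d) + (b' + d') = (a' + d') + (b + d)" using 1 by (metis add.assoc add.commute)
  also have "(c + b) + (b' + d') = (c' + b') + (b + d)" using 2 by (metis add.assoc add.commute)
  finally show "a + d \<le> c + b \<longleftrightarrow> a' + d' \<le> c' + b'" by simp
qed
definition "x < y \<longleftrightarrow> x \<le> y \<and> \<not> y \<le> x" for x y :: zz
definition zz_abs: "\<bar>x\<bar> = (if x < 0 then - x else x)" for x :: zz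
definition "sgn x = (if x = 0 then 0 else if 0 < x then 1 else - 1)" for x :: zz
lemma zz_pos: "0 < x \<Longrightarrow> \<exists>n > 0. x = abs_zz (n, 0)"
  unfolding less_zz_def
proof transfer
  fix x :: "nn \<times> nn"
  assume *: "(case (0, 0) of (a, b) \<Rightarrow> \<lambda>(c, d). a + d \<le> c + b) x \<and>
    \<not> (case x of (a, b) \<Rightarrow> \<lambda>(c, d). a + d \<le> c + b) (0, 0)"
  obtain a b where x: "x = (a, b)" by (cases x)
  from * have "b < a" by (simp add: x less_le_not_le)
  then show "\<exists>n > 0. (case x of (a, b) \<Rightarrow> \<lambda>(c, d). a + d = c + b) (n, 0)"
  proof -
    obtain k where "a = b + k + 1" using \<open>b < a\<close> nn_laws(12) by blast
    then show ?thesis by (intro exI[of _ "k + 1"]) (simp add: x add_pos_nonneg add_ac)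
  qed
qed
instance
proof
  fix x y z :: zz
  show "x \<le> x" by transfer auto
  show "x \<le> y \<Longrightarrow> y \<le> z \<Longrightarrow> x \<le> z"
  proof transfer
    fix x y z :: "nn \<times> nn"
    assume "(case x of (a, b) \<Rightarrow> \<lambda>(c, d). a + d \<le> c + b) y" "(case y of (a, b) \<Rightarrow> \<lambda>(c, d). a + d \<le> c + b) z"
    moreover obtain a b c d e f where xyz: "x = (a, b)" "y = (c, d)" "z = (e, f)"
      by (cases x, cases y, cases z)
    ultimately have h: "a + d \<le> c + b" "c + f \<le> e + d" by simp_all
    have "(a + f) + (c + d) \<le> (e + b) + (c + d)" using add_mono[OF h] by (simp only: add_ac)
    then show "(case x of (a, b) \<Rightarrow> \<lambda>(c, d). a + d \<le> c + b) z" by (simp add: xyz)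
  qed
  show "x \<le> y \<Longrightarrow> y \<le> x \<Longrightarrow> x = y" by transfer auto
  show "x \<le> y \<or> y \<le> x" by transfer (auto simp: add.commute)
  show "x < y \<longleftrightarrow> x \<le> y \<and> \<not> y \<le> x" by (rule less_zz_def)
  show *: "x \<le> y \<Longrightarrow> z + x \<le> z + y" for x y z :: zz
    by transfer (auto simp: add_ac)
  show "x < y \<Longrightarrow> 0 < z \<Longrightarrow> z * x < z * y"
  proof -
    assume xy: "x < y" and "0 < z"
    from zz_pos[OF this(2)] obtain n where n: "0 < n" "z = abs_zz (n, 0)" by blast
    have **: "abs_zz (n, 0) * u \<le> abs_zz (n, 0) * v \<longleftrightarrow> u \<le> v" for u v
    proof -
      have "\<exists>a b. w = abs_zz (a, b)" for w by (induction w rule: zz.abs_induct) auto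
      then obtain a b c d where uv: "u = abs_zz (a, b)" "v = abs_zz (c, d)" by meson
      have "n * (a + d) \<le> n * (c + b) \<longleftrightarrow> a + d \<le> c + b"
        using n(1) mult_strict_left_mono[of "c + b" "a + d" n] mult_left_mono[of "a + d" "c + b" n]
        by (auto simp: not_le[symmetric])
      then show ?thesis
        by (simp add: uv times_zz.abs_eq less_eq_zz.abs_eq distrib_left)
    qed
    show "z * x < z * y" using xy by (simp add: less_zz_def n(2) **)
  qed
  show "\<bar>x\<bar> = (if x < 0 then - x else x)" by (rule zz_abs)
  show "sgn x = (if x = 0 then 0 else if 0 < x then 1 else - 1)" by (rule sgn_zz_def)
qed
end

section \<open>The numbers of the model inside its integers and rationals\<close>

lift_definition zn :: "nn \<Rightarrow> zz" is "\<lambda>n. (n, 0)" .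

lemma zn_simps [simp]: "zn 0 = 0" "zn 1 = 1" "zn (a + b) = zn a + zn b" "zn (a * b) = zn a * zn b"
  by (transfer, simp)+

lemma zn_le_iff [simp]: "zn a \<le> zn b \<longleftrightarrow> a \<le> b"
  by transfer simp

type_synonym qq = "zz fract"

definition nq :: "nn \<Rightarrow> qq" where "nq n = Fract (zn n) 1"

lemma nq_simps [simp]: "nq 0 = 0" "nq 1 = 1" "nq (a + b) = nq a + nq b" "nq (a * b) = nq a * nq b"
  by (simp_all add: nq_def Zero_fract_def One_fract_def)

lemma nq_le_iff [simp]: "nq a \<le> nq b \<longleftrightarrow> a \<le> b"
  by (simp add: nq_def)

lemma zz_bound: "\<exists>n. z \<le> zn n"
proof transfer
  fix z :: "nn \<times> nn"
  show "\<exists>n. (case z of (a, b) \<Rightarrow> \<lambda>(c, d). a + d \<le> c + b) (n, 0)"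
    by (cases z) (auto intro: exI[of _ "fst z"])
qed

text \<open>A positive denominator is at least 1, so a bound for the numerator also bounds the
  fraction. The field is archimedean relative to the numbers of the model, which need not be
  standard.\<close>

lemma qq_bound: "\<exists>n. q \<le> nq n"
proof (induction q rule: fract_induct_pos)
  case (Fract a b)
  obtain n where n: "a \<le> zn n" "0 \<le> zn n"
    using zz_bound[of "max a 0"] by auto
  obtain m where "b = zn m" "0 < m" using zz_pos[OF Fract] by (auto simp: zn.abs_eq)
  moreover have "1 \<le> m" using \<open>0 < m\<close> nn_laws(11)[of m] by (auto simp: add_increasing)
  ultimately have "1 \<le> b" using zn_le_iff[of 1 m] by simp
  then have "a * b \<le> zn n * b * b"
    using n Fract mult_mono[OF n(1) \<open>1 \<le> b\<close>] by (simp add: mult_right_mono)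
  then show "\<exists>n. Fract a b \<le> nq n" using Fract by (intro exI[of _ n]) (simp add: nq_def)
qed


subsection \<open>Completion\<close>

definition Cauchy_seq :: "(nn \<Rightarrow> qq) \<Rightarrow> bool" where
  "Cauchy_seq X \<longleftrightarrow> (\<forall>r > 0. \<exists>c. eventually (\<lambda>n. \<bar>X n - c\<bar> < r) at_top)"

definition null_seq :: "(nn \<Rightarrow> qq) \<Rightarrow> bool" where
  "null_seq X \<longleftrightarrow> (\<forall>r > 0. eventually (\<lambda>n. \<bar>X n\<bar> < r) at_top)"

definition pos_seq :: "(nn \<Rightarrow> qq) \<Rightarrow> bool" where
  "pos_seq X \<longleftrightarrow> (\<exists>r > 0. eventually (\<lambda>n. r < X n) at_top)"

lemma Cauchy_const [simp]: "Cauchy_seq (\<lambda>_. c)"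
  by (auto simp: Cauchy_seq_def intro!: exI[of _ c])

lemma Cauchy_add: "Cauchy_seq X \<Longrightarrow> Cauchy_seq Y \<Longrightarrow> Cauchy_seq (\<lambda>n. X n + Y n)"
  unfolding Cauchy_seq_def
proof (intro allI impI)
  fix r :: qq assume X: "\<forall>r > 0. \<exists>c. eventually (\<lambda>n. \<bar>X n - c\<bar> < r) at_top"
    and Y: "\<forall>r > 0. \<exists>c. eventually (\<lambda>n. \<bar>Y n - c\<bar> < r) at_top" and "0 < r"
  then obtain c d where "eventually (\<lambda>n. \<bar>X n - c\<bar> < r / 2) at_top" "eventually (\<lambda>n. \<bar>Y n - d\<bar> < r / 2) at_top"
    using X[rule_format, of "r / 2"] Y[rule_format, of "r / 2"] by auto
  then have "eventually (\<lambda>n. \<bar>X n + Y n - (c + d)\<bar> < r) at_top"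
  proof eventually_elim
    case (elim n)
    have "\<bar>X n + Y n - (c + d)\<bar> \<le> \<bar>X n - c\<bar> + \<bar>Y n - d\<bar>" by linarith
    with elim show ?case by linarith
  qed
  then show "\<exists>c. eventually (\<lambda>n. \<bar>X n + Y n - c\<bar> < r) at_top" ..
qed

lemma Cauchy_bounded: "Cauchy_seq X \<Longrightarrow> \<exists>b > 0. eventually (\<lambda>n. \<bar>X n\<bar> < b) at_top"
proof -
  assume "Cauchy_seq X"
  then obtain c where "eventually (\<lambda>n. \<bar>X n - c\<bar> < 1) at_top" unfolding Cauchy_seq_def by force
  then have "eventually (\<lambda>n. \<bar>X n\<bar> < \<bar>c\<bar> + 1) at_top" by eventually_elim linarith
  then show ?thesis by (intro exI[of _ "\<bar>c\<bar> + 1"]) (simp add: add_nonneg_pos)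
qed

lemma Cauchy_mult: "Cauchy_seq X \<Longrightarrow> Cauchy_seq Y \<Longrightarrow> Cauchy_seq (\<lambda>n. X n * Y n)"
proof -
  assume X: "Cauchy_seq X" and Y: "Cauchy_seq Y"
  obtain b where b: "0 < b" "eventually (\<lambda>n. \<bar>X n\<bar> < b) at_top" using Cauchy_bounded[OF X] by blast
  have cancel: "x / e * e = x" if "e \<noteq> 0" for x e :: qq using that by simp
  show ?thesis
    unfolding Cauchy_seq_def
  proof (intro allI impI)
    fix r :: qq assume r: "0 < r"
    obtain d where d: "eventually (\<lambda>n. \<bar>Y n - d\<bar> < r / 2 / b) at_top"
      using Y r b(1) unfolding Cauchy_seq_def by (meson divide_pos_pos zero_less_numeral)
    have d1: "0 < \<bar>d\<bar> + 1" by (simp add: add_nonneg_pos)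
    obtain c where c: "eventually (\<lambda>n. \<bar>X n - c\<bar> < r / 2 / (\<bar>d\<bar> + 1)) at_top"
      using X r d1 unfolding Cauchy_seq_def by (meson divide_pos_pos zero_less_numeral)
    have "eventually (\<lambda>n. \<bar>X n * Y n - c * d\<bar> < r) at_top"
      using b(2) c d
    proof eventually_elim
      case (elim n)
      have "X n * Y n - c * d = X n * (Y n - d) + (X n - c) * d" by (simp add: algebra_simps)
      then have "\<bar>X n * Y n - c * d\<bar> \<le> \<bar>X n\<bar> * \<bar>Y n - d\<bar> + \<bar>X n - c\<bar> * \<bar>d\<bar>"
        by (metis abs_mult abs_triangle_ineq)
      also have "\<bar>X n\<bar> * \<bar>Y n - d\<bar> \<le> b * (r / 2 / b)" using elim by (intro mult_mono) auto
      also have "\<bar>X n - c\<bar> * \<bar>d\<bar> \<le> \<bar>X n - c\<bar> * (\<bar>d\<bar> + 1)" by (intro mult_left_mono) auto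
      also have "\<bar>X n - c\<bar> * (\<bar>d\<bar> + 1) < r / 2 / (\<bar>d\<bar> + 1) * (\<bar>d\<bar> + 1)"
        using elim d1 by (intro mult_strict_right_mono) auto
      also have "r / 2 / (\<bar>d\<bar> + 1) * (\<bar>d\<bar> + 1) = r / 2"  using d1 cancel[of "\<bar>d\<bar> + 1" "r / 2"] by (metis less_irrefl)
      also have "b * (r / 2 / b) = r / 2" using b(1) by simp
      finally show ?case by simp
    qed
    then show "\<exists>c. eventually (\<lambda>n. \<bar>X n * Y n - c\<bar> < r) at_top" ..
  qed
qed

lemma Cauchy_uminus: "Cauchy_seq X \<Longrightarrow> Cauchy_seq (\<lambda>n. - X n)"
  using Cauchy_mult[OF Cauchy_const[of "- 1"], of X] by simp

lemma Cauchy_diff: "Cauchy_seq X \<Longrightarrow> Cauchy_seq Y \<Longrightarrow> Cauchy_seq (\<lambda>n. X n - Y n)"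
  using Cauchy_add[OF _ Cauchy_uminus, of X Y] by simp

lemma null_const: "null_seq (\<lambda>_. c) \<longleftrightarrow> c = 0"
  by (auto simp: null_seq_def) (metis abs_not_less_zero less_irrefl zero_less_abs_iff)

lemma null_add: "null_seq X \<Longrightarrow> null_seq Y \<Longrightarrow> null_seq (\<lambda>n. X n + Y n)"
  unfolding null_seq_def
proof (intro allI impI)
  fix r :: qq assume X: "\<forall>r > 0. eventually (\<lambda>n. \<bar>X n\<bar> < r) at_top"
    and Y: "\<forall>r > 0. eventually (\<lambda>n. \<bar>Y n\<bar> < r) at_top" and "0 < r"
  then have "eventually (\<lambda>n. \<bar>X n\<bar> < r / 2) at_top" "eventually (\<lambda>n. \<bar>Y n\<bar> < r / 2) at_top"
    using X[rule_format, of "r / 2"] Y[rule_format, of "r / 2"] by simp_all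
  then show "eventually (\<lambda>n. \<bar>X n + Y n\<bar> < r) at_top"
  proof eventually_elim
    case (elim n)
    have "\<bar>X n + Y n\<bar> \<le> \<bar>X n\<bar> + \<bar>Y n\<bar>" by linarith
    with elim show ?case by linarith
  qed
qed

lemma null_uminus: "null_seq X \<Longrightarrow> null_seq (\<lambda>n. - X n)"
  by (simp add: null_seq_def)

lemma null_mult: "null_seq X \<Longrightarrow> Cauchy_seq Y \<Longrightarrow> null_seq (\<lambda>n. X n * Y n)"
proof -
  assume X: "null_seq X" and "Cauchy_seq Y"
  then obtain b where b: "0 < b" "eventually (\<lambda>n. \<bar>Y n\<bar> < b) at_top" using Cauchy_bounded by blast
  show ?thesis
    unfolding null_seq_def
  proof (intro allI impI)
    fix r :: qq assume r: "0 < r"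
    have "eventually (\<lambda>n. \<bar>X n\<bar> < r / b) at_top" using X r b(1) unfolding null_seq_def by simp
    then show "eventually (\<lambda>n. \<bar>X n * Y n\<bar> < r) at_top"
      using b(2)
    proof eventually_elim
      case (elim n)
      have "\<bar>X n\<bar> * \<bar>Y n\<bar> \<le> \<bar>X n\<bar> * b" using elim by (intro mult_left_mono) auto
      also have "\<dots> < r / b * b" using elim b(1) by (intro mult_strict_right_mono) auto
      finally show ?case using b(1) by (simp add: abs_mult)
    qed
  qed
qed

lemma pos_add: "pos_seq X \<Longrightarrow> pos_seq Y \<Longrightarrow> pos_seq (\<lambda>n. X n + Y n)"
  unfolding pos_seq_def
proof (elim exE conjE)
  fix r s :: qq assume rs: "0 < r" "0 < s"
  assume "eventually (\<lambda>n. r < X n) at_top" "eventually (\<lambda>n. s < Y n) at_top"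
  then have "eventually (\<lambda>n. r + s < X n + Y n) at_top" by eventually_elim linarith
  then show "\<exists>r > 0. eventually (\<lambda>n. r < X n + Y n) at_top"
    using rs by (intro exI[of _ "r + s"]) simp
qed

lemma pos_mult: "pos_seq X \<Longrightarrow> pos_seq Y \<Longrightarrow> pos_seq (\<lambda>n. X n * Y n)"
  unfolding pos_seq_def
proof (elim exE conjE)
  fix r s :: qq assume rs: "0 < r" "0 < s"
  assume "eventually (\<lambda>n. r < X n) at_top" "eventually (\<lambda>n. s < Y n) at_top"
  then have "eventually (\<lambda>n. r * s < X n * Y n) at_top"
    by eventually_elim (use rs in \<open>auto intro!: mult_strict_mono\<close>)
  then show "\<exists>r > 0. eventually (\<lambda>n. r < X n * Y n) at_top"
    using rs by (intro exI[of _ "r * s"]) simp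
qed

lemma pos_null: "pos_seq X \<Longrightarrow> null_seq (\<lambda>n. X n - Y n) \<Longrightarrow> pos_seq Y"
  unfolding pos_seq_def
proof (elim exE conjE)
  fix r :: qq assume r: "0 < r" "eventually (\<lambda>n. r < X n) at_top" and "null_seq (\<lambda>n. X n - Y n)"
  from this(3)[unfolded null_seq_def, rule_format, of "r / 2"] r(1)
  have "eventually (\<lambda>n. \<bar>X n - Y n\<bar> < r / 2) at_top" by simp
  with r(2) have "eventually (\<lambda>n. r / 2 < Y n) at_top" by eventually_elim (simp add: abs_if field_simps split: if_splits)
  then show "\<exists>r > 0. eventually (\<lambda>n. r < Y n) at_top" using r(1) by (intro exI[of _ "r / 2"]) simp
qed

lemma pos_antisym: "pos_seq X \<Longrightarrow> pos_seq (\<lambda>n. - X n) \<Longrightarrow> False"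
proof -
  assume "pos_seq X" "pos_seq (\<lambda>n. - X n)"
  then have "pos_seq (\<lambda>_. 0)" using pos_add[of X "\<lambda>n. - X n"] by simp
  then show False by (auto simp: pos_seq_def)
qed

text \<open>Infinitely often the terms have absolute value at least \<open>r\<close>, and from some
  point on they stay within \<open>r / 4\<close> of a constant \<open>c\<close>. So the absolute
  value of \<open>c\<close> exceeds 3/4 of \<open>r\<close>, and the later terms keep its sign and a
  distance of \<open>r / 2\<close> from 0.\<close>

lemma pos_or_null:
  assumes "Cauchy_seq X" "\<not> null_seq X"
  shows "pos_seq X \<or> pos_seq (\<lambda>n. - X n)"
proof -
  obtain r where r: "0 < r" "\<not> eventually (\<lambda>n. \<bar>X n\<bar> < r) at_top"
    using assms(2) by (auto simp: null_seq_def)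
  obtain c where c: "eventually (\<lambda>n. \<bar>X n - c\<bar> < r / 4) at_top"
    using assms(1) r(1) unfolding Cauchy_seq_def by (meson divide_pos_pos zero_less_numeral)
  have "\<exists>n. \<not> \<bar>X n\<bar> < r \<and> \<bar>X n - c\<bar> < r / 4"
  proof (rule ccontr)
    assume "\<not> ?thesis"
    with c have "eventually (\<lambda>n. \<bar>X n\<bar> < r) at_top" by (auto elim: eventually_mono)
    with r(2) show False by simp
  qed
  then obtain n where n: "r \<le> \<bar>X n\<bar>" "\<bar>X n - c\<bar> < r / 4" by (auto simp: not_less)
  have c': "r / 2 < \<bar>c\<bar> - r / 4" using n r(1) by (simp add: abs_if field_simps split: if_splits)
  show ?thesis
  proof (cases "0 < c")
    case True
    from c have "eventually (\<lambda>n. r / 2 < X n) at_top"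
      by eventually_elim (use True c' in \<open>simp add: abs_if split: if_splits\<close>)
    then show ?thesis unfolding pos_seq_def using r(1) by (intro disjI1 exI[of _ "r / 2"]) simp
  next
    case False
    from c have "eventually (\<lambda>n. r / 2 < - X n) at_top"
      by eventually_elim (use False c' in \<open>simp add: abs_if split: if_splits\<close>)
    then show ?thesis unfolding pos_seq_def using r(1) by (intro disjI2 exI[of _ "r / 2"]) simp
  qed
qed

section \<open>The ordered ring of Cauchy sequences modulo null sequences\<close>

definition crel :: "(nn \<Rightarrow> qq) \<Rightarrow> (nn \<Rightarrow> qq) \<Rightarrow> bool" where
  "crel X Y \<longleftrightarrow> Cauchy_seq X \<and> Cauchy_seq Y \<and> null_seq (\<lambda>n. X n - Y n)"

quotient_type creal = "nn \<Rightarrow> qq" / partial: crel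
proof (rule part_equivpI)
  show "\<exists>X. crel X X" by (intro exI[of _ "\<lambda>_. 0"]) (simp add: crel_def null_const)
  show "symp crel" by (rule sympI) (use null_uminus in \<open>fastforce simp: crel_def\<close>)
  show "transp crel"
  proof (rule transpI)
    fix X Y Z assume "crel X Y" "crel Y Z"
    then show "crel X Z"
      using null_add[of "\<lambda>n. X n - Y n" "\<lambda>n. Y n - Z n"] by (simp add: crel_def)
  qed
qed

lemma null_diff_add: "null_seq (\<lambda>n. X n - X' n) \<Longrightarrow> null_seq (\<lambda>n. Y n - Y' n) \<Longrightarrow>
    null_seq (\<lambda>n. X n + Y n - (X' n + Y' n))"
  using null_add[of "\<lambda>n. X n - X' n" "\<lambda>n. Y n - Y' n"] by (simp add: algebra_simps)

instantiation creal :: comm_ring_1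
begin
lift_definition zero_creal :: creal is "\<lambda>_. 0" by (simp add: crel_def null_const)
lift_definition one_creal :: creal is "\<lambda>_. 1" by (simp add: crel_def null_const)
lift_definition plus_creal :: "creal \<Rightarrow> creal \<Rightarrow> creal" is "\<lambda>X Y n. X n + Y n"
  by (auto simp: crel_def intro: Cauchy_add null_diff_add)
lift_definition uminus_creal :: "creal \<Rightarrow> creal" is "\<lambda>X n. - X n"
  using null_uminus by (fastforce simp: crel_def intro: Cauchy_uminus)
lift_definition times_creal :: "creal \<Rightarrow> creal \<Rightarrow> creal" is "\<lambda>X Y n. X n * Y n"
proof -
  fix X X' Y Y' assume *: "crel X X'" "crel Y Y'"
  then have "null_seq (\<lambda>n. (X n - X' n) * Y n + (Y n - Y' n) * X' n)"
    by (auto simp: crel_def intro!: null_add null_mult)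
  moreover have "(\<lambda>n. (X n - X' n) * Y n + (Y n - Y' n) * X' n) = (\<lambda>n. X n * Y n - X' n * Y' n)"
    by (simp add: algebra_simps)
  ultimately show "crel (\<lambda>n. X n * Y n) (\<lambda>n. X' n * Y' n)"
    using * by (simp add: crel_def Cauchy_mult)
qed
definition "x - y = x + - y" for x y :: creal
instance
proof
  fix a b c :: creal
  show "a + b + c = a + (b + c)" by transfer (simp add: crel_def Cauchy_add null_const algebra_simps)
  show "a + b = b + a" by transfer (simp add: crel_def Cauchy_add null_const algebra_simps)
  show "0 + a = a" by transfer (simp add: crel_def)
  show "- a + a = 0" by transfer (simp add: crel_def null_const)
  show "a - b = a + - b" by (rule minus_creal_def)
  show "a * b * c = a * (b * c)" by transfer (simp add: crel_def Cauchy_mult null_const algebra_simps)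
  show "a * b = b * a" by transfer (simp add: crel_def Cauchy_mult null_const algebra_simps)
  show "1 * a = a" by transfer (simp add: crel_def)
  show "(a + b) * c = a * c + b * c"
    by transfer (simp add: crel_def Cauchy_add Cauchy_mult null_const algebra_simps)
  show "(0 :: creal) \<noteq> 1" by transfer (simp add: crel_def null_const)
qed
end

lift_definition cpos :: "creal \<Rightarrow> bool" is pos_seq
  using pos_null null_uminus by (fastforce simp: crel_def)

lemma cpos_add: "cpos x \<Longrightarrow> cpos y \<Longrightarrow> cpos (x + y)"
  by transfer (rule pos_add)
lemma cpos_mult: "cpos x \<Longrightarrow> cpos y \<Longrightarrow> cpos (x * y)"
  by transfer (rule pos_mult)
lemma cpos_antisym: "cpos x \<Longrightarrow> cpos (- x) \<Longrightarrow> False"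
  by transfer (rule pos_antisym)
lemma cpos_or: "x = 0 \<or> cpos x \<or> cpos (- x)"
  by transfer (use pos_or_null in \<open>auto simp: crel_def\<close>)
instantiation creal :: linordered_idom
begin
definition "x < y \<longleftrightarrow> cpos (y - x)" for x y :: creal
definition "x \<le> y \<longleftrightarrow> x < y \<or> x = y" for x y :: creal
definition creal_abs: "\<bar>x\<bar> = (if x < 0 then - x else x)" for x :: creal
definition "sgn x = (if x = 0 then 0 else if 0 < x then 1 else - 1)" for x :: creal
instance
proof
  fix x y z :: creal
  have trans: "x < y \<Longrightarrow> y < z \<Longrightarrow> x < z" for x y z :: creal
    using cpos_add[of "y - x" "z - y"] by (simp add: less_creal_def)
  have anti: "x < y \<Longrightarrow> y < x \<Longrightarrow> False" for x y :: creal
    using cpos_antisym[of "y - x"] by (simp add: less_creal_def)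
  show "x \<le> x" by (simp add: less_eq_creal_def)
  show "x \<le> y \<Longrightarrow> y \<le> z \<Longrightarrow> x \<le> z" using trans by (auto simp: less_eq_creal_def)
  show "x \<le> y \<Longrightarrow> y \<le> x \<Longrightarrow> x = y" using anti by (auto simp: less_eq_creal_def)
  show "x < y \<longleftrightarrow> x \<le> y \<and> \<not> y \<le> x" using anti by (auto simp: less_eq_creal_def)
  show "x \<le> y \<or> y \<le> x" using cpos_or[of "y - x"] by (auto simp: less_eq_creal_def less_creal_def)
  show "x \<le> y \<Longrightarrow> z + x \<le> z + y" by (auto simp: less_eq_creal_def less_creal_def)
  show "x < y \<Longrightarrow> 0 < z \<Longrightarrow> z * x < z * y"
    using cpos_mult[of z "y - x"] by (simp add: less_creal_def right_diff_distrib)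
  show "\<bar>x\<bar> = (if x < 0 then - x else x)" by (rule creal_abs)
  show "sgn x = (if x = 0 then 0 else if 0 < x then 1 else - 1)" by (rule sgn_creal_def)
qed
end

definition cr :: "qq \<Rightarrow> creal" where "cr q = abs_creal (\<lambda>_. q)"

lemma cr_simps: "cr 0 = 0" "cr 1 = 1" "cr (a + b) = cr a + cr b" "cr (a * b) = cr a * cr b" "cr (- a) = - cr a"
  by (simp_all add: cr_def zero_creal_def one_creal_def plus_creal.abs_eq times_creal.abs_eq
      uminus_creal.abs_eq crel_def null_const)

lemma cpos_cr: "cpos (cr q) \<longleftrightarrow> 0 < q"
  by (auto simp: cr_def cpos.abs_eq crel_def null_const pos_seq_def intro: less_trans dense)

lemma cr_less_iff: "cr a < cr b \<longleftrightarrow> a < b"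
  using cpos_cr[of "b - a"] cr_simps(3)[of b "- a"] cr_simps(5)[of a] by (simp add: less_creal_def)

text \<open>Only the order and the field operations of the real numbers are needed, so instead of
  defining inverses of Cauchy sequences we pass to the field of fractions.\<close>

type_synonym rl = "creal fract"

definition rq :: "qq \<Rightarrow> rl" where "rq q = Fract (cr q) 1"

lemma rq_simps [simp]: "rq 0 = 0" "rq 1 = 1" "rq (a + b) = rq a + rq b" "rq (a * b) = rq a * rq b"
  "rq (- a) = - rq a"
  by (simp_all add: rq_def cr_simps Zero_fract_def[symmetric] One_fract_def[symmetric])

lemma rq_less_iff [simp]: "rq a < rq b \<longleftrightarrow> a < b"
  by (simp add: rq_def cr_less_iff)

lemma rq_le_iff [simp]: "rq a \<le> rq b \<longleftrightarrow> a \<le> b"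
  using rq_less_iff[of b a] by (simp only: not_less[symmetric])

lemma rq_diff [simp]: "rq (a - b) = rq a - rq b"
  using rq_simps(3)[of a "- b"] by simp

lemma rq_divide [simp]: "rq (a / b) = rq a / rq b"
proof (cases "b = 0")
  case False
  then have "rq b \<noteq> 0" using rq_le_iff[of b 0] rq_le_iff[of 0 b] by (metis order.antisym order_refl rq_simps(1))
  moreover have "rq (a / b) * rq b = rq a" using False rq_simps(4)[of "a / b" b] by simp
  ultimately show ?thesis by (simp add: field_simps)
qed simp

definition clim :: "(nn \<Rightarrow> qq) \<Rightarrow> rl" where "clim X = Fract (abs_creal X) 1"

lemma clim_less:
  assumes "Cauchy_seq X" "0 < e" "eventually (\<lambda>n. X n + e \<le> q) at_top"
  shows "clim X < rq q"
proof -
  have "pos_seq (\<lambda>n. q + - X n)"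
    unfolding pos_seq_def
    by (rule exI[of _ "e / 2"], rule conjI, use assms(2) in simp,
        rule eventually_mono[OF assms(3)], use assms(2) in \<open>simp add: field_simps\<close>)
  then have "cpos (cr q - abs_creal X)"
    using assms(1) by (simp add: minus_creal_def cr_def uminus_creal.abs_eq plus_creal.abs_eq
        cpos.abs_eq crel_def Cauchy_add Cauchy_uminus Cauchy_diff null_const)
  then show ?thesis by (simp add: clim_def rq_def less_creal_def)
qed

lemma clim_uminus: "Cauchy_seq X \<Longrightarrow> clim (\<lambda>n. - X n) = - clim X"
  by (simp add: clim_def uminus_creal.abs_eq crel_def null_const)

text \<open>A positive difference of limits is bounded below by a positive rational
  \<open>r\<close>, by the definition of positivity for Cauchy sequences. The choice of
  \<open>r / 2\<close> for \<open>e\<close> then contradicts the assumption.\<close>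

lemma rl_archimedean:
  assumes "Cauchy_seq X" "Cauchy_seq Y" "\<And>e. 0 < e \<Longrightarrow> clim X \<le> clim Y + rq e"
  shows "clim X \<le> clim Y"
proof (rule ccontr)
  assume "\<not> clim X \<le> clim Y"
  then have "cpos (abs_creal X - abs_creal Y)" by (simp add: clim_def less_creal_def not_le)
  then have "pos_seq (\<lambda>n. X n + - Y n)"
    using assms(1,2) by (simp add: minus_creal_def uminus_creal.abs_eq plus_creal.abs_eq
        cpos.abs_eq crel_def Cauchy_add Cauchy_uminus Cauchy_diff null_const)
  then obtain r where r: "0 < r" "eventually (\<lambda>n. r < X n + - Y n) at_top" by (auto simp: pos_seq_def)
  from r(2) have "eventually (\<lambda>n. r / 2 < X n + - Y n + - (r / 2)) at_top"
    by eventually_elim (simp add: field_simps)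
  then have "pos_seq (\<lambda>n. X n + - Y n + - (r / 2))" using r(1) unfolding pos_seq_def
    by (intro exI[of _ "r / 2"]) simp
  then have "cpos (abs_creal X - (abs_creal Y + cr (r / 2)))"
    using assms(1,2) by (simp add: cr_def minus_creal_def uminus_creal.abs_eq plus_creal.abs_eq
        cpos.abs_eq crel_def Cauchy_add Cauchy_uminus Cauchy_diff null_const algebra_simps)
  then have "clim Y + rq (r / 2) < clim X" by (simp add: clim_def rq_def less_creal_def)
  with assms(3)[of "r / 2"] r(1) show False by simp
qed

definition nr :: "nn \<Rightarrow> rl"  ("\<iota>") where "\<iota> n = rq (nq n)"

lemma nr_simps [simp]: "\<iota> 0 = 0" "\<iota> 1 = 1" "\<iota> (a + b) = \<iota> a + \<iota> b" "\<iota> (a * b) = \<iota> a * \<iota> b"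
  by (simp_all add: nr_def)

lemma nr_le_iff [simp]: "\<iota> a \<le> \<iota> b \<longleftrightarrow> a \<le> b"
  by (simp add: nr_def)

lemma nr_less_iff [simp]: "\<iota> a < \<iota> b \<longleftrightarrow> a < b"
  by (simp add: not_le[symmetric])

lemma nr_eq_iff [simp]: "\<iota> a = \<iota> b \<longleftrightarrow> a = b"
  by (simp add: order.eq_iff)

lemma nr_nonneg [simp]: "0 \<le> \<iota> a"
  using nr_le_iff[of 0 a] by (simp only: nr_simps nn_zero_le)

lemma nr_numeral [simp]: "\<iota> 2 = 2"
  unfolding one_add_one[symmetric] by (simp only: nr_simps)

subsection \<open>More definable operations\<close>

context model
begin

text \<open>The projections from nested pairs act as de Bruijn indices; ten of them cover the
  nesting of binders that occurs.\<close>

lemma idef_v: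
  "idef (\<lambda>p :: 'a :: sort \<times> 'c :: ctx. fst p)"
  "idef (\<lambda>p :: 'b1 :: sort \<times> 'a \<times> 'c. fst (snd p))"
  "idef (\<lambda>p :: 'b2 :: sort \<times> 'b1 \<times> 'a \<times> 'c. fst (snd (snd p)))"
  "idef (\<lambda>p :: 'b3 :: sort \<times> 'b2 \<times> 'b1 \<times> 'a \<times> 'c. fst (snd (snd (snd p))))"
  "idef (\<lambda>p :: 'b4 :: sort \<times> 'b3 \<times> 'b2 \<times> 'b1 \<times> 'a \<times> 'c. fst (snd (snd (snd (snd p)))))"
  "idef (\<lambda>p :: 'b5 :: sort \<times> 'b4 \<times> 'b3 \<times> 'b2 \<times> 'b1 \<times> 'a \<times> 'c. fst (snd (snd (snd (snd (snd p))))))"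
  "idef (\<lambda>p :: 'b6 :: sort \<times> 'b5 \<times> 'b4 \<times> 'b3 \<times> 'b2 \<times> 'b1 \<times> 'a \<times> 'c.
     fst (snd (snd (snd (snd (snd (snd p)))))))"
  "idef (\<lambda>p :: 'b7 :: sort \<times> 'b6 \<times> 'b5 \<times> 'b4 \<times> 'b3 \<times> 'b2 \<times> 'b1 \<times> 'a \<times> 'c.
     fst (snd (snd (snd (snd (snd (snd (snd p))))))))"
  "idef (\<lambda>p :: 'b8 :: sort \<times> 'b7 \<times> 'b6 \<times> 'b5 \<times> 'b4 \<times> 'b3 \<times> 'b2 \<times> 'b1 \<times> 'a \<times> 'c.
     fst (snd (snd (snd (snd (snd (snd (snd (snd p)))))))))"
  "idef (\<lambda>p :: 'b9 :: sort \<times> 'b8 \<times> 'b7 \<times> 'b6 \<times> 'b5 \<times> 'b4 \<times> 'b3 \<times> 'b2 \<times> 'b1 \<times> 'a \<times> 'c.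
     fst (snd (snd (snd (snd (snd (snd (snd (snd (snd p))))))))))"
proof -
  note v0 = idef_fst[where 'a = 'a and 'c = 'c]
  note v1 = idef_weak[OF v0]
  note v2 = idef_weak[OF v1]
  note v3 = idef_weak[OF v2]
  note v4 = idef_weak[OF v3]
  note v5 = idef_weak[OF v4]
  note v6 = idef_weak[OF v5]
  note v7 = idef_weak[OF v6]
  note v8 = idef_weak[OF v7]
  note v9 = idef_weak[OF v8]
  show "idef (\<lambda>p :: 'a :: sort \<times> 'c :: ctx. fst p)"
  "idef (\<lambda>p :: 'b1 :: sort \<times> 'a \<times> 'c. fst (snd p))"
  "idef (\<lambda>p :: 'b2 :: sort \<times> 'b1 \<times> 'a \<times> 'c. fst (snd (snd p)))"
  "idef (\<lambda>p :: 'b3 :: sort \<times> 'b2 \<times> 'b1 \<times> 'a \<times> 'c. fst (snd (snd (snd p))))"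
  "idef (\<lambda>p :: 'b4 :: sort \<times> 'b3 \<times> 'b2 \<times> 'b1 \<times> 'a \<times> 'c. fst (snd (snd (snd (snd p)))))"
  "idef (\<lambda>p :: 'b5 :: sort \<times> 'b4 \<times> 'b3 \<times> 'b2 \<times> 'b1 \<times> 'a \<times> 'c. fst (snd (snd (snd (snd (snd p))))))"
  "idef (\<lambda>p :: 'b6 :: sort \<times> 'b5 \<times> 'b4 \<times> 'b3 \<times> 'b2 \<times> 'b1 \<times> 'a \<times> 'c.
     fst (snd (snd (snd (snd (snd (snd p)))))))"
  "idef (\<lambda>p :: 'b7 :: sort \<times> 'b6 \<times> 'b5 \<times> 'b4 \<times> 'b3 \<times> 'b2 \<times> 'b1 \<times> 'a \<times> 'c.
     fst (snd (snd (snd (snd (snd (snd (snd p))))))))"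
  "idef (\<lambda>p :: 'b8 :: sort \<times> 'b7 \<times> 'b6 \<times> 'b5 \<times> 'b4 \<times> 'b3 \<times> 'b2 \<times> 'b1 \<times> 'a \<times> 'c.
     fst (snd (snd (snd (snd (snd (snd (snd (snd p)))))))))"
  "idef (\<lambda>p :: 'b9 :: sort \<times> 'b8 \<times> 'b7 \<times> 'b6 \<times> 'b5 \<times> 'b4 \<times> 'b3 \<times> 'b2 \<times> 'b1 \<times> 'a \<times> 'c.
     fst (snd (snd (snd (snd (snd (snd (snd (snd (snd p))))))))))"
    by (rule v0 v1 v2 v3 v4 v5 v6 v7 v8 v9)+
qed

lemma Lam_app: "idef (\<lambda>p :: 'a \<times> 'c. f (snd p) (fst p)) \<Longrightarrow> Lam (f c) \<bullet> x = f c x"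
  for f :: "'c :: ctx \<Rightarrow> 'a :: sort \<Rightarrow> 'b :: sort"
  using Lam_code[of f] by blast

lemma idef_fun1:
  fixes g :: "'a :: sort \<Rightarrow> 'b :: sort"
  assumes "idef (\<lambda>p :: 'a \<times> unit. g (fst p))" "idef f"
  shows "idef (\<lambda>c :: 'c :: ctx. g (f c))"
  using beta[OF assms(1)] idef_app[OF idef_const[of "Lam g"] assms(2)] by simp

lemma beta2:
  fixes g :: "'a :: sort \<Rightarrow> 'b :: sort \<Rightarrow> 'd :: sort"
  assumes "idef (\<lambda>p :: 'b \<times> 'a \<times> unit. g (fst (snd p)) (fst p))"
  shows "Lam (\<lambda>x. Lam (g x)) \<bullet> x \<bullet> y = g x y"
proof -
  have "idef (\<lambda>p :: 'a \<times> unit. Lam (g (fst p)))"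
    using idef_Lam[of "\<lambda>p :: 'a \<times> unit. g (fst p)"] assms by simp
  from beta[OF this] have "Lam (\<lambda>x. Lam (g x)) \<bullet> x = Lam (g x)" by simp
  moreover have "Lam (g x) \<bullet> y = g x y"
    using Lam_app[of "\<lambda>p :: 'a \<times> unit. g (fst p)" "(x, ())" y] assms by simp
  ultimately show ?thesis by simp
qed

lemma idef_fun2:
  fixes g :: "'a :: sort \<Rightarrow> 'b :: sort \<Rightarrow> 'd :: sort"
  assumes "idef (\<lambda>p :: 'b \<times> 'a \<times> unit. g (fst (snd p)) (fst p))" "idef f" "idef f'"
  shows "idef (\<lambda>c :: 'c :: ctx. g (f c) (f' c))"
  using beta2[OF assms(1)] idef_app[OF idef_app[OF idef_const[of "Lam (\<lambda>x. Lam (g x))"] assms(2)] assms(3)]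
  by simp

lemma idefp_fun1:
  fixes P :: "'a :: sort \<Rightarrow> bool"
  assumes "idefp (\<lambda>p :: 'a \<times> unit. P (fst p))" "idef f"
  shows "idefp (\<lambda>c :: 'c :: ctx. P (f c))"
  using assms unfolding idefp_def by (rule idef_fun1)

lemma idefp_fun2:
  fixes P :: "'a :: sort \<Rightarrow> 'b :: sort \<Rightarrow> bool"
  assumes "idefp (\<lambda>p :: 'b \<times> 'a \<times> unit. P (fst (snd p)) (fst p))" "idef f" "idef f'"
  shows "idefp (\<lambda>c :: 'c :: ctx. P (f c) (f' c))"
  using assms unfolding idefp_def by (rule idef_fun2)

lemma idefp_le: "idef f \<Longrightarrow> idef g \<Longrightarrow> idefp (\<lambda>c :: 'c :: ctx. f c \<le> (g c :: nn))"
  unfolding le_less by (intro idefp_disj idefp_less idefp_eq)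

lemma idefp_const: "idefp (\<lambda>_ :: 'c :: ctx. b)"
  unfolding idefp_def by (rule idef_const)

lemmas idef_rules = idef_const idef_v idef_plus idef_times idef_Lam idef_app idef_If
lemmas idefp_rules = idefp_const idefp_base idefp_le

text \<open>Cases between functions are reduced to cases between their values, since internal
  functions with the same values are equal.\<close>

lemma idef_If1:
  assumes "idefp P" "idef f" "idef g"
  shows "idef (\<lambda>c :: 'c :: ctx. if P c then f c else (g c :: n1))"
proof -
  have "idef (\<lambda>p :: n1 \<times> n1 \<times> nn \<times> unit.
      Lam (\<lambda>n. if fst (snd (snd p)) = 0 then fst (snd p) \<bullet> n else fst p \<bullet> n))"
    by (intro idef_rules idefp_rules)
  then have L: "idef (\<lambda>p :: n1 \<times> n1 \<times> nn \<times> unit. if fst (snd (snd p)) = 0 then fst (snd p) else fst p)"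
  proof -
    have "idef (\<lambda>q :: nn \<times> n1 \<times> n1 \<times> nn \<times> unit.
      (\<lambda>p n. if fst (snd (snd p)) = 0 then fst (snd p) \<bullet> n else fst p \<bullet> n) (snd q) (fst q))"
      by (intro idef_rules idefp_rules)
    from Lam_app[OF this]
    have "Lam (\<lambda>n. if fst (snd (snd p)) = 0 then fst (snd p) \<bullet> n else fst p \<bullet> n) =
        (if fst (snd (snd p)) = 0 then fst (snd p) else fst p)" for p :: "n1 \<times> n1 \<times> nn \<times> unit"
      by (intro ifn_eqI) simp
    then show ?thesis using \<open>idef (\<lambda>p. Lam _)\<close> by simp
  qed
  define h where "h = (\<lambda>k x y :: n1. if k = (0 :: nn) then x else y)"
  have "idef (\<lambda>p :: n1 \<times> n1 \<times> nn \<times> unit. h (fst (snd (snd p))) (fst (snd p)) (fst p))"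
    using L by (simp add: h_def)
  then have "idef (\<lambda>p :: n1 \<times> nn \<times> unit. Lam (h (fst (snd p)) (fst p)))"
    using idef_Lam[of "\<lambda>p :: n1 \<times> nn \<times> unit. h (fst (snd p)) (fst p)"] by simp
  note 1 = idef_fun2[OF this assms(1)[unfolded idefp_def] assms(2)]
  have "Lam (h k x) \<bullet> y = h k x y" for k x y
    using Lam_app[of "\<lambda>p :: n1 \<times> nn \<times> unit. h (fst (snd p)) (fst p)" "(x, k, ())" y]
      \<open>idef (\<lambda>p :: n1 \<times> n1 \<times> nn \<times> unit. h _ _ _)\<close> by simp
  then have "(\<lambda>c. if P c then f c else g c) = (\<lambda>c. Lam (h (if P c then 0 else 1) (f c)) \<bullet> g c)"
    using one_neq_zero by (auto simp: h_def)
  then show ?thesis using idef_app[OF 1 assms(3)] by simp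
qed

section \<open>Recursion and search inside the model\<close>

definition nrec :: "(nn \<Rightarrow> nn \<Rightarrow> nn) \<Rightarrow> nn \<Rightarrow> nn \<Rightarrow> nn" where
  "nrec h a n = RecI \<bullet> Lam (\<lambda>k. Lam (h k)) \<bullet> a \<bullet> n"

lemma idef_nrec:
  assumes "idef (\<lambda>p :: nn \<times> nn \<times> 'c :: ctx. h (snd (snd p)) (fst (snd p)) (fst p))" "idef a" "idef n"
  shows "idef (\<lambda>c. nrec (h c) (a c) (n c))"
proof -
  have "idef (\<lambda>p :: nn \<times> 'c. Lam (h (snd p) (fst p)))"
    using idef_Lam[of "\<lambda>p :: nn \<times> 'c. h (snd p) (fst p)"] assms(1) by simp
  then have "idef (\<lambda>c. Lam (\<lambda>k. Lam (h c k)))" by (rule idef_Lam)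
  with assms(2,3) show ?thesis unfolding nrec_def by (intro idef_app idef_const)
qed

lemma nrec_simps:
  assumes "idef (\<lambda>p :: nn \<times> nn \<times> unit. h (fst (snd p)) (fst p))"
  shows "nrec h a 0 = a" "nrec h a (n + 1) = h n (nrec h a n)"
  unfolding nrec_def RecI_simps beta2[OF assms] by simp_all

lemma least_ex:
  assumes "idefp (\<lambda>p :: nn \<times> unit. P (fst p))" "P n"
  shows "\<exists>m. P m \<and> (\<forall>k. k < m \<longrightarrow> \<not> P k)"
proof (rule ccontr)
  assume no: "\<not> ?thesis"
  have P: "idefp (\<lambda>c :: nn \<times> nn \<times> unit. P (fst c))"
    by (rule idefp_fun1[OF assms(1)]) (rule idef_v)
  have "\<forall>m. m \<le> n \<longrightarrow> \<not> P m"
  proof (rule idefp_induct[of "\<lambda>n. \<forall>m. m \<le> n \<longrightarrow> \<not> P m"])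
    show "idefp (\<lambda>p :: nn \<times> unit. \<forall>m. m \<le> fst p \<longrightarrow> \<not> P m)"
      using P by (intro idefp_rules idef_rules)
    show "\<forall>m. m \<le> 0 \<longrightarrow> \<not> P m" using no nn_zero_le by (metis leD order.antisym)
    fix n assume IH: "\<forall>m. m \<le> n \<longrightarrow> \<not> P m"
    then have "\<not> P (n + 1)" using no by (metis basic(8) le_less)
    with IH show "\<forall>m. m \<le> n + 1 \<longrightarrow> \<not> P m" by (metis basic(8) le_less)
  qed
  with assms(2) show False by blast
qed

text \<open>Seen from outside, the order of the model need not be well-founded. A least element is
  guaranteed for internal predicates, by \<open>least_ex\<close>.\<close>

definition lst :: "(nn \<Rightarrow> bool) \<Rightarrow> nn" where
  "lst P = (if \<exists>n. P n then LEAST n. P n else 0)"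

lemma lst:
  assumes "idefp (\<lambda>p :: nn \<times> unit. P (fst p))" "P n"
  shows "P (lst P)" "k < lst P \<Longrightarrow> \<not> P k" "lst P \<le> n"
proof -
  obtain m where m: "P m" "\<And>k. k < m \<Longrightarrow> \<not> P k" using least_ex[OF assms] by blast
  then have "(LEAST n. P n) = m" by (intro Least_equality) (auto simp: not_less[symmetric])
  then have "lst P = m" using m(1) by (auto simp: lst_def)
  with m assms(2) show "P (lst P)" "k < lst P \<Longrightarrow> \<not> P k" "lst P \<le> n" by (auto simp: not_less[symmetric])
qed

text \<open>The search functional returns some zero. Applied to the characteristic function of being
  least with the property \<open>P c\<close>, it has a single zero to return, and this is uniform in
  the parameters \<open>c\<close>.\<close>

lemma idef_lst:
  assumes "idefp (\<lambda>p :: nn \<times> 'c :: ctx. P (snd p) (fst p))"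
  shows "idef (\<lambda>c. lst (P c))"
proof -
  obtain E :: "(n1, nn) ifn" where "\<And>f. (\<exists>n. f \<bullet> n = 0) \<longleftrightarrow> E \<bullet> f = 0"
    using E_ex by blast
  then obtain Y :: "(n1, nn) ifn" where Y: "\<And>f. (\<exists>n. f \<bullet> n = 0) \<longrightarrow> f \<bullet> (Y \<bullet> f) = 0"
    using mu_ex[of E] by auto
  define Q where "Q c n = (if P c n \<and> (\<forall>m. m < n \<longrightarrow> \<not> P c m) then 0 else 1 :: nn)" for c n
  have "idef (\<lambda>p :: nn \<times> 'c. Lam (\<lambda>n. if P (snd p) n then 0 else 1 :: nn))"
  proof -
    have "idef (\<lambda>c. Lam (\<lambda>n. if P c n then 0 else 1 :: nn))"
      using assms unfolding idefp_def by (rule idef_Lam)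
    then show ?thesis by (rule idef_weak)
  qed
  from idefp_eq[OF idef_app[OF idef_weak[OF this] idef_fst] idef_const]
  have "idefp (\<lambda>q :: nn \<times> nn \<times> 'c. Lam (\<lambda>n. if P (snd (snd q)) n then 0 else 1 :: nn) \<bullet> fst q = 0)" .
  moreover have "Lam (\<lambda>n. if P c n then 0 else 1 :: nn) \<bullet> k = 0 \<longleftrightarrow> P c k" for c k
    using Lam_app[of "\<lambda>c n. if P c n then 0 else 1 :: nn"] assms one_neq_zero by (simp add: idefp_def)
  ultimately have "idefp (\<lambda>q :: nn \<times> nn \<times> 'c. P (snd (snd q)) (fst q))" by simp
  then have Qd: "idef (\<lambda>p :: nn \<times> 'c. Q (snd p) (fst p))"
    unfolding Q_def using assms by (intro idef_If idefp_conj idefp_all idefp_imp idefp_not idefp_less idef_rules)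
  have Q: "Lam (Q c) \<bullet> n = Q c n" for c n by (rule Lam_app) (rule Qd)
  have "lst (P c) = (if \<exists>n. P c n then Y \<bullet> Lam (Q c) else 0)" for c
  proof (cases "\<exists>n. P c n")
    case True
    have Pc: "idefp (\<lambda>p :: nn \<times> unit. P c (fst p))"
    proof -
      have "idefp (\<lambda>p :: nn \<times> unit. Lam (\<lambda>n. if P c n then 0 else 1 :: nn) \<bullet> fst p = 0)"
        by (intro idefp_rules idef_rules)
      then show ?thesis
        using \<open>\<And>c k. (Lam (\<lambda>n. if P c n then 0 else 1 :: nn) \<bullet> k = 0) = P c k\<close> by simp
    qed
    from True obtain n where "P c n" ..
    from lst[OF Pc this] have "Q c (lst (P c)) = 0" by (simp add: Q_def)
    then have "Q c (Y \<bullet> Lam (Q c)) = 0" using Y[of "Lam (Q c)"] by (auto simp: Q)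
    then have *: "P c (Y \<bullet> Lam (Q c))" "\<And>m. m < Y \<bullet> Lam (Q c) \<Longrightarrow> \<not> P c m"
      using one_neq_zero by (auto simp: Q_def split: if_splits)
    have "lst (P c) = Y \<bullet> Lam (Q c)"
      using lst(1)[OF Pc *(1)] lst(3)[OF Pc *(1)] *(2)[of "lst (P c)"] by (auto simp: le_less)
    with True show ?thesis by simp
  qed (simp add: lst_def)
  moreover have "idef (\<lambda>c. if \<exists>n. P c n then Y \<bullet> Lam (Q c) else 0)"
    by (intro idef_If idefp_ex assms idef_app idef_const idef_Lam Qd)
  ultimately show ?thesis by simp
qed


subsection \<open>Powers of two and codes of rational numbers\<close>

definition p2 :: "nn \<Rightarrow> nn" where "p2 n = nrec (\<lambda>_ y. y + y) 1 n"

lemma p2_simps: "p2 0 = 1" "p2 (n + 1) = p2 n + p2 n"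
  unfolding p2_def by (subst nrec_simps, intro idef_rules, rule refl)+

lemma idef_p2: "idef f \<Longrightarrow> idef (\<lambda>c :: 'c :: ctx. p2 (f c))"
  unfolding p2_def by (intro idef_nrec idef_rules)

lemma p2_ge: "n + 1 \<le> p2 n"
proof (rule idefp_induct[of "\<lambda>n. n + 1 \<le> p2 n"])
  show "idefp (\<lambda>p :: nn \<times> unit. fst p + 1 \<le> p2 (fst p))" by (intro idefp_rules idef_rules idef_p2)
  fix n assume "n + 1 \<le> p2 n"
  moreover have "1 \<le> p2 n" using calculation by (rule order_trans[rotated]) simp
  ultimately show "n + 1 + 1 \<le> p2 (n + 1)" by (simp add: p2_simps add_mono)
qed (simp add: p2_simps)

lemma p2_pos [simp]: "0 < p2 n"
  using p2_ge[of n] add_nonneg_pos[of n 1] by (simp add: less_le_trans)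

end

section \<open>Codes of pairs and of rational numbers\<close>

definition npair :: "nn \<Rightarrow> nn \<Rightarrow> nn" where "npair i j = (i + j) * (i + j) + i"

text \<open>The codes of pairs with sum \<open>s\<close> lie between \<open>s * s\<close> and
  \<open>s * s + s\<close>, hence below the square of \<open>s + 1\<close>. So a code determines the
  sum, and then the first component.\<close>

lemma npair_sum_less: "i + j < k + l \<Longrightarrow> npair i j < npair k l"
proof -
  assume "i + j < k + l"
  then obtain m where m: "k + l = i + j + m + 1" using nn_laws(12) by blast
  define s where "s = i + j"
  have "npair i j \<le> s * s + s" by (simp add: npair_def s_def)
  also have "\<dots> < s * s + s + (s + 1)" by (simp add: add_nonneg_pos)
  also have "\<dots> = (s + 1) * (s + 1)" by (simp add: algebra_simps)
  also have "\<dots> \<le> (k + l) * (k + l)"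
    by (intro mult_mono) (simp_all add: m s_def add_ac)
  also have "\<dots> \<le> npair k l" by (simp add: npair_def)
  finally show ?thesis .
qed

lemma npair_inject [simp]: "npair i j = npair k l \<longleftrightarrow> i = k \<and> j = l"
proof
  assume eq: "npair i j = npair k l"
  then have "i + j = k + l"
    using npair_sum_less[of i j k l] npair_sum_less[of k l i j]
    by (cases "i + j" "k + l" rule: linorder_cases) simp_all
  with eq show "i = k \<and> j = l" by (simp add: npair_def)
qed simp

definition qcode :: "nn \<Rightarrow> nn \<Rightarrow> nn \<Rightarrow> nn" where "qcode a b c = npair (npair a b) c"

lemma qcode_inject [simp]: "qcode a b c = qcode a' b' c' \<longleftrightarrow> a = a' \<and> b = b' \<and> c = c'"
  by (auto simp: qcode_def)

definition dq :: "nn \<Rightarrow> qq" where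
  "dq t = (THE q. \<exists>a b c. t = qcode a b c \<and> q = (nq a - nq b) / (nq c + 1))"

lemma dq_qcode [simp]: "dq (qcode a b c) = (nq a - nq b) / (nq c + 1)"
  unfolding dq_def by (rule the_equality) auto

text \<open>Rational numbers as triples, as in the definition of the formulas.\<close>

type_synonym tri = "nn \<times> nn \<times> nn"

fun tval :: "tri \<Rightarrow> rl" where "tval (a, b, c) = (\<iota> a - \<iota> b) / \<iota> c"
fun tok :: "tri \<Rightarrow> bool" where "tok (a, b, c) \<longleftrightarrow> 0 < c"
fun tle :: "tri \<Rightarrow> tri \<Rightarrow> bool" where
  "tle (a, b, c) (a', b', c') \<longleftrightarrow> a * c' + b' * c \<le> a' * c + b * c'"
fun tlt :: "tri \<Rightarrow> tri \<Rightarrow> bool" where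
  "tlt (a, b, c) (a', b', c') \<longleftrightarrow> a * c' + b' * c < a' * c + b * c'"
fun tadd :: "tri \<Rightarrow> tri \<Rightarrow> tri" where
  "tadd (a, b, c) (a', b', c') = (a * c' + a' * c, b * c' + b' * c, c * c')"
fun tmul :: "tri \<Rightarrow> tri \<Rightarrow> tri" where
  "tmul (a, b, c) (a', b', c') = (a * a' + b * b', a * b' + b * a', c * c')"
fun tneg :: "tri \<Rightarrow> tri" where "tneg (a, b, c) = (b, a, c)"

lemma tle_iff: "tok p \<Longrightarrow> tok q \<Longrightarrow> tle p q \<longleftrightarrow> tval p \<le> tval q"
proof (cases p; cases q; simp only: tok.simps tle.simps tval.simps)
  fix a b c a' b' c' :: nn assume "0 < c" "0 < c'"
  then have "0 < \<iota> c" "0 < \<iota> c'" using nr_less_iff[of 0] by simp_all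
  then have "(\<iota> a - \<iota> b) / \<iota> c \<le> (\<iota> a' - \<iota> b') / \<iota> c' \<longleftrightarrow>
      \<iota> a * \<iota> c' + \<iota> b' * \<iota> c \<le> \<iota> a' * \<iota> c + \<iota> b * \<iota> c'"
    by (simp add: divide_simps algebra_simps)
  also have "\<dots> \<longleftrightarrow> \<iota> (a * c' + b' * c) \<le> \<iota> (a' * c + b * c')" by (simp only: nr_simps)
  finally show "a * c' + b' * c \<le> a' * c + b * c' \<longleftrightarrow> (\<iota> a - \<iota> b) / \<iota> c \<le> (\<iota> a' - \<iota> b') / \<iota> c'"
    by (simp only: nr_le_iff)
qed

lemma tlt_iff: "tok p \<Longrightarrow> tok q \<Longrightarrow> tlt p q \<longleftrightarrow> tval p < tval q"
  using tle_iff[of q p] by (cases p; cases q) (simp add: not_le[symmetric] add.commute)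

lemma tadd_val: "tok p \<Longrightarrow> tok q \<Longrightarrow> tval (tadd p q) = tval p + tval q \<and> tok (tadd p q)"
proof (cases p; cases q; simp only: tok.simps tadd.simps tval.simps)
  fix a b c a' b' c' :: nn assume "0 < c" "0 < c'"
  then have "0 < \<iota> c" "0 < \<iota> c'" using nr_less_iff[of 0] by simp_all
  with \<open>0 < c\<close> \<open>0 < c'\<close> show "(\<iota> (a * c' + a' * c) - \<iota> (b * c' + b' * c)) / \<iota> (c * c') =
      (\<iota> a - \<iota> b) / \<iota> c + (\<iota> a' - \<iota> b') / \<iota> c' \<and> 0 < c * c'"
    by (simp add: divide_simps) (simp add: algebra_simps)
qed

lemma tmul_val: "tok p \<Longrightarrow> tok q \<Longrightarrow> tval (tmul p q) = tval p * tval q \<and> tok (tmul p q)"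
proof (cases p; cases q; simp only: tok.simps tmul.simps tval.simps)
  fix a b c a' b' c' :: nn assume "0 < c" "0 < c'"
  then have "0 < \<iota> c" "0 < \<iota> c'" using nr_less_iff[of 0] by simp_all
  with \<open>0 < c\<close> \<open>0 < c'\<close> show "(\<iota> (a * a' + b * b') - \<iota> (a * b' + b * a')) / \<iota> (c * c') =
      (\<iota> a - \<iota> b) / \<iota> c * ((\<iota> a' - \<iota> b') / \<iota> c') \<and> 0 < c * c'"
    by (simp add: divide_simps) (simp add: algebra_simps)
qed

lemma tneg_val: "tval (tneg p) = - tval p" "tok (tneg p) = tok p"
  by (cases p, simp add: minus_divide_left)+


subsection \<open>Real numbers of the model\<close>

context model
begin

definition Re :: "n1 \<Rightarrow> bool" where
  "Re x \<longleftrightarrow> (\<forall>n i. \<exists>a b c. x \<bullet> n = qcode a b c \<and> (\<exists>a' b' c'. x \<bullet> (n + i) = qcode a' b' c' \<and>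
     tlt (a, b, c + 1) (tadd (a', b', c' + 1) (1, 0, p2 n)) \<and>
     tlt (a', b', c' + 1) (tadd (a, b, c + 1) (1, 0, p2 n))))"

text \<open>The order of values, expressed inside the model. As \<open>val\<close> lives outside,
  conditions on values have to be written with \<open>vle\<close> wherever induction, search or
  choice is applied to them.\<close>

definition vle :: "n1 \<Rightarrow> n1 \<Rightarrow> bool" where
  "vle x y \<longleftrightarrow> (\<forall>n. \<exists>a b c. x \<bullet> n = qcode a b c \<and> (\<exists>a' b' c'. y \<bullet> n = qcode a' b' c' \<and>
     tle (a, b, c + 1) (tadd (a', b', c' + 1) (1 + 1, 0, p2 n))))"

definition val :: "n1 \<Rightarrow> rl" where "val x = clim (\<lambda>n. dq (x \<bullet> n))"

lemma idefp_Re: "idef f \<Longrightarrow> idefp (\<lambda>c :: 'c :: ctx. Re (f c))"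
proof (rule idefp_fun1)
  show "idefp (\<lambda>p :: n1 \<times> unit. Re (fst p))"
    unfolding Re_def qcode_def npair_def tlt.simps tadd.simps by (intro idefp_rules idef_rules idef_p2)
qed

lemma idefp_vle: "idef f \<Longrightarrow> idef g \<Longrightarrow> idefp (\<lambda>c :: 'c :: ctx. vle (f c) (g c))"
proof (rule idefp_fun2)
  show "idefp (\<lambda>p :: n1 \<times> n1 \<times> unit. vle (fst (snd p)) (fst p))"
    unfolding vle_def qcode_def npair_def tle.simps tadd.simps by (intro idefp_rules idef_rules idef_p2)
qed

definition hp :: "nn \<Rightarrow> rl" where "hp n = 1 / \<iota> (p2 n)"

lemma hp_pos: "0 < hp n"
  unfolding hp_def using nr_less_iff[of 0 "p2 n"] by simp

lemma hp_simps: "hp 0 = 1" "hp (n + 1) = hp n / 2"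
  by (simp_all add: hp_def p2_simps)

lemma tval_qcode: "rq (dq (qcode a b c)) = tval (a, b, c + 1)"
  by (simp add: nr_def)

lemma tval_hp: "tval (1, 0, p2 n) = hp n" "tval (1 + 1, 0, p2 n) = 2 * hp n"
  by (simp_all add: hp_def)

lemma nn_plus1_pos: "0 < n + (1 :: nn)"
  by (simp add: add_nonneg_pos)

lemma Re_iff: "Re x \<longleftrightarrow> (\<forall>n. \<exists>a b c. x \<bullet> n = qcode a b c) \<and>
    (\<forall>n i. \<bar>rq (dq (x \<bullet> n)) - rq (dq (x \<bullet> (n + i)))\<bar> < hp n)"
proof -
  have "(\<exists>a b c. s = qcode a b c \<and> (\<exists>a' b' c'. t = qcode a' b' c' \<and>
     tlt (a, b, c + 1) (tadd (a', b', c' + 1) (1, 0, p2 n)) \<and>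
     tlt (a', b', c' + 1) (tadd (a, b, c + 1) (1, 0, p2 n)))) \<longleftrightarrow>
     (\<exists>a b c. s = qcode a b c) \<and> (\<exists>a b c. t = qcode a b c) \<and> \<bar>rq (dq s) - rq (dq t)\<bar> < hp n" for s t n
  proof -
    have "tlt (a, b, c + 1) (tadd (a', b', c' + 1) (1, 0, p2 n)) \<and>
      tlt (a', b', c' + 1) (tadd (a, b, c + 1) (1, 0, p2 n)) \<longleftrightarrow>
      \<bar>rq (dq (qcode a b c)) - rq (dq (qcode a' b' c'))\<bar> < hp n" for a b c a' b' c'
    proof -
      have ok: "tok (a, b, c + 1)" "tok (a', b', c' + 1)" "tok (1, 0, p2 n)"
        by (simp_all add: nn_plus1_pos)
      show ?thesis
        unfolding tval_qcode using ok tadd_val[OF ok(1,3)] tadd_val[OF ok(2,3)]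
        by (simp add: tlt_iff tval_hp del: tval.simps tadd.simps tok.simps) linarith
    qed
    then show ?thesis by blast
  qed
  note * = this
  show ?thesis unfolding Re_def * by (metis add_0_right)
qed

lemma Re_code: "Re x \<Longrightarrow> \<exists>a b c. x \<bullet> n = qcode a b c"
  by (simp add: Re_iff)

lemma Re_diff: "Re x \<Longrightarrow> \<bar>rq (dq (x \<bullet> n)) - rq (dq (x \<bullet> (n + i)))\<bar> < hp n"
  by (simp add: Re_iff)

lemma nq_pos: "0 < nq n \<longleftrightarrow> 0 < n"
  using nq_le_iff[of n 0] by (simp add: not_le[symmetric] del: nq_le_iff)

lemma hp_small: "0 < e \<Longrightarrow> \<exists>n. hp n < rq e"
proof -
  assume e: "0 < (e :: qq)"
  obtain n where n: "1 / e \<le> nq n" using qq_bound by blast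
  have "n < p2 n" using p2_ge[of n] less_add_one[of n] by (rule less_le_trans[rotated])
  then have "nq n < nq (p2 n)" by (simp add: not_le[symmetric])
  then have "1 / e < nq (p2 n)" using n by simp
  then have "1 / nq (p2 n) < e" using e nq_pos[of "p2 n"] by (simp add: field_simps)
  then have "rq (1 / nq (p2 n)) < rq e" by (simp only: rq_less_iff)
  then show ?thesis by (auto simp: hp_def nr_def)
qed

lemma rq_abs: "\<bar>rq a\<bar> = rq \<bar>a\<bar>"
  using rq_less_iff[of a 0] unfolding rq_simps(1) by (auto simp: abs_if)

lemma Re_Cauchy:
  assumes "Re x" shows "Cauchy_seq (\<lambda>n. dq (x \<bullet> n))"
  unfolding Cauchy_seq_def
proof (intro allI impI)
  fix r :: qq assume "0 < r"
  then obtain n where n: "hp n < rq r" using hp_small by blast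
  have "\<bar>dq (x \<bullet> m) - dq (x \<bullet> n)\<bar> < r" if "n \<le> m" for m
  proof -
    have "m = n + (m - n)" using that by simp
    then have "\<bar>rq (dq (x \<bullet> n)) - rq (dq (x \<bullet> m))\<bar> < rq r"
      using Re_diff[OF assms, of n "m - n"] n by (metis less_trans)
    then show ?thesis by (simp add: rq_abs abs_minus_commute flip: rq_diff)
  qed
  then show "\<exists>c. eventually (\<lambda>n. \<bar>dq (x \<bullet> n) - c\<bar> < r) at_top"
    by (intro exI[of _ "dq (x \<bullet> n)"]) (auto simp: eventually_at_top_linorder)
qed

lemma clim_const: "clim (\<lambda>_. q) = rq q"
  by (simp add: clim_def rq_def cr_def)

lemma val_le: "Re x \<Longrightarrow> val x \<le> rq (dq (x \<bullet> n)) + hp n"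
proof -
  assume x: "Re x"
  define q where "q = dq (x \<bullet> n) + 1 / nq (p2 n)"
  have q: "rq q = rq (dq (x \<bullet> n)) + hp n" by (simp add: q_def hp_def nr_def)
  have "clim (\<lambda>n. dq (x \<bullet> n)) \<le> clim (\<lambda>_. q)"
  proof (rule rl_archimedean)
    fix e :: qq assume e: "0 < e"
    \<comment> \<open>Half of \<open>e\<close> is kept as the gap that \<open>clim_less\<close> asks
      for.\<close>
    have "dq (x \<bullet> m) + e / 2 \<le> q + e" if "n \<le> m" for m
    proof -
      have "m = n + (m - n)" using that by simp
      then have "\<bar>rq (dq (x \<bullet> n)) - rq (dq (x \<bullet> m))\<bar> < hp n"
        using Re_diff[OF x, of n "m - n"] by metis
      then have "rq (dq (x \<bullet> m)) < rq q" by (simp add: q)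
      then show ?thesis using e by simp
    qed
    then have "clim (\<lambda>n. dq (x \<bullet> n)) < rq (q + e)"
      using e by (intro clim_less[of _ "e / 2"] Re_Cauchy[OF x]) (auto simp: eventually_at_top_linorder)
    then show "clim (\<lambda>n. dq (x \<bullet> n)) \<le> clim (\<lambda>_. q) + rq e" by (simp add: clim_const)
  qed (simp_all add: Re_Cauchy[OF x])
  then show ?thesis by (simp add: val_def clim_const q)
qed

lemma val_ge: "Re x \<Longrightarrow> rq (dq (x \<bullet> n)) - hp n \<le> val x"
proof -
  assume x: "Re x"
  define q where "q = dq (x \<bullet> n) - 1 / nq (p2 n)"
  have q: "rq q = rq (dq (x \<bullet> n)) - hp n" by (simp add: q_def hp_def nr_def)
  have "clim (\<lambda>_. q) \<le> clim (\<lambda>n. dq (x \<bullet> n))"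
  proof (rule rl_archimedean)
    fix e :: qq assume e: "0 < e"
    have "- dq (x \<bullet> m) + e / 2 \<le> - q + e" if "n \<le> m" for m
    proof -
      have "m = n + (m - n)" using that by simp
      then have "\<bar>rq (dq (x \<bullet> n)) - rq (dq (x \<bullet> m))\<bar> < hp n"
        using Re_diff[OF x, of n "m - n"] by metis
      then have "rq q < rq (dq (x \<bullet> m))" unfolding q by linarith
      then show ?thesis using e by simp
    qed
    then have "clim (\<lambda>n. - dq (x \<bullet> n)) < rq (- q + e)"
      using e by (intro clim_less[of _ "e / 2"] Cauchy_uminus Re_Cauchy[OF x]) (auto simp: eventually_at_top_linorder)
    then show "clim (\<lambda>_. q) \<le> clim (\<lambda>n. dq (x \<bullet> n)) + rq e"
      by (simp add: clim_const clim_uminus[OF Re_Cauchy[OF x]])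
  qed (simp_all add: Re_Cauchy[OF x])
  then show ?thesis by (simp add: val_def clim_const q)
qed

lemma val_approx: "Re x \<Longrightarrow> \<bar>rq (dq (x \<bullet> n)) - val x\<bar> \<le> hp n"
  using val_le[of x n] val_ge[of x n] by (simp add: abs_le_iff)

text \<open>The factor 4 is what estimates by \<open>n\<close>-th approximations produce: the
  tolerance \<open>2 * hp n\<close> of the comparison and an error of \<open>hp n\<close> on each
  side.\<close>

lemma val_archimedean:
  assumes "Re x" "Re y" "\<And>n. val x \<le> val y + 4 * hp n"
  shows "val x \<le> val y"
  unfolding val_def
proof (rule rl_archimedean[OF Re_Cauchy[OF assms(1)] Re_Cauchy[OF assms(2)]])
  fix e :: qq assume "0 < e"
  then obtain n where "hp n < rq (e / 4)" using hp_small[of "e / 4"] by auto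
  moreover have "4 * rq (e / 4) = rq e"
  proof -
    have "rq 4 = 4" using rq_simps(3)[of "1 + 1" "1 + 1"] rq_simps(2) by (simp del: rq_simps(3)) (metis numeral_plus_numeral one_add_one rq_simps(2,3) semiring_norm(2))
    then show ?thesis by simp
  qed
  ultimately show "clim (\<lambda>n. dq (x \<bullet> n)) \<le> clim (\<lambda>n. dq (y \<bullet> n)) + rq e"
    using assms(3)[of n] by (simp add: val_def)
qed

lemma vle_iff: "Re x \<Longrightarrow> Re y \<Longrightarrow> vle x y \<longleftrightarrow> val x \<le> val y"
proof -
  assume xy: "Re x" "Re y"
  have *: "(\<exists>a b c. x \<bullet> n = qcode a b c \<and> (\<exists>a' b' c'. y \<bullet> n = qcode a' b' c' \<and>
     tle (a, b, c + 1) (tadd (a', b', c' + 1) (1 + 1, 0, p2 n)))) \<longleftrightarrow>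
     rq (dq (x \<bullet> n)) \<le> rq (dq (y \<bullet> n)) + 2 * hp n" for n
  proof -
    obtain a b c a' b' c' where c: "x \<bullet> n = qcode a b c" "y \<bullet> n = qcode a' b' c'"
      using Re_code xy by meson
    have ok: "tok (a, b, c + 1)" "tok (a', b', c' + 1)" "tok (1 + 1, 0, p2 n)"
      by (simp_all add: nn_plus1_pos)
    have "tle (a, b, c + 1) (tadd (a', b', c' + 1) (1 + 1, 0, p2 n)) \<longleftrightarrow>
       rq (dq (qcode a b c)) \<le> rq (dq (qcode a' b' c')) + 2 * hp n"
      unfolding tval_qcode using ok tadd_val[OF ok(2,3)] by (simp only: tle_iff tval_hp)
    then show ?thesis by (simp add: c del: dq_qcode)
  qed
  show ?thesis
    unfolding vle_def *
  proof
    assume le: "\<forall>n. rq (dq (x \<bullet> n)) \<le> rq (dq (y \<bullet> n)) + 2 * hp n"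
    show "val x \<le> val y"
    proof (rule val_archimedean[OF xy])
      show "val x \<le> val y + 4 * hp n" for n
        using val_le[OF xy(1), of n] val_ge[OF xy(2), of n] le[rule_format, of n] by linarith
    qed
  next
    assume "val x \<le> val y"
    show "\<forall>n. rq (dq (x \<bullet> n)) \<le> rq (dq (y \<bullet> n)) + 2 * hp n"
    proof
      fix n
      show "rq (dq (x \<bullet> n)) \<le> rq (dq (y \<bullet> n)) + 2 * hp n"
        using val_le[OF xy(2), of n] val_ge[OF xy(1), of n] \<open>val x \<le> val y\<close> by linarith
    qed
  qed
qed

lemma val_bound: "Re x \<Longrightarrow> \<exists>m. \<bar>val x\<bar> \<le> \<iota> m"
proof -
  assume x: "Re x"
  obtain m where m: "\<bar>dq (x \<bullet> 0)\<bar> \<le> nq m" using qq_bound by blast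
  have "\<bar>rq (dq (x \<bullet> 0))\<bar> \<le> \<iota> m" using m by (simp add: rq_abs nr_def)
  then have "\<bar>val x\<bar> \<le> \<iota> (m + 1)"
    using val_approx[OF x, of 0] by (simp add: hp_simps)
  then show ?thesis ..
qed

lemma hp_small_val: "Re x \<Longrightarrow> 0 < val x \<Longrightarrow> \<exists>n. hp n < val x"
proof (rule ccontr)
  assume x: "Re x" "0 < val x" and "\<nexists>n. hp n < val x"
  then have *: "val x \<le> hp n" for n by (simp add: not_less)
  have "clim (\<lambda>n. dq (x \<bullet> n)) \<le> clim (\<lambda>_. 0)"
  proof (rule rl_archimedean)
    fix e :: qq assume "0 < e"
    then obtain n where "hp n < rq e" using hp_small by blast
    then show "clim (\<lambda>n. dq (x \<bullet> n)) \<le> clim (\<lambda>_. 0) + rq e"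
      using *[of n] by (simp add: val_def clim_const)
  qed (simp_all add: Re_Cauchy[OF x(1)])
  with x(2) show False by (simp add: val_def clim_const)
qed

definition cq :: "nn \<Rightarrow> nn \<Rightarrow> nn \<Rightarrow> n1" where "cq a b c = Lam (\<lambda>_. qcode a b c)"

lemma idef_qcode: "idef f \<Longrightarrow> idef g \<Longrightarrow> idef h \<Longrightarrow> idef (\<lambda>c :: 'c :: ctx. qcode (f c) (g c) (h c))"
  unfolding qcode_def npair_def by (intro idef_plus idef_times)

lemma idef_cq: "idef f \<Longrightarrow> idef g \<Longrightarrow> idef h \<Longrightarrow> idef (\<lambda>c :: 'c :: ctx. cq (f c) (g c) (h c))"
  unfolding cq_def by (intro idef_Lam idef_qcode idef_weak)

lemma cq_app: "cq a b c \<bullet> n = qcode a b c"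
  unfolding cq_def by (rule beta) (rule idef_const)

lemma Re_cq [simp]: "Re (cq a b c)"
  by (auto simp: Re_iff cq_app hp_pos simp del: dq_qcode)

lemma val_cq [simp]: "val (cq a b c) = (\<iota> a - \<iota> b) / (\<iota> c + 1)"
  by (simp add: val_def cq_app clim_const nr_def)

end

subsection \<open>From formulas to statements about the model\<close>

text \<open>A world consists of an assignment, the number of quantifiers passed so far, and the
  variables that they bind.\<close>

type_synonym world = "(nat \<times> ty \<Rightarrow> trm set) \<times> nat \<times> (nat \<times> ty) set"

fun idx :: "world \<Rightarrow> nat" where "idx (w, k, V) = k"
fun upd :: "world \<Rightarrow> ty \<Rightarrow> trm set \<Rightarrow> world" where
  "upd (w, k, V) \<sigma> a = (w((k, \<sigma>) := a), Suc k, insert (k, \<sigma>) V)"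

context model
begin

text \<open>The bound on the indices ensures that quantifiers met later, which bind the variable
  with number \<open>k\<close> or larger ones, do not overwrite the value of the term.\<close>

fun Tm :: "world \<Rightarrow> trm \<Rightarrow> 'a :: sort \<Rightarrow> bool" where
  "Tm (w, k, V) t a \<longleftrightarrow> vars t \<subseteq> V \<and> (\<forall>z \<in> vars t. fst z < k) \<and> evm w t = enc a"

text \<open>The meaning \<open>P\<close> is claimed under the hypothesis \<open>H\<close> only,
  because formulas about reals have their intended meaning only for arguments that are reals. The
  statement on free variables is unconditional and will give closedness of the sentences.\<close>

fun R :: "bool \<Rightarrow> world \<Rightarrow> bfm \<Rightarrow> bool \<Rightarrow> bool" where
  "R H (w, k, V) A P \<longleftrightarrow> fv (A k) \<subseteq> V \<and> (H \<longrightarrow> (SatM w (A k) \<longleftrightarrow> P))"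

fun wext :: "world \<Rightarrow> world \<Rightarrow> bool" where
  "wext (w, k, V) (w', k', V') \<longleftrightarrow> k \<le> k' \<and> V \<subseteq> V' \<and> (\<forall>z. fst z < k \<longrightarrow> w' z = w z)"

lemma evm_cong: "(\<And>z. z \<in> vars t \<Longrightarrow> w z = w' z) \<Longrightarrow> evm w t = evm w' t"
  by (induction t) auto

lemma wext_refl [simp]: "wext W W"
  by (cases W) auto

lemma wext_trans: "wext W W' \<Longrightarrow> wext W' W'' \<Longrightarrow> wext W W''"
  by (cases W; cases W'; cases W'') auto

lemma wext_upd: "wext W W' \<Longrightarrow> wext W (upd W' \<sigma> a)"
  by (cases W; cases W') auto

lemma Tm_wext: "Tm W t a \<Longrightarrow> wext W W' \<Longrightarrow> Tm W' t a"
  using evm_cong[of t "fst W" "fst W'"] by (cases W; cases W') fastforce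

lemma Tm_weak: "Tm W t a \<Longrightarrow> Tm (upd W \<sigma> b) t a"
  by (rule Tm_wext) (auto intro: wext_upd)

lemma Tm_var: "Tm (upd W \<sigma> (enc a)) (Var (idx W) \<sigma>) a"
  by (cases W) auto

lemma Tm_zero: "Tm W \<zero> (0 :: nn)" and Tm_one: "Tm W \<one> (1 :: nn)"
  by (cases W, simp add: enc_zero enc_one)+

lemma Tm_plus: "Tm W s a \<Longrightarrow> Tm W t b \<Longrightarrow> Tm W (s \<oplus> t) (a + b :: nn)"
  by (cases W) (auto simp: enc_plus)

lemma Tm_times: "Tm W s a \<Longrightarrow> Tm W t b \<Longrightarrow> Tm W (s \<otimes> t) (a * b :: nn)"
  by (cases W) (auto simp: enc_times)

lemma Tm_app: "Tm W s f \<Longrightarrow> Tm W t a \<Longrightarrow> Tm W (s \<cdot> t) (f \<bullet> a)"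
  by (cases W) (auto simp: apm_enc)

text \<open>The inner combinator term \<open>S\<close> evaluates to the identity, hence
  \<open>Sig\<close> applied to addition and \<open>S\<close> doubles its argument. By
  extensionality the step function of \<open>pow2\<close> is the one of \<open>p2\<close>.\<close>

lemma Tm_pow2: "Tm W t n \<Longrightarrow> Tm W (pow2 t) (p2 n)"
proof (cases W)
  fix w k V assume W: "W = (w, k, V)" and t: "Tm W t n"
  define S where "S = apm (apm (csm (Sig N N\<^sub>1 N)) (csm (Pi N N\<^sub>1))) (csm (Pi N N))"
  define F where "F = apm (csm (Pi N\<^sub>1 N)) (apm (apm (csm (Sig N N N)) (csm Plus)) S)"
  have P: "csm Plus \<in> Dm (N \<rightarrow> N \<rightarrow> N)" using csm_in[OF Bad, of Plus] by simp
  have S: "S \<in> Dm N\<^sub>1" "\<And>a. a \<in> Dm N \<Longrightarrow> apm S a = a"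
    unfolding S_def using Dm_app[OF Dm_app[OF Sig_in Pi_in] Pi_in] Bad apm_Sig apm_Pi Pi_in
      Dm_app[OF Pi_in] by auto
  have SP: "apm (apm (csm (Sig N N N)) (csm Plus)) S \<in> Dm N\<^sub>1"
    using Dm_app[OF Dm_app[OF Sig_in P] S(1)] Bad by auto
  have F: "F \<in> Dm (N \<rightarrow> N\<^sub>1)" unfolding F_def using Dm_app[OF Pi_in SP] Bad by auto
  define f :: "(nn, n1) ifn" where "f = dec F"
  have f: "enc f = F" unfolding f_def using F by (intro enc_dec) (simp add: sty_simps)
  have nn_in: "enc (y :: nn) \<in> Dm N" for y using enc_in[of y] by (simp add: sty_simps)
  have "enc (f \<bullet> x \<bullet> y) = enc (y + y)" for x y :: nn
  proof -
    have "enc (f \<bullet> x \<bullet> y) = apm (apm F (enc x)) (enc y)" by (simp add: apm_enc flip: f)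
    also have "apm F (enc x) = apm (apm (csm (Sig N N N)) (csm Plus)) S"
      unfolding F_def using apm_Pi[OF Bad SP nn_in] by simp
    also have "apm \<dots> (enc y) = apm (apm (csm Plus) (enc y)) (apm S (enc y))"
      using apm_Sig[OF Bad P S(1) nn_in] .
    finally show ?thesis using S(2)[OF nn_in] by (simp add: enc_plus)
  qed
  then have "f \<bullet> x \<bullet> y = y + y" for x y by simp
  moreover have "Lam (\<lambda>x :: nn. Lam (\<lambda>y :: nn. y + y)) \<bullet> x \<bullet> y = y + y" for x y
    by (rule beta2) (intro idef_rules)
  ultimately have "f = Lam (\<lambda>x. Lam (\<lambda>y. y + y))" by (intro ifn_eqI) simp
  then have "enc (p2 n) = apm (apm (apm (csm Rec) F) (csm One)) (enc n)"
    by (simp add: p2_def nrec_def enc_Rec[symmetric] enc_one[symmetric] f[symmetric] apm_enc)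
  then show ?thesis using t by (simp add: W pow2_def F_def S_def)
qed

lemma R_cong: "R H W A P' \<Longrightarrow> (H \<Longrightarrow> P' \<longleftrightarrow> P) \<Longrightarrow> R H W A P"
  by (cases W) auto

lemma R_mono: "R H W A P \<Longrightarrow> (H' \<Longrightarrow> H) \<Longrightarrow> R H' W A P"
  by (cases W) auto

lemma R_eq: "Tm W s (a :: nn) \<Longrightarrow> Tm W t b \<Longrightarrow> R H W (s \<^bold>= t) (a = b)"
  by (cases W) (auto simp: eq_def)
lemma R_lt: "Tm W s (a :: nn) \<Longrightarrow> Tm W t b \<Longrightarrow> R H W (s \<^bold>< t) (a < b)"
  by (cases W) (auto simp: lt_def less_lsm)
lemma R_bot: "R H W \<^bold>\<bottom> False"
  by (cases W) (auto simp: bot_def)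
text \<open>The conclusion may be interpreted under the premise as an additional hypothesis, because
  a false premise makes the implication true anyway. Bounded quantifiers thereby provide the
  information that their variables are reals or points.\<close>

lemma R_imp: "R H W A P \<Longrightarrow> R (H \<and> P) W B Q \<Longrightarrow> R H W (A \<^bold>\<longrightarrow> B) (P \<longrightarrow> Q)"
  by (cases W) (auto simp: imp_def)
lemma R_neg: "R H W A P \<Longrightarrow> R H W (\<^bold>\<not> A) (\<not> P)"
  by (cases W) (auto simp: neg_def imp_def bot_def)
lemma R_conj: "R H W A P \<Longrightarrow> R (H \<and> P) W B Q \<Longrightarrow> R H W (A \<^bold>\<and> B) (P \<and> Q)"
  by (cases W) (auto simp: conj_def neg_def imp_def bot_def)
lemma R_disj: "R H W A P \<Longrightarrow> R H W B Q \<Longrightarrow> R H W (A \<^bold>\<or> B) (P \<or> Q)"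
  by (cases W) (auto simp: disj_def neg_def imp_def bot_def)
lemma R_iff: "R H W A P \<Longrightarrow> R H W B Q \<Longrightarrow> R H W (A \<^bold>\<longleftrightarrow> B) (P \<longleftrightarrow> Q)"
  by (cases W) (auto simp: iff_def conj_def neg_def imp_def bot_def)
lemma R_le: "Tm W s (a :: nn) \<Longrightarrow> Tm W t b \<Longrightarrow> R H W (s \<^bold>\<le> t) (a \<le> b)"
  unfolding le_def le_less by (intro R_disj R_lt R_eq)

lemma R_all:
  assumes "sty TYPE('a :: sort) = \<sigma>"
    and "\<And>x :: 'a. R H (upd W \<sigma> (enc x)) (F (Var (idx W) \<sigma>)) (P x)"
  shows "R H W (allq \<sigma> F) (\<forall>x. P x)"
  using assms(2) ball_Dm[where 'a = 'a] assms(1)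
  by (cases W) (fastforce simp: allq_def)

lemma R_ex:
  assumes "sty TYPE('a :: sort) = \<sigma>"
    and "\<And>x :: 'a. R H (upd W \<sigma> (enc x)) (F (Var (idx W) \<sigma>)) (P x)"
  shows "R H W (exq \<sigma> F) (\<exists>x. P x)"
proof -
  have "R H W (allq \<sigma> (\<lambda>x. \<^bold>\<not> F x)) (\<forall>x :: 'a. \<not> P x)"
    by (rule R_all[OF assms(1)], rule R_neg, rule assms(2))
  from R_neg[OF this] show ?thesis unfolding exq_def by simp
qed

lemma R_ballq:
  assumes "\<And>x :: n1. R H (upd W N\<^sub>1 (enc x)) (P (Var (idx W) N\<^sub>1)) (PS x)"
    and "\<And>x :: n1. R (H \<and> PS x) (upd W N\<^sub>1 (enc x)) (F (Var (idx W) N\<^sub>1)) (FS x)"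
  shows "R H W (ballq P F) (\<forall>x. PS x \<longrightarrow> FS x)"
  unfolding ballq_def by (rule R_all) (auto simp: sty_simps intro: R_imp assms)

lemma R_bexq:
  assumes "\<And>x :: n1. R H (upd W N\<^sub>1 (enc x)) (P (Var (idx W) N\<^sub>1)) (PS x)"
    and "\<And>x :: n1. R (H \<and> PS x) (upd W N\<^sub>1 (enc x)) (F (Var (idx W) N\<^sub>1)) (FS x)"
  shows "R H W (bexq P F) (\<exists>x. PS x \<and> FS x)"
  unfolding bexq_def by (rule R_ex) (auto simp: sty_simps intro: R_conj assms)

lemma sty_eqs:
  "sty TYPE(nn) = N" "sty TYPE(n1) = N\<^sub>1" "sty TYPE((n1, nn) ifn) = N\<^sub>1 \<rightarrow> N"
  "sty TYPE((nn, n1) ifn) = N \<rightarrow> N\<^sub>1" "sty TYPE((nn, (n1, nn) ifn) ifn) = N \<rightarrow> N\<^sub>1 \<rightarrow> N"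
  "sty TYPE((n1, (n1, nn) ifn) ifn) = N\<^sub>1 \<rightarrow> N\<^sub>1 \<rightarrow> N" "sty TYPE((n1, n1) ifn) = N\<^sub>1 \<rightarrow> N\<^sub>1"
  "sty TYPE((n1, (n1, n1) ifn) ifn) = N\<^sub>1 \<rightarrow> N\<^sub>1 \<rightarrow> N\<^sub>1" "sty TYPE((n1, n1) ifn) = N\<^sub>1 \<rightarrow> N \<rightarrow> N"
  by (simp_all add: sty_simps)

lemmas R_quants = R_all[OF sty_eqs(1)] R_all[OF sty_eqs(2)] R_all[OF sty_eqs(3)] R_all[OF sty_eqs(4)]
  R_all[OF sty_eqs(5)] R_all[OF sty_eqs(6)] R_all[OF sty_eqs(7)] R_all[OF sty_eqs(8)]
  R_ex[OF sty_eqs(1)] R_ex[OF sty_eqs(2)] R_ex[OF sty_eqs(3)] R_ex[OF sty_eqs(4)]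
  R_ex[OF sty_eqs(5)] R_ex[OF sty_eqs(6)] R_ex[OF sty_eqs(7)] R_ex[OF sty_eqs(8)]

lemmas R_rules = R_eq R_lt R_bot R_le R_imp R_neg R_conj R_disj R_iff R_quants R_ballq R_bexq
lemmas Tm_rules = Tm_zero Tm_one Tm_plus Tm_times Tm_pow2 Tm_app Tm_var Tm_weak

lemma Tm_pair: "Tm W s a \<Longrightarrow> Tm W t b \<Longrightarrow> Tm W (pair s t) (npair a b)"
  unfolding pair_def npair_def by (intro Tm_plus Tm_times)


subsubsection \<open>Rational and real expressions\<close>

fun TmQ :: "world \<Rightarrow> rat_exp \<Rightarrow> tri \<Rightarrow> bool" where
  "TmQ W (a, b, c) (x, y, z) \<longleftrightarrow> Tm W a x \<and> Tm W b y \<and> Tm W c z"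

lemma TmQ_wext: "TmQ W p q \<Longrightarrow> wext W W' \<Longrightarrow> TmQ W' p q"
  by (cases p; cases q) (auto intro: Tm_wext)

lemma TmQ_add: "TmQ W p q \<Longrightarrow> TmQ W p' q' \<Longrightarrow> TmQ W (p +\<^sub>Q p') (tadd q q')"
  by (cases p; cases q; cases p'; cases q') (auto intro!: Tm_plus Tm_times)
lemma TmQ_mul: "TmQ W p q \<Longrightarrow> TmQ W p' q' \<Longrightarrow> TmQ W (p *\<^sub>Q p') (tmul q q')"
  by (cases p; cases q; cases p'; cases q') (auto intro!: Tm_plus Tm_times)
lemma TmQ_neg: "TmQ W p q \<Longrightarrow> TmQ W (-\<^sub>Q p) (tneg q)"
  by (cases p; cases q) auto
lemma TmQ_nat: "Tm W t n \<Longrightarrow> TmQ W (natQ t) (n, 0, 1)"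
  by (auto simp: natQ_def intro: Tm_zero Tm_one)
lemma TmQ_half_pow: "Tm W t n \<Longrightarrow> TmQ W (half_pow t) (1, 0, p2 n)"
  by (auto simp: half_pow_def intro: Tm_zero Tm_one Tm_pow2)

lemma R_leQ: "TmQ W p q \<Longrightarrow> TmQ W p' q' \<Longrightarrow> R H W (p \<le>\<^sub>Q p') (tle q q')"
  by (cases p; cases q; cases p'; cases q') (auto intro!: R_le Tm_plus Tm_times)
lemma R_ltQ: "TmQ W p q \<Longrightarrow> TmQ W p' q' \<Longrightarrow> R H W (p <\<^sub>Q p') (tlt q q')"
  by (cases p; cases q; cases p'; cases q') (auto intro!: R_lt Tm_plus Tm_times)

text \<open>The continuation is placed under three new quantifiers, so it has to be understood in
  extended worlds and for the triple of the new variables.\<close>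

lemma R_decodeQ:
  assumes "Tm W t n" "\<And>W' p q. wext W W' \<Longrightarrow> TmQ W' p q \<Longrightarrow> R H W' (K p) (KS q)"
  shows "R H W (decodeQ t K) (\<exists>a b c. n = qcode a b c \<and> KS (a, b, c + 1))"
  unfolding decodeQ_def qcode_def
proof (intro R_ex sty_eqs R_conj R_eq Tm_pair)
  fix a b c :: nn
  let ?W = "upd (upd (upd W N (enc a)) N (enc b)) N (enc c)"
  show "Tm ?W t n" by (intro Tm_weak assms(1))
  have v: "Tm ?W (Var (idx W) N) a" "Tm ?W (Var (idx (upd W N (enc a))) N) b"
    "Tm ?W (Var (idx (upd (upd W N (enc a)) N (enc b))) N) c"
    by (intro Tm_weak Tm_var)+
  show "Tm ?W (Var (idx W) N) a" "Tm ?W (Var (idx (upd W N (enc a))) N) b"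
    "Tm ?W (Var (idx (upd (upd W N (enc a)) N (enc b))) N) c" by (rule v)+
  have "R H ?W (K (Var (idx W) N, Var (idx (upd W N (enc a))) N,
     Var (idx (upd (upd W N (enc a)) N (enc b))) N \<oplus> \<one>)) (KS (a, b, c + 1))"
    using v by (intro assms(2) wext_upd wext_refl) (auto intro: Tm_plus Tm_one)
  then show "R (H \<and> n = npair (npair a b) c) ?W (K (Var (idx W) N, Var (idx (upd W N (enc a))) N,
     Var (idx (upd (upd W N (enc a)) N (enc b))) N \<oplus> \<one>)) (KS (a, b, c + 1))"
    by (rule R_mono) auto
qed

lemma R_Reals: "Tm W t x \<Longrightarrow> R H W (Reals t) (Re x)"
  unfolding Reals_def Re_def
proof (intro R_all sty_eqs)
  fix n i :: nn
  let ?W = "upd (upd W N (enc n)) N (enc i)"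
  assume t: "Tm W t x"
  have v: "Tm ?W t x" "Tm ?W (Var (idx W) N) n" "Tm ?W (Var (idx (upd W N (enc n))) N) i"
    by (intro Tm_weak Tm_var t)+
  show "R H ?W (decodeQ (t \<cdot> Var (idx W) N) (\<lambda>p. decodeQ (t \<cdot> (Var (idx W) N \<oplus> Var (idx (upd W N (enc n))) N))
      (\<lambda>q. p <\<^sub>Q q +\<^sub>Q half_pow (Var (idx W) N) \<^bold>\<and> q <\<^sub>Q p +\<^sub>Q half_pow (Var (idx W) N))))
    (\<exists>a b c. x \<bullet> n = qcode a b c \<and> (\<exists>a' b' c'. x \<bullet> (n + i) = qcode a' b' c' \<and>
     tlt (a, b, c + 1) (tadd (a', b', c' + 1) (1, 0, p2 n)) \<and>
     tlt (a', b', c' + 1) (tadd (a, b, c + 1) (1, 0, p2 n))))"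
  proof (rule R_decodeQ[where KS = "\<lambda>p. \<exists>a' b' c'. x \<bullet> (n + i) = qcode a' b' c' \<and>
        tlt p (tadd (a', b', c' + 1) (1, 0, p2 n)) \<and> tlt (a', b', c' + 1) (tadd p (1, 0, p2 n))"])
    show "Tm ?W (t \<cdot> Var (idx W) N) (x \<bullet> n)" by (intro Tm_app v)
    fix W' p q assume W': "wext ?W W'" and p: "TmQ W' p q"
    show "R H W' (decodeQ (t \<cdot> (Var (idx W) N \<oplus> Var (idx (upd W N (enc n))) N))
        (\<lambda>q. p <\<^sub>Q q +\<^sub>Q half_pow (Var (idx W) N) \<^bold>\<and> q <\<^sub>Q p +\<^sub>Q half_pow (Var (idx W) N)))
      (\<exists>a' b' c'. x \<bullet> (n + i) = qcode a' b' c' \<and>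
        tlt q (tadd (a', b', c' + 1) (1, 0, p2 n)) \<and> tlt (a', b', c' + 1) (tadd q (1, 0, p2 n)))"
    proof (rule R_decodeQ)
      show "Tm W' (t \<cdot> (Var (idx W) N \<oplus> Var (idx (upd W N (enc n))) N)) (x \<bullet> (n + i))"
        using v W' by (intro Tm_app Tm_plus) (auto intro: Tm_wext)
      fix W'' p' q' assume "wext W' W''" "TmQ W'' p' q'"
      moreover have "Tm W'' (Var (idx W) N) n" using v W' calculation Tm_wext wext_trans by blast
      moreover have "TmQ W'' p q" using p calculation TmQ_wext by blast
      ultimately show "R H W'' (p <\<^sub>Q p' +\<^sub>Q half_pow (Var (idx W) N) \<^bold>\<and> p' <\<^sub>Q p +\<^sub>Q half_pow (Var (idx W) N))
          (tlt q (tadd q' (1, 0, p2 n)) \<and> tlt q' (tadd q (1, 0, p2 n)))"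
        by (intro R_conj R_ltQ TmQ_add TmQ_half_pow)
    qed
  qed
qed

text \<open>A logical relation for expressions in continuation-passing style: the continuation
  receives the triples listed by \<open>s\<close>. Quantifying over extended worlds makes it stable
  under further quantifiers, such as those hidden in decoding and in products.\<close>

definition relE :: "bool \<Rightarrow> world \<Rightarrow> real_exp \<Rightarrow> (nn \<Rightarrow> tri) \<Rightarrow> bool" where
  "relE H W e s \<longleftrightarrow> (\<forall>W' t n K KS. wext W W' \<longrightarrow> Tm W' t n \<longrightarrow>
     (\<forall>W'' p q. wext W' W'' \<longrightarrow> TmQ W'' p q \<longrightarrow> R H W'' (K p) (KS q)) \<longrightarrow> R H W' (e t K) (KS (s n)))"

lemma relED:
  "relE H W e s \<Longrightarrow> wext W W' \<Longrightarrow> Tm W' t n \<Longrightarrow>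
   (\<And>W'' p q. wext W' W'' \<Longrightarrow> TmQ W'' p q \<Longrightarrow> R H W'' (K p) (KS q)) \<Longrightarrow> R H W' (e t K) (KS (s n))"
  unfolding relE_def by blast

lemma relEI:
  "(\<And>W' t n K KS. wext W W' \<Longrightarrow> Tm W' t n \<Longrightarrow>
     \<forall>W'' p q. wext W' W'' \<longrightarrow> TmQ W'' p q \<longrightarrow> R H W'' (K p) (KS q) \<Longrightarrow> R H W' (e t K) (KS (s n))) \<Longrightarrow>
   relE H W e s"
  unfolding relE_def by blast

definition tri_of :: "nn \<Rightarrow> tri" where
  "tri_of t = (THE q. \<exists>a b c. t = qcode a b c \<and> q = (a, b, c + 1))"

lemma tri_of [simp]: "tri_of (qcode a b c) = (a, b, c + 1)"
  unfolding tri_of_def by (rule the_equality) auto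

lemma relE_val: "Tm W t x \<Longrightarrow> (H \<Longrightarrow> Re x) \<Longrightarrow> relE H W \<langle>t\<rangle> (\<lambda>n. tri_of (x \<bullet> n))"
  unfolding relE_def rval_def
proof (intro allI impI)
  fix W' u and n :: nn and K KS
  assume t: "Tm W t x" "H \<Longrightarrow> Re x" "wext W W'" "Tm W' u n"
    and K: "\<forall>W'' p q. wext W' W'' \<longrightarrow> TmQ W'' p q \<longrightarrow> R H W'' (K p) (KS q)"
  show "R H W' (decodeQ (t \<cdot> u) K) (KS (tri_of (x \<bullet> n)))"
  proof (rule R_cong, rule R_decodeQ)
    show "Tm W' (t \<cdot> u) (x \<bullet> n)" using t by (intro Tm_app) (auto intro: Tm_wext)
    show "R H W'' (K p) (KS q)" if "wext W' W''" "TmQ W'' p q" for W'' p q using K that by blast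
    assume H
    then obtain a b c where "x \<bullet> n = qcode a b c" using t(2) Re_code by blast
    then show "(\<exists>a b c. x \<bullet> n = qcode a b c \<and> KS (a, b, c + 1)) \<longleftrightarrow> KS (tri_of (x \<bullet> n))" by simp
  qed
qed

lemma relE_const: "TmQ W p q \<Longrightarrow> relE H W (rconst p) (\<lambda>_. q)"
  unfolding relE_def rconst_def
proof (intro allI impI)
  fix W' K KS
  assume p: "TmQ W p q" "wext W W'"
    and K: "\<forall>W'' p q. wext W' W'' \<longrightarrow> TmQ W'' p q \<longrightarrow> R H W'' (K p) (KS q)"
  show "R H W' (K p) (KS q)" using K[rule_format, OF wext_refl TmQ_wext[OF p]] .
qed

lemma relE_add: "relE H W e s \<Longrightarrow> relE H W e' s' \<Longrightarrow> relE H W (e +\<^sub>R e') (\<lambda>n. tadd (s (n + 1)) (s' (n + 1)))"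
proof (rule relEI, unfold radd_def)
  fix W' t and n :: nn and K KS
  assume e: "relE H W e s" "relE H W e' s'" and W': "wext W W'" and t: "Tm W' t n"
    and K: "\<forall>W'' p q. wext W' W'' \<longrightarrow> TmQ W'' p q \<longrightarrow> R H W'' (K p) (KS q)"
  have t1: "Tm W' (t \<oplus> \<one>) (n + 1)" by (intro Tm_plus t Tm_one)
  show "R H W' (e (t \<oplus> \<one>) (\<lambda>p. e' (t \<oplus> \<one>) (\<lambda>q. K (p +\<^sub>Q q)))) (KS (tadd (s (n + 1)) (s' (n + 1))))"
  proof (rule relED[OF e(1) W' t1, where KS = "\<lambda>q. KS (tadd q (s' (n + 1)))"])
    fix W1 p q assume 1: "wext W' W1" "TmQ W1 p q"
    show "R H W1 (e' (t \<oplus> \<one>) (\<lambda>q. K (p +\<^sub>Q q))) (KS (tadd q (s' (n + 1))))"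
    proof (rule relED[OF e(2) _ _, where KS = "\<lambda>q'. KS (tadd q q')"])
      show "wext W W1" by (rule wext_trans[OF W' 1(1)])
      show "Tm W1 (t \<oplus> \<one>) (n + 1)" by (rule Tm_wext[OF t1 1(1)])
      fix W2 p' q' assume 2: "wext W1 W2" "TmQ W2 p' q'"
      show "R H W2 (K (p +\<^sub>Q p')) (KS (tadd q q'))"
        using K[rule_format, OF wext_trans[OF 1(1) 2(1)] TmQ_add[OF TmQ_wext[OF 1(2) 2(1)] 2(2)]] .
    qed
  qed
qed

lemma relE_neg: "relE H W e s \<Longrightarrow> relE H W (-\<^sub>R e) (\<lambda>n. tneg (s n))"
proof (rule relEI, unfold rneg_def)
  fix W' t and n :: nn and K KS
  assume e: "relE H W e s" and W': "wext W W'" and t: "Tm W' t n"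
    and K: "\<forall>W'' p q. wext W' W'' \<longrightarrow> TmQ W'' p q \<longrightarrow> R H W'' (K p) (KS q)"
  show "R H W' (e t (\<lambda>p. K (-\<^sub>Q p))) (KS (tneg (s n)))"
    by (rule relED[OF e W' t, where KS = "\<lambda>q. KS (tneg q)"]) (use K TmQ_neg in blast)
qed

definition tabs :: "tri \<Rightarrow> tri" where "tabs q = (if tle (0, 0, 1) q then q else tneg q)"

lemma tabs_val: "tok q \<Longrightarrow> tval (tabs q) = \<bar>tval q\<bar> \<and> tok (tabs q)"
  using tle_iff[of "(0, 0, 1)" q] tneg_val[of q] by (auto simp: tabs_def)

lemma R_absQ:
  assumes "TmQ W p q" "\<And>p' q'. TmQ W p' q' \<Longrightarrow> R H W (K p') (KS q')"
  shows "R H W (absQ p K) (KS (tabs q))"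
proof (rule R_cong)
  have z: "TmQ W (natQ \<zero>) (0, 0, 1)" by (intro TmQ_nat Tm_zero)
  show "R H W (absQ p K) ((tle (0, 0, 1) q \<longrightarrow> KS q) \<and> (tlt q (0, 0, 1) \<longrightarrow> KS (tneg q)))"
  proof -
    have K: "R H W (K p) (KS q)" "R H W (K (-\<^sub>Q p)) (KS (tneg q))"
      using assms TmQ_neg by blast+
    show ?thesis
      unfolding absQ_def
      by (intro R_conj R_imp R_leQ R_ltQ z assms(1) R_mono[OF K(1)] R_mono[OF K(2)]) auto
  qed
  have "tlt q (0, 0, 1) \<longleftrightarrow> \<not> tle (0, 0, 1) q" by (cases q) (auto simp: not_le)
  then show "(tle (0, 0, 1) q \<longrightarrow> KS q) \<and> (tlt q (0, 0, 1) \<longrightarrow> KS (tneg q)) \<longleftrightarrow> KS (tabs q)"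
    by (auto simp: tabs_def)
qed

lemma relE_abs: "relE H W e s \<Longrightarrow> relE H W \<bar>e\<bar>\<^sub>R (\<lambda>n. tabs (s n))"
proof (rule relEI, unfold rabs_def)
  fix W' t and n :: nn and K KS
  assume e: "relE H W e s" and W': "wext W W'" and t: "Tm W' t n"
    and K: "\<forall>W'' p q. wext W' W'' \<longrightarrow> TmQ W'' p q \<longrightarrow> R H W'' (K p) (KS q)"
  show "R H W' (e t (\<lambda>p. absQ p K)) (KS (tabs (s n)))"
    by (rule relED[OF e W' t, where KS = "\<lambda>q. KS (tabs q)"]) (use K in \<open>auto intro!: R_absQ\<close>)
qed

definition mbound :: "tri \<Rightarrow> tri \<Rightarrow> nn \<Rightarrow> bool" where
  "mbound p q k \<longleftrightarrow> tle (tadd (tadd (tabs p) (tabs q)) (1 + 1, 0, 1)) (p2 k, 0, 1)"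

lemma R_mul_bound:
  assumes "TmQ W p q" "TmQ W p' q'" "Tm W t k"
  shows "R H W (mul_bound p p' t) (mbound q q' k)"
  unfolding mul_bound_def mbound_def
proof (rule R_absQ[OF assms(1), where KS = "\<lambda>q. tle (tadd (tadd q (tabs q')) (1 + 1, 0, 1)) (p2 k, 0, 1)"])
  fix p1 q1 assume 1: "TmQ W p1 q1"
  show "R H W (absQ p' (\<lambda>q'. p1 +\<^sub>Q q' +\<^sub>Q natQ (\<one> \<oplus> \<one>) \<le>\<^sub>Q natQ (pow2 t)))
     (tle (tadd (tadd q1 (tabs q')) (1 + 1, 0, 1)) (p2 k, 0, 1))"
    by (rule R_absQ[OF assms(2), where KS = "\<lambda>q'. tle (tadd (tadd q1 q') (1 + 1, 0, 1)) (p2 k, 0, 1)"])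
      (intro R_leQ TmQ_add TmQ_nat Tm_pow2 Tm_plus Tm_one 1 assms)
qed

lemma idefp_mbound: "idefp (\<lambda>c :: nn \<times> unit. mbound p q (fst c))"
proof -
  obtain a b c where "tadd (tadd (tabs p) (tabs q)) (1 + 1, 0, 1) = (a, b, c)"
    by (cases "tadd (tadd (tabs p) (tabs q)) (1 + 1, 0, 1)") auto
  then show ?thesis
    unfolding mbound_def by (simp only: tle.simps) (intro idefp_rules idef_rules idef_p2)
qed

lemma mbound_iff: "tok p \<Longrightarrow> tok q \<Longrightarrow> mbound p q k \<longleftrightarrow> \<bar>tval p\<bar> + \<bar>tval q\<bar> + 2 \<le> \<iota> (p2 k)"
proof -
  assume "tok p" "tok q"
  then have *: "tval (tadd (tabs p) (tabs q)) = \<bar>tval p\<bar> + \<bar>tval q\<bar> \<and> tok (tadd (tabs p) (tabs q))"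
    using tabs_val tadd_val by metis
  have "tok (1 + 1, 0, 1 :: nn)" "tok (p2 k, 0, 1)" by simp_all
  then show ?thesis
    unfolding mbound_def using * tadd_val[of "tadd (tabs p) (tabs q)" "(1 + 1, 0, 1)"]
    by (subst tle_iff) (simp_all del: tadd.simps tok.simps)
qed

lemma mbound_ex: "tok p \<Longrightarrow> tok q \<Longrightarrow> \<exists>k. mbound p q k"
proof -
  assume ok: "tok p" "tok q"
  have "\<exists>n. \<bar>tval p\<bar> \<le> \<iota> n" if "tok p" for p
  proof (cases p)
    case (fields a b c)
    obtain n where "\<bar>(nq a - nq b) / nq c\<bar> \<le> nq n" using qq_bound by blast
    then have "\<bar>tval p\<bar> \<le> \<iota> n" by (simp add: fields nr_def flip: rq_divide rq_diff rq_abs)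
      (simp add: rq_abs del: rq_divide rq_diff)
    then show ?thesis ..
  qed
  then obtain m n where mn: "\<bar>tval p\<bar> \<le> \<iota> m" "\<bar>tval q\<bar> \<le> \<iota> n" using ok by meson
  have "m + n + 2 \<le> p2 (m + n + 2)"
    using p2_ge[of "m + n + 2"] by (rule order_trans[rotated]) simp
  then have "\<iota> (m + n + 2) \<le> \<iota> (p2 (m + n + 2))" by (simp only: nr_le_iff)
  then have "\<bar>tval p\<bar> + \<bar>tval q\<bar> + 2 \<le> \<iota> (p2 (m + n + 2))" using mn by simp
  with ok show ?thesis by (auto simp: mbound_iff)
qed

lemma relE_mul:
  assumes e: "relE H W e s" "relE H W e' s'" and ok: "H \<Longrightarrow> tok (s 0) \<and> tok (s' 0)"
  defines "k \<equiv> lst (mbound (s 0) (s' 0))"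
  shows "relE H W (e *\<^sub>R e') (\<lambda>n. tmul (s (n + k)) (s' (n + k)))"
proof (rule relEI, unfold rmul_def)
  fix W' t and n :: nn and K KS
  assume W': "wext W W'" and t: "Tm W' t n"
    and K: "\<forall>W'' p q. wext W' W'' \<longrightarrow> TmQ W'' p q \<longrightarrow> R H W'' (K p) (KS q)"
  \<comment> \<open>At the actual 0-th approximations exactly one \<open>j\<close> satisfies the two
    conditions of minimality, namely \<open>k\<close>; the existential quantifier of the product
    therefore reduces to its matrix at \<open>k\<close>.\<close>
  define L where "L q0 q0' j \<longleftrightarrow> mbound q0 q0' j \<and> (\<forall>i. i < j \<longrightarrow> \<not> mbound q0 q0' i) \<and>
    KS (tmul (s (n + j)) (s' (n + j)))" for q0 q0' j
  have Lk: "(\<exists>j. L (s 0) (s' 0) j) \<longleftrightarrow> KS (tmul (s (n + k)) (s' (n + k)))" if H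
  proof -
    have "\<exists>j. mbound (s 0) (s' 0) j" using mbound_ex ok[OF that] by blast
    then obtain j where j: "mbound (s 0) (s' 0) j" ..
    note l = lst[OF idefp_mbound j, folded k_def]
    have "i = k" if "mbound (s 0) (s' 0) i" "\<forall>j. j < i \<longrightarrow> \<not> mbound (s 0) (s' 0) j" for i
      using that l(1) l(2) by (meson linorder_less_linear)
    then show ?thesis unfolding L_def using l by blast
  qed
  have "R H W' (e \<zero> (\<lambda>p0. e' \<zero> (\<lambda>q0. \<^bold>\<exists>k \<^bold>: N.
     mul_bound p0 q0 k \<^bold>\<and> (\<^bold>\<forall>j \<^bold>: N. j \<^bold>< k \<^bold>\<longrightarrow> \<^bold>\<not> mul_bound p0 q0 j) \<^bold>\<and>
     e (t \<oplus> k) (\<lambda>p. e' (t \<oplus> k) (\<lambda>q. K (p *\<^sub>Q q)))))) (\<exists>j. L (s 0) (s' 0) j)"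
  proof (rule relED[OF e(1) W' Tm_zero, where KS = "\<lambda>q. \<exists>j. L q (s' 0) j"])
    fix W1 p0 q0 assume 1: "wext W' W1" "TmQ W1 p0 q0"
    have W1: "wext W W1" using W' 1 wext_trans by blast
    show "R H W1 (e' \<zero> (\<lambda>q0. \<^bold>\<exists>k \<^bold>: N.
       mul_bound p0 q0 k \<^bold>\<and> (\<^bold>\<forall>j \<^bold>: N. j \<^bold>< k \<^bold>\<longrightarrow> \<^bold>\<not> mul_bound p0 q0 j) \<^bold>\<and>
       e (t \<oplus> k) (\<lambda>p. e' (t \<oplus> k) (\<lambda>q. K (p *\<^sub>Q q))))) (\<exists>j. L q0 (s' 0) j)"
    proof (rule relED[OF e(2) W1 Tm_zero, where KS = "\<lambda>q. \<exists>j. L q0 q j"])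
      fix W2 p0' q0' assume 2: "wext W1 W2" "TmQ W2 p0' q0'"
      have p0: "TmQ W2 p0 q0" using 1 2 TmQ_wext by blast
      have W2: "wext W' W2" using 1 2 wext_trans by blast
      show "R H W2 (\<^bold>\<exists>k \<^bold>: N. mul_bound p0 p0' k \<^bold>\<and> (\<^bold>\<forall>j \<^bold>: N. j \<^bold>< k \<^bold>\<longrightarrow> \<^bold>\<not> mul_bound p0 p0' j) \<^bold>\<and>
         e (t \<oplus> k) (\<lambda>p. e' (t \<oplus> k) (\<lambda>q. K (p *\<^sub>Q q)))) (\<exists>j. L q0 q0' j)"
        unfolding L_def
      proof (intro R_ex sty_eqs R_conj)
        fix j :: nn
        let ?W = "upd W2 N (enc j)"
        have W3: "wext W2 ?W" by (intro wext_upd wext_refl)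
        have j: "Tm ?W (Var (idx W2) N) j" by (rule Tm_var)
        show "R H ?W (mul_bound p0 p0' (Var (idx W2) N)) (mbound q0 q0' j)"
          using j p0 2 W3 TmQ_wext by (intro R_mul_bound) blast+
        show "R (H \<and> mbound q0 q0' j) ?W (\<^bold>\<forall>i \<^bold>: N. i \<^bold>< Var (idx W2) N \<^bold>\<longrightarrow> \<^bold>\<not> mul_bound p0 p0' i)
            (\<forall>i. i < j \<longrightarrow> \<not> mbound q0 q0' i)"
        proof (intro R_all sty_eqs R_imp R_neg R_lt R_mul_bound)
          fix i :: nn
          have W4: "wext W2 (upd ?W N (enc i))" by (intro wext_upd wext_refl)
          show "Tm (upd ?W N (enc i)) (Var (idx ?W) N) i" "Tm (upd ?W N (enc i)) (Var (idx ?W) N) i"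
            by (rule Tm_var)+
          show "Tm (upd ?W N (enc i)) (Var (idx W2) N) j" by (intro Tm_weak j)
          show "TmQ (upd ?W N (enc i)) p0 q0" "TmQ (upd ?W N (enc i)) p0' q0'"
            using p0 2 W4 TmQ_wext by blast+
        qed
        have tj: "Tm ?W (t \<oplus> Var (idx W2) N) (n + j)"
          using t W2 W3 Tm_wext wext_trans j by (intro Tm_plus) blast+
        have W5: "wext W' ?W" using W2 W3 wext_trans by blast
        have "R H ?W (e (t \<oplus> Var (idx W2) N) (\<lambda>p. e' (t \<oplus> Var (idx W2) N) (\<lambda>q. K (p *\<^sub>Q q))))
           (KS (tmul (s (n + j)) (s' (n + j))))"
        proof (rule relED[OF e(1) _ tj, where KS = "\<lambda>q. KS (tmul q (s' (n + j)))"])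
          show "wext W ?W" using W' W5 wext_trans by blast
          fix W6 p q assume 6: "wext ?W W6" "TmQ W6 p q"
          show "R H W6 (e' (t \<oplus> Var (idx W2) N) (\<lambda>q. K (p *\<^sub>Q q))) (KS (tmul q (s' (n + j))))"
          proof (rule relED[OF e(2), where KS = "\<lambda>q'. KS (tmul q q')"])
            show "wext W W6" using W' W5 6 wext_trans by blast
            show "Tm W6 (t \<oplus> Var (idx W2) N) (n + j)" using tj 6 Tm_wext by blast
            fix W7 p' q' assume 7: "wext W6 W7" "TmQ W7 p' q'"
            have "wext W' W7" using W5 6 7 wext_trans by blast
            moreover have "TmQ W7 (p *\<^sub>Q p') (tmul q q')" using 6 7 TmQ_wext by (intro TmQ_mul) blast+
            ultimately show "R H W7 (K (p *\<^sub>Q p')) (KS (tmul q q'))" using K by blast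
          qed
        qed
        then show "R ((H \<and> mbound q0 q0' j) \<and> (\<forall>i. i < j \<longrightarrow> \<not> mbound q0 q0' i)) ?W
           (e (t \<oplus> Var (idx W2) N) (\<lambda>p. e' (t \<oplus> Var (idx W2) N) (\<lambda>q. K (p *\<^sub>Q q))))
           (KS (tmul (s (n + j)) (s' (n + j))))"
          by (rule R_mono) auto
      qed
    qed
  qed
  then show "R H W' (e \<zero> (\<lambda>p0. e' \<zero> (\<lambda>q0. \<^bold>\<exists>k \<^bold>: N.
     mul_bound p0 q0 k \<^bold>\<and> (\<^bold>\<forall>j \<^bold>: N. j \<^bold>< k \<^bold>\<longrightarrow> \<^bold>\<not> mul_bound p0 q0 j) \<^bold>\<and>
     e (t \<oplus> k) (\<lambda>p. e' (t \<oplus> k) (\<lambda>q. K (p *\<^sub>Q q)))))) (KS (tmul (s (n + k)) (s' (n + k))))"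
    by (rule R_cong) (rule Lk)
qed

section \<open>Values of real expressions\<close>

definition fin :: "rl \<Rightarrow> bool" where "fin r \<longleftrightarrow> (\<exists>X. Cauchy_seq X \<and> r = clim X)"

lemma fin_val: "Re x \<Longrightarrow> fin (val x)"
  using Re_Cauchy by (auto simp: fin_def val_def)

lemma fin_rq: "fin (rq q)"
  unfolding fin_def by (intro exI[of _ "\<lambda>_. q"]) (simp add: clim_const)

lemma fin_add: "fin r \<Longrightarrow> fin s \<Longrightarrow> fin (r + s)"
  unfolding fin_def
  by (elim exE conjE, intro exI conjI, rule Cauchy_add, assumption, assumption)
    (simp add: clim_def plus_creal.abs_eq crel_def null_const)

lemma fin_mult: "fin r \<Longrightarrow> fin s \<Longrightarrow> fin (r * s)"
  unfolding fin_def
  by (elim exE conjE, intro exI conjI, rule Cauchy_mult, assumption, assumption)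
    (simp add: clim_def times_creal.abs_eq crel_def null_const)

lemma fin_uminus: "fin r \<Longrightarrow> fin (- r)"
  unfolding fin_def using clim_uminus Cauchy_uminus by metis

lemma fin_abs: "fin r \<Longrightarrow> fin \<bar>r\<bar>"
  using fin_uminus by (auto simp: abs_if)

lemma fin_archimedean:
  assumes "fin r" "fin s" "\<And>n. r \<le> s + 4 * hp n"
  shows "r \<le> s"
proof -
  obtain X Y where XY: "Cauchy_seq X" "Cauchy_seq Y" "r = clim X" "s = clim Y"
    using assms(1,2) by (auto simp: fin_def)
  show ?thesis
    unfolding XY(3,4)
  proof (rule rl_archimedean[OF XY(1,2)])
    fix e :: qq assume "0 < e"
    then obtain n where "hp n < rq e" using hp_small by blast
    \<comment> \<open>Two more halvings absorb the factor 4.\<close>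
    moreover have "hp (n + 1 + 1) = hp n / 2 / 2" by (simp only: hp_simps)
    ultimately show "clim X \<le> clim Y + rq e" using assms(3)[of "n + 1 + 1"] XY(3,4) by simp
  qed
qed

text \<open>The invariant is an error of at most \<open>hp n\<close> at stage \<open>n\<close>. Sums
  and products preserve it thanks to the shifts of the index in their definitions, and it suffices
  to evaluate comparisons.\<close>

definition relV :: "bool \<Rightarrow> world \<Rightarrow> real_exp \<Rightarrow> rl \<Rightarrow> bool" where
  "relV H W e r \<longleftrightarrow> (\<exists>s. relE H W e s \<and>
     (H \<longrightarrow> fin r \<and> (\<forall>n. tok (s n) \<and> \<bar>tval (s n) - r\<bar> \<le> hp n)))"

lemma tri_of_Re: "Re x \<Longrightarrow> tok (tri_of (x \<bullet> n)) \<and> tval (tri_of (x \<bullet> n)) = rq (dq (x \<bullet> n))"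
  using Re_code[of x n] tval_qcode by (auto simp: nn_plus1_pos simp del: dq_qcode tval.simps)

lemma V_val: "Tm W t x \<Longrightarrow> (H \<longrightarrow> Re x) \<Longrightarrow> relV H W \<langle>t\<rangle> (val x)"
  unfolding relV_def
  by (intro exI[of _ "\<lambda>n. tri_of (x \<bullet> n)"] conjI impI relE_val)
    (auto simp: tri_of_Re val_approx fin_val)

lemma V_const: "Tm W s m \<Longrightarrow> Tm W t n \<Longrightarrow> (H \<longrightarrow> 0 < n) \<Longrightarrow> relV H W (rconst (s, \<zero>, t)) (\<iota> m / \<iota> n)"
  unfolding relV_def
proof (intro exI[of _ "\<lambda>_. (m, 0, n)"] conjI impI relE_const)
  show "fin (\<iota> m / \<iota> n)" using fin_rq[of "nq m / nq n"] by (simp add: nr_def)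
qed (auto simp: Tm_zero hp_pos less_imp_le)

lemma V_nat: "Tm W t n \<Longrightarrow> relV H W (rnat t) (\<iota> n)"
  using V_const[of W t n \<one> 1 H] by (simp add: natQ_def Tm_one)

lemma V_add: "relV H W e r \<Longrightarrow> relV H W e' r' \<Longrightarrow> relV H W (e +\<^sub>R e') (r + r')"
  unfolding relV_def
proof (elim exE conjE)
  fix s s' assume e: "relE H W e s" "relE H W e' s'"
    and s: "H \<longrightarrow> fin r \<and> (\<forall>n. tok (s n) \<and> \<bar>tval (s n) - r\<bar> \<le> hp n)"
      "H \<longrightarrow> fin r' \<and> (\<forall>n. tok (s' n) \<and> \<bar>tval (s' n) - r'\<bar> \<le> hp n)"
  show "\<exists>s. relE H W (e +\<^sub>R e') s \<and> (H \<longrightarrow> fin (r + r') \<and> (\<forall>n. tok (s n) \<and> \<bar>tval (s n) - (r + r')\<bar> \<le> hp n))"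
  proof (intro exI conjI impI allI, rule relE_add[OF e])
    assume H
    then show "fin (r + r')" using s fin_add by blast
    fix n
    have *: "tok (s (n + 1))" "tok (s' (n + 1))" "\<bar>tval (s (n + 1)) - r\<bar> \<le> hp n / 2"
      "\<bar>tval (s' (n + 1)) - r'\<bar> \<le> hp n / 2"
      using s \<open>H\<close> hp_simps(2) by metis+
    show "tok (tadd (s (n + 1)) (s' (n + 1)))" using tadd_val[OF *(1,2)] by simp
    show "\<bar>tval (tadd (s (n + 1)) (s' (n + 1))) - (r + r')\<bar> \<le> hp n"
      using tadd_val[OF *(1,2)] *(3,4) by linarith
  qed
qed

lemma V_neg: "relV H W e r \<Longrightarrow> relV H W (-\<^sub>R e) (- r)"
  unfolding relV_def
proof (elim exE conjE)
  fix s assume e: "relE H W e s" and s: "H \<longrightarrow> fin r \<and> (\<forall>n. tok (s n) \<and> \<bar>tval (s n) - r\<bar> \<le> hp n)"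
  show "\<exists>s. relE H W (-\<^sub>R e) s \<and> (H \<longrightarrow> fin (- r) \<and> (\<forall>n. tok (s n) \<and> \<bar>tval (s n) - - r\<bar> \<le> hp n))"
    by (intro exI[of _ "\<lambda>n. tneg (s n)"] conjI relE_neg[OF e])
      (use s in \<open>auto simp: tneg_val fin_uminus abs_minus_commute\<close>)
qed

lemma V_sub: "relV H W e r \<Longrightarrow> relV H W e' r' \<Longrightarrow> relV H W (e -\<^sub>R e') (r - r')"
  unfolding rsub_def using V_add[OF _ V_neg, of H W e r e' r'] by simp

lemma V_abs: "relV H W e r \<Longrightarrow> relV H W \<bar>e\<bar>\<^sub>R \<bar>r\<bar>"
  unfolding relV_def
proof (elim exE conjE)
  fix s assume e: "relE H W e s" and s: "H \<longrightarrow> fin r \<and> (\<forall>n. tok (s n) \<and> \<bar>tval (s n) - r\<bar> \<le> hp n)"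
  have "\<bar>\<bar>a\<bar> - \<bar>r\<bar>\<bar> \<le> h" if "\<bar>a - r\<bar> \<le> h" for a h using that by linarith
  then show "\<exists>s. relE H W \<bar>e\<bar>\<^sub>R s \<and> (H \<longrightarrow> fin \<bar>r\<bar> \<and> (\<forall>n. tok (s n) \<and> \<bar>tval (s n) - \<bar>r\<bar>\<bar> \<le> hp n))"
    by (intro exI[of _ "\<lambda>n. tabs (s n)"] conjI relE_abs[OF e])
      (use s tabs_val in \<open>auto simp: fin_abs\<close>)
qed

lemma hp_add: "hp (n + k) = hp n * hp k"
proof -
  have "p2 (n + k) = p2 n * p2 k"
    by (rule idefp_induct[of "\<lambda>k. p2 (n + k) = p2 n * p2 k"], intro idefp_rules idef_rules idef_p2)
      (simp_all add: p2_simps distrib_left flip: add.assoc)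
  then show ?thesis by (simp add: hp_def)
qed

text \<open>Write \<open>a * b - val x * val y\<close> as
  \<open>a * (b - val y) + (a - val x) * val y\<close>. The summand 2 in \<open>mul_bound\<close>
  pays for the errors of the two 0-th approximations, so that the absolute values of
  \<open>a\<close> and \<open>val y\<close> add up to at most \<open>p2 k\<close>; the shift by
  \<open>k\<close> cancels this factor.\<close>

lemma V_mul:
  assumes "Tm W t x" "Tm W u y" and Re: "H \<longrightarrow> Re x" "H \<longrightarrow> Re y"
  shows "relV H W (\<langle>t\<rangle> *\<^sub>R \<langle>u\<rangle>) (val x * val y)"
proof -
  define s s' where "s n = tri_of (x \<bullet> n)" and "s' n = tri_of (y \<bullet> n)" for n
  define k where "k = lst (mbound (s 0) (s' 0))"
  have e: "relE H W \<langle>t\<rangle> s" "relE H W \<langle>u\<rangle> s'"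
    unfolding s_def s'_def using assms by (auto intro!: relE_val)
  have ok: "tok (s n)" "tok (s' n)" if H for n
    using that Re tri_of_Re by (auto simp: s_def s'_def)
  have "relE H W (\<langle>t\<rangle> *\<^sub>R \<langle>u\<rangle>) (\<lambda>n. tmul (s (n + k)) (s' (n + k)))"
    unfolding k_def using ok by (intro relE_mul[OF e]) blast
  moreover have "tok (tmul (s (n + k)) (s' (n + k))) \<and>
      \<bar>tval (tmul (s (n + k)) (s' (n + k))) - val x * val y\<bar> \<le> hp n" if H for n
  proof -
    have xy: "Re x" "Re y" using that Re by auto
    note m = tmul_val[OF ok(1)[OF that] ok(2)[OF that]]
    define a b where "a = tval (s (n + k))" and "b = tval (s' (n + k))"
    have ab: "a = rq (dq (x \<bullet> (n + k)))" "b = rq (dq (y \<bullet> (n + k)))"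
      using tri_of_Re xy by (auto simp: a_def b_def s_def s'_def)
    have a0: "tval (s 0) = rq (dq (x \<bullet> 0))" "tval (s' 0) = rq (dq (y \<bullet> 0))"
      using tri_of_Re xy by (auto simp: s_def s'_def)
    have "\<exists>j. mbound (s 0) (s' 0) j" using mbound_ex ok that by blast
    then obtain j where "mbound (s 0) (s' 0) j" ..
    then have "mbound (s 0) (s' 0) k" unfolding k_def by (rule lst(1)[OF idefp_mbound])
    then have B: "\<bar>tval (s 0)\<bar> + \<bar>tval (s' 0)\<bar> + 2 \<le> \<iota> (p2 k)" using mbound_iff ok that by blast
    have "\<bar>tval (s 0) - a\<bar> < 1" using Re_diff[OF xy(1), of 0 "n + k"] by (simp add: ab a0 hp_simps)
    moreover have "\<bar>tval (s' 0) - val y\<bar> \<le> 1" using val_approx[OF xy(2), of 0] by (simp add: a0 hp_simps)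
    ultimately have C: "\<bar>a\<bar> + \<bar>val y\<bar> \<le> \<iota> (p2 k)" using B by linarith
    have D: "\<bar>a - val x\<bar> \<le> hp n * hp k" "\<bar>b - val y\<bar> \<le> hp n * hp k"
      using val_approx[OF xy(1), of "n + k"] val_approx[OF xy(2), of "n + k"] by (simp_all add: ab hp_add)
    have "a * b - val x * val y = a * (b - val y) + (a - val x) * val y" by (simp add: algebra_simps)
    then have "\<bar>a * b - val x * val y\<bar> \<le> \<bar>a\<bar> * \<bar>b - val y\<bar> + \<bar>a - val x\<bar> * \<bar>val y\<bar>"
      by (metis abs_mult abs_triangle_ineq)
    also have "\<dots> \<le> \<bar>a\<bar> * (hp n * hp k) + hp n * hp k * \<bar>val y\<bar>"
      using D by (intro add_mono mult_left_mono mult_right_mono) auto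
    also have "\<dots> = (\<bar>a\<bar> + \<bar>val y\<bar>) * (hp n * hp k)" by (simp add: algebra_simps)
    also have "\<dots> \<le> \<iota> (p2 k) * (hp n * hp k)"
      using C hp_pos by (intro mult_right_mono) (auto simp: less_imp_le)
    also have "\<dots> = hp n" using nr_less_iff[of 0 "p2 k"] by (simp add: hp_def del: nr_less_iff)
    finally show ?thesis using m by (simp add: a_def b_def)
  qed
  moreover have "fin (val x * val y)" if H using that Re fin_val fin_mult by blast
  ultimately show ?thesis unfolding relV_def by blast
qed

text \<open>The tolerance of two units covers the approximation errors of both sides, hence
  \<open>r \<le> r'\<close> passes to all approximations. Conversely, the approximations give
  \<open>r \<le> r'\<close> up to four units, which vanish in the limit.\<close>

lemma R_leR: "relV H W e r \<Longrightarrow> relV H W e' r' \<Longrightarrow> R H W (e \<le>\<^sub>R e') (r \<le> r')"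
proof -
  assume "relV H W e r" "relV H W e' r'"
  then obtain s s' where e: "relE H W e s" "relE H W e' s'"
    and s: "H \<longrightarrow> fin r \<and> (\<forall>n. tok (s n) \<and> \<bar>tval (s n) - r\<bar> \<le> hp n)"
      "H \<longrightarrow> fin r' \<and> (\<forall>n. tok (s' n) \<and> \<bar>tval (s' n) - r'\<bar> \<le> hp n)"
    unfolding relV_def by blast
  have "R H W (e \<le>\<^sub>R e') (\<forall>n. tle (s n) (tadd (s' n) (1 + 1, 0, p2 n)))"
    unfolding leR_def
  proof (intro R_all sty_eqs)
    fix n :: nn
    let ?W = "upd W N (enc n)"
    have n: "Tm ?W (Var (idx W) N) n" by (rule Tm_var)
    have W: "wext W ?W" by (intro wext_upd wext_refl)
    show "R H ?W (e (Var (idx W) N) (\<lambda>p. e' (Var (idx W) N) (\<lambda>q. p \<le>\<^sub>Q q +\<^sub>Q (\<one> \<oplus> \<one>, \<zero>, pow2 (Var (idx W) N)))))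
        (tle (s n) (tadd (s' n) (1 + 1, 0, p2 n)))"
    proof (rule relED[OF e(1) W n, where KS = "\<lambda>q. tle q (tadd (s' n) (1 + 1, 0, p2 n))"])
      fix W1 p q assume 1: "wext ?W W1" "TmQ W1 p q"
      show "R H W1 (e' (Var (idx W) N) (\<lambda>q. p \<le>\<^sub>Q q +\<^sub>Q (\<one> \<oplus> \<one>, \<zero>, pow2 (Var (idx W) N))))
          (tle q (tadd (s' n) (1 + 1, 0, p2 n)))"
      proof (rule relED[OF e(2), where KS = "\<lambda>q'. tle q (tadd q' (1 + 1, 0, p2 n))"])
        show "wext W W1" using W 1 wext_trans by blast
        show "Tm W1 (Var (idx W) N) n" using n 1 Tm_wext by blast
        fix W2 p' q' assume 2: "wext W1 W2" "TmQ W2 p' q'"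
        have "Tm W2 (Var (idx W) N) n" using n 1 2 Tm_wext by blast
        then show "R H W2 (p \<le>\<^sub>Q p' +\<^sub>Q (\<one> \<oplus> \<one>, \<zero>, pow2 (Var (idx W) N))) (tle q (tadd q' (1 + 1, 0, p2 n)))"
          by (intro R_leQ TmQ_add TmQ_wext[OF 1(2) 2(1)] 2(2))
            (simp only: TmQ.simps, intro conjI Tm_plus Tm_one Tm_zero Tm_pow2)
      qed
    qed
  qed
  then show ?thesis
  proof (rule R_cong)
    assume H
    have *: "tle (s n) (tadd (s' n) (1 + 1, 0, p2 n)) \<longleftrightarrow> tval (s n) \<le> tval (s' n) + 2 * hp n" for n
    proof -
      have ok: "tok (s n)" "tok (s' n)" "tok (1 + 1, 0, p2 n)" using s \<open>H\<close> by auto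
      show ?thesis using ok tadd_val[OF ok(2,3)] by (simp only: tle_iff tval_hp)
    qed
    have s': "fin r" "fin r'" "\<bar>tval (s n) - r\<bar> \<le> hp n" "\<bar>tval (s' n) - r'\<bar> \<le> hp n" for n
      using s \<open>H\<close> by auto
    show "(\<forall>n. tle (s n) (tadd (s' n) (1 + 1, 0, p2 n))) \<longleftrightarrow> r \<le> r'"
      unfolding *
    proof
      assume le: "\<forall>n. tval (s n) \<le> tval (s' n) + 2 * hp n"
      have "r \<le> r' + 4 * hp n" for n using s'(3,4)[of n] le[rule_format, of n] by linarith
      then show "r \<le> r'" by (rule fin_archimedean[OF s'(1,2)])
    next
      assume "r \<le> r'"
      show "\<forall>n. tval (s n) \<le> tval (s' n) + 2 * hp n"
      proof
        show "tval (s n) \<le> tval (s' n) + 2 * hp n" for n using s'(3,4)[of n] \<open>r \<le> r'\<close> by linarith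
      qed
    qed
  qed
qed

lemma R_ltR: "relV H W e r \<Longrightarrow> relV H W e' r' \<Longrightarrow> R H W (e <\<^sub>R e') (r < r')"
  unfolding ltR_def not_le[symmetric] by (intro R_neg R_leR)

lemma R_eqR: "relV H W e r \<Longrightarrow> relV H W e' r' \<Longrightarrow> R H W (e =\<^sub>R e') (r = r')"
proof -
  assume h: "relV H W e r" "relV H W e' r'"
  have "R H W (e \<le>\<^sub>R e') (r \<le> r')" "R H W (e' \<le>\<^sub>R e) (r' \<le> r)"
    by (rule R_leR[OF h], rule R_leR[OF h(2,1)])
  then show ?thesis
    unfolding eqR_def order.eq_iff[of r r'] by (intro R_conj) (auto intro: R_mono)
qed

end

subsubsection \<open>Well-formedness\<close>

definition wfE :: "real_exp \<Rightarrow> bool" where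
  "wfE e \<longleftrightarrow> (\<forall>t K k. ty_of t = Some N \<longrightarrow>
     (\<forall>a b c k. ty_of a = Some N \<longrightarrow> ty_of b = Some N \<longrightarrow> ty_of c = Some N \<longrightarrow> wff (K (a, b, c) k)) \<longrightarrow>
     wff (e t K k))"

lemmas builder_defs = allq_def exq_def ballq_def bexq_def imp_def neg_def conj_def disj_def iff_def
  eq_def lt_def le_def bot_def

lemma ty_pow2: "ty_of t = Some N \<Longrightarrow> ty_of (pow2 t) = Some N"
  by (simp add: pow2_def)

lemma ty_pair: "ty_of s = Some N \<Longrightarrow> ty_of t = Some N \<Longrightarrow> ty_of (pair s t) = Some N"
  by (simp add: pair_def)

lemma wff_Reals: "ty_of t = Some N\<^sub>1 \<Longrightarrow> wff (Reals t k)"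
  by (simp add: Reals_def decodeQ_def builder_defs half_pow_def ty_pow2 ty_pair)

lemma wfE_val: "ty_of t = Some N\<^sub>1 \<Longrightarrow> wfE \<langle>t\<rangle>"
  by (simp add: wfE_def rval_def decodeQ_def builder_defs ty_pair)

lemma wfE_const: "ty_of a = Some N \<Longrightarrow> ty_of c = Some N \<Longrightarrow> wfE (rconst (a, \<zero>, c))"
  by (simp add: wfE_def rconst_def)

lemma wfE_nat: "ty_of a = Some N \<Longrightarrow> wfE (rnat a)"
  by (simp add: wfE_def rconst_def natQ_def)

lemma wfE_add: "wfE e \<Longrightarrow> wfE e' \<Longrightarrow> wfE (e +\<^sub>R e')"
  by (simp add: wfE_def radd_def)

lemma wfE_neg: "wfE e \<Longrightarrow> wfE (-\<^sub>R e)"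
  by (simp add: wfE_def rneg_def)

lemma wfE_sub: "wfE e \<Longrightarrow> wfE e' \<Longrightarrow> wfE (e -\<^sub>R e')"
  unfolding rsub_def by (intro wfE_add wfE_neg)

lemma wff_absQ:
  assumes "ty_of a = Some N" "ty_of b = Some N" "ty_of c = Some N"
    and "\<And>a b c k. ty_of a = Some N \<Longrightarrow> ty_of b = Some N \<Longrightarrow> ty_of c = Some N \<Longrightarrow> wff (K (a, b, c) k)"
  shows "wff (absQ (a, b, c) K k)"
  using assms by (simp add: absQ_def builder_defs natQ_def)

lemma wfE_abs: "wfE e \<Longrightarrow> wfE \<bar>e\<bar>\<^sub>R"
  by (simp add: wfE_def rabs_def wff_absQ)

lemma wff_mul_bound:
  "ty_of a = Some N \<Longrightarrow> ty_of b = Some N \<Longrightarrow> ty_of c = Some N \<Longrightarrow>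
   ty_of a' = Some N \<Longrightarrow> ty_of b' = Some N \<Longrightarrow> ty_of c' = Some N \<Longrightarrow> ty_of t = Some N \<Longrightarrow>
   wff (mul_bound (a, b, c) (a', b', c') t k)"
  unfolding mul_bound_def by (intro wff_absQ) (simp_all add: builder_defs natQ_def ty_pow2)

lemma wfE_mul: "wfE e \<Longrightarrow> wfE e' \<Longrightarrow> wfE (e *\<^sub>R e')"
  by (simp add: wfE_def rmul_def builder_defs wff_mul_bound)

lemma wff_leR: "wfE e \<Longrightarrow> wfE e' \<Longrightarrow> wff ((e \<le>\<^sub>R e') k)"
  by (simp add: wfE_def leR_def builder_defs ty_pow2)

lemma wff_ltR: "wfE e \<Longrightarrow> wfE e' \<Longrightarrow> wff ((e <\<^sub>R e') k)"
  by (simp add: ltR_def builder_defs wff_leR)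

lemma wff_eqR: "wfE e \<Longrightarrow> wfE e' \<Longrightarrow> wff ((e =\<^sub>R e') k)"
  by (simp add: eqR_def builder_defs wff_leR)

lemmas wff_simps = wff_Reals wfE_val wfE_nat wfE_const wfE_add wfE_sub wfE_abs wfE_mul wff_leR wff_ltR wff_eqR
  elem_def eqM_def

lemma wff_goals: "\<phi> \<in> goals \<Longrightarrow> wff \<phi>"
proof -
  have FC: "wff (Finite_Choice k)" for k
    by (simp add: Finite_Choice_def real_set_def finite_set_def builder_defs wff_simps)
  have QF: "wff (QF_AC_0_1 k)" for k by (simp add: QF_AC_0_1_def builder_defs)
  have met: "wff (metric_space M e d k)"
    if "ty_of M = Some (N\<^sub>1 \<rightarrow> N)" "ty_of e = Some (N\<^sub>1 \<rightarrow> N\<^sub>1 \<rightarrow> N)" "ty_of d = Some (N\<^sub>1 \<rightarrow> N\<^sub>1 \<rightarrow> N\<^sub>1)" for M e d k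
    using that by (simp add: metric_space_def metric_equality_def real_set_def builder_defs wff_simps)
  have seq: "wff (seq_compact_set d C k)"
    if "ty_of C = Some (N\<^sub>1 \<rightarrow> N)" "ty_of d = Some (N\<^sub>1 \<rightarrow> N\<^sub>1 \<rightarrow> N\<^sub>1)" for C d k
    using that by (simp add: seq_compact_set_def builder_defs wff_simps)
  have Ho: "wff (Hoelder M d f k)"
    if "ty_of M = Some (N\<^sub>1 \<rightarrow> N)" "ty_of f = Some (N\<^sub>1 \<rightarrow> N\<^sub>1)" "ty_of d = Some (N\<^sub>1 \<rightarrow> N\<^sub>1 \<rightarrow> N\<^sub>1)" for M d f k
    using that by (simp add: Hoelder_def is_rpow_def is_npow_def builder_defs wff_simps)
  note defs = for_all_metric_spaces_def real_function_def bounded_set_def bounded_function_def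
    subset_of_space_def real_set_def finite_set_def unif_continuous_def Lipschitz_def is_infimum_def
  have "wff (item_a k)" "wff (item_b k)" "wff (item_c_Hoelder k)" "wff (item_c_Lipschitz k)"
    "wff (item_d k)" "wff (item_e k)" for k
    by (simp_all add: item_a_def item_b_def item_c_Hoelder_def item_c_Lipschitz_def item_d_def
        item_e_def defs builder_defs wff_simps met seq Ho)
  then show "\<phi> \<in> goals \<Longrightarrow> wff \<phi>" using FC QF by (auto simp: goals_def imp_def)
qed


subsubsection \<open>The meaning of the definitions\<close>

context model
begin

lemma V_zero: "relV H W 0\<^sub>R 0"
  using V_nat[OF Tm_zero] by simp
lemma V_one: "relV H W 1\<^sub>R 1"
  using V_nat[OF Tm_one] by simp

definition El :: "(n1, nn) ifn \<Rightarrow> n1 \<Rightarrow> bool" where "El X x \<longleftrightarrow> Re x \<and> X \<bullet> x = 1"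

lemma El_Re: "El X x \<Longrightarrow> Re x"
  by (simp add: El_def)

lemma R_elem: "Tm W X M \<Longrightarrow> Tm W t x \<Longrightarrow> R H W (elem X t) (El M x)"
  unfolding elem_def El_def by (intro R_conj R_Reals R_eq Tm_app Tm_one)

lemma R_eqM: "Tm W e E \<Longrightarrow> Tm W s x \<Longrightarrow> Tm W t y \<Longrightarrow> R H W (eqM e s t) (E \<bullet> x \<bullet> y = (1 :: nn))"
  unfolding eqM_def by (intro R_eq Tm_app Tm_one)

lemmas V_rules = V_mul V_zero V_one V_nat V_add V_sub V_abs V_val V_const
lemmas R_all_rules = R_Reals R_elem R_eqM R_leR R_ltR R_eqR V_rules R_rules Tm_rules

definition RS :: "(n1, nn) ifn \<Rightarrow> bool" where
  "RS X \<longleftrightarrow> (\<forall>x. Re x \<longrightarrow> (X \<bullet> x = 0 \<or> X \<bullet> x = 1) \<and> (\<forall>y. Re y \<longrightarrow> val x = val y \<longrightarrow> X \<bullet> x = X \<bullet> y))"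

lemma R_real_set: "Tm W t X \<Longrightarrow> R H W (real_set t) (RS X)"
  unfolding real_set_def RS_def by (assumption | rule R_all_rules | blast)+

lemma below_Re: "\<forall>i. i \<le> n \<longrightarrow> Re ((w :: (nn, n1) ifn) \<bullet> i) \<Longrightarrow> i < j \<Longrightarrow> j \<le> n \<Longrightarrow> Re (w \<bullet> i)"
  by auto

definition finR :: "(n1, nn) ifn \<Rightarrow> bool" where
  "finR X \<longleftrightarrow> (\<exists>n. \<forall>w :: (nn, n1) ifn. (\<forall>i. i \<le> n \<longrightarrow> Re (w \<bullet> i)) \<and>
     (\<forall>i j. i < j \<and> j \<le> n \<longrightarrow> \<not> val (w \<bullet> i) = val (w \<bullet> j)) \<longrightarrow> (\<exists>i. i \<le> n \<and> \<not> El X (w \<bullet> i)))"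

lemma R_finR: "Tm W t X \<Longrightarrow> R H W (finite_set (\<lambda>x y. \<langle>x\<rangle> =\<^sub>R \<langle>y\<rangle>) t) (finR X)"
  unfolding finite_set_def finR_def by (assumption | rule R_all_rules | blast intro: below_Re)+

definition finE :: "(n1, (n1, nn) ifn) ifn \<Rightarrow> (n1, nn) ifn \<Rightarrow> bool" where
  "finE e X \<longleftrightarrow> (\<exists>n. \<forall>w :: (nn, n1) ifn. (\<forall>i. i \<le> n \<longrightarrow> Re (w \<bullet> i)) \<and>
     (\<forall>i j. i < j \<and> j \<le> n \<longrightarrow> \<not> e \<bullet> (w \<bullet> i) \<bullet> (w \<bullet> j) = 1) \<longrightarrow> (\<exists>i. i \<le> n \<and> \<not> El X (w \<bullet> i)))"

lemma R_finE: "Tm W u e \<Longrightarrow> Tm W t X \<Longrightarrow> R H W (finite_set (eqM u) t) (finE e X)"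
  unfolding finite_set_def finE_def by (assumption | rule R_all_rules | blast)+

definition FC :: bool where
  "FC \<longleftrightarrow> (\<forall>X :: (nn, (n1, nn) ifn) ifn.
     (\<forall>n. RS (X \<bullet> n) \<and> (\<forall>x. El (X \<bullet> n) x \<longrightarrow> 0 \<le> val x \<and> val x \<le> 1) \<and>
        (\<exists>x. El (X \<bullet> n) x) \<and> finR (X \<bullet> n)) \<longrightarrow>
     (\<exists>x :: (nn, n1) ifn. \<forall>n. El (X \<bullet> n) (x \<bullet> n)))"

lemma R_FC: "R H W Finite_Choice FC"
  unfolding Finite_Choice_def FC_def
  by (assumption | rule R_real_set R_finR R_all_rules | blast dest: El_Re)+

definition QFAC :: bool where
  "QFAC \<longleftrightarrow> (\<forall>Y :: (n1, n1) ifn. (\<forall>n. \<exists>f :: n1. Y \<bullet> f \<bullet> n = 0) \<longrightarrow>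
     (\<exists>F :: (nn, n1) ifn. \<forall>n. Y \<bullet> (F \<bullet> n) \<bullet> n = 0))"

lemma R_QFAC: "R H W QF_AC_0_1 QFAC"
  unfolding QF_AC_0_1_def QFAC_def by (assumption | rule R_all_rules)+

definition Can :: "n1 \<Rightarrow> bool" where "Can f \<longleftrightarrow> (\<forall>k. f \<bullet> k = 0 \<or> f \<bullet> k = 1)"

lemma R_Cantor: "Tm W t f \<Longrightarrow> R H W (Cantor t) (Can f)"
  unfolding Cantor_def Can_def by (assumption | rule R_all_rules)+

definition IND2 :: bool where
  "IND2 \<longleftrightarrow> (\<forall>Y :: (nn, (n1, nn) ifn) ifn. (\<forall>n. \<exists>f. Can f \<and> Y \<bullet> n \<bullet> f = 0) \<longrightarrow>
     (\<forall>n. \<exists>w :: (nn, n1) ifn. \<forall>i. i < n \<longrightarrow> Can (w \<bullet> i) \<and> Y \<bullet> i \<bullet> (w \<bullet> i) = 0))"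

lemma R_IND2: "R H W IND_2 IND2"
  unfolding IND_2_def IND2_def by (assumption | rule R_Cantor R_all_rules)+

definition metE :: "(n1, nn) ifn \<Rightarrow> (n1, (n1, nn) ifn) ifn \<Rightarrow> bool" where
  "metE M e \<longleftrightarrow> (\<forall>x. El M x \<longrightarrow> (\<forall>y. El M y \<longrightarrow> e \<bullet> x \<bullet> y = 0 \<or> e \<bullet> x \<bullet> y = 1)) \<and>
     (\<forall>x. El M x \<longrightarrow> (\<forall>y. El M y \<longrightarrow> val x = val y \<longrightarrow> e \<bullet> x \<bullet> y = 1)) \<and>
     (\<forall>x. El M x \<longrightarrow> (\<forall>y. El M y \<longrightarrow> e \<bullet> x \<bullet> y = 1 \<longrightarrow> e \<bullet> y \<bullet> x = 1)) \<and>
     (\<forall>x. El M x \<longrightarrow> (\<forall>y. El M y \<longrightarrow> (\<forall>z. El M z \<longrightarrow> e \<bullet> x \<bullet> y = 1 \<and> e \<bullet> y \<bullet> z = 1 \<longrightarrow> e \<bullet> x \<bullet> z = 1)))"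

lemma R_metE: "Tm W t M \<Longrightarrow> Tm W u e \<Longrightarrow> R H W (metric_equality t u) (metE M e)"
  unfolding metric_equality_def metE_def by (assumption | rule R_all_rules | blast dest: El_Re)+

definition metS :: "(n1, nn) ifn \<Rightarrow> (n1, (n1, nn) ifn) ifn \<Rightarrow> (n1, (n1, n1) ifn) ifn \<Rightarrow> bool" where
  "metS M e d \<longleftrightarrow> RS M \<and> (\<exists>x. El M x) \<and> metE M e \<and>
     (\<forall>x. El M x \<longrightarrow> (\<forall>y. El M y \<longrightarrow> Re (d \<bullet> x \<bullet> y))) \<and>
     (\<forall>x. El M x \<longrightarrow> (\<forall>x'. El M x' \<longrightarrow> (\<forall>y. El M y \<longrightarrow> (\<forall>y'. El M y' \<longrightarrow>
        e \<bullet> x \<bullet> x' = 1 \<and> e \<bullet> y \<bullet> y' = 1 \<longrightarrow> val (d \<bullet> x \<bullet> y) = val (d \<bullet> x' \<bullet> y'))))) \<and>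
     (\<forall>x. El M x \<longrightarrow> (\<forall>y. El M y \<longrightarrow> (val (d \<bullet> x \<bullet> y) = 0 \<longleftrightarrow> e \<bullet> x \<bullet> y = 1))) \<and>
     (\<forall>x. El M x \<longrightarrow> (\<forall>y. El M y \<longrightarrow> 0 \<le> val (d \<bullet> x \<bullet> y) \<and> val (d \<bullet> x \<bullet> y) = val (d \<bullet> y \<bullet> x))) \<and>
     (\<forall>x. El M x \<longrightarrow> (\<forall>y. El M y \<longrightarrow> (\<forall>z. El M z \<longrightarrow>
        val (d \<bullet> x \<bullet> z) \<le> val (d \<bullet> x \<bullet> y) + val (d \<bullet> y \<bullet> z))))"

lemma R_metS:
  "Tm W t M \<Longrightarrow> Tm W u e \<Longrightarrow> Tm W v d \<Longrightarrow> R H W (metric_space t u v) (metS M e d)"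
  unfolding metric_space_def metS_def
  by (assumption | rule R_real_set R_metE R_all_rules | blast dest: El_Re)+

lemma metS_Re: "metS M e d \<Longrightarrow> El M x \<Longrightarrow> El M y \<Longrightarrow> Re (d \<bullet> x \<bullet> y)"
  by (simp add: metS_def)

definition subS :: "(n1, nn) ifn \<Rightarrow> (n1, (n1, nn) ifn) ifn \<Rightarrow> (n1, nn) ifn \<Rightarrow> bool" where
  "subS M e C \<longleftrightarrow> RS C \<and> (\<forall>x. El C x \<longrightarrow> El M x) \<and>
     (\<forall>x. El M x \<longrightarrow> (\<forall>y. El M y \<longrightarrow> e \<bullet> x \<bullet> y = 1 \<longrightarrow> C \<bullet> x = C \<bullet> y))"

lemma R_subS:
  "Tm W t M \<Longrightarrow> Tm W u e \<Longrightarrow> Tm W v C \<Longrightarrow> R H W (subset_of_space t u v) (subS M e C)"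
  unfolding subset_of_space_def subS_def by (assumption | rule R_real_set R_all_rules)+

definition RF :: "(n1, nn) ifn \<Rightarrow> (n1, (n1, nn) ifn) ifn \<Rightarrow> (n1, n1) ifn \<Rightarrow> bool" where
  "RF M e f \<longleftrightarrow> (\<forall>x. El M x \<longrightarrow> Re (f \<bullet> x)) \<and>
     (\<forall>x. El M x \<longrightarrow> (\<forall>y. El M y \<longrightarrow> e \<bullet> x \<bullet> y = 1 \<longrightarrow> val (f \<bullet> x) = val (f \<bullet> y)))"

lemma R_RF: "Tm W t M \<Longrightarrow> Tm W u e \<Longrightarrow> Tm W v f \<Longrightarrow> R H W (real_function t u v) (RF M e f)"
  unfolding real_function_def RF_def by (assumption | rule R_all_rules | blast)+

lemma RF_Re: "RF M e f \<Longrightarrow> El M x \<Longrightarrow> Re (f \<bullet> x)"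
  by (simp add: RF_def)

definition seqc :: "(n1, (n1, n1) ifn) ifn \<Rightarrow> (n1, nn) ifn \<Rightarrow> bool" where
  "seqc d C \<longleftrightarrow> (\<forall>s :: (nn, n1) ifn. (\<forall>n. El C (s \<bullet> n)) \<longrightarrow>
     (\<exists>g :: n1. (\<forall>n. g \<bullet> n < g \<bullet> (n + 1)) \<and>
       (\<exists>x. El C x \<and> (\<forall>\<epsilon>. Re \<epsilon> \<longrightarrow> 0 < val \<epsilon> \<longrightarrow>
         (\<exists>m. \<forall>n. m \<le> n \<longrightarrow> val (d \<bullet> (s \<bullet> (g \<bullet> n)) \<bullet> x) < val \<epsilon>)))))"

lemma R_seqc:
  "Tm W v d \<Longrightarrow> Tm W t C \<Longrightarrow> (\<And>x y. H \<Longrightarrow> El C x \<Longrightarrow> El C y \<Longrightarrow> Re (d \<bullet> x \<bullet> y)) \<Longrightarrow>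
   R H W (seq_compact_set v t) (seqc d C)"
  unfolding seq_compact_set_def seqc_def by (assumption | rule R_all_rules | blast)+

definition bddS :: "(n1, nn) ifn \<Rightarrow> (n1, (n1, n1) ifn) ifn \<Rightarrow> (n1, nn) ifn \<Rightarrow> bool" where
  "bddS M d C \<longleftrightarrow> (\<exists>w. El M w \<and> (\<exists>m. \<forall>v. El C v \<longrightarrow> val (d \<bullet> v \<bullet> w) \<le> \<iota> m))"

lemma R_bddS:
  "Tm W t M \<Longrightarrow> Tm W v d \<Longrightarrow> Tm W u C \<Longrightarrow> (\<And>x y. H \<Longrightarrow> El C x \<Longrightarrow> El M y \<Longrightarrow> Re (d \<bullet> x \<bullet> y)) \<Longrightarrow>
   R H W (bounded_set t v u) (bddS M d C)"
  unfolding bounded_set_def bddS_def by (assumption | rule R_all_rules | blast)+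

definition bddF :: "(n1, nn) ifn \<Rightarrow> (n1, n1) ifn \<Rightarrow> bool" where
  "bddF M f \<longleftrightarrow> (\<exists>m. \<forall>x. El M x \<longrightarrow> \<bar>val (f \<bullet> x)\<bar> \<le> \<iota> m)"

lemma R_bddF:
  "Tm W t M \<Longrightarrow> Tm W v f \<Longrightarrow> (\<And>x. H \<Longrightarrow> El M x \<Longrightarrow> Re (f \<bullet> x)) \<Longrightarrow>
   R H W (bounded_function t v) (bddF M f)"
  unfolding bounded_function_def bddF_def by (assumption | rule R_all_rules | blast)+

definition unifc :: "(n1, nn) ifn \<Rightarrow> (n1, (n1, n1) ifn) ifn \<Rightarrow> (n1, n1) ifn \<Rightarrow> bool" where
  "unifc M d f \<longleftrightarrow> (\<forall>\<epsilon>. Re \<epsilon> \<longrightarrow> 0 < val \<epsilon> \<longrightarrow> (\<exists>\<delta>. Re \<delta> \<and> 0 < val \<delta> \<and>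
     (\<forall>v. El M v \<longrightarrow> (\<forall>w. El M w \<longrightarrow> val (d \<bullet> v \<bullet> w) < val \<delta> \<longrightarrow>
       \<bar>val (f \<bullet> v) - val (f \<bullet> w)\<bar> < val \<epsilon>))))"

lemma R_unifc:
  "Tm W t M \<Longrightarrow> Tm W u d \<Longrightarrow> Tm W v f \<Longrightarrow>
   (\<And>x y. H \<Longrightarrow> El M x \<Longrightarrow> El M y \<Longrightarrow> Re (d \<bullet> x \<bullet> y)) \<Longrightarrow> (\<And>x. H \<Longrightarrow> El M x \<Longrightarrow> Re (f \<bullet> x)) \<Longrightarrow>
   R H W (unif_continuous t u v) (unifc M d f)"
  unfolding unif_continuous_def unifc_def by (assumption | rule R_all_rules | blast)+

definition npow :: "n1 \<Rightarrow> nn \<Rightarrow> n1 \<Rightarrow> bool" where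
  "npow x n y \<longleftrightarrow> (\<exists>s :: (nn, n1) ifn. (\<forall>i. Re (s \<bullet> i)) \<and> val (s \<bullet> 0) = 1 \<and>
     (\<forall>i. i < n \<longrightarrow> val (s \<bullet> (i + 1)) = val (s \<bullet> i) * val x) \<and> val y = val (s \<bullet> n))"

lemma R_npow:
  "Tm W t x \<Longrightarrow> Tm W u n \<Longrightarrow> Tm W v y \<Longrightarrow> (H \<longrightarrow> Re x) \<Longrightarrow> (H \<longrightarrow> Re y) \<Longrightarrow>
   R H W (is_npow t u v) (npow x n y)"
  unfolding is_npow_def npow_def by (assumption | rule R_all_rules | blast)+

definition rpow :: "n1 \<Rightarrow> n1 \<Rightarrow> n1 \<Rightarrow> bool" where
  "rpow x \<alpha> y \<longleftrightarrow> 0 \<le> val y \<and> (\<forall>m n. 0 < n \<longrightarrow>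
     (\<forall>u. Re u \<longrightarrow> (\<forall>v. Re v \<longrightarrow> npow x m u \<and> npow y n v \<longrightarrow>
       (\<iota> m / \<iota> n \<le> val \<alpha> \<longrightarrow> (1 \<le> val x \<longrightarrow> val u \<le> val v) \<and> (val x \<le> 1 \<longrightarrow> val v \<le> val u)) \<and>
       (val \<alpha> \<le> \<iota> m / \<iota> n \<longrightarrow> (1 \<le> val x \<longrightarrow> val v \<le> val u) \<and> (val x \<le> 1 \<longrightarrow> val u \<le> val v)))))"

lemma R_rpow:
  "Tm W t x \<Longrightarrow> Tm W u \<alpha> \<Longrightarrow> Tm W v y \<Longrightarrow> (H \<longrightarrow> Re x) \<Longrightarrow> (H \<longrightarrow> Re \<alpha>) \<Longrightarrow> (H \<longrightarrow> Re y) \<Longrightarrow>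
   R H W (is_rpow t u v) (rpow x \<alpha> y)"
  unfolding is_rpow_def rpow_def by (assumption | rule R_npow R_all_rules | blast)+

definition Hoel :: "(n1, nn) ifn \<Rightarrow> (n1, (n1, n1) ifn) ifn \<Rightarrow> (n1, n1) ifn \<Rightarrow> bool" where
  "Hoel M d f \<longleftrightarrow> (\<exists>K. Re K \<and> (\<exists>\<alpha>. Re \<alpha> \<and> 0 < val K \<and> 0 < val \<alpha> \<and>
     (\<forall>v. El M v \<longrightarrow> (\<forall>w. El M w \<longrightarrow> (\<exists>p. Re p \<and> rpow (d \<bullet> v \<bullet> w) \<alpha> p \<and>
       \<bar>val (f \<bullet> v) - val (f \<bullet> w)\<bar> \<le> val K * val p)))))"

lemma R_Hoel:
  "Tm W t M \<Longrightarrow> Tm W u d \<Longrightarrow> Tm W v f \<Longrightarrow>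
   (\<And>x y. H \<Longrightarrow> El M x \<Longrightarrow> El M y \<Longrightarrow> Re (d \<bullet> x \<bullet> y)) \<Longrightarrow> (\<And>x. H \<Longrightarrow> El M x \<Longrightarrow> Re (f \<bullet> x)) \<Longrightarrow>
   R H W (Hoelder t u v) (Hoel M d f)"
  unfolding Hoelder_def Hoel_def by (assumption | rule R_rpow R_all_rules | blast)+

definition Lips :: "(n1, nn) ifn \<Rightarrow> (n1, (n1, n1) ifn) ifn \<Rightarrow> (n1, n1) ifn \<Rightarrow> bool" where
  "Lips M d f \<longleftrightarrow> (\<exists>K. Re K \<and> 0 < val K \<and> (\<forall>v. El M v \<longrightarrow> (\<forall>w. El M w \<longrightarrow>
       \<bar>val (f \<bullet> v) - val (f \<bullet> w)\<bar> \<le> val K * val (d \<bullet> v \<bullet> w))))"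

lemma R_Lips:
  "Tm W t M \<Longrightarrow> Tm W u d \<Longrightarrow> Tm W v f \<Longrightarrow>
   (\<And>x y. H \<Longrightarrow> El M x \<Longrightarrow> El M y \<Longrightarrow> Re (d \<bullet> x \<bullet> y)) \<Longrightarrow> (\<And>x. H \<Longrightarrow> El M x \<Longrightarrow> Re (f \<bullet> x)) \<Longrightarrow>
   R H W (Lipschitz t u v) (Lips M d f)"
  unfolding Lipschitz_def Lips_def by (assumption | rule R_all_rules | blast)+

definition infS :: "(n1, nn) ifn \<Rightarrow> (n1, n1) ifn \<Rightarrow> n1 \<Rightarrow> bool" where
  "infS M f y \<longleftrightarrow> (\<forall>x. El M x \<longrightarrow> val y \<le> val (f \<bullet> x)) \<and>
     (\<forall>z. Re z \<longrightarrow> (\<forall>x. El M x \<longrightarrow> val z \<le> val (f \<bullet> x)) \<longrightarrow> val z \<le> val y)"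

lemma R_infS:
  "Tm W t M \<Longrightarrow> Tm W v f \<Longrightarrow> Tm W u y \<Longrightarrow> (\<And>x. H \<Longrightarrow> El M x \<Longrightarrow> Re (f \<bullet> x)) \<Longrightarrow> (H \<longrightarrow> Re y) \<Longrightarrow>
   R H W (is_infimum t v u) (infS M f y)"
  unfolding is_infimum_def infS_def by (assumption | rule R_all_rules | blast)+

section \<open>The items as statements about the model\<close>

definition itemA :: bool where
  "itemA \<longleftrightarrow> (\<forall>M e d. metS M e d \<longrightarrow> (\<forall>C. subS M e C \<and> seqc d C \<longrightarrow> bddS M d C))"
definition itemB :: bool where
  "itemB \<longleftrightarrow> (\<forall>M e d. metS M e d \<longrightarrow> seqc d M \<longrightarrow> (\<forall>f. RF M e f \<and> unifc M d f \<longrightarrow> bddF M f))"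
definition itemCH :: bool where
  "itemCH \<longleftrightarrow> (\<forall>M e d. metS M e d \<longrightarrow> seqc d M \<longrightarrow> (\<forall>f. RF M e f \<and> Hoel M d f \<longrightarrow> bddF M f))"
definition itemCL :: bool where
  "itemCL \<longleftrightarrow> (\<forall>M e d. metS M e d \<longrightarrow> seqc d M \<longrightarrow> (\<forall>f. RF M e f \<and> Lips M d f \<longrightarrow> bddF M f))"
definition itemD :: bool where
  "itemD \<longleftrightarrow> (\<forall>M e d. metS M e d \<longrightarrow> seqc d M \<and> \<not> finE e M \<longrightarrow>
     (\<exists>f. RF M e f \<and> bddF M f \<and> \<not> Lips M d f))"
definition itemE :: bool where
  "itemE \<longleftrightarrow> (\<forall>M e d. metS M e d \<longrightarrow> seqc d M \<and> bddS M d M \<longrightarrow>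
     (\<forall>f y. Re y \<longrightarrow> RF M e f \<and> Lips M d f \<and> infS M f y \<longrightarrow> (\<exists>x. El M x \<and> val (f \<bullet> x) = val y)))"

lemma subS_Re: "metS M e d \<Longrightarrow> subS M e C \<Longrightarrow> El C x \<Longrightarrow> El C y \<Longrightarrow> Re (d \<bullet> x \<bullet> y)"
  "metS M e d \<Longrightarrow> subS M e C \<Longrightarrow> El C x \<Longrightarrow> El M y \<Longrightarrow> Re (d \<bullet> x \<bullet> y)"
  by (simp_all add: metS_def subS_def)

lemmas R_items = R_metS R_subS R_RF R_seqc R_bddS R_bddF R_unifc R_Hoel R_Lips R_infS R_finE

lemma R_item_a: "R H W item_a itemA"
  unfolding item_a_def itemA_def for_all_metric_spaces_def
  by (assumption | rule R_items R_all_rules | blast intro: metS_Re subS_Re)+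
lemma R_item_b: "R H W item_b itemB"
  unfolding item_b_def itemB_def for_all_metric_spaces_def
  by (assumption | rule R_items R_all_rules | blast intro: metS_Re RF_Re)+
lemma R_item_c_Hoelder: "R H W item_c_Hoelder itemCH"
  unfolding item_c_Hoelder_def itemCH_def for_all_metric_spaces_def
  by (assumption | rule R_items R_all_rules | blast intro: metS_Re RF_Re)+
lemma R_item_c_Lipschitz: "R H W item_c_Lipschitz itemCL"
  unfolding item_c_Lipschitz_def itemCL_def for_all_metric_spaces_def
  by (assumption | rule R_items R_all_rules | blast intro: metS_Re RF_Re)+
lemma R_item_d: "R H W item_d itemD"
  unfolding item_d_def itemD_def for_all_metric_spaces_def
  by (assumption | rule R_items R_all_rules | blast intro: metS_Re RF_Re)+
lemma R_item_e: "R H W item_e itemE"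
  unfolding item_e_def itemE_def for_all_metric_spaces_def
  by (assumption | rule R_items R_all_rules | blast intro: metS_Re RF_Re)+

lemma IND2_holds: IND2
proof -
  have R: "R True (\<lambda>z. SOME a. a \<in> Dm (snd z), 0, {}) IND_2 IND2" by (rule R_IND2)
  have "wff (sentence IND_2)" by (simp add: IND_2_def Cantor_def builder_defs)
  with R SatM_axiom[of "sentence IND_2"] show ?thesis by (simp add: axioms_used_def)
qed

text \<open>By \<open>SatM_goals\<close>, one of the twelve sentences is not both closed and true in
  the model, whereas their meanings make all of them closed and true.\<close>

lemma contradiction_if_all:
  assumes "itemA \<longrightarrow> FC" "itemB \<longrightarrow> FC" "itemCH \<longrightarrow> FC" "itemCL \<longrightarrow> FC" "itemD \<longrightarrow> FC" "itemE \<longrightarrow> FC"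
    and "QFAC \<longrightarrow> itemA" "QFAC \<longrightarrow> itemB" "QFAC \<longrightarrow> itemCH" "QFAC \<longrightarrow> itemCL" "QFAC \<longrightarrow> itemD" "QFAC \<longrightarrow> itemE"
  shows False
proof -
  let ?w = "\<lambda>z. SOME a. a \<in> Dm (snd z)"
  have 1: "fv (sentence (A \<^bold>\<longrightarrow> B)) = {} \<and> SatM ?w (sentence (A \<^bold>\<longrightarrow> B))"
    if "R True (?w, 0, {}) A P" "R True (?w, 0, {}) B Q" "P \<longrightarrow> Q" for A B P Q
    using that by (simp add: imp_def)
  define ok where "ok \<phi> \<longleftrightarrow> fv \<phi> = {} \<and> SatM ?w \<phi>" for \<phi>
  note items = R_item_a R_item_b R_item_c_Hoelder R_item_c_Lipschitz R_item_d R_item_e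
  have g: "ok (sentence (item_a \<^bold>\<longrightarrow> Finite_Choice))" "ok (sentence (item_b \<^bold>\<longrightarrow> Finite_Choice))" "ok (sentence (item_c_Hoelder \<^bold>\<longrightarrow> Finite_Choice))" "ok (sentence (item_c_Lipschitz \<^bold>\<longrightarrow> Finite_Choice))" "ok (sentence (item_d \<^bold>\<longrightarrow> Finite_Choice))" "ok (sentence (item_e \<^bold>\<longrightarrow> Finite_Choice))"
    by (unfold ok_def, rule 1[OF items(1) R_FC assms(1)], rule 1[OF items(2) R_FC assms(2)], rule 1[OF items(3) R_FC assms(3)], rule 1[OF items(4) R_FC assms(4)], rule 1[OF items(5) R_FC assms(5)], rule 1[OF items(6) R_FC assms(6)])
  have h: "ok (sentence (QF_AC_0_1 \<^bold>\<longrightarrow> item_a))" "ok (sentence (QF_AC_0_1 \<^bold>\<longrightarrow> item_b))" "ok (sentence (QF_AC_0_1 \<^bold>\<longrightarrow> item_c_Hoelder))" "ok (sentence (QF_AC_0_1 \<^bold>\<longrightarrow> item_c_Lipschitz))" "ok (sentence (QF_AC_0_1 \<^bold>\<longrightarrow> item_d))" "ok (sentence (QF_AC_0_1 \<^bold>\<longrightarrow> item_e))"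
    by (unfold ok_def, rule 1[OF R_QFAC items(1) assms(7)], rule 1[OF R_QFAC items(2) assms(8)], rule 1[OF R_QFAC items(3) assms(9)], rule 1[OF R_QFAC items(4) assms(10)], rule 1[OF R_QFAC items(5) assms(11)], rule 1[OF R_QFAC items(6) assms(12)])
  have "\<forall>\<phi> \<in> goals. ok \<phi>"
    unfolding goals_def by (simp only: ball_UN ball_simps g h simp_thms)
  then have "fv \<phi> = {} \<and> SatM ?w \<phi>" if "\<phi> \<in> goals" for \<phi> using that by (simp only: ok_def)
  with SatM_goals show False by blast
qed


subsection \<open>The items follow from quantifier-free choice\<close>

lemma idefp_El: "idef f \<Longrightarrow> idef g \<Longrightarrow> idefp (\<lambda>c :: 'c :: ctx. El (f c) (g c))"
  unfolding El_def by (intro idefp_rules idefp_Re idef_rules)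

text \<open>Every internally definable condition has a characteristic functional, so numerical
  quantifiers are allowed in the matrix of the choice principle.\<close>

lemma QFAC_choice:
  assumes QFAC "idefp (\<lambda>p :: nn \<times> n1 \<times> unit. P (fst p) (fst (snd p)))" "\<And>n. \<exists>x. P n x"
  shows "\<exists>F :: (nn, n1) ifn. \<forall>n. P n (F \<bullet> n)"
proof -
  have Y: "Lam (\<lambda>x. Lam (\<lambda>n. if P n x then 0 else 1 :: nn)) \<bullet> x \<bullet> n = (if P n x then 0 else 1)" for x n
    by (rule beta2) (use assms(2) in \<open>simp add: idefp_def\<close>)
  have "\<exists>F :: (nn, n1) ifn. \<forall>n. Lam (\<lambda>x. Lam (\<lambda>n. if P n x then 0 else 1 :: nn)) \<bullet> (F \<bullet> n) \<bullet> n = 0"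
  proof (rule assms(1)[unfolded QFAC_def, rule_format])
    fix n obtain x where "P n x" using assms(3) by blast
    then show "\<exists>x. Lam (\<lambda>x. Lam (\<lambda>n. if P n x then 0 else 1 :: nn)) \<bullet> x \<bullet> n = 0"
      by (intro exI[of _ x]) (simp add: Y)
  qed
  then show ?thesis using one_neq_zero by (auto simp: Y split: if_splits)
qed

lemma increasing_ge: "\<forall>n. g \<bullet> n < g \<bullet> (n + 1) \<Longrightarrow> n \<le> g \<bullet> n" for g :: n1
proof (rule idefp_induct[of "\<lambda>n. n \<le> g \<bullet> n"], intro idefp_rules idef_rules)
  fix n assume g: "\<forall>n. g \<bullet> n < g \<bullet> (n + 1)" and "n \<le> g \<bullet> n"
  then have "n < g \<bullet> (n + 1)" by (meson le_less_trans)
  then show "n + 1 \<le> g \<bullet> (n + 1)" using basic(8)[of "g \<bullet> (n + 1)" n] by (metis not_le not_less_iff_gr_or_eq)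
qed simp

lemma val_cq_nat: "val (cq n 0 0) = \<iota> n" "val (cq 0 n 0) = - \<iota> n"
  by simp_all

lemma seqcE:
  fixes s :: "(nn, n1) ifn"
  assumes "seqc d C" "\<And>n. El C (s \<bullet> n)"
  obtains g :: n1 and x where "\<forall>n. g \<bullet> n < g \<bullet> (n + 1)" "El C x"
    "\<forall>\<epsilon>. Re \<epsilon> \<longrightarrow> 0 < val \<epsilon> \<longrightarrow> (\<exists>m. \<forall>n. m \<le> n \<longrightarrow> val (d \<bullet> (s \<bullet> (g \<bullet> n)) \<bullet> x) < val \<epsilon>)"
proof -
  have "\<forall>n. El C (s \<bullet> n)" using assms(2) by blast
  from assms(1)[unfolded seqc_def, rule_format, OF this[rule_format]] show thesis
    using that by blast
qed

text \<open>A function without a bound yields points where it exceeds every natural number; it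
  cannot be bounded near the limit of a convergent subsequence.\<close>

lemma locally_bounded:
  assumes QFAC "seqc d C" and Re: "\<And>x. El C x \<Longrightarrow> Re (f \<bullet> x)"
    and loc: "\<And>x. El C x \<Longrightarrow> \<exists>\<epsilon> B. Re \<epsilon> \<and> 0 < val \<epsilon> \<and>
      (\<forall>v. El C v \<longrightarrow> val (d \<bullet> v \<bullet> x) < val \<epsilon> \<longrightarrow> \<bar>val (f \<bullet> v)\<bar> \<le> \<iota> B)"
  shows "\<exists>m. \<forall>x. El C x \<longrightarrow> \<bar>val (f \<bullet> x)\<bar> \<le> \<iota> m"
proof (rule ccontr)
  assume no: "\<not> ?thesis"
  \<comment> \<open>The comparison of the absolute value with \<open>n\<close> is expressed by
    \<open>vle\<close>, so that choice applies to it.\<close>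
  define P where "P n v \<longleftrightarrow> El C v \<and> \<not> (vle (f \<bullet> v) (cq n 0 0) \<and> vle (cq 0 n 0) (f \<bullet> v))" for n v
  have P: "P n v \<longleftrightarrow> El C v \<and> \<iota> n < \<bar>val (f \<bullet> v)\<bar>" for n v
    unfolding P_def using Re by (auto simp: vle_iff abs_le_iff not_le[symmetric] simp del: val_cq simp: val_cq_nat)
  have "\<exists>F :: (nn, n1) ifn. \<forall>n. P n (F \<bullet> n)"
  proof (rule QFAC_choice[OF assms(1)])
    show "idefp (\<lambda>p :: nn \<times> n1 \<times> unit. P (fst p) (fst (snd p)))"
      unfolding P_def by (intro idefp_rules idefp_El idefp_vle idef_cq idef_rules)
    show "\<exists>v. P n v" for n using no by (simp add: P not_le)
  qed
  then obtain s :: "(nn, n1) ifn" where s: "\<And>n. El C (s \<bullet> n)" "\<And>n. \<iota> n < \<bar>val (f \<bullet> (s \<bullet> n))\<bar>"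
    by (auto simp: P)
  obtain g :: n1 and x where g: "\<forall>n. g \<bullet> n < g \<bullet> (n + 1)" and x: "El C x" and
    lim: "\<forall>\<epsilon>. Re \<epsilon> \<longrightarrow> 0 < val \<epsilon> \<longrightarrow> (\<exists>m. \<forall>n. m \<le> n \<longrightarrow> val (d \<bullet> (s \<bullet> (g \<bullet> n)) \<bullet> x) < val \<epsilon>)"
    by (rule seqcE[OF assms(2) s(1)]) blast
  obtain \<epsilon> B where \<epsilon>: "Re \<epsilon>" "0 < val \<epsilon>"
    "\<And>v. El C v \<Longrightarrow> val (d \<bullet> v \<bullet> x) < val \<epsilon> \<Longrightarrow> \<bar>val (f \<bullet> v)\<bar> \<le> \<iota> B"
    using loc[OF x] by blast
  obtain m where m: "\<And>n. m \<le> n \<Longrightarrow> val (d \<bullet> (s \<bullet> (g \<bullet> n)) \<bullet> x) < val \<epsilon>" using lim[rule_format, OF \<epsilon>(1,2)] by blast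
  \<comment> \<open>The index \<open>m + B\<close> is late enough for closeness to \<open>x\<close>,
    and its image under \<open>g\<close> is at least \<open>B\<close>, beyond which the values of
    \<open>f\<close> must exceed \<open>B\<close>.\<close>
  have "\<bar>val (f \<bullet> (s \<bullet> (g \<bullet> (m + B))))\<bar> \<le> \<iota> B" using s(1) m by (intro \<epsilon>(3)) simp_all
  then have "\<iota> (g \<bullet> (m + B)) < \<iota> B" using s(2) by (rule less_le_trans[rotated])
  then have "g \<bullet> (m + B) < B" by simp
  then have "m + B < B" using increasing_ge[OF g] by (rule le_less_trans[rotated])
  then show False by (simp add: basic(7))
qed

lemma val_bound': "Re x \<Longrightarrow> \<exists>m. val x \<le> \<iota> m"
  using val_bound by (meson abs_le_D1)

lemma unit_ball: "Re (cq 1 0 0)" "val (cq 1 0 0) = 1"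
  by simp_all

text \<open>The function to be bounded on \<open>C\<close> is the distance from a fixed point; on
  the unit ball around \<open>x\<close> it exceeds its value at \<open>x\<close> by at most
  1.\<close>

lemma QFAC_itemA: "QFAC \<longrightarrow> itemA"
  unfolding itemA_def
proof (intro impI allI)
  fix M e d C assume Q: QFAC and met: "metS M e d" and C: "subS M e C \<and> seqc d C"
  obtain w where w: "El M w" using met by (auto simp: metS_def)
  define f where "f = Lam (\<lambda>v. d \<bullet> v \<bullet> w)"
  have f: "f \<bullet> v = d \<bullet> v \<bullet> w" for v unfolding f_def by (rule beta) (intro idef_rules)
  have CM: "El C v \<Longrightarrow> El M v" for v using C by (simp add: subS_def)
  have Red: "El C v \<Longrightarrow> Re (d \<bullet> v \<bullet> w)" for v using CM w met metS_Re by blast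
  have "\<exists>m. \<forall>x. El C x \<longrightarrow> \<bar>val (f \<bullet> x)\<bar> \<le> \<iota> m"
  proof (rule locally_bounded[OF Q, of d])
    show "seqc d C" using C by simp
    show "Re (f \<bullet> x)" if "El C x" for x using Red[OF that] by (simp add: f)
    fix x assume x: "El C x"
    obtain b where b: "val (d \<bullet> x \<bullet> w) \<le> \<iota> b" using val_bound' Red x by blast
    have "\<bar>val (d \<bullet> v \<bullet> w)\<bar> \<le> \<iota> (b + 1)" if "El C v" "val (d \<bullet> v \<bullet> x) < 1" for v
    proof -
      have "val (d \<bullet> v \<bullet> w) \<le> val (d \<bullet> v \<bullet> x) + val (d \<bullet> x \<bullet> w)" "0 \<le> val (d \<bullet> v \<bullet> w)"
        using met CM that(1) x w by (auto simp: metS_def)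
      then show ?thesis using b that(2) by simp
    qed
    then show "\<exists>\<epsilon> B. Re \<epsilon> \<and> 0 < val \<epsilon> \<and>
        (\<forall>v. El C v \<longrightarrow> val (d \<bullet> v \<bullet> x) < val \<epsilon> \<longrightarrow> \<bar>val (f \<bullet> v)\<bar> \<le> \<iota> B)"
      using unit_ball by (intro exI[of _ "cq 1 0 0"] exI[of _ "b + 1"]) (simp add: f)
  qed
  then show "bddS M d C" using w unfolding bddS_def f by (meson abs_le_D1)
qed

text \<open>The common consequence of the three notions of continuity: on some fixed scale
  \<open>\<delta>\<close> the function varies by at most a constant \<open>K\<close>.\<close>

lemma unit_bound_bddF:
  assumes QFAC "metS M e d" "seqc d M" "RF M e f" "Re \<delta>" "0 < val \<delta>"
    and bd: "\<And>v w. El M v \<Longrightarrow> El M w \<Longrightarrow> val (d \<bullet> v \<bullet> w) < val \<delta> \<Longrightarrow> \<bar>val (f \<bullet> v) - val (f \<bullet> w)\<bar> \<le> \<iota> K"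
  shows "bddF M f"
  unfolding bddF_def
proof (rule locally_bounded[OF assms(1,3)])
  show "Re (f \<bullet> x)" if "El M x" for x using RF_Re[OF assms(4) that] .
  fix x assume x: "El M x"
  obtain b where b: "\<bar>val (f \<bullet> x)\<bar> \<le> \<iota> b" using val_bound RF_Re[OF assms(4) x] by blast
  have "\<bar>val (f \<bullet> v)\<bar> \<le> \<iota> (K + b)" if "El M v" "val (d \<bullet> v \<bullet> x) < val \<delta>" for v
    using bd[OF that(1) x that(2)] b by (simp add: abs_le_iff)
  then show "\<exists>\<epsilon> B. Re \<epsilon> \<and> 0 < val \<epsilon> \<and>
      (\<forall>v. El M v \<longrightarrow> val (d \<bullet> v \<bullet> x) < val \<epsilon> \<longrightarrow> \<bar>val (f \<bullet> v)\<bar> \<le> \<iota> B)"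
    using assms(5,6) by blast
qed

lemma QFAC_itemB: "QFAC \<longrightarrow> itemB"
  unfolding itemB_def
proof (intro impI allI)
  fix M e d f assume *: QFAC "metS M e d" "seqc d M" and f: "RF M e f \<and> unifc M d f"
  obtain \<delta> where \<delta>: "Re \<delta>" "0 < val \<delta>" "\<And>v w. El M v \<Longrightarrow> El M w \<Longrightarrow> val (d \<bullet> v \<bullet> w) < val \<delta> \<Longrightarrow>
      \<bar>val (f \<bullet> v) - val (f \<bullet> w)\<bar> < 1"
    using f unit_ball zero_less_one unfolding unifc_def by metis
  show "bddF M f"
    using f \<delta>(3) by (intro unit_bound_bddF[OF * _ \<delta>(1,2), where K = 1]) (auto simp: less_imp_le)
qed

lemma QFAC_itemCL: "QFAC \<longrightarrow> itemCL"
  unfolding itemCL_def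
proof (intro impI allI)
  fix M e d f assume *: QFAC "metS M e d" "seqc d M" and f: "RF M e f \<and> Lips M d f"
  obtain K where K: "Re K" "0 < val K" "\<And>v w. El M v \<Longrightarrow> El M w \<Longrightarrow>
      \<bar>val (f \<bullet> v) - val (f \<bullet> w)\<bar> \<le> val K * val (d \<bullet> v \<bullet> w)"
    using f unfolding Lips_def by metis
  obtain b where b: "val K \<le> \<iota> b" using val_bound' K(1) by blast
  show "bddF M f"
  proof (rule unit_bound_bddF[OF * _ unit_ball(1), where K = b])
    show "\<bar>val (f \<bullet> v) - val (f \<bullet> w)\<bar> \<le> \<iota> b" if "El M v" "El M w" "val (d \<bullet> v \<bullet> w) < val (cq 1 0 0)" for v w
    proof -
      have "val K * val (d \<bullet> v \<bullet> w) \<le> val K * 1" using that(3) K(2) by (intro mult_left_mono) simp_all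
      then show ?thesis using K(3)[OF that(1,2)] b by simp
    qed
  qed (use f in simp_all)
qed

text \<open>For exponent \<open>0 / 1\<close> the definition of powers says \<open>p \<le> 1\<close> whenever the distance is at
  most 1, which is all that is needed of \<open>p\<close>.\<close>

lemma rpow_le_one:
  assumes "rpow x \<alpha> p" "Re x" "Re p" "0 < val \<alpha>" "val x \<le> 1"
  shows "val p \<le> 1"
proof -
  have const: "Lam (\<lambda>_ :: nn. y) \<bullet> i = y" for y :: n1 and i by (rule beta) (rule idef_const)
  have "npow x 0 (cq 1 0 0)"
    unfolding npow_def by (intro exI[of _ "Lam (\<lambda>_. cq 1 0 0)"]) (simp add: const basic(7))
  moreover have "npow p 1 p"
  proof -
    define s where "s = Lam (\<lambda>i :: nn. if i = 0 then cq 1 0 0 else p)"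
    have s: "s \<bullet> i = (if i = 0 then cq 1 0 0 else p)" for i
      unfolding s_def by (rule beta) (intro idef_If1 idefp_rules idef_rules)
    have "i = 0" if "i < 1" for i :: nn using that basic(7)[of i] basic(8)[of i 0] by simp
    then show ?thesis unfolding npow_def using assms(3) basic(1) by (intro exI[of _ s]) (auto simp: s basic(1))
  qed
  ultimately have "val p \<le> val (cq 1 0 0)"
    using assms zero_less_one unit_ball unfolding rpow_def
    by (metis div_by_1 less_imp_le nr_simps(1) nr_simps(2))
  then show ?thesis by simp
qed

lemma QFAC_itemCH: "QFAC \<longrightarrow> itemCH"
  unfolding itemCH_def
proof (intro impI allI)
  fix M e d f assume *: QFAC "metS M e d" "seqc d M" and f: "RF M e f \<and> Hoel M d f"
  then obtain K where K: "Re K" "\<exists>\<alpha>. Re \<alpha> \<and> 0 < val K \<and> 0 < val \<alpha> \<and>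
     (\<forall>v. El M v \<longrightarrow> (\<forall>w. El M w \<longrightarrow> (\<exists>p. Re p \<and> rpow (d \<bullet> v \<bullet> w) \<alpha> p \<and>
       \<bar>val (f \<bullet> v) - val (f \<bullet> w)\<bar> \<le> val K * val p)))"
    unfolding Hoel_def by blast
  then obtain \<alpha> where \<alpha>: "0 < val K" "0 < val \<alpha>" "\<And>v w. El M v \<Longrightarrow> El M w \<Longrightarrow>
     \<exists>p. Re p \<and> rpow (d \<bullet> v \<bullet> w) \<alpha> p \<and> \<bar>val (f \<bullet> v) - val (f \<bullet> w)\<bar> \<le> val K * val p"
    by blast
  obtain b where b: "val K \<le> \<iota> b" using val_bound' K(1) by blast
  show "bddF M f"
  proof (rule unit_bound_bddF[OF * _ unit_ball(1), where K = b])
    show "\<bar>val (f \<bullet> v) - val (f \<bullet> w)\<bar> \<le> \<iota> b" if vw: "El M v" "El M w" "val (d \<bullet> v \<bullet> w) < val (cq 1 0 0)" for v w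
    proof -
      obtain p where p: "Re p" "rpow (d \<bullet> v \<bullet> w) \<alpha> p" "\<bar>val (f \<bullet> v) - val (f \<bullet> w)\<bar> \<le> val K * val p"
        using \<alpha>(3)[OF vw(1,2)] by blast
      have "val p \<le> 1"
        using vw metS_Re[OF *(2)] by (intro rpow_le_one[OF p(2) _ p(1) \<alpha>(2)]) simp_all
      then have "val K * val p \<le> val K * 1" using \<alpha>(1) by (intro mult_left_mono) simp_all
      then show ?thesis using p(3) b by simp
    qed
  qed (use f in simp_all)
qed


subsubsection \<open>Infinite spaces\<close>

text \<open>Finite cardinalities are replaced by an internal count: \<open>c m n\<close> is the
  number of \<open>i < n\<close> with \<open>h \<bullet> i < m\<close>. Raising \<open>m\<close> by
  one adds at most one to the count, because values do not repeat, so
  \<open>c m (K + 1) \<le> m\<close>; but all \<open>K + 1\<close> values lie below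
  \<open>K\<close>.\<close>

lemma pigeonhole:
  fixes h :: n1
  assumes h: "\<And>i. i \<le> K \<Longrightarrow> h \<bullet> i < K" and inj: "\<And>i j. i < j \<Longrightarrow> j \<le> K \<Longrightarrow> h \<bullet> i \<noteq> h \<bullet> j"
  shows False
proof -
  define c where "c m n = nrec (\<lambda>i y. if h \<bullet> i < m then y + 1 else y) 0 n" for m n
  have c: "c m 0 = 0" "c m (n + 1) = (if h \<bullet> n < m then c m n + 1 else c m n)" for m n
    unfolding c_def by (subst nrec_simps, intro idef_rules idefp_rules, rule refl)+
  have c0: "idef (\<lambda>p :: nn \<times> nn \<times> unit. c (fst (snd p)) (fst p))"
    unfolding c_def by (intro idef_nrec idef_rules idefp_rules)
  note idef_c = idef_fun2[OF c0]
  have full: "n \<le> K + 1 \<longrightarrow> c K n = n" for n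
  proof (rule idefp_induct[of "\<lambda>n. n \<le> K + 1 \<longrightarrow> c K n = n"], intro idefp_rules idef_c idef_rules)
    fix n assume IH: "n \<le> K + 1 \<longrightarrow> c K n = n"
    show "n + 1 \<le> K + 1 \<longrightarrow> c K (n + 1) = n + 1"
      using IH h[of n] by (auto simp: c add_increasing2)
  qed (simp add: c)
  define Q where "Q m n \<longleftrightarrow> n \<le> K + 1 \<longrightarrow> c (m + 1) n = c m n \<and> (\<forall>i. i < n \<longrightarrow> h \<bullet> i \<noteq> m) \<or>
      c (m + 1) n = c m n + 1 \<and> (\<exists>i. i < n \<and> h \<bullet> i = m)" for m n
  have Q: "Q m n" for m n
  proof (rule idefp_induct[of "Q m"])
    show "idefp (\<lambda>p :: nn \<times> unit. Q m (fst p))"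
      unfolding Q_def by (intro idefp_rules idef_c idef_rules)
    show "Q m 0" by (simp add: Q_def c basic(7))
    fix n assume IH: "Q m n"
    show "Q m (n + 1)"
      unfolding Q_def
    proof
      assume n: "n + 1 \<le> K + 1"
      then have "n \<le> K + 1" by (simp add: add_increasing2)
      with IH consider (no) "c (m + 1) n = c m n" "\<forall>i. i < n \<longrightarrow> h \<bullet> i \<noteq> m"
        | (yes) "c (m + 1) n = c m n + 1" "\<exists>i. i < n \<and> h \<bullet> i = m"
        unfolding Q_def by blast
      then show "c (m + 1) (n + 1) = c m (n + 1) \<and> (\<forall>i. i < n + 1 \<longrightarrow> h \<bullet> i \<noteq> m) \<or>
          c (m + 1) (n + 1) = c m (n + 1) + 1 \<and> (\<exists>i. i < n + 1 \<and> h \<bullet> i = m)"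
      proof cases
        case no
        show ?thesis
        proof (cases "h \<bullet> n = m")
          case True
          then show ?thesis using no by (intro disjI2) (auto simp: c basic(8))
        next
          case False
          then show ?thesis using no by (intro disjI1) (auto simp: c basic(8))
        qed
      next
        case yes
        then obtain i where i: "i < n" "h \<bullet> i = m" by blast
        then have "h \<bullet> n \<noteq> m" using inj[of i n] n by auto
        then show ?thesis using yes(1) i by (intro disjI2) (auto simp: c basic(8))
      qed
    qed
  qed
  have "c m (K + 1) \<le> m" for m
  proof (rule idefp_induct[of "\<lambda>m. c m (K + 1) \<le> m"])
    show "idefp (\<lambda>p :: nn \<times> unit. c (fst p) (K + 1) \<le> fst p)"
      by (intro idefp_rules idef_c idef_rules)
    have "c 0 n = 0" for n
      by (rule idefp_induct[of "\<lambda>n. c 0 n = 0"], intro idefp_rules idef_c idef_rules) (simp_all add: c not_less)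
    then show "c 0 (K + 1) \<le> 0" by simp
    show "c (m + 1) (K + 1) \<le> m + 1" if "c m (K + 1) \<le> m" for m
      using Q[of m "K + 1"] that by (auto simp: Q_def add_increasing2)
  qed
  from this[of K] full[of "K + 1"] have "K + 1 \<le> K" by simp
  then show False by (simp add: not_less[symmetric])
qed

lemma increasing_less: "\<forall>n. g \<bullet> n < g \<bullet> (n + 1) \<Longrightarrow> i < j \<Longrightarrow> g \<bullet> i < g \<bullet> j" for g :: n1
proof -
  assume g: "\<forall>n. g \<bullet> n < g \<bullet> (n + 1)" and "i < j"
  then obtain k where j: "j = i + k + 1" using nn_laws(12) by blast
  have "g \<bullet> i < g \<bullet> (i + k + 1)"
  proof (rule idefp_induct[of "\<lambda>k. g \<bullet> i < g \<bullet> (i + k + 1)"], intro idefp_rules idef_rules)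
    show "g \<bullet> i < g \<bullet> (i + 0 + 1)" using g by simp
    show "g \<bullet> i < g \<bullet> (i + (n + 1) + 1)" if "g \<bullet> i < g \<bullet> (i + n + 1)" for n
      using less_trans[OF that] g[rule_format, of "i + n + 1"] by (simp only: add.assoc)
  qed
  then show ?thesis using j by simp
qed

section \<open>Unpairing, and sequences of functions packed into one function\<close>

definition pfst :: "nn \<Rightarrow> nn" where "pfst m = lst (\<lambda>i. \<exists>k. m = npair i k)"
definition psnd :: "nn \<Rightarrow> nn" where "psnd m = lst (\<lambda>k. \<exists>i. m = npair i k)"

lemma idef_npair: "idef f \<Longrightarrow> idef g \<Longrightarrow> idef (\<lambda>c :: 'c :: ctx. npair (f c) (g c))"
  unfolding npair_def by (intro idef_plus idef_times)

lemma pfst_npair [simp]: "pfst (npair i k) = i" and psnd_npair [simp]: "psnd (npair i k) = k"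
proof -
  have "\<exists>k'. npair i k = npair (pfst (npair i k)) k'"
    unfolding pfst_def by (rule lst(1)[of _ i]) (intro idefp_rules idef_npair idef_rules, blast)
  then show "pfst (npair i k) = i" by simp
  have "\<exists>i'. npair i k = npair i' (psnd (npair i k))"
    unfolding psnd_def by (rule lst(1)[of _ k]) (intro idefp_rules idef_npair idef_rules, blast)
  then show "psnd (npair i k) = k" by simp
qed

lemma idef_psnd0: "idef (\<lambda>p :: nn \<times> unit. pfst (fst p))" "idef (\<lambda>p :: nn \<times> unit. psnd (fst p))"
  unfolding pfst_def psnd_def by (intro idef_lst idefp_rules idef_npair idef_rules)+

lemmas idef_pfst = idef_fun1[OF idef_psnd0(1)] and idef_psnd = idef_fun1[OF idef_psnd0(2)]

definition row :: "n1 \<Rightarrow> nn \<Rightarrow> n1" where "row f i = Lam (\<lambda>k. f \<bullet> npair i k)"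

lemma row [simp]: "row f i \<bullet> k = f \<bullet> npair i k"
  unfolding row_def by (rule beta) (intro idef_npair idef_rules)

lemma idef_row0: "idef (\<lambda>p :: nn \<times> n1 \<times> unit. row (fst (snd p)) (fst p))"
  unfolding row_def by (intro idef_npair idef_rules)

lemmas idef_row = idef_fun2[OF idef_row0]

text \<open>Choice provides objects of type 1, so a finite list of points has to be available as a
  single function.\<close>

lemma rows_ex: "\<exists>f. \<forall>i. row f i = w \<bullet> i" for w :: "(nn, n1) ifn"
proof -
  have "Lam (\<lambda>m. w \<bullet> pfst m \<bullet> psnd m) \<bullet> m = w \<bullet> pfst m \<bullet> psnd m" for m
    by (rule beta) (intro idef_pfst idef_psnd idef_rules)
  then show ?thesis by (intro exI[of _ "Lam (\<lambda>m. w \<bullet> pfst m \<bullet> psnd m)"] allI ifn_eqI) simp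
qed

text \<open>Choice gives, for every \<open>N\<close>, a list of \<open>N + 1\<close> distinct
  points. All lists are merged into one sequence \<open>y\<close>, and \<open>J\<close> selects the
  indices at which a new point appears. If all of these were at most \<open>B\<close>, the
  \<open>B + 2\<close> points of list number \<open>B + 1\<close> would make their first appearance
  at \<open>B + 1\<close> indices, against the pigeonhole principle. The increasing enumeration of
  \<open>J\<close> gives the sequence.\<close>

lemma distinct_sequence:
  assumes QFAC "metS M e d" "\<not> finE e M"
  obtains s :: "(nn, n1) ifn" where "\<And>k. El M (s \<bullet> k)" "\<And>k l. k < l \<Longrightarrow> e \<bullet> (s \<bullet> k) \<bullet> (s \<bullet> l) \<noteq> 1"
proof -
  have eq: "El M x \<Longrightarrow> El M y \<Longrightarrow> val x = val y \<Longrightarrow> e \<bullet> x \<bullet> y = 1"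
    and sym: "El M x \<Longrightarrow> El M y \<Longrightarrow> e \<bullet> x \<bullet> y = 1 \<Longrightarrow> e \<bullet> y \<bullet> x = 1"
    and trans: "El M x \<Longrightarrow> El M y \<Longrightarrow> El M z \<Longrightarrow> e \<bullet> x \<bullet> y = 1 \<Longrightarrow> e \<bullet> y \<bullet> z = 1 \<Longrightarrow> e \<bullet> x \<bullet> z = 1" for x y z
    using assms(2) unfolding metS_def metE_def by metis+
  define P where "P N f \<longleftrightarrow> (\<forall>i. i \<le> N \<longrightarrow> El M (row f i)) \<and>
    (\<forall>i j. i < j \<and> j \<le> N \<longrightarrow> \<not> e \<bullet> row f i \<bullet> row f j = 1)" for N f
  have "\<exists>F :: (nn, n1) ifn. \<forall>n. P n (F \<bullet> n)"
  proof (rule QFAC_choice[OF assms(1)])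
    show "idefp (\<lambda>p :: nn \<times> n1 \<times> unit. P (fst p) (fst (snd p)))"
      unfolding P_def by (intro idefp_rules idefp_El idef_row idef_rules)
    fix N
    obtain w :: "(nn, n1) ifn" where w: "\<forall>i. i \<le> N \<longrightarrow> El M (w \<bullet> i)"
      "\<forall>i j. i < j \<and> j \<le> N \<longrightarrow> \<not> e \<bullet> (w \<bullet> i) \<bullet> (w \<bullet> j) = 1"
      using assms(3) unfolding finE_def by blast
    obtain f where f: "\<forall>i. row f i = w \<bullet> i" using rows_ex by blast
    show "\<exists>f. P N f" using w f by (intro exI[of _ f]) (simp add: P_def)
  qed
  then obtain F :: "(nn, n1) ifn" where F: "\<And>n. P n (F \<bullet> n)" by blast
  \<comment> \<open>Pairs that address no valid entry of a list yield the point of list 0, so that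
    \<open>y\<close> stays in \<open>M\<close> throughout.\<close>
  define y where "y m = (if psnd m \<le> pfst m then row (F \<bullet> pfst m) (psnd m) else row (F \<bullet> 0) 0)" for m
  have y0: "idef (\<lambda>p :: nn \<times> unit. y (fst p))"
    unfolding y_def by (intro idef_If1 idefp_rules idef_row idef_pfst idef_psnd idef_rules)
  note idef_y = idef_fun1[OF y0]
  have yM: "El M (y m)" for m using F by (simp add: y_def P_def)
  define J where "J m \<longleftrightarrow> (\<forall>k. k < m \<longrightarrow> e \<bullet> y k \<bullet> y m \<noteq> 1)" for m
  have J0: "idefp (\<lambda>p :: nn \<times> unit. J (fst p))"
    unfolding J_def by (intro idefp_rules idef_y idef_rules)
  note idef_J = idefp_fun1[OF J0]
  have ex: "\<exists>m. B < m \<and> J m" for B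
  proof (rule ccontr)
    assume no: "\<nexists>m. B < m \<and> J m"
    define h where "h = Lam (\<lambda>i. lst (\<lambda>k. e \<bullet> y k \<bullet> y (npair (B + 1) i) = 1))"
    have h: "h \<bullet> i = lst (\<lambda>k. e \<bullet> y k \<bullet> y (npair (B + 1) i) = 1)" for i
      unfolding h_def by (rule beta) (intro idef_lst idefp_rules idef_y idef_npair idef_rules)
    have D: "idefp (\<lambda>p :: nn \<times> unit. e \<bullet> y (fst p) \<bullet> y m = 1)" for m
      by (intro idefp_rules idef_y idef_rules)
    have self: "e \<bullet> y m \<bullet> y m = 1" for m using eq yM by blast
    have h1: "e \<bullet> y (h \<bullet> i) \<bullet> y (npair (B + 1) i) = 1" for i
      unfolding h by (rule lst(1)[OF D, OF self])
    have "J (h \<bullet> i)" for i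
      unfolding J_def
    proof (intro allI impI notI)
      fix k assume k: "k < h \<bullet> i" "e \<bullet> y k \<bullet> y (h \<bullet> i) = 1"
      have "e \<bullet> y k \<bullet> y (npair (B + 1) i) = 1" using trans[OF yM yM yM k(2) h1] .
      with lst(2)[OF D[of "npair (B + 1) i"] self] k(1) show False unfolding h by blast
    qed
    then have "h \<bullet> i < B + 1" for i using no basic(8) by (metis not_less le_less)
    moreover have "h \<bullet> i \<noteq> h \<bullet> j" if "i < j" "j \<le> B + 1" for i j
    proof
      assume "h \<bullet> i = h \<bullet> j"
      then have "e \<bullet> y (npair (B + 1) i) \<bullet> y (npair (B + 1) j) = 1"
        using h1[of i] h1[of j] by (metis trans sym yM)
      moreover have "i \<le> B + 1" using that by simp
      ultimately show False using F[of "B + 1"] that by (simp add: y_def P_def)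
    qed
    ultimately show False by (rule pigeonhole)
  qed
  define t where "t k = nrec (\<lambda>_ x. lst (\<lambda>m. x < m \<and> J m)) 0 k" for k
  have idef_t: "idef (\<lambda>p :: nn \<times> unit. t (fst p))"
    unfolding t_def by (intro idef_nrec idef_lst idefp_rules idef_J idef_rules)
  have t: "t 0 = 0" "t (k + 1) = lst (\<lambda>m. t k < m \<and> J m)" for k
    unfolding t_def by (subst nrec_simps, intro idef_lst idefp_rules idef_J idef_rules, rule refl)+
  have t1: "t k < t (k + 1) \<and> J (t (k + 1))" for k
  proof -
    obtain m where m: "t k < m \<and> J m" using ex by blast
    show ?thesis unfolding t by (rule lst(1)[of "\<lambda>n. t k < n \<and> J n", OF _ m]) (intro idefp_rules idef_J idef_rules)
  qed
  have tJ: "J (t k)" for k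
  proof (cases "k = 0")
    case True
    then show ?thesis by (simp add: t J_def basic(7))
  next
    case False
    then obtain l where "k = l + 1" using nn_laws(11) by blast
    then show ?thesis using t1 by simp
  qed
  have T: "Lam t \<bullet> k = t k" for k by (rule beta[OF idef_t])
  have "t k < t l" if "k < l" for k l
    using increasing_less[of "Lam t" k l] t1 that by (simp add: T)
  then have "e \<bullet> y (t k) \<bullet> y (t l) \<noteq> 1" if "k < l" for k l
    using that tJ[of l] by (simp add: J_def)
  moreover have "Lam (\<lambda>k. y (t k)) \<bullet> k = y (t k)" for k
    by (rule beta) (intro idef_y idef_t)
  ultimately show thesis using yM that[of "Lam (\<lambda>k. y (t k))"] by simp
qed

text \<open>The function is 0 at the limit \<open>x\<close> of a convergent sequence of distinct
  points and 1 elsewhere. A Lipschitz constant would force all points close to \<open>x\<close> to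
  be equal to \<open>x\<close>, in particular two different terms of the sequence.\<close>

lemma QFAC_itemD: "QFAC \<longrightarrow> itemD"
  unfolding itemD_def
proof (intro impI allI)
  fix M e d assume Q: QFAC and met: "metS M e d" and seq: "seqc d M \<and> \<not> finE e M"
  have sym: "El M x \<Longrightarrow> El M y \<Longrightarrow> e \<bullet> x \<bullet> y = 1 \<Longrightarrow> e \<bullet> y \<bullet> x = 1"
    and trans: "El M x \<Longrightarrow> El M y \<Longrightarrow> El M z \<Longrightarrow> e \<bullet> x \<bullet> y = 1 \<Longrightarrow> e \<bullet> y \<bullet> z = 1 \<Longrightarrow> e \<bullet> x \<bullet> z = 1" 
    and refl: "El M x \<Longrightarrow> e \<bullet> x \<bullet> x = 1" for x y z
    using met unfolding metS_def metE_def by metis+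
  obtain s :: "(nn, n1) ifn" where s: "\<And>k. El M (s \<bullet> k)" "\<And>k l. k < l \<Longrightarrow> e \<bullet> (s \<bullet> k) \<bullet> (s \<bullet> l) \<noteq> 1"
    using distinct_sequence[OF Q met] seq by blast
  obtain g :: n1 and x where g: "\<forall>n. g \<bullet> n < g \<bullet> (n + 1)" and x: "El M x" and
    lim: "\<forall>\<epsilon>. Re \<epsilon> \<longrightarrow> 0 < val \<epsilon> \<longrightarrow> (\<exists>m. \<forall>n. m \<le> n \<longrightarrow> val (d \<bullet> (s \<bullet> (g \<bullet> n)) \<bullet> x) < val \<epsilon>)"
    by (rule seqcE[OF conjunct1[OF seq] s(1)]) blast
  define f where "f = Lam (\<lambda>v. if e \<bullet> v \<bullet> x = 1 then cq 0 0 0 else cq 1 0 0)"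
  have f: "f \<bullet> v = (if e \<bullet> v \<bullet> x = 1 then cq 0 0 0 else cq 1 0 0)" for v
    unfolding f_def by (rule beta) (intro idef_If1 idefp_rules idef_rules)
  have "e \<bullet> v \<bullet> x = 1 \<longleftrightarrow> e \<bullet> w \<bullet> x = 1" if "El M v" "El M w" "e \<bullet> v \<bullet> w = 1" for v w
    using trans[OF that(1,2) x that(3)] trans[OF that(2,1) x sym[OF that]] by blast
  then have "RF M e f" unfolding RF_def by (simp add: f)
  moreover have "bddF M f" unfolding bddF_def by (intro exI[of _ 1]) (simp add: f)
  moreover have "\<not> Lips M d f"
  proof
    assume "Lips M d f"
    then obtain K where K: "Re K" "0 < val K" "\<And>v w. El M v \<Longrightarrow> El M w \<Longrightarrow>
        \<bar>val (f \<bullet> v) - val (f \<bullet> w)\<bar> \<le> val K * val (d \<bullet> v \<bullet> w)"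
      unfolding Lips_def by metis
    obtain b where b: "val K \<le> \<iota> b" using val_bound' K(1) by blast
    have pos: "0 < \<iota> b + 1" by (simp add: add_nonneg_pos)
    \<comment> \<open>As \<open>b\<close> bounds the Lipschitz constant, a jump of height 1 requires
      a distance of at least \<open>1 / (\<iota> b + 1)\<close>.\<close>
    obtain m where m: "\<And>n. m \<le> n \<Longrightarrow> val (d \<bullet> (s \<bullet> (g \<bullet> n)) \<bullet> x) < 1 / (\<iota> b + 1)"
      using lim[rule_format, of "cq 1 0 b"] pos by auto
    have near: "e \<bullet> v \<bullet> x = 1" if "El M v" "val (d \<bullet> v \<bullet> x) < 1 / (\<iota> b + 1)" for v
    proof (rule ccontr)
      assume "e \<bullet> v \<bullet> x \<noteq> 1"
      then have "1 \<le> val K * val (d \<bullet> v \<bullet> x)" using K(3)[OF that(1) x] refl[OF x] by (simp add: f)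
      also have "\<dots> \<le> (\<iota> b + 1) * val (d \<bullet> v \<bullet> x)"
        using b met that(1) x unfolding metS_def by (intro mult_right_mono) auto
      finally show False using that(2) pos by (simp add: field_simps)
    qed
    have "e \<bullet> (s \<bullet> (g \<bullet> m)) \<bullet> x = 1" "e \<bullet> (s \<bullet> (g \<bullet> (m + 1))) \<bullet> x = 1"
      by (intro near s(1) m; simp)+
    then have "e \<bullet> (s \<bullet> (g \<bullet> m)) \<bullet> (s \<bullet> (g \<bullet> (m + 1))) = 1" using s(1) x sym trans by metis
    with s(2) g show False by blast
  qed
  ultimately show "\<exists>f. RF M e f \<and> bddF M f \<and> \<not> Lips M d f" by blast
qed

text \<open>Choice picks points where \<open>f\<close> exceeds the infimum by at most
  \<open>3 / (\<iota> k + 1)\<close>. At the limit of a convergent subsequence the infimum is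
  attained, since \<open>f\<close> is Lipschitz.\<close>

lemma QFAC_itemE: "QFAC \<longrightarrow> itemE"
  unfolding itemE_def
proof (intro impI allI)
  fix M e d f y
  assume Q: QFAC and met: "metS M e d" and seq: "seqc d M \<and> bddS M d M" and y: "Re y"
    and f: "RF M e f \<and> Lips M d f \<and> infS M f y"
  \<comment> \<open>The \<open>k\<close>-th approximation of \<open>y\<close> plus
    \<open>2 / (\<iota> k + 1)\<close>, written over the product of the two denominators, whose
    predecessor is \<open>c * k + c + k\<close>. Of the two units one covers the approximation error
    and the other makes the bound strictly larger than the infimum.\<close>
  define z where "z k a b c = cq (a * (k + 1) + (1 + 1) * (c + 1)) (b * (k + 1)) (c * k + c + k)" for k a b c
  have pos: "0 < \<iota> k + 1" for k by (simp add: add_nonneg_pos)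
  have z: "val (z k a b c) = rq (dq (qcode a b c)) + 2 / (\<iota> k + 1)" for k a b c
  proof -
    have "\<iota> (c * k + c + k) + 1 = (\<iota> c + 1) * (\<iota> k + 1)" by (simp add: algebra_simps)
    then show ?thesis
      unfolding z_def val_cq tval_qcode using pos[of c] pos[of k] by (simp add: field_simps)
  qed
  have hp_le: "hp k \<le> 1 / (\<iota> k + 1)" for k
    using p2_ge[of k] pos[of k] unfolding hp_def
    by (intro divide_left_mono) (simp_all flip: nr_le_iff[of "k + 1"] nr_less_iff[of 0] add: nr_simps)
  define P where "P k x \<longleftrightarrow> El M x \<and> (\<exists>a b c. y \<bullet> k = qcode a b c \<and> vle (f \<bullet> x) (z k a b c))" for k x
  have P: "val (f \<bullet> x) \<le> val y + 3 / (\<iota> k + 1)" if "P k x" for k x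
  proof -
    from that obtain a b c where x: "El M x" "y \<bullet> k = qcode a b c" "vle (f \<bullet> x) (z k a b c)"
      unfolding P_def by blast
    have "val (f \<bullet> x) \<le> val (z k a b c)"
      using x(3) RF_Re[OF conjunct1[OF f] x(1)] by (simp add: vle_iff z_def del: val_cq)
    then have "val (f \<bullet> x) \<le> rq (dq (y \<bullet> k)) + 2 / (\<iota> k + 1)" unfolding z x(2) .
    moreover have "rq (dq (y \<bullet> k)) \<le> val y + 1 / (\<iota> k + 1)"
      using val_approx[OF y, of k] hp_le[of k] by (simp add: abs_le_iff)
    moreover have "3 / (\<iota> k + 1) = 1 / (\<iota> k + 1) + 2 / (\<iota> k + 1)" by (simp add: add_divide_distrib[symmetric])
    ultimately show ?thesis by linarith
  qed
  have "\<exists>F :: (nn, n1) ifn. \<forall>n. P n (F \<bullet> n)"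
  proof (rule QFAC_choice[OF Q])
    show "idefp (\<lambda>p :: nn \<times> n1 \<times> unit. P (fst p) (fst (snd p)))"
      unfolding P_def z_def by (intro idefp_rules idefp_El idefp_vle idef_cq idef_qcode idef_rules)
    fix k
    obtain a b c where abc: "y \<bullet> k = qcode a b c" using Re_code[OF y] by blast
    have "val y \<le> rq (dq (y \<bullet> k)) + 1 / (\<iota> k + 1)"
      using val_approx[OF y, of k] hp_le[of k] by (simp add: abs_le_iff)
    moreover have "1 / (\<iota> k + 1) < 2 / (\<iota> k + 1)" using pos by (simp add: divide_strict_right_mono)
    ultimately have "val y < val (z k a b c)" unfolding z abc by linarith
    moreover have "Re (z k a b c)" by (simp add: z_def)
    ultimately obtain x where x: "El M x" "val (f \<bullet> x) < val (z k a b c)"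
      using f unfolding infS_def by (meson not_le)
    then have "P k x" using abc RF_Re[OF conjunct1[OF f] x(1)] unfolding P_def
      by (auto simp: vle_iff z_def simp del: val_cq)
    then show "\<exists>x. P k x" by blast
  qed
  then obtain s :: "(nn, n1) ifn" where s: "\<And>k. P k (s \<bullet> k)" by blast
  then have sM: "El M (s \<bullet> k)" for k by (simp add: P_def)
  obtain g :: n1 and x where g: "\<forall>n. g \<bullet> n < g \<bullet> (n + 1)" and x: "El M x" and
    lim: "\<forall>\<epsilon>. Re \<epsilon> \<longrightarrow> 0 < val \<epsilon> \<longrightarrow> (\<exists>m. \<forall>n. m \<le> n \<longrightarrow> val (d \<bullet> (s \<bullet> (g \<bullet> n)) \<bullet> x) < val \<epsilon>)"
    by (rule seqcE[OF conjunct1[OF seq] sM]) blast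
  obtain K where K: "Re K" "0 < val K" "\<And>v w. El M v \<Longrightarrow> El M w \<Longrightarrow>
      \<bar>val (f \<bullet> v) - val (f \<bullet> w)\<bar> \<le> val K * val (d \<bullet> v \<bullet> w)"
    using conjunct1[OF conjunct2[OF f]] unfolding Lips_def by metis
  obtain b where b: "val K \<le> \<iota> b" using val_bound' K(1) by blast
  have fx: "Re (f \<bullet> x)" using RF_Re f x by blast
  have "val (f \<bullet> x) \<le> val y + 4 * hp n" for n
  proof -
    have pp: "0 < \<iota> (p2 n)" using nr_less_iff[of 0 "p2 n"] by simp
    \<comment> \<open>This radius keeps the Lipschitz error below \<open>hp n\<close>; with the
      \<open>3 * hp n\<close> from the choice of points this is the bound of
      \<open>fin_archimedean\<close>.\<close>
    obtain m where m: "\<And>j. m \<le> j \<Longrightarrow> val (d \<bullet> (s \<bullet> (g \<bullet> j)) \<bullet> x) < 1 / (\<iota> (b * p2 n) + 1)"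
      using lim[rule_format, of "cq 1 0 (b * p2 n)"] pos[of "b * p2 n"] by auto
    define v where "v = s \<bullet> (g \<bullet> (m + p2 n))"
    have d: "val (d \<bullet> v \<bullet> x) < 1 / (\<iota> (b * p2 n) + 1)" unfolding v_def by (rule m) simp
    have vM: "El M v" unfolding v_def by (rule sM)
    have d0: "0 \<le> val (d \<bullet> v \<bullet> x)" using met vM x unfolding metS_def by blast
    have "val K * val (d \<bullet> v \<bullet> x) \<le> \<iota> b * val (d \<bullet> v \<bullet> x)" using b d0 by (rule mult_right_mono)
    also have "\<dots> \<le> \<iota> b * (1 / (\<iota> (b * p2 n) + 1))" using d by (intro mult_left_mono) simp_all
    also have "\<dots> \<le> hp n"
      using pp pos[of "b * p2 n"] unfolding hp_def by (simp add: field_simps)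
    finally have 1: "val K * val (d \<bullet> v \<bullet> x) \<le> hp n" .
    have "p2 n \<le> g \<bullet> (m + p2 n)" using increasing_ge[OF g, of "m + p2 n"] by (rule order_trans[rotated]) simp
    then have "\<iota> (p2 n) \<le> \<iota> (g \<bullet> (m + p2 n)) + 1" by (simp add: add_increasing2)
    then have "3 / (\<iota> (g \<bullet> (m + p2 n)) + 1) \<le> 3 / \<iota> (p2 n)" using pp pos by (intro divide_left_mono) simp_all
    then have "val (f \<bullet> v) \<le> val y + 3 * hp n"
      using P[OF s[of "g \<bullet> (m + p2 n)"]] unfolding v_def[symmetric] hp_def times_divide_eq_right mult_1_right
      by linarith
    moreover have "\<bar>val (f \<bullet> v) - val (f \<bullet> x)\<bar> \<le> hp n" using K(3)[OF vM x] 1 by linarith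
    ultimately show ?thesis by linarith
  qed
  then have "val (f \<bullet> x) \<le> val y" by (rule fin_archimedean[OF fin_val[OF fx] fin_val[OF y]])
  moreover have "val y \<le> val (f \<bullet> x)" using f x unfolding infS_def by blast
  ultimately show "\<exists>x. El M x \<and> val (f \<bullet> x) = val y" using x by (intro exI[of _ x]) simp
qed


subsection \<open>Coding sequences of real numbers by real numbers\<close>

lemma nn_Suc_le: "m < n \<Longrightarrow> m + 1 \<le> n" for m n :: nn
  using basic(8)[of n m] by (metis leI less_asym less_irrefl)

text \<open>Codes of rationals stand for denominators \<open>c + 1\<close>, so a power of two is
  entered through its predecessor.\<close>

definition den :: "nn \<Rightarrow> nn" where "den k = lst (\<lambda>d. d + 1 = p2 k)"

lemma den_plus1: "den k + 1 = p2 k"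
proof -
  have "p2 k \<noteq> 0" using p2_pos[of k] basic(7) by metis
  then obtain d where "d + 1 = p2 k" using nn_laws(11) by metis
  then show ?thesis unfolding den_def by (rule lst(1)[rotated]) (intro idefp_rules idef_rules)
qed

lemma idef_den0: "idef (\<lambda>p :: nn \<times> unit. den (fst p))"
  unfolding den_def by (intro idef_lst idefp_rules idef_p2 idef_rules)
lemmas idef_den = idef_fun1[OF idef_den0]

lemma dyadic: "rq (dq (qcode a 0 (den k))) = \<iota> a * hp k" "val (cq a 0 (den k)) = \<iota> a * hp k"
proof -
  have *: "\<iota> (den k) + 1 = \<iota> (p2 k)" using den_plus1[of k] by (simp flip: nr_simps(2,3) del: nr_simps)
  then show "val (cq a 0 (den k)) = \<iota> a * hp k" by (simp add: hp_def)
  show "rq (dq (qcode a 0 (den k))) = \<iota> a * hp k"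
    unfolding tval_qcode using * by (simp add: hp_def)
qed

lemma hp_p2: "\<iota> (p2 k) * hp k = 1"
  using nr_less_iff[of 0 "p2 k"] by (simp add: hp_def)

lemma hp_le_one: "hp k \<le> 1"
proof -
  have "1 \<le> p2 k" using p2_ge[of k] by (rule order_trans[rotated]) simp
  then have "1 \<le> \<iota> (p2 k)" using nr_le_iff[of 1 "p2 k"] by simp
  then show ?thesis by (simp add: hp_def divide_le_eq_1)
qed

text \<open>A real number is coded by the set of dyadic rationals above it.\<close>

definition cutr :: "n1 \<Rightarrow> n1" where
  "cutr x = Lam (\<lambda>m. if vle x (cq (pfst m) 0 (den (psnd m))) then 1 else 0)"
definition decr :: "n1 \<Rightarrow> n1" where
  "decr f = Lam (\<lambda>k. qcode (lst (\<lambda>j. f \<bullet> npair j k \<noteq> 0)) 0 (den k))"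

lemma idef_decr0: "idef (\<lambda>p :: n1 \<times> unit. decr (fst p))"
  unfolding decr_def by (intro idef_qcode idef_lst idef_den idefp_rules idef_npair idef_rules)
lemmas idef_decr = idef_fun1[OF idef_decr0]

lemma Can_cutr: "Can (cutr x)"
proof -
  have "cutr x \<bullet> m = (if vle x (cq (pfst m) 0 (den (psnd m))) then 1 else 0)" for m
    unfolding cutr_def by (rule beta)
      (intro idefp_vle idef_cq idef_den idef_pfst idef_psnd idefp_rules idef_rules)
  then show ?thesis by (simp add: Can_def)
qed

text \<open>The least \<open>j\<close> with \<open>val x \<le> \<iota> j * hp k\<close> exceeds
  \<open>val x\<close> by less than \<open>hp k\<close>, because \<open>j - 1\<close> fails, or
  because \<open>j\<close> is 0 and the value is nonnegative. Decoding returns a real of the same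
  value, though in general another representative.\<close>

lemma decr_cutr:
  assumes "Re x" "0 \<le> val x"
  shows "Re (decr (cutr x))" "val (decr (cutr x)) = val x"
proof -
  define c where "c k = lst (\<lambda>j. vle x (cq j 0 (den k)))" for k
  have cut: "cutr x \<bullet> npair j k = (if vle x (cq j 0 (den k)) then 1 else 0)" for j k
    unfolding cutr_def
    by (subst beta, intro idefp_vle idef_cq idef_den idef_pfst idef_psnd idefp_rules idef_rules) simp
  have dec: "decr (cutr x) \<bullet> k = qcode (c k) 0 (den k)" for k
    unfolding decr_def
    by (subst beta, intro idef_qcode idef_lst idef_den idefp_rules idef_npair idef_rules)
      (simp add: cut c_def)
  have D: "idefp (\<lambda>p :: nn \<times> unit. vle x (cq (fst p) 0 (den k)))" for k
    by (intro idefp_vle idef_cq idef_rules)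
  have v: "vle x (cq j 0 (den k)) \<longleftrightarrow> val x \<le> \<iota> j * hp k" for j k
    using assms(1) by (simp add: vle_iff dyadic(2) del: val_cq)
  obtain b where b: "val x \<le> \<iota> b" using val_bound' assms(1) by blast
  have ex: "vle x (cq (b * p2 k) 0 (den k))" for k
    unfolding v using b hp_p2[of k] by (simp add: mult.assoc)
  have up: "val x \<le> \<iota> (c k) * hp k" for k
    using lst(1)[OF D ex] unfolding v c_def .
  have lo: "\<iota> (c k) * hp k < val x + hp k" for k
  proof (cases "c k = 0")
    case True
    then show ?thesis using assms(2) hp_pos[of k] by simp
  next
    case False
    then obtain l where l: "c k = l + 1" using nn_laws(11) by blast
    then have "l < c k" using basic(8) by simp
    then have "\<not> val x \<le> \<iota> l * hp k" using lst(2)[OF D[of k] ex, of l] unfolding c_def v by blast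
    then show ?thesis by (simp add: l algebra_simps)
  qed
  show R: "Re (decr (cutr x))"
    unfolding Re_iff dec dyadic
  proof (intro conjI allI)
    fix n i
    have "hp (n + i) \<le> hp n"
      unfolding hp_add using hp_le_one[of i] hp_pos[of n] by (simp add: mult_left_le)
    then show "\<bar>\<iota> (c n) * hp n - \<iota> (c (n + i)) * hp (n + i)\<bar> < hp n"
      using up[of n] up[of "n + i"] lo[of n] lo[of "n + i"] by linarith
  qed auto
  have a: "\<bar>\<iota> (c k) * hp k - val (decr (cutr x))\<bar> \<le> hp k" for k
    using val_approx[OF R, of k] unfolding dec dyadic .
  have "val (decr (cutr x)) \<le> val x + 4 * hp k" "val x \<le> val (decr (cutr x)) + 4 * hp k" for k
    using a[of k] up[of k] lo[of k] hp_pos[of k] by linarith+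
  then show "val (decr (cutr x)) = val x"
    by (rule order.antisym[OF fin_archimedean[OF fin_val[OF R] fin_val[OF assms(1)]]
          fin_archimedean[OF fin_val[OF assms(1)] fin_val[OF R]]])
qed

text \<open>A number \<open>n\<close> and a sequence of bits are coded by the real number with integer part \<open>n\<close>
  whose digits to base 4 are these bits; \<open>enca\<close> lists the numerators of its partial sums.\<close>

definition enca :: "nn \<Rightarrow> n1 \<Rightarrow> nn \<Rightarrow> nn" where
  "enca n f k = nrec (\<lambda>k y. (y + y) + (y + y) + (if f \<bullet> k = 0 then 0 else 1)) n k"
definition encr :: "nn \<Rightarrow> n1 \<Rightarrow> n1" where
  "encr n f = Lam (\<lambda>k. qcode (enca n f k) 0 (den (k + k)))"
text \<open>The integer part of \<open>z\<close> times the \<open>k\<close>-th power of 4, for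
  nonnegative \<open>z\<close>, found as the first \<open>a\<close> such that \<open>a + 1\<close>
  is too large.\<close>

definition flr :: "n1 \<Rightarrow> nn \<Rightarrow> nn" where
  "flr z k = lst (\<lambda>a. \<not> vle (cq (a + 1) 0 (den (k + k))) z)"

lemma enca: "enca n f 0 = n"
  "enca n f (k + 1) = (enca n f k + enca n f k) + (enca n f k + enca n f k) + (if f \<bullet> k = 0 then 0 else 1)"
  unfolding enca_def by (subst nrec_simps, intro idef_rules idefp_rules, rule refl)+

lemma idef_encr: "idef (\<lambda>p :: nn \<times> unit. encr (fst p) f)"
  unfolding encr_def enca_def by (intro idef_qcode idef_nrec idef_den idef_rules idefp_rules)

lemma idef_flr0: "idef (\<lambda>p :: nn \<times> n1 \<times> unit. flr (fst (snd p)) (fst p))"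
  unfolding flr_def by (intro idef_lst idefp_vle idef_cq idef_den idef_rules idefp_rules)
lemmas idef_flr = idef_fun2[OF idef_flr0]

text \<open>The partial sums increase, while the partial sums plus half a unit of their last place
  decrease: digits at most 1 leave a remainder of at most a third of a unit. One half is convenient
  because, doubled, the claim is an inequality between numbers of the model that can be proved by
  internal induction.\<close>

lemma enca_bounds:
  "\<iota> (enca n f k) * hp (k + k) \<le> \<iota> (enca n f (k + i)) * hp (k + i + (k + i))"
  "\<iota> (enca n f (k + i)) * hp (k + i + (k + i)) + hp (k + i + (k + i)) / 2 \<le>
    \<iota> (enca n f k) * hp (k + k) + hp (k + k) / 2"
proof -
  define A where "A j = enca n f j" for j
  have A0: "idef (\<lambda>p :: nn \<times> unit. A (fst p))"
    unfolding A_def enca_def by (intro idef_nrec idef_rules idefp_rules)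
  note idef_A = idef_fun1[OF A0]
  have A: "A (j + 1) = (A j + A j) + (A j + A j) + (if f \<bullet> j = 0 then 0 else 1)" for j
    by (simp only: A_def enca)
  have p2: "p2 (i + 1 + (i + 1)) = (p2 (i + i) + p2 (i + i)) + (p2 (i + i) + p2 (i + i))" for i
    using p2_simps(2)[of "i + i + 1"] p2_simps(2)[of "i + i"] by (simp only: add_ac)
  have 1: "A k * p2 (i + i) \<le> A (k + i)"
  proof (rule idefp_induct[of "\<lambda>i. A k * p2 (i + i) \<le> A (k + i)"], intro idefp_rules idef_p2 idef_A idef_rules)
    fix i assume IH: "A k * p2 (i + i) \<le> A (k + i)"
    have "A k * p2 (i + 1 + (i + 1)) \<le> (A (k + i) + A (k + i)) + (A (k + i) + A (k + i))"
      unfolding p2 distrib_left by (intro add_mono IH)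
    also have "\<dots> \<le> A (k + i + 1)" unfolding A by simp
    finally show "A k * p2 (i + 1 + (i + 1)) \<le> A (k + (i + 1))" by (simp only: add_ac)
  qed (simp add: p2_simps)
  have 2: "A (k + i) + A (k + i) + 1 \<le> (A k + A k + 1) * p2 (i + i)"
  proof (rule idefp_induct[of "\<lambda>i. A (k + i) + A (k + i) + 1 \<le> (A k + A k + 1) * p2 (i + i)"],
      intro idefp_rules idef_p2 idef_A idef_rules)
    fix i assume IH: "A (k + i) + A (k + i) + 1 \<le> (A k + A k + 1) * p2 (i + i)"
    define B where "B = A (k + i) + A (k + i) + 1"
    define u where "u = A (k + i)"
    have "A (k + i + 1) \<le> (u + u) + (u + u) + 1" unfolding A u_def by simp
    then have "A (k + i + 1) + A (k + i + 1) + 1 \<le> ((u + u) + (u + u) + 1) + ((u + u) + (u + u) + 1) + 1"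
      by (intro add_mono order_refl)
    also have "\<dots> \<le> (B + B) + (B + B)" unfolding B_def u_def[symmetric] by (simp add: algebra_simps)
    also have "\<dots> \<le> (A k + A k + 1) * p2 (i + 1 + (i + 1))"
      unfolding p2 distrib_left B_def by (intro add_mono IH)
    finally show "A (k + (i + 1)) + A (k + (i + 1)) + 1 \<le> (A k + A k + 1) * p2 (i + 1 + (i + 1))"
      by (simp only: add_ac)
  qed (simp add: p2_simps)
  define h where "h = hp (k + i + (k + i))"
  have h: "hp (k + k) = \<iota> (p2 (i + i)) * h" "0 < h"
  proof -
    have "h = hp (k + k) * hp (i + i)" unfolding h_def hp_add[symmetric] by (simp only: add_ac)
    then show "hp (k + k) = \<iota> (p2 (i + i)) * h" using hp_p2[of "i + i"] by (simp add: mult_ac)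
  qed (simp add: h_def hp_pos)
  have "\<iota> (A k) * \<iota> (p2 (i + i)) \<le> \<iota> (A (k + i))" using 1 by (simp flip: nr_simps)
  from mult_right_mono[OF this less_imp_le[OF h(2)]]
  show "\<iota> (enca n f k) * hp (k + k) \<le> \<iota> (enca n f (k + i)) * hp (k + i + (k + i))"
    unfolding h h_def[symmetric] A_def by (simp add: mult_ac)
  have "\<iota> (A (k + i)) + \<iota> (A (k + i)) + 1 \<le> (\<iota> (A k) + \<iota> (A k) + 1) * \<iota> (p2 (i + i))"
    using 2 by (simp only: nr_simps flip: nr_le_iff)
  from mult_right_mono[OF this less_imp_le[OF h(2)]]
  show "\<iota> (enca n f (k + i)) * hp (k + i + (k + i)) + hp (k + i + (k + i)) / 2 \<le>
    \<iota> (enca n f k) * hp (k + k) + hp (k + k) / 2"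
    unfolding h h_def[symmetric] A_def by (simp add: algebra_simps)
qed

text \<open>The remainder is at most half a unit and hence strictly below one, so that rounding down
  recovers the numerators exactly.\<close>

lemma encr: "Re (encr n f)" "\<iota> (enca n f k) * hp (k + k) \<le> val (encr n f)"
  "val (encr n f) < (\<iota> (enca n f k) + 1) * hp (k + k)"
proof -
  define a where "a k = \<iota> (enca n f k) * hp (k + k)" for k
  have lo: "a k \<le> a (k + i)" and up: "a (k + i) \<le> a k + hp (k + k) / 2" for k i
    using enca_bounds(1)[of n f k i] enca_bounds(2)[of n f k i] hp_pos[of "k + i + (k + i)"] by (simp_all add: a_def)
  have hh: "hp (k + k) \<le> hp k" for k
    unfolding hp_add using hp_le_one[of k] hp_pos[of k] by (simp add: mult_left_le)
  have e: "encr n f \<bullet> k = qcode (enca n f k) 0 (den (k + k))" for k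
    unfolding encr_def enca_def
    by (subst beta, intro idef_qcode idef_nrec idef_den idef_rules idefp_rules) simp
  have ea: "rq (dq (encr n f \<bullet> k)) = a k" for k by (simp only: e dyadic a_def)
  show R: "Re (encr n f)"
    unfolding Re_iff ea
  proof (intro conjI allI)
    fix m i show "\<bar>a m - a (m + i)\<bar> < hp m"
      using lo[of m i] up[of m i] hh[of m] hp_pos[of m] by linarith
  qed (auto simp: e)
  have fa: "fin (a k)" for k
    using fin_val[OF Re_cq] unfolding a_def by (simp only: dyadic(2)[symmetric])
  have ap: "\<bar>a k - val (encr n f)\<bar> \<le> hp k" for k using val_approx[OF R, of k] unfolding ea .
  have hm: "hp (k + i) \<le> hp i" for k i
    unfolding hp_add using hp_le_one[of k] hp_pos[of i] by (simp add: mult_right_le_one_le less_imp_le hp_pos)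
  have 1: "a k \<le> val (encr n f)"
  proof (rule fin_archimedean[OF fa fin_val[OF R]])
    show "a k \<le> val (encr n f) + 4 * hp i" for i
      using lo[of k i] ap[of "k + i"] hm[of k i] hp_pos[of i] by linarith
  qed
  then show "\<iota> (enca n f k) * hp (k + k) \<le> val (encr n f)" by (simp add: a_def)
  have "fin (hp (k + k) / 2)"
    using fin_val[OF Re_cq, of 1 0 "den (k + k + 1)"] unfolding dyadic(2) hp_simps by simp
  have "val (encr n f) \<le> a k + hp (k + k) / 2"
  proof (rule fin_archimedean[OF fin_val[OF R] fin_add[OF fa \<open>fin (hp (k + k) / 2)\<close>]])
    show "val (encr n f) \<le> a k + hp (k + k) / 2 + 4 * hp i" for i
      using up[of k i] ap[of "k + i"] hm[of k i] hp_pos[of i] by linarith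
  qed
  then show "val (encr n f) < (\<iota> (enca n f k) + 1) * hp (k + k)"
    using hp_pos[of "k + k"] by (simp add: a_def algebra_simps)
qed

lemma flr_encr: "flr (encr n f) k = enca n f k"
proof -
  have v: "vle (cq (a + 1) 0 (den (k + k))) (encr n f) \<longleftrightarrow> (\<iota> a + 1) * hp (k + k) \<le> val (encr n f)" for a
    by (simp add: vle_iff encr(1) dyadic(2) del: val_cq)
  have D: "idefp (\<lambda>p :: nn \<times> unit. \<not> vle (cq (fst p + 1) 0 (den (k + k))) (encr n f))"
    by (intro idefp_vle idef_cq idefp_rules idef_rules)
  have ok: "\<not> vle (cq (enca n f k + 1) 0 (den (k + k))) (encr n f)"
    unfolding v not_le by (rule encr(3))
  note l = lst[OF D, OF ok, folded flr_def]
  show ?thesis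
  proof (rule ccontr)
    assume "flr (encr n f) k \<noteq> enca n f k"
    then have "flr (encr n f) k < enca n f k" using l(3) by simp
    then have "flr (encr n f) k + 1 \<le> enca n f k" by (rule nn_Suc_le)
    then have "\<iota> (flr (encr n f) k) + 1 \<le> \<iota> (enca n f k)" by (simp only: nr_simps flip: nr_le_iff)
    then have "(\<iota> (flr (encr n f) k) + 1) * hp (k + k) \<le> \<iota> (enca n f k) * hp (k + k)"
      using hp_pos by (intro mult_right_mono) (simp_all add: less_imp_le)
    then have "vle (cq (flr (encr n f) k + 1) 0 (den (k + k))) (encr n f)"
      unfolding v using encr(2) by (rule order_trans)
    with l(1) show False by blast
  qed
qed

lemma flr_val: "Re z \<Longrightarrow> Re z' \<Longrightarrow> val z = val z' \<Longrightarrow> flr z k = flr z' k"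
  by (simp add: flr_def vle_iff)

text \<open>The digit is 0 exactly if passing to the next place multiplies the integer part by 4.
  Other reals than codes also receive bits, so the decoding is total.\<close>

definition bitr :: "n1 \<Rightarrow> nn \<Rightarrow> nn" where
  "bitr z k = (if flr z (k + 1) = (flr z k + flr z k) + (flr z k + flr z k) then 0 else 1)"
definition compr :: "n1 \<Rightarrow> nn \<Rightarrow> n1" where
  "compr z i = decr (Lam (\<lambda>k. bitr z (npair i k)))"

lemma bitr_encr: "bitr (encr n f) k = (if f \<bullet> k = 0 then 0 else 1)"
  using one_neq_zero by (simp add: bitr_def flr_encr enca(2) del: mult_2 one_add_one)

lemma idef_bitr: "idef (\<lambda>p :: nn \<times> nn \<times> n1 \<times> unit. bitr (fst (snd (snd p))) (npair (fst (snd p)) (fst p)))"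
  unfolding bitr_def by (intro idef_flr idef_npair idef_rules idefp_rules)

lemma idef_compr0: "idef (\<lambda>p :: nn \<times> n1 \<times> unit. compr (fst (snd p)) (fst p))"
  unfolding compr_def by (intro idef_decr idef_Lam idef_bitr)
lemmas idef_compr = idef_fun2[OF idef_compr0]

text \<open>Rounding down depends on the value alone, hence equal reals have identical components.
  This is what makes the set of codes respect equality of reals.\<close>

lemma compr_val: "Re z \<Longrightarrow> Re z' \<Longrightarrow> val z = val z' \<Longrightarrow> compr z i = compr z' i"
  by (simp add: compr_def bitr_def flr_val[of z z'])

lemma compr_encr:
  assumes "\<And>k. row f i \<bullet> k = 0 \<or> row f i \<bullet> k = 1"
  shows "compr (encr n f) i = decr (row f i)"
proof -
  have b: "Lam (\<lambda>k. bitr z (npair i k)) \<bullet> k = bitr z (npair i k)" for z k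
    by (rule beta) (unfold bitr_def, intro idef_flr idef_npair idef_rules idefp_rules)
  then have "Lam (\<lambda>k. bitr (encr n f) (npair i k)) = row f i"
    by (intro ifn_eqI, unfold b, unfold bitr_encr) (use assms in auto)
  then show ?thesis by (simp add: compr_def)
qed


subsection \<open>The items imply finite choice\<close>

lemma lengths_bounded:
  fixes X :: "(nn, (n1, nn) ifn) ifn" and s :: "(nn, n1) ifn"
  assumes no: "\<nexists>x :: (nn, n1) ifn. \<forall>n. El (X \<bullet> n) (x \<bullet> n)"
    and s: "\<And>n i. i < flr (s \<bullet> n) 0 \<Longrightarrow> El (X \<bullet> i) (compr (s \<bullet> n) i)"
  shows "\<exists>B. \<forall>n. flr (s \<bullet> n) 0 \<le> B"
proof (rule ccontr)
  assume "\<nexists>B. \<forall>n. flr (s \<bullet> n) 0 \<le> B"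
  then have ex: "\<exists>n. i < flr (s \<bullet> n) 0" for i by (meson not_le)
  \<comment> \<open>The first term that is long enough is found by search, so the choice function is
    internal without any appeal to choice.\<close>
  define x where "x = Lam (\<lambda>i. compr (s \<bullet> lst (\<lambda>n. i < flr (s \<bullet> n) 0)) i)"
  have x: "x \<bullet> i = compr (s \<bullet> lst (\<lambda>n. i < flr (s \<bullet> n) 0)) i" for i
    unfolding x_def by (rule beta) (intro idef_compr idef_lst idefp_rules idef_flr idef_rules)
  have "El (X \<bullet> i) (x \<bullet> i)" for i
  proof -
    obtain n where n: "i < flr (s \<bullet> n) 0" using ex by blast
    have "i < flr (s \<bullet> lst (\<lambda>n. i < flr (s \<bullet> n) 0)) 0"
      by (rule lst(1)[of "\<lambda>n. i < flr (s \<bullet> n) 0", OF _ n]) (intro idefp_rules idef_flr idef_rules)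
    then show ?thesis unfolding x by (rule s)
  qed
  with no show False by blast
qed

text \<open>The space of the counterexamples: finite sequences of elements of the given sets. If there
  is no choice function, then their lengths are bounded along any sequence of points.\<close>

lemma no_choice_space:
  fixes X :: "(nn, (n1, nn) ifn) ifn"
  assumes X: "\<forall>n. RS (X \<bullet> n) \<and> (\<forall>x. El (X \<bullet> n) x \<longrightarrow> 0 \<le> val x \<and> val x \<le> 1) \<and>
      (\<exists>x. El (X \<bullet> n) x) \<and> finR (X \<bullet> n)"
    and no: "\<nexists>x :: (nn, n1) ifn. \<forall>n. El (X \<bullet> n) (x \<bullet> n)"
  obtains M where "RS M" "\<And>n. \<exists>w :: (nn, n1) ifn. \<forall>i. i \<le> n \<longrightarrow> El M (w \<bullet> i) \<and> flr (w \<bullet> i) 0 = i"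
    "\<And>s :: (nn, n1) ifn. (\<And>n. El M (s \<bullet> n)) \<Longrightarrow> \<exists>B. \<forall>n. flr (s \<bullet> n) 0 \<le> B"
proof -
  define M where "M = Lam (\<lambda>z. if \<forall>i. i < flr z 0 \<longrightarrow> El (X \<bullet> i) (compr z i) then 1 else 0 :: nn)"
  have M: "M \<bullet> z = (if \<forall>i. i < flr z 0 \<longrightarrow> El (X \<bullet> i) (compr z i) then 1 else 0)" for z
    unfolding M_def by (rule beta) (intro idefp_El idef_compr idef_flr idefp_rules idef_rules)
  have ElM: "El M z \<longleftrightarrow> Re z \<and> (\<forall>i. i < flr z 0 \<longrightarrow> El (X \<bullet> i) (compr z i))" for z
    using one_neq_zero by (auto simp: El_def[of M] M)
  have "M \<bullet> x = M \<bullet> y" if "Re x" "Re y" "val x = val y" for x y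
    unfolding M using flr_val[OF that] compr_val[OF that] by simp
  moreover have "M \<bullet> x = 0 \<or> M \<bullet> x = 1" for x unfolding M by simp
  ultimately have "RS M" unfolding RS_def by blast
  define Y where "Y = Lam (\<lambda>n. Lam (\<lambda>f. if El (X \<bullet> n) (decr f) then 0 else 1 :: nn))"
  have Y: "Y \<bullet> n \<bullet> f = (if El (X \<bullet> n) (decr f) then 0 else 1)" for n f
    unfolding Y_def by (rule beta2) (intro idefp_El idef_decr idefp_rules idef_rules)
  have "\<exists>f. Can f \<and> Y \<bullet> n \<bullet> f = 0" for n
  proof -
    \<comment> \<open>\<open>IND_2\<close> asks for a bit sequence, so the element is replaced by
      its cut. Decoding gives a real of the same value, which lies in the set because the set
      respects equality of reals.\<close>
    obtain x where x: "El (X \<bullet> n) x" "0 \<le> val x" using X by blast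
    have "Re x" using x(1) by (rule El_Re)
    note d = decr_cutr[OF this x(2)]
    have "X \<bullet> n \<bullet> x = X \<bullet> n \<bullet> decr (cutr x)" using X \<open>Re x\<close> d unfolding RS_def by metis
    then have "El (X \<bullet> n) (decr (cutr x))" using x(1) d(1) by (simp add: El_def)
    then show ?thesis using Can_cutr by (intro exI[of _ "cutr x"]) (simp add: Y)
  qed
  then have w: "\<exists>w :: (nn, n1) ifn. \<forall>i. i < n \<longrightarrow> Can (w \<bullet> i) \<and> Y \<bullet> i \<bullet> (w \<bullet> i) = 0" for n
    using IND2_holds unfolding IND2_def by blast
  have "\<exists>w :: (nn, n1) ifn. \<forall>i. i \<le> n \<longrightarrow> El M (w \<bullet> i) \<and> flr (w \<bullet> i) 0 = i" for n
  proof -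
    obtain w :: "(nn, n1) ifn" where w: "\<And>i. i < n \<Longrightarrow> Can (w \<bullet> i)" "\<And>i. i < n \<Longrightarrow> Y \<bullet> i \<bullet> (w \<bullet> i) = 0"
      using w[of n] by blast
    \<comment> \<open>One bit sequence carries all \<open>n\<close> cuts. The codes
      \<open>encr i f\<close> differ in their integer part \<open>i\<close>, which tells how many
      components count; so an internal sequence contains codes of all lengths up to
      \<open>n\<close>.\<close>
    obtain f where f: "\<forall>i. row f i = w \<bullet> i" using rows_ex by blast
    have e: "Lam (\<lambda>i. encr i f) \<bullet> i = encr i f" for i by (rule beta) (rule idef_encr)
    have l: "flr (encr i f) 0 = i" for i by (simp add: flr_encr enca)
    have "El M (encr i f)" if "i \<le> n" for i
      unfolding ElM l
    proof (intro conjI allI impI)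
      fix j assume "j < i"
      then have j: "j < n" using that by simp
      have "row f j \<bullet> k = 0 \<or> row f j \<bullet> k = 1" for k using w(1)[OF j] f unfolding Can_def by metis
      then have "compr (encr i f) j = decr (w \<bullet> j)" using compr_encr f by metis
      then show "El (X \<bullet> j) (compr (encr i f) j)"
        using w(2)[OF j] one_neq_zero by (auto simp: Y split: if_splits)
    qed (rule encr)
    then show ?thesis by (intro exI[of _ "Lam (\<lambda>i. encr i f)"]) (simp add: e l)
  qed
  moreover have "\<exists>B. \<forall>n. flr (s \<bullet> n) 0 \<le> B" if "\<And>n. El M (s \<bullet> n)" for s :: "(nn, n1) ifn"
    using that by (intro lengths_bounded[OF no]) (simp add: ElM)
  ultimately show thesis using \<open>RS M\<close> that by blast
qed

section \<open>Metric spaces that depend on the lengths of the codes\<close>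

definition len :: "n1 \<Rightarrow> nn" where "len z = flr z 0"

lemma idef_len: "idef f \<Longrightarrow> idef (\<lambda>c :: 'c :: ctx. len (f c))"
  unfolding len_def by (intro idef_flr idef_const)

lemma len_val: "Re z \<Longrightarrow> Re z' \<Longrightarrow> val z = val z' \<Longrightarrow> len z = len z'"
  unfolding len_def by (rule flr_val)

text \<open>Sequences of the same length are identified, so the points of the space amount to the
  lengths that occur.\<close>

definition same_len :: "(n1, (n1, nn) ifn) ifn" where
  "same_len = Lam (\<lambda>z. Lam (\<lambda>z'. if len z = len z' then 1 else 0))"

lemma same_len: "same_len \<bullet> z \<bullet> z' = 1 \<longleftrightarrow> len z = len z'" "same_len \<bullet> z \<bullet> z' = 0 \<or> same_len \<bullet> z \<bullet> z' = 1"
proof -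
  have "same_len \<bullet> z \<bullet> z' = (if len z = len z' then 1 else 0)"
    unfolding same_len_def by (rule beta2) (intro idef_len idefp_rules idef_rules)
  then show "same_len \<bullet> z \<bullet> z' = 1 \<longleftrightarrow> len z = len z'" "same_len \<bullet> z \<bullet> z' = 0 \<or> same_len \<bullet> z \<bullet> z' = 1"
    using one_neq_zero by auto
qed

text \<open>Bounded lengths take some value infinitely often, namely the least eventual upper bound.\<close>

lemma length_space:
  fixes G :: "nn \<Rightarrow> rl"
  assumes dd: "idef (\<lambda>p :: nn \<times> nn \<times> unit. dd (fst (snd p)) (fst p))"
    and Re: "\<And>l l'. Re (dd l l')" and val: "\<And>l l'. val (dd l l') = \<bar>G l - G l'\<bar>" and G: "inj G"
    and M: "RS M" "El M z0"
    and bd: "\<And>s :: (nn, n1) ifn. (\<And>n. El M (s \<bullet> n)) \<Longrightarrow> \<exists>B. \<forall>n. len (s \<bullet> n) \<le> B"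
  obtains d where "\<And>z z'. d \<bullet> z \<bullet> z' = dd (len z) (len z')" "metS M same_len d" "seqc d M"
proof -
  define d where "d = Lam (\<lambda>z. Lam (\<lambda>z'. dd (len z) (len z')))"
  have d: "d \<bullet> z \<bullet> z' = dd (len z) (len z')" for z z'
    unfolding d_def by (rule beta2) (intro idef_fun2[OF dd] idef_len idef_rules)
  have metE: "metE M same_len"
    unfolding metE_def same_len(1)
  proof (intro conjI allI impI)
    show "len x = len y" if "El M x" "El M y" "val x = val y" for x y
      using len_val[OF El_Re[OF that(1)] El_Re[OF that(2)] that(3)] .
    show "same_len \<bullet> x \<bullet> y = 0 \<or> len x = len y" for x y
      using same_len[of x y] by blast
  qed simp_all
  have met: "metS M same_len d"
    unfolding metS_def d val same_len(1)
  proof (intro conjI allI impI)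
    show "(\<bar>G (len x) - G (len y)\<bar> = 0) = (len x = len y)" for x y
      using injD[OF G, of "len x" "len y"] by auto
    show "\<bar>G (len x) - G (len y)\<bar> = \<bar>G (len y) - G (len x)\<bar>" for x y
      by (rule abs_minus_commute)
    show "\<exists>x. El M x" using M(2) by blast
  qed (simp_all add: Re M(1) metE)
  have "seqc d M"
    unfolding seqc_def
  proof (intro allI impI)
    fix s :: "(nn, n1) ifn" assume s: "\<forall>n. El M (s \<bullet> n)"
    then obtain B where B: "\<And>n. len (s \<bullet> n) \<le> B" using bd by blast
    define P where "P b \<longleftrightarrow> (\<exists>N. \<forall>n. N \<le> n \<longrightarrow> len (s \<bullet> n) \<le> b)" for b
    have D: "idefp (\<lambda>p :: nn \<times> unit. P (fst p))"
      unfolding P_def by (intro idefp_rules idef_len idef_rules)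
    have "P B" using B by (simp add: P_def)
    define j where "j = lst P"
    obtain N where N: "\<And>n. N \<le> n \<Longrightarrow> len (s \<bullet> n) \<le> j"
      using lst(1)[OF D \<open>P B\<close>] unfolding P_def j_def by blast
    \<comment> \<open>If the length \<open>j\<close> did not occur after \<open>m\<close>, then
      later lengths would eventually be at most \<open>j - 1\<close>, against the minimality of
      \<open>j\<close>.\<close>
    have often: "\<exists>n. m < n \<and> len (s \<bullet> n) = j" for m
    proof (rule ccontr)
      assume none: "\<nexists>n. m < n \<and> len (s \<bullet> n) = j"
      have small: "len (s \<bullet> n) < j" if "N + m + 1 \<le> n" for n
      proof -
        have "N \<le> N + m + 1" "m < N + m + 1" by (simp_all add: add_increasing add_increasing2 basic(8) add.assoc less_le_trans[of m "m + 1"])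
        then have "N \<le> n" "m < n" using that by (meson order_trans less_le_trans)+
        then show ?thesis using N[of n] none by (metis le_less)
      qed
      have "j \<noteq> 0" using small[OF order_refl] basic(7) by metis
      then obtain i where i: "j = i + 1" using nn_laws(11) by metis
      have "P i" unfolding P_def using small unfolding i basic(8) by (metis le_less)
      moreover have "i < j" unfolding i using basic(8) by blast
      ultimately show False using lst(2)[OF D \<open>P B\<close>, of i] unfolding j_def by blast
    qed
    define h where "h k = nrec (\<lambda>_ m. lst (\<lambda>n. m < n \<and> len (s \<bullet> n) = j)) (lst (\<lambda>n. len (s \<bullet> n) = j)) k" for k
    have idef_h: "idef (\<lambda>p :: nn \<times> unit. h (fst p))"
      unfolding h_def by (intro idef_nrec idef_lst idefp_rules idef_len idef_rules)
    have h: "h 0 = lst (\<lambda>n. len (s \<bullet> n) = j)" "h (k + 1) = lst (\<lambda>n. h k < n \<and> len (s \<bullet> n) = j)" for k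
      unfolding h_def by (subst nrec_simps, intro idef_lst idefp_rules idef_len idef_rules, rule refl)+
    have h1: "h k < h (k + 1) \<and> len (s \<bullet> h (k + 1)) = j" for k
    proof -
      obtain n where n: "h k < n \<and> len (s \<bullet> n) = j" using often by blast
      show ?thesis unfolding h
        by (rule lst(1)[of "\<lambda>n. h k < n \<and> len (s \<bullet> n) = j", OF _ n]) (intro idefp_rules idef_len idef_rules)
    qed
    have h0: "len (s \<bullet> h k) = j" for k
    proof (cases "k = 0")
      case True
      obtain n where n: "len (s \<bullet> n) = j" using often by blast
      show ?thesis unfolding True h
        by (rule lst(1)[of "\<lambda>n. len (s \<bullet> n) = j", OF _ n]) (intro idefp_rules idef_len idef_rules)
    next
      case False
      then obtain l where "k = l + 1" using nn_laws(11) by metis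
      then show ?thesis using h1 by simp
    qed
    have H: "Lam h \<bullet> k = h k" for k by (rule beta[OF idef_h])
    \<comment> \<open>Along this subsequence the length is constantly \<open>j\<close>, so all
      distances to its first term are 0, whatever \<open>G\<close> is.\<close>
    show "\<exists>g :: n1. (\<forall>n. g \<bullet> n < g \<bullet> (n + 1)) \<and>
       (\<exists>x. El M x \<and> (\<forall>\<epsilon>. Re \<epsilon> \<longrightarrow> 0 < val \<epsilon> \<longrightarrow>
         (\<exists>m. \<forall>n. m \<le> n \<longrightarrow> val (d \<bullet> (s \<bullet> (g \<bullet> n)) \<bullet> x) < val \<epsilon>)))"
      using s h1 by (intro exI[of _ "Lam h"] conjI exI[of _ "s \<bullet> h 0"]) (simp_all add: H h0 d val)
  qed
  with met d show thesis using that by blast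
qed

definition dl :: "nn \<Rightarrow> nn \<Rightarrow> n1" where "dl l l' = (if l \<le> l' then cq l' l 0 else cq l l' 0)"

lemma dl: "idef (\<lambda>p :: nn \<times> nn \<times> unit. dl (fst (snd p)) (fst p))" "Re (dl l l')" "val (dl l l') = \<bar>\<iota> l - \<iota> l'\<bar>"
  unfolding dl_def by (intro idef_If1 idef_cq idefp_rules idef_rules, simp, simp)

text \<open>The distance of \<open>1 / (l + 1)\<close> and \<open>1 / (l' + 1)\<close> as one
  fraction: its denominator is the product, whose predecessor is
  \<open>l * l' + l + l'\<close>.\<close>

definition di :: "nn \<Rightarrow> nn \<Rightarrow> n1" where
  "di l l' = (if l \<le> l' then cq l' l (l * l' + l + l') else cq l l' (l * l' + l + l'))"

lemma di: "idef (\<lambda>p :: nn \<times> nn \<times> unit. di (fst (snd p)) (fst p))" "Re (di l l')"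
  "val (di l l') = \<bar>1 / (\<iota> l + 1) - 1 / (\<iota> l' + 1)\<bar>"
proof -
  show "idef (\<lambda>p :: nn \<times> nn \<times> unit. di (fst (snd p)) (fst p))"
    unfolding di_def by (intro idef_If1 idef_cq idefp_rules idef_rules)
  show "Re (di l l')" by (simp add: di_def)
  have pos: "0 < \<iota> l + 1" "0 < \<iota> l' + 1" by (simp_all add: add_nonneg_pos)
  have m: "\<iota> (l * l' + l + l') + 1 = (\<iota> l + 1) * (\<iota> l' + 1)" by (simp add: algebra_simps)
  have "1 / (\<iota> l + 1) - 1 / (\<iota> l' + 1) = (\<iota> l' - \<iota> l) / ((\<iota> l + 1) * (\<iota> l' + 1))"
    using pos by (simp add: field_simps)
  then have "\<bar>1 / (\<iota> l + 1) - 1 / (\<iota> l' + 1)\<bar> = \<bar>\<iota> l' - \<iota> l\<bar> / ((\<iota> l + 1) * (\<iota> l' + 1))"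
    using pos by (simp add: abs_mult)
  then show "val (di l l') = \<bar>1 / (\<iota> l + 1) - 1 / (\<iota> l' + 1)\<bar>"
    unfolding di_def val_cq m[symmetric] by auto
qed

text \<open>A failure of finite choice makes the numbers of the model, with their usual distance,
  into a sequentially compact space. The length as a real function preserves distances, hence has
  every kind of continuity in question, but is unbounded.\<close>

lemma unbounded_space:
  assumes "\<not> FC"
  obtains M d f where "metS M same_len d" "seqc d M" "RF M same_len f"
    "\<forall>n. \<exists>w :: (nn, n1) ifn. \<forall>i. i \<le> n \<longrightarrow> El M (w \<bullet> i) \<and> len (w \<bullet> i) = i"
    "\<forall>v w. val (d \<bullet> v \<bullet> w) = \<bar>\<iota> (len v) - \<iota> (len w)\<bar>" "\<forall>v. val (f \<bullet> v) = \<iota> (len v)" "\<not> bddF M f"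
proof -
  obtain M where M: "RS M"
    "\<And>n. \<exists>w :: (nn, n1) ifn. \<forall>i. i \<le> n \<longrightarrow> El M (w \<bullet> i) \<and> len (w \<bullet> i) = i"
    "\<And>s :: (nn, n1) ifn. (\<And>n. El M (s \<bullet> n)) \<Longrightarrow> \<exists>B. \<forall>n. len (s \<bullet> n) \<le> B"
    using assms no_choice_space unfolding FC_def len_def by metis
  have ex: "\<exists>z. El M z \<and> len z = n" for n using M(2)[of n] by blast
  then obtain z0 where "El M z0" by blast
  moreover have "inj \<iota>" by (rule injI) simp
  ultimately obtain d where d: "\<And>z z'. d \<bullet> z \<bullet> z' = dl (len z) (len z')" "metS M same_len d" "seqc d M"
    using length_space[OF dl _ M(1) _ M(3)] by blast
  define f where "f = Lam (\<lambda>z. cq (len z) 0 0)"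
  have f: "f \<bullet> v = cq (len v) 0 0" for v
    unfolding f_def by (rule beta) (intro idef_cq idef_len idef_rules)
  have "RF M same_len f" by (simp add: RF_def f same_len(1))
  moreover have "\<not> bddF M f"
  proof
    assume "bddF M f"
    then obtain m where m: "\<And>x. El M x \<Longrightarrow> len x \<le> m" by (auto simp: bddF_def f)
    obtain z where "El M z" "len z = m + 1" using ex by blast
    with m[of z] show False using basic(8)[of m m] by simp
  qed
  ultimately show thesis using that[OF d(2,3)] M(2) by (simp add: d(1) dl f)
qed

section \<open>Refutation of each item if finite choice fails\<close>

lemma itemA_FC: "itemA \<longrightarrow> FC"
proof (rule impI, rule ccontr)
  assume A: itemA and no: "\<not> FC"
  obtain M d f where space: "metS M same_len d" "seqc d M" "RF M same_len f"
    "\<forall>v w. val (d \<bullet> v \<bullet> w) = \<bar>\<iota> (len v) - \<iota> (len w)\<bar>" "\<forall>v. val (f \<bullet> v) = \<iota> (len v)" "\<not> bddF M f"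
    by (rule unbounded_space[OF no]) blast
  note * = space(1-3) space(4,5)[rule_format] space(6)
  have "RS M" using *(1) by (simp add: metS_def)
  then have "subS M same_len M" by (simp add: subS_def El_def)
  with A *(1,2) have "bddS M d M" unfolding itemA_def by blast
  then obtain w m where "\<And>v. El M v \<Longrightarrow> val (d \<bullet> v \<bullet> w) \<le> \<iota> m" unfolding bddS_def by blast
  then have "\<iota> (len v) \<le> \<iota> (len w + m)" if "El M v" for v using that unfolding *(4) by fastforce
  then have "bddF M f" unfolding bddF_def *(5) by (intro exI[of _ "len w + m"]) simp
  with *(6) show False ..
qed

lemma itemB_FC: "itemB \<longrightarrow> FC"
proof (rule impI, rule ccontr)
  assume B: itemB and no: "\<not> FC"
  obtain M d f where space: "metS M same_len d" "seqc d M" "RF M same_len f"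
    "\<forall>v w. val (d \<bullet> v \<bullet> w) = \<bar>\<iota> (len v) - \<iota> (len w)\<bar>" "\<forall>v. val (f \<bullet> v) = \<iota> (len v)" "\<not> bddF M f"
    by (rule unbounded_space[OF no]) blast
  note * = space(1-3) space(4,5)[rule_format] space(6)
  have "unifc M d f" unfolding unifc_def *(4,5) by blast
  with B * show False unfolding itemB_def by blast
qed

lemma itemCL_FC: "itemCL \<longrightarrow> FC"
proof (rule impI, rule ccontr)
  assume B: itemCL and no: "\<not> FC"
  obtain M d f where space: "metS M same_len d" "seqc d M" "RF M same_len f"
    "\<forall>v w. val (d \<bullet> v \<bullet> w) = \<bar>\<iota> (len v) - \<iota> (len w)\<bar>" "\<forall>v. val (f \<bullet> v) = \<iota> (len v)" "\<not> bddF M f"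
    by (rule unbounded_space[OF no]) blast
  note * = space(1-3) space(4,5)[rule_format] space(6)
  have "Lips M d f" unfolding Lips_def *(4,5) by (intro exI[of _ "cq 1 0 0"]) simp
  with B * show False unfolding itemCL_def by blast
qed

text \<open>The sequences of powers witnessing the two premises may be different objects, so they
  are first shown to have equal values up to \<open>m\<close>. Then the longer one is increasing or
  decreasing from \<open>m\<close> on, according to the position of \<open>x\<close> relative to 1.
  All inductions are on statements written with \<open>vle\<close>.\<close>

lemma npow_mono:
  assumes "npow x m u" "npow x n v" "m \<le> n" "0 \<le> val x"
  shows "1 \<le> val x \<Longrightarrow> val u \<le> val v" "val x \<le> 1 \<Longrightarrow> val v \<le> val u"
proof -
  obtain s :: "(nn, n1) ifn" where s: "\<And>i. Re (s \<bullet> i)" "val (s \<bullet> 0) = 1"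
    "\<And>i. i < m \<Longrightarrow> val (s \<bullet> (i + 1)) = val (s \<bullet> i) * val x" "val u = val (s \<bullet> m)"
    using assms(1) unfolding npow_def by blast
  obtain t :: "(nn, n1) ifn" where t: "\<And>i. Re (t \<bullet> i)" "val (t \<bullet> 0) = 1"
    "\<And>i. i < n \<Longrightarrow> val (t \<bullet> (i + 1)) = val (t \<bullet> i) * val x" "val v = val (t \<bullet> n)"
    using assms(2) unfolding npow_def by blast
  have lt: "i < k" if "i + 1 \<le> k" for i k :: nn
    using that basic(8)[of i i] less_le_trans by blast
  define P where "P i \<longleftrightarrow> i \<le> m \<longrightarrow> vle (s \<bullet> i) (t \<bullet> i) \<and> vle (t \<bullet> i) (s \<bullet> i)" for i
  have P: "P i \<longleftrightarrow> i \<le> m \<longrightarrow> val (s \<bullet> i) = val (t \<bullet> i)" for i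
    unfolding P_def by (auto simp: vle_iff s(1) t(1))
  have "P m"
  proof (rule idefp_induct[of P])
    show "idefp (\<lambda>p :: nn \<times> unit. P (fst p))"
      unfolding P_def by (intro idefp_rules idefp_vle idef_rules)
    show "P 0" by (simp add: P s t)
    fix i assume IH: "P i"
    show "P (i + 1)"
      unfolding P
    proof
      assume "i + 1 \<le> m"
      then have "i < m" by (rule lt)
      moreover from this have "i < n" using assms(3) by simp
      ultimately show "val (s \<bullet> (i + 1)) = val (t \<bullet> (i + 1))"
        using IH s(3) t(3) by (simp add: P)
    qed
  qed
  then have u: "val u = val (t \<bullet> m)" using s(4) by (simp add: P)
  have a: "\<exists>j. n = m + j" using assms(3) nn_laws(12)[of m n] by (metis add.assoc add_0_right le_less)
  have nonneg: "i \<le> n \<longrightarrow> 0 \<le> val (t \<bullet> i)" for i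
  proof -
    have "i \<le> n \<longrightarrow> vle (cq 0 0 0) (t \<bullet> i)"
    proof (rule idefp_induct[of "\<lambda>i. i \<le> n \<longrightarrow> vle (cq 0 0 0) (t \<bullet> i)"], intro idefp_rules idefp_vle idef_rules)
      fix i assume IH: "i \<le> n \<longrightarrow> vle (cq 0 0 0) (t \<bullet> i)"
      show "i + 1 \<le> n \<longrightarrow> vle (cq 0 0 0) (t \<bullet> (i + 1))"
      proof
        assume "i + 1 \<le> n"
        then have "i < n" by (rule lt)
        then show "vle (cq 0 0 0) (t \<bullet> (i + 1))" using IH assms(4) by (simp add: vle_iff t)
      qed
    qed (simp add: vle_iff t)
    then show ?thesis by (simp add: vle_iff t(1))
  qed
  from a obtain j where j: "n = m + j" ..
  have "m + i \<le> n \<longrightarrow> val (t \<bullet> m) \<le> val (t \<bullet> (m + i))" if x: "1 \<le> val x" for i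
  proof -
    have "m + i \<le> n \<longrightarrow> vle (t \<bullet> m) (t \<bullet> (m + i))"
    proof (rule idefp_induct[of "\<lambda>i. m + i \<le> n \<longrightarrow> vle (t \<bullet> m) (t \<bullet> (m + i))"],
        intro idefp_rules idefp_vle idef_rules)
      fix i assume IH: "m + i \<le> n \<longrightarrow> vle (t \<bullet> m) (t \<bullet> (m + i))"
      show "m + (i + 1) \<le> n \<longrightarrow> vle (t \<bullet> m) (t \<bullet> (m + (i + 1)))"
      proof
        assume "m + (i + 1) \<le> n"
        then have i: "m + i < n" by (intro lt) (simp only: add.assoc)
        then have "val (t \<bullet> m) \<le> val (t \<bullet> (m + i)) * 1" using IH by (simp add: vle_iff t(1))
        also have "\<dots> \<le> val (t \<bullet> (m + i)) * val x" using x nonneg i by (intro mult_left_mono) simp_all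
        also have "\<dots> = val (t \<bullet> (m + (i + 1)))" using t(3)[OF i] by (simp only: add.assoc)
        finally show "vle (t \<bullet> m) (t \<bullet> (m + (i + 1)))" by (simp add: vle_iff t(1))
      qed
    qed (simp add: vle_iff t)
    then show ?thesis by (simp add: vle_iff t(1))
  qed
  from this[of j] show "1 \<le> val x \<Longrightarrow> val u \<le> val v" by (simp add: u t(4) j)
  have "m + i \<le> n \<longrightarrow> val (t \<bullet> (m + i)) \<le> val (t \<bullet> m)" if x: "val x \<le> 1" for i
  proof -
    have "m + i \<le> n \<longrightarrow> vle (t \<bullet> (m + i)) (t \<bullet> m)"
    proof (rule idefp_induct[of "\<lambda>i. m + i \<le> n \<longrightarrow> vle (t \<bullet> (m + i)) (t \<bullet> m)"],
        intro idefp_rules idefp_vle idef_rules)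
      fix i assume IH: "m + i \<le> n \<longrightarrow> vle (t \<bullet> (m + i)) (t \<bullet> m)"
      show "m + (i + 1) \<le> n \<longrightarrow> vle (t \<bullet> (m + (i + 1))) (t \<bullet> m)"
      proof
        assume "m + (i + 1) \<le> n"
        then have i: "m + i < n" by (intro lt) (simp only: add.assoc)
        have "val (t \<bullet> (m + (i + 1))) = val (t \<bullet> (m + i)) * val x" using t(3)[OF i] by (simp only: add.assoc)
        also have "\<dots> \<le> val (t \<bullet> (m + i)) * 1" using x nonneg i by (intro mult_left_mono) simp_all
        also have "\<dots> \<le> val (t \<bullet> m)" using IH i by (simp add: vle_iff t(1))
        finally show "vle (t \<bullet> (m + (i + 1))) (t \<bullet> m)" by (simp add: vle_iff t(1))
      qed
    qed (simp add: vle_iff t)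
    then show ?thesis by (simp add: vle_iff t(1))
  qed
  from this[of j] show "val x \<le> 1 \<Longrightarrow> val v \<le> val u" by (simp add: u t(4) j)
qed

text \<open>A fraction \<open>m / n\<close> lies below or above 1 according to the order of
  \<open>m\<close> and \<open>n\<close>, so the defining bounds for the first power reduce to
  monotonicity of \<open>x ^ n\<close> in the exponent.\<close>

lemma rpow_one: "rpow x (cq 1 0 0) x" if x: "0 \<le> val x"
proof -
  have le: "\<iota> m / \<iota> n \<le> 1 \<longleftrightarrow> m \<le> n" "1 \<le> \<iota> m / \<iota> n \<longleftrightarrow> n \<le> m" if "0 < n" for m n
    using that nr_less_iff[of 0 n] by (simp_all add: divide_le_eq_1 le_divide_eq_1)
  show ?thesis
    unfolding rpow_def using x le npow_mono[OF _ _ _ x] by auto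
qed

lemma itemCH_FC: "itemCH \<longrightarrow> FC"
proof (rule impI, rule ccontr)
  assume B: itemCH and no: "\<not> FC"
  obtain M d f where space: "metS M same_len d" "seqc d M" "RF M same_len f"
    "\<forall>v w. val (d \<bullet> v \<bullet> w) = \<bar>\<iota> (len v) - \<iota> (len w)\<bar>" "\<forall>v. val (f \<bullet> v) = \<iota> (len v)" "\<not> bddF M f"
    by (rule unbounded_space[OF no]) blast
  note * = space(1-3) space(4,5)[rule_format] space(6)
  have "Hoel M d f"
    unfolding Hoel_def
  proof (rule exI[of _ "cq 1 0 0"], intro conjI, rule Re_cq, rule exI[of _ "cq 1 0 0"], intro conjI allI impI)
    fix v w assume "El M v" "El M w"
    then have "Re (d \<bullet> v \<bullet> w)" using metS_Re[OF *(1)] by blast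
    moreover have "rpow (d \<bullet> v \<bullet> w) (cq 1 0 0) (d \<bullet> v \<bullet> w)" by (rule rpow_one) (simp add: *(4))
    ultimately show "\<exists>p. Re p \<and> rpow (d \<bullet> v \<bullet> w) (cq 1 0 0) p \<and>
        \<bar>val (f \<bullet> v) - val (f \<bullet> w)\<bar> \<le> val (cq 1 0 0) * val p"
      by (intro exI[of _ "d \<bullet> v \<bullet> w"]) (simp add: *(4,5))
  qed simp_all
  with B * show False unfolding itemCH_def by blast
qed

text \<open>Different lengths have distance at least 1, so a function bounded by \<open>m\<close> is
  Lipschitz with the constant \<open>2 * m + 1\<close>; the last summand makes the constant
  positive.\<close>

lemma itemD_FC: "itemD \<longrightarrow> FC"
proof (rule impI, rule ccontr)
  assume D: itemD and no: "\<not> FC"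
  obtain M d where space: "metS M same_len d" "seqc d M"
    "\<forall>n. \<exists>w :: (nn, n1) ifn. \<forall>i. i \<le> n \<longrightarrow> El M (w \<bullet> i) \<and> len (w \<bullet> i) = i"
    "\<forall>v w. val (d \<bullet> v \<bullet> w) = \<bar>\<iota> (len v) - \<iota> (len w)\<bar>"
    by (rule unbounded_space[OF no]) blast
  note * = space(1,2) spec[OF space(3)] space(4)[rule_format]
  have "\<not> finE same_len M"
  proof
    assume "finE same_len M"
    then obtain n where n: "\<And>w :: (nn, n1) ifn. (\<forall>i. i \<le> n \<longrightarrow> Re (w \<bullet> i)) \<and>
       (\<forall>i j. i < j \<and> j \<le> n \<longrightarrow> \<not> same_len \<bullet> (w \<bullet> i) \<bullet> (w \<bullet> j) = 1) \<longrightarrow> (\<exists>i. i \<le> n \<and> \<not> El M (w \<bullet> i))"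
      unfolding finE_def by blast
    obtain w :: "(nn, n1) ifn" where w: "\<And>i. i \<le> n \<Longrightarrow> El M (w \<bullet> i)" "\<And>i. i \<le> n \<Longrightarrow> len (w \<bullet> i) = i"
      using *(3)[of n] by blast
    have "len (w \<bullet> i) \<noteq> len (w \<bullet> j)" if "i < j" "j \<le> n" for i j
      using that w(2)[of i] w(2)[of j] by simp
    then show False using n[of w] w(1) El_Re unfolding same_len(1) by blast
  qed
  then obtain f where f: "RF M same_len f" "bddF M f" "\<not> Lips M d f"
    using D *(1,2) unfolding itemD_def by blast
  obtain m where m: "\<And>x. El M x \<Longrightarrow> \<bar>val (f \<bullet> x)\<bar> \<le> \<iota> m" using f(2) unfolding bddF_def by blast
  have "Lips M d f"
    unfolding Lips_def
  proof (intro exI[of _ "cq (m + m + 1) 0 0"] conjI allI impI)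
    show "0 < val (cq (m + m + 1) 0 0)" by (simp add: add_nonneg_pos)
    fix v w assume vw: "El M v" "El M w"
    show "\<bar>val (f \<bullet> v) - val (f \<bullet> w)\<bar> \<le> val (cq (m + m + 1) 0 0) * val (d \<bullet> v \<bullet> w)"
    proof (cases "len v = len w")
      case True
      then have "val (f \<bullet> v) = val (f \<bullet> w)" using f(1) vw unfolding RF_def same_len(1) by blast
      then show ?thesis using True by (simp add: *(4))
    next
      case False
      then have "len v + 1 \<le> len w \<or> len w + 1 \<le> len v" using nn_Suc_le by (metis linorder_cases)
      then have "\<iota> (len v) + 1 \<le> \<iota> (len w) \<or> \<iota> (len w) + 1 \<le> \<iota> (len v)"
        by (simp only: nr_simps flip: nr_le_iff)
      then have "1 \<le> val (d \<bullet> v \<bullet> w)" unfolding *(4) by linarith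
      have "\<bar>val (f \<bullet> v) - val (f \<bullet> w)\<bar> \<le> \<iota> m + \<iota> m" using m[OF vw(1)] m[OF vw(2)] abs_triangle_ineq4[of "val (f \<bullet> v)" "val (f \<bullet> w)"] by linarith
      also have "\<dots> \<le> (\<iota> m + \<iota> m + 1) * 1" by simp
      also have "\<dots> \<le> (\<iota> m + \<iota> m + 1) * val (d \<bullet> v \<bullet> w)"
        using \<open>1 \<le> val (d \<bullet> v \<bullet> w)\<close> by (intro mult_left_mono) simp_all
      finally show ?thesis by simp
    qed
  qed simp
  with f(3) show False ..
qed

text \<open>With the metric of reciprocals the space is bounded. The function
  \<open>1 / (len z + 1)\<close> preserves distances and is positive, but its infimum is 0 because
  all lengths occur.\<close>

lemma itemE_FC: "itemE \<longrightarrow> FC"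
proof (rule impI, rule ccontr)
  assume E: itemE and "\<not> FC"
  then obtain M where M: "RS M"
    "\<And>n. \<exists>w :: (nn, n1) ifn. \<forall>i. i \<le> n \<longrightarrow> El M (w \<bullet> i) \<and> len (w \<bullet> i) = i"
    "\<And>s :: (nn, n1) ifn. (\<And>n. El M (s \<bullet> n)) \<Longrightarrow> \<exists>B. \<forall>n. len (s \<bullet> n) \<le> B"
    using no_choice_space unfolding FC_def len_def by metis
  have ex: "\<exists>z. El M z \<and> len z = n" for n using M(2)[of n] by blast
  then obtain z0 where z0: "El M z0" by blast
  have pos: "0 < \<iota> l + 1" for l by (simp add: add_nonneg_pos)
  have "inj (\<lambda>l. 1 / (\<iota> l + 1))"
  proof (rule injI)
    fix l l' assume "1 / (\<iota> l + 1) = 1 / (\<iota> l' + 1)"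
    then show "l = l'" using pos[of l] pos[of l'] by (simp add: field_simps)
  qed
  then obtain d where d: "\<And>z z'. d \<bullet> z \<bullet> z' = di (len z) (len z')" "metS M same_len d" "seqc d M"
    using length_space[OF di _ M(1) z0 M(3)] by blast
  define f where "f = Lam (\<lambda>z. cq 1 0 (len z))"
  have f: "f \<bullet> v = cq 1 0 (len v)" for v
    unfolding f_def by (rule beta) (intro idef_cq idef_len idef_rules)
  have le1: "0 < 1 / (\<iota> l + 1)" "1 / (\<iota> l + 1) \<le> 1" for l using pos[of l] by (simp_all add: divide_le_eq_1)
  have "bddS M d M"
    unfolding bddS_def
  proof (intro exI[of _ z0] conjI z0 exI[of _ 1] allI impI)
    show "val (d \<bullet> v \<bullet> z0) \<le> \<iota> 1" for v
      unfolding d(1) di nr_simps using le1[of "len v"] le1[of "len z0"] by linarith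
  qed
  moreover have "RF M same_len f" by (simp add: RF_def f same_len(1))
  moreover have "Lips M d f"
    unfolding Lips_def d(1) di f by (intro exI[of _ "cq 1 0 0"]) simp
  moreover have "infS M f (cq 0 0 0)"
    unfolding infS_def
  proof (intro conjI allI impI)
    show "val (cq 0 0 0) \<le> val (f \<bullet> x)" for x using le1(1)[of "len x"] by (simp add: f)
    fix z assume z: "Re z" "\<forall>x. El M x \<longrightarrow> val z \<le> val (f \<bullet> x)"
    show "val z \<le> val (cq 0 0 0)"
    proof (rule ccontr)
      assume "\<not> ?thesis"
      then obtain n where n: "hp n < val z" using hp_small_val[OF z(1)] by auto
      \<comment> \<open>At a point of length \<open>p2 n\<close> the function is smaller than
        \<open>hp n\<close>, hence smaller than the supposed positive lower bound.\<close>
      obtain x where x: "El M x" "len x = p2 n" using ex by blast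
      have "val z \<le> 1 / (\<iota> (p2 n) + 1)" using z(2) x by (auto simp: f)
      also have "\<dots> \<le> hp n"
        using nr_less_iff[of 0 "p2 n"] unfolding hp_def by (intro divide_left_mono) simp_all
      finally show False using n by simp
    qed
  qed
  ultimately obtain x where "val (f \<bullet> x) = val (cq 0 0 0)"
    using E d(2,3) Re_cq unfolding itemE_def by blast
  then show False using le1(1)[of "len x"] by (simp add: f)
qed

end

theorem theorem2p10:
  "\<forall>item \<in> {item_a, item_b, item_c_Hoelder, item_c_Lipschitz, item_d, item_e}.
     ACA0_omega \<union> {sentence IND_2} \<turnstile> sentence (item \<^bold>\<longrightarrow> Finite_Choice) \<and>
     ACA0_omega \<union> {sentence IND_2} \<turnstile> sentence (QF_AC_0_1 \<^bold>\<longrightarrow> item)"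
proof -
  have "\<not> Bad"
  proof
    assume Bad
    then interpret model by unfold_locales
    show False
      by (rule contradiction_if_all) (rule itemA_FC itemB_FC itemCH_FC itemCL_FC itemD_FC itemE_FC
        QFAC_itemA QFAC_itemB QFAC_itemCH QFAC_itemCL QFAC_itemD QFAC_itemE)+
  qed
  then have "T0 \<turnstile> \<phi>" if "\<phi> \<in> goals" for \<phi>
    using that wff_goals unfolding Bad_def by blast
  then show ?thesis
    unfolding T0_def goals_def by blast
qed

end
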